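(* Fix $\theta\in[0,\pi)$. As $n\to\infty$, the law $\mathbb{P}^n_\theta$ converges locally to a law $\mathbb{P}^\infty_\theta$ supported on infinite plane binary trees with an allowed angle assignment having a unique infinite simple path from the root (one spine), where $\mathbb{P}^\infty_\theta$ is characterized by the following Markov property at the root. Under $\mathbb{P}^\infty_\theta$, let $u_1$ be the internal vertex adjacent to the root leaf and let $\pi-\alpha$ (resp. $\pi-\beta$) be the angle of the corner of $u_1$ opposite to the left (resp. right) child edge of $u_1$. Cutting at $u_1$ and duplicating $u_1$ into a root leaf of each piece yields a left subtree $\tau_L$ and a right subtree $\tau_R$, exactly one of which is infinite. The joint density of $(\alpha,\beta)$ together with the event that $\tau_L$ is finite and $\tau_R$ infinite is $\mathbf{1}_{\theta<\alpha+\beta<\pi}F(\alpha)F_\infty(\beta)/F_\infty(\theta)\,\mathrm{d}\alpha\,\mathrm{d}\beta$, and conditionally on this, $\tau_L,\tau_R$ are independent with laws $\mathbb{P}_\alpha$ and $\mathbb{P}^\infty_\beta$; symmetrically the event that $\tau_L$ is infinite and $\tau_R$ finite has density $\mathbf{1}_{\theta<\alpha+\beta<\pi}F_\infty(\alpha)F(\beta)/F_\infty(\theta)\,\mathrm{d}\alpha\,\mathrm{d}\beta$ and conditionally $\tau_L,\tau_R$ are independent with laws $\mathbb{P}^\infty_\alpha$ and $\mathbb{P}_\beta$.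
   Context: A plane binary tree is a plane tree with vertices of degree $1$ (leaves) or $3$ (internal), rooted at a leaf; for internal vertices other than the neighbor of the root, children are ordered left/right by the planar structure. An angle assignment gives each corner of an internal vertex an angle in $(0,\pi)$, summing to $2\pi$ at each internal vertex, and each leaf corner the angle $\pi$; the corner of an endpoint $v$ of an edge $e$ opposite to $e$ is the corner of $v$ not incident to $e$; the assignment is allowed if for every edge the two opposite corners have angles summing to more than $\pi$. Let $c_0$ be the first positive zero of $J_0$, $x_c=\frac{c_0}{2\pi^2}J_1(c_0)$, $F(\theta)=\frac{c_0}{2\pi\theta}J_1(\tfrac{\theta}{\pi}c_0)$ (with $F(0)=c_0^2/(4\pi^2)$) and $F_\infty(\theta)=J_0(\tfrac{\theta}{\pi}c_0)$. For $\theta\in[0,\pi)$, $\mathbb{P}_\theta$ is the probability measure on finite plane binary trees with allowed angle assignment given by $F(\theta)^{-1}\sum_{n\ge2}x_c^{n-1}\sum_{\tau}\mathrm{Leb}_{A_{\theta,\tau}}$, where the sum is over trees $\tau$ with $n$ leaves, $A_{\theta,\tau}$ is the set of allowed assignments on $\tau$ for which the corner of the vertex adjacent to the root leaf opposite the root edge has angle $>\theta$, Lebesgue measure is taken in two angles per internal vertex, and the tree with two leaves and no internal vertex gets mass $x_c/F(\theta)$. $\mathbb{P}^n_\theta=\mathbb{P}_\theta(\cdot\mid n\text{ leaves})$. Local convergence: for a (possibly infinite) tree with angle assignment $\boldsymbol\tau$, let $[\boldsymbol\tau]_r$ be the subtree of vertices at graph distance at most $r$ from the root vertex together with the corner angles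 of its internal vertices at distance less than $r$ (equivalently, with the edge labels $\ell$ defined from angles by $e^{\ell(e_i)/2}/\sin\theta_i$ constant at each internal vertex and $\ell(\text{root edge})=0$); random trees $\boldsymbol T_n$ converge locally to $\boldsymbol T$ if for every $r$ the total variation distance between the laws of $[\boldsymbol T_n]_r$ and $[\boldsymbol T]_r$ tends to $0$ (exact equality of labels is required, no approximation). *)

theory Defs
  imports "HOL-Probability.Probability"
begin

definition besselJ0 :: "real \<Rightarrow> real" where
  "besselJ0 x = (\<Sum>k. (-1) ^ k / (fact k)\<^sup>2 * (x / 2) ^ (2 * k))"

definition besselJ1 :: "real \<Rightarrow> real" where
  "besselJ1 x = (\<Sum>k. (-1) ^ k / (fact k * fact (Suc k)) * (x / 2) ^ (2 * k + 1))"

definition c0 :: real where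
  "c0 = (THE c. 0 < c \<and> besselJ0 c = 0 \<and> (\<forall>y. 0 < y \<and> y < c \<longrightarrow> besselJ0 y \<noteq> 0))"

definition xc :: real where
  "xc = c0 / (2 * pi\<^sup>2) * besselJ1 c0"

definition F :: "real \<Rightarrow> real" where
  "F \<theta> = (if \<theta> = 0 then c0\<^sup>2 / (4 * pi\<^sup>2) else c0 / (2 * pi * \<theta>) * besselJ1 (\<theta> / pi * c0))"

definition Finf :: "real \<Rightarrow> real" where
  "Finf \<theta> = besselJ0 (\<theta> / pi * c0)"

text \<open>A tree is encoded by its vertex addresses. The root leaf is not stored; the address
  [] is the vertex u1 adjacent to the root leaf, and the children of the vertex p are
  p@[False] (left) and p@[True] (right).  The value at p is None (no vertex),
  Some None (a leaf), or Some (Some (a,b)) (an internal vertex whose corner opposite the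
  left child edge has angle a and whose corner opposite the right child edge has angle b;
  the corner opposite the parent edge then has angle 2*pi - a - b).\<close>

type_synonym node = "(real \<times> real) option option"
type_synonym atree = "bool list \<Rightarrow> node"

definition node_M :: "node measure" where
  "node_M = sigma UNIV ({{None}, {Some None}} \<union>
     {(\<lambda>ab. Some (Some ab)) ` B | B. B \<in> sets (borel :: (real \<times> real) measure)})"

definition tree_M :: "atree measure" where
  "tree_M = (\<Pi>\<^sub>M p\<in>(UNIV :: bool list set). node_M)"

definition supp :: "atree \<Rightarrow> bool list set" where
  "supp t = {p. t p \<noteq> None}"

definition is_tree :: "atree \<Rightarrow> bool" where
  "is_tree t \<longleftrightarrow> t [] \<noteq> None \<and>
     (\<forall>p c. t (p @ [c]) \<noteq> None \<longleftrightarrow> (\<exists>ab. t p = Some (Some ab)))"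

definition valid_angles :: "atree \<Rightarrow> bool" where
  "valid_angles t \<longleftrightarrow> (\<forall>p a b. t p = Some (Some (a, b)) \<longrightarrow>
     0 < a \<and> a < pi \<and> 0 < b \<and> b < pi \<and> 0 < 2 * pi - a - b \<and> 2 * pi - a - b < pi)"

definition corner_opp_parent :: "atree \<Rightarrow> bool list \<Rightarrow> real" where
  "corner_opp_parent t p = (case t p of Some (Some (a, b)) \<Rightarrow> 2 * pi - a - b | _ \<Rightarrow> pi)"

definition corner_opp_child :: "atree \<Rightarrow> bool list \<Rightarrow> bool \<Rightarrow> real" where
  "corner_opp_child t p c = (case t p of Some (Some (a, b)) \<Rightarrow> (if c then b else a) | _ \<Rightarrow> pi)"

text \<open>Allowed angle assignment; the root leaf has corner pi.\<close>
definition allowed :: "atree \<Rightarrow> bool" where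
  "allowed t \<longleftrightarrow> valid_angles t \<and> pi + corner_opp_parent t [] > pi \<and>
     (\<forall>p c. t (p @ [c]) \<noteq> None \<longrightarrow> corner_opp_child t p c + corner_opp_parent t (p @ [c]) > pi)"

text \<open>Number of leaves of the plane tree (the root leaf included).\<close>
definition num_leaves :: "atree \<Rightarrow> nat" where
  "num_leaves t = card {p. t p = Some None} + 1"

definition one_spine :: "atree \<Rightarrow> bool" where
  "one_spine t \<longleftrightarrow> (\<exists>!s :: nat \<Rightarrow> bool. \<forall>k. t (map s [0..<k]) \<noteq> None)"

definition subL :: "atree \<Rightarrow> atree" where "subL t = (\<lambda>p. t (False # p))"
definition subR :: "atree \<Rightarrow> atree" where "subR t = (\<lambda>p. t (True # p))"

definition shape_ok :: "bool list set \<Rightarrow> bool" where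
  "shape_ok S \<longleftrightarrow> finite S \<and> [] \<in> S \<and> (\<forall>p c. p @ [c] \<in> S \<longrightarrow> p \<in> S) \<and>
     (\<forall>p. p @ [False] \<in> S \<longleftrightarrow> p @ [True] \<in> S)"

definition internal :: "bool list set \<Rightarrow> bool list set" where
  "internal S = {p \<in> S. p @ [False] \<in> S}"

definition tree_of :: "bool list set \<Rightarrow> (bool list \<Rightarrow> real \<times> real) \<Rightarrow> atree" where
  "tree_of S x = (\<lambda>p. if p \<in> internal S then Some (Some (x p)) else if p \<in> S then Some None else None)"

definition angle_leb :: "bool list set \<Rightarrow> (bool list \<Rightarrow> real \<times> real) measure" where
  "angle_leb S = (\<Pi>\<^sub>M p\<in>internal S. (lborel :: (real \<times> real) measure))"

definition Pfin :: "real \<Rightarrow> atree measure" where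
  "Pfin \<theta> = measure_of (space tree_M) (sets tree_M)
     (\<lambda>A. \<Sum>\<^sub>\<infinity>S\<in>{S. shape_ok S}.
        ennreal (xc ^ (card (internal S) + 1) / F \<theta>) *
        emeasure (angle_leb S) {x \<in> space (angle_leb S).
           tree_of S x \<in> A \<and> allowed (tree_of S x) \<and> \<theta> < corner_opp_parent (tree_of S x) []})"

definition Pn :: "real \<Rightarrow> nat \<Rightarrow> atree measure" where
  "Pn \<theta> n = density (Pfin \<theta>)
     (\<lambda>t. indicator {t. finite (supp t) \<and> num_leaves t = n} t /
          emeasure (Pfin \<theta>) {t. finite (supp t) \<and> num_leaves t = n})"

text \<open>Ball of radius r around the root leaf (which is at distance 0; the vertex p is at
  distance length p + 1); angles are kept only for vertices at distance < r, vertices at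
  distance exactly r are recorded as bare vertices.\<close>
definition trunc :: "nat \<Rightarrow> atree \<Rightarrow> atree" where
  "trunc r t = (\<lambda>p. if Suc (length p) < r then t p
     else if Suc (length p) = r then (case t p of None \<Rightarrow> None | Some _ \<Rightarrow> Some None)
     else None)"

definition tv_dist :: "'a measure \<Rightarrow> 'a measure \<Rightarrow> real" where
  "tv_dist M N = (SUP A\<in>sets M. \<bar>measure M A - measure N A\<bar>)"

definition local_conv :: "(nat \<Rightarrow> atree measure) \<Rightarrow> atree measure \<Rightarrow> bool" where
  "local_conv Q P \<longleftrightarrow> (\<forall>r. (\<lambda>n. tv_dist (distr (Q n) tree_M (trunc r)) (distr P tree_M (trunc r)))
      \<longlonglongrightarrow> 0)"

definition spine_tree :: "atree \<Rightarrow> bool" where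
  "spine_tree t \<longleftrightarrow> is_tree t \<and> allowed t \<and> infinite (supp t) \<and> one_spine t"

definition root_event :: "(real \<times> real) set \<Rightarrow> atree set" where
  "root_event C = {t. \<exists>a b. t [] = Some (Some (a, b)) \<and> (pi - a, pi - b) \<in> C}"

definition markov :: "(real \<Rightarrow> atree measure) \<Rightarrow> real \<Rightarrow> bool" where
  "markov Q \<theta> \<longleftrightarrow>
    (\<forall>A\<in>sets tree_M. \<forall>B\<in>sets tree_M. \<forall>C\<in>sets (borel :: (real \<times> real) measure).
      emeasure (Q \<theta>) {t \<in> root_event C. finite (supp (subL t)) \<and> infinite (supp (subR t)) \<and>
                                     subL t \<in> A \<and> subR t \<in> B}
      = (\<integral>\<^sup>+ z. indicator C z *
           (if 0 < fst z \<and> 0 < snd z \<and> \<theta> < fst z + snd z \<and> fst z + snd z < pi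
            then ennreal (F (fst z) * Finf (snd z) / Finf \<theta>) *
                 emeasure (Pfin (fst z)) A * emeasure (Q (snd z)) B
            else 0) \<partial>lborel)
    \<and> emeasure (Q \<theta>) {t \<in> root_event C. infinite (supp (subL t)) \<and> finite (supp (subR t)) \<and>
                                     subL t \<in> A \<and> subR t \<in> B}
      = (\<integral>\<^sup>+ z. indicator C z *
           (if 0 < fst z \<and> 0 < snd z \<and> \<theta> < fst z + snd z \<and> fst z + snd z < pi
            then ennreal (Finf (fst z) * F (snd z) / Finf \<theta>) *
                 emeasure (Q (fst z)) A * emeasure (Pfin (snd z)) B
            else 0) \<partial>lborel))"

definition spine_family :: "(real \<Rightarrow> atree measure) \<Rightarrow> bool" where
  "spine_family Q \<longleftrightarrow> (\<forall>\<theta>\<in>{0..<pi}. prob_space (Q \<theta>) \<and> sets (Q \<theta>) = sets tree_M \<and>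
      (AE t in Q \<theta>. spine_tree t) \<and> markov Q \<theta>)"

end

theory Submission
  imports Defs "HOL-Complex_Analysis.Complex_Analysis" "HOL-Real_Asymp.Real_Asymp"
begin

text \<open>Cutting a tree at \<open>u\<^sub>1\<close> turns the total volume \<open>V\<^sub>m(\<theta>)\<close> of the allowed assignments on trees with \<open>m\<close>
  leaves besides the root into a convolution over the triangle \<open>\<theta> < \<alpha> + \<beta> < \<pi>\<close>. The Bessel series
  \<open>\<Phi>\<^sub>\<theta>(p) = p \<Sum> (-1)\<^sup>k (\<theta>\<^sup>2 p)\<^sup>k / (k! (k+1)!)\<close> satisfies
  \<open>\<Phi>\<^sub>\<theta> = \<Phi>\<^sub>\<pi> + \<integral>\<integral> \<Phi>\<^sub>\<alpha> \<Phi>\<^sub>\<beta>\<close>, so the generating function of \<open>V\<^sub>m(\<theta>)\<close> is \<open>\<Phi>\<^sub>\<theta>\<close> composed with the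
  inverse series of \<open>\<Phi>\<^sub>\<pi>\<close>. Lagrange inversion writes \<open>V\<^sub>m(\<theta>)\<close> as a Cauchy integral over the circle through
  the critical point \<open>c\<^sub>0\<^sup>2 / (4 \<pi>\<^sup>2)\<close>, and Laplace's method gives
  \<open>x\<^sub>c\<^sup>m V\<^sub>m(\<theta>) \<sim> \<kappa> F\<^sub>\<infinity>(\<theta>) m\<^sup>-\<^sup>3\<^sup>/\<^sup>2\<close>. A convolution of two summable sequences of this order
  concentrates on one of its two factors: this yields the integral equation for \<open>F\<^sub>\<infinity>\<close> that makes the Markov
  description consistent, and it shows that the density, with respect to the finite law, of a truncated tree
  conditioned on its size converges pointwise to the corresponding density of the tree with a spine.
  Scheffe's lemma upgrades this to total variation. The Markov property determines the measure of all
  cylinder sets by induction on their depth, whence uniqueness.\<close>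

unbundle no vec_syntax

section \<open>The volume polynomials\<close>

text \<open>Two difficulties shape the proof. The Cauchy integral needs a single dominant saddle on
  its circle, which the alternating Bessel coefficients hide. The negative logarithmic derivative of
  \<open>Phi pi\<close> divided by its variable solves a Riccati equation with positive terms, so
  the exponent of the integrand has nonnegative coefficients. The same recursion gives a radius of
  convergence of at least 2/pi^2, and the crude estimate J_0(2 sqrt 2) < 0 puts the critical point
  inside. Secondly, the infinite law must be a kernel in the angle, since the Markov property at
  \<theta> integrates over the laws at \<alpha> and \<beta>. The root density at \<theta> is that at
  0 conditioned on \<theta> < \<alpha> + \<beta>, an event of probability
  \<open>Finf \<theta>\<close>. Hence one random input serves all angles: independent proposals at
  angle 0, of which the first acceptable one is taken, so the tree is an explicit measurable
  function of angle and input. Local convergence demands equality of angles, not approximation; this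
  is why both truncated laws are compared through densities with respect to the common measure
  \<open>Pfin \<theta>\<close>.\<close>

definition bessel_coeff :: "nat \<Rightarrow> real" where
  "bessel_coeff k = (-1) ^ k / (fact k * fact (Suc k))"

definition Phi :: "real \<Rightarrow> real fps" where
  "Phi \<theta> = Abs_fps (\<lambda>n. if n = 0 then 0 else bessel_coeff (n - 1) * \<theta> ^ (2 * (n - 1)))"

text \<open>The polynomial \<open>vol m \<theta>\<close> will turn out to be the volume of the allowed assignments with parameter \<open>\<theta>\<close> on
  trees with \<open>m\<close> leaves besides the root, and \<open>vol0\<close> collects its values at \<open>\<theta> = 0\<close>.\<close>
definition vol0 :: "real fps" where
  "vol0 = fps_inv (Phi pi)"

definition vol :: "nat \<Rightarrow> real \<Rightarrow> real" where
  "vol m \<theta> = (Phi \<theta> oo vol0) $ m"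

text \<open>With \<alpha> = pi - a and \<beta> = pi - b, the corner of a root vertex opposite its
  parent edge is \<alpha> + \<beta>. For \<theta> \<ge> 0 the triangle therefore collects the pairs
  whose three corners are admissible and whose upper corner exceeds \<theta>.\<close>

definition tri :: "real \<Rightarrow> (real \<times> real) set" where
  "tri \<theta> = {z. 0 < fst z \<and> 0 < snd z \<and> \<theta> < fst z + snd z \<and> fst z + snd z < pi}"

lemma measurable_fst_borel [measurable]: "(fst :: real \<times> real \<Rightarrow> real) \<in> borel \<rightarrow>\<^sub>M borel"
  and measurable_snd_borel [measurable]: "(snd :: real \<times> real \<Rightarrow> real) \<in> borel \<rightarrow>\<^sub>M borel"
  by (auto intro!: borel_measurable_continuous_onI continuous_intros)

lemma tri_measurable [measurable]: "tri \<theta> \<in> sets borel"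
proof -
  have "tri \<theta> = {z \<in> space borel. 0 < fst z \<and> 0 < snd z \<and> \<theta> < fst z + snd z \<and> fst z + snd z < pi}"
    by (simp add: tri_def)
  also have "\<dots> \<in> sets (borel :: (real \<times> real) measure)" by measurable
  finally show ?thesis .
qed

section \<open>Moments of the triangle\<close>

lemma beta_integral_nat:
  fixes s :: real
  assumes "0 \<le> s"
  shows "((\<lambda>x. x ^ i * (s - x) ^ j) has_integral
    (fact i * fact j / fact (i + j + 1) * s ^ (i + j + 1))) {0..s}"
proof (induction j arbitrary: i)
  case 0
  have "((\<lambda>x. x ^ i) has_integral (s ^ (Suc i) / (Suc i) - 0 ^ (Suc i) / (Suc i))) {0..s}"
    by (rule fundamental_theorem_of_calculus[OF assms])
      (auto intro!: derivative_eq_intros simp flip: has_real_derivative_iff_has_vector_derivative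
        simp del: of_nat_Suc power_Suc)
  moreover have "fact i * fact 0 / fact (i + 0 + 1) = 1 / real (Suc i)" by simp
  ultimately show ?case by simp
next
  case (Suc j)
  \<comment> \<open>Integration by parts: the primitive x^(i+1) (s - x)^(j+1) / (i+1) vanishes at
    both ends and trades one power of s - x for one of x. The induction therefore keeps
    \<open>i\<close> arbitrary.\<close>
  have "((\<lambda>x. x ^ i * (s - x) ^ Suc j - (Suc j / Suc i) * (x ^ Suc i * (s - x) ^ j)) has_integral
     (s ^ Suc i * (s - s) ^ Suc j / Suc i - 0 ^ Suc i * (s - 0) ^ Suc j / Suc i)) {0..s}"
  proof (rule fundamental_theorem_of_calculus[OF assms])
    fix x
    have "((\<lambda>x. x ^ Suc i * (s - x) ^ Suc j / Suc i) has_real_derivative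
        x ^ i * (s - x) ^ Suc j - (Suc j / Suc i) * (x ^ Suc i * (s - x) ^ j)) (at x within {0..s})"
      by (rule derivative_eq_intros refl | simp del: of_nat_Suc power_Suc)+
        (simp add: field_simps del: of_nat_Suc)
    then show "((\<lambda>x. x ^ Suc i * (s - x) ^ Suc j / Suc i) has_vector_derivative
        x ^ i * (s - x) ^ Suc j - (Suc j / Suc i) * (x ^ Suc i * (s - x) ^ j)) (at x within {0..s})"
      by (simp add: has_real_derivative_iff_has_vector_derivative)
  qed
  from has_integral_add[OF this has_integral_mult_right[OF Suc.IH[of "Suc i"], of "Suc j / Suc i"]]
  have "((\<lambda>x. x ^ i * (s - x) ^ Suc j) has_integral
     (Suc j / Suc i) * (fact (Suc i) * fact j / fact (Suc i + j + 1) * s ^ (Suc i + j + 1))) {0..s}"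
    by simp
  also have "(Suc j / Suc i) * (fact (Suc i) * fact j / fact (Suc i + j + 1) * s ^ (Suc i + j + 1))
     = fact i * fact (Suc j) / fact (i + Suc j + 1) * s ^ (i + Suc j + 1)"
  proof -
    have "Suc i + j + 1 = i + Suc j + 1" by simp
    then show ?thesis
      by (simp only: fact_Suc[of i] fact_Suc[of j]) (simp del: fact_Suc of_nat_Suc)
  qed
  finally show ?case .
qed

text \<open>Substituting s = a + b turns the inner integral into a beta integral over 0 < a < s, and
  the only condition left on s is \<theta> < s < pi; the remaining power of s has an explicit
  primitive.\<close>

lemma nn_integral_tri_monomial:
  assumes "0 \<le> \<theta>" "\<theta> \<le> pi"
  shows "(\<integral>\<^sup>+z. ennreal (indicator (tri \<theta>) z * (fst z ^ i * snd z ^ j)) \<partial>(lborel :: (real \<times> real) measure))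
     = ennreal (fact i * fact j / fact (i + j + 2) * (pi ^ (i + j + 2) - \<theta> ^ (i + j + 2)))"
proof -
  let ?c = "fact i * fact j / fact (i + j + 1) :: real"
  have "(\<integral>\<^sup>+z. ennreal (indicator (tri \<theta>) z * (fst z ^ i * snd z ^ j)) \<partial>(lborel :: (real \<times> real) measure))
    = (\<integral>\<^sup>+a. \<integral>\<^sup>+b. ennreal (indicator (tri \<theta>) (a, b) * (a ^ i * b ^ j)) \<partial>lborel \<partial>lborel)"
    by (subst lborel_prod[symmetric], subst lborel.nn_integral_fst[symmetric]) (simp_all add: lborel_prod)
  also have "\<dots> = (\<integral>\<^sup>+a. \<integral>\<^sup>+s. ennreal (indicator (tri \<theta>) (a, s - a) * (a ^ i * (s - a) ^ j)) \<partial>lborel \<partial>lborel)"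
  proof (rule nn_integral_cong)
    fix a :: real
    show "(\<integral>\<^sup>+b. ennreal (indicator (tri \<theta>) (a, b) * (a ^ i * b ^ j)) \<partial>lborel)
      = (\<integral>\<^sup>+s. ennreal (indicator (tri \<theta>) (a, s - a) * (a ^ i * (s - a) ^ j)) \<partial>lborel)"
      by (subst nn_integral_real_affine[of _ 1 "-a"]) (auto simp: algebra_simps)
  qed
  also have "\<dots> = (\<integral>\<^sup>+s. \<integral>\<^sup>+a. ennreal (indicator (tri \<theta>) (a, s - a) * (a ^ i * (s - a) ^ j)) \<partial>lborel \<partial>lborel)"
    by (rule lborel_pair.Fubini') measurable
  also have "\<dots> = (\<integral>\<^sup>+s. ennreal (?c * s ^ (i + j + 1)) * indicator {\<theta>..pi} s \<partial>lborel)"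
  proof (rule nn_integral_cong_AE)
    \<comment> \<open>Discarding the two endpoints reconciles the strict inequalities of
      \<open>tri\<close> with the closed interval on which the primitive is evaluated.\<close>
    have "AE s in lborel. s \<noteq> \<theta> \<and> s \<noteq> pi"
      by (intro AE_conjI AE_lborel_singleton)
    then show "AE s in lborel. (\<integral>\<^sup>+a. ennreal (indicator (tri \<theta>) (a, s - a) * (a ^ i * (s - a) ^ j)) \<partial>lborel)
      = ennreal (?c * s ^ (i + j + 1)) * indicator {\<theta>..pi} s"
    proof eventually_elim
      case (elim s)
      show ?case
      proof (cases "\<theta> < s \<and> s < pi")
        case True
        then have s: "0 \<le> s" using assms by simp
        let ?h = "\<lambda>a. if a \<in> {0..s} then a ^ i * (s - a) ^ j else 0"
        have h: "(?h has_integral (?c * s ^ (i + j + 1))) UNIV"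
          using beta_integral_nat[OF s, of i j] by (simp only: has_integral_restrict_UNIV)
        have "(\<integral>\<^sup>+a. ennreal (indicator (tri \<theta>) (a, s - a) * (a ^ i * (s - a) ^ j)) \<partial>lborel)
          = (\<integral>\<^sup>+a. ennreal (?h a) \<partial>lborel)"
        proof (rule nn_integral_cong_AE)
          have "AE a in lborel. a \<noteq> 0 \<and> a \<noteq> s"
            by (intro AE_conjI AE_lborel_singleton)
          then show "AE a in lborel. ennreal (indicator (tri \<theta>) (a, s - a) * (a ^ i * (s - a) ^ j))
             = ennreal (?h a)"
            by eventually_elim (use True in \<open>auto simp: tri_def indicator_def\<close>)
        qed
        also have "\<dots> = ennreal (?c * s ^ (i + j + 1))"
        proof -
          have "?h \<in> borel_measurable borel" by measurable
          then show ?thesis by (rule nn_integral_has_integral_lborel[OF _ _ h]) (use s in auto)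
        qed
        finally show ?thesis using True by simp
      next
        case False
        then have "s \<notin> {\<theta>..pi}" using elim by auto
        moreover have "indicator (tri \<theta>) (a, s - a) = (0::real)" for a
          using False by (auto simp: tri_def indicator_def)
        ultimately show ?thesis by simp
      qed
    qed
  qed
  also have "\<dots> = ennreal (?c * (pi ^ (i + j + 2) / (i + j + 2)) - ?c * (\<theta> ^ (i + j + 2) / (i + j + 2)))"
  proof (rule nn_integral_FTC_Icc[where F = "\<lambda>x. ?c * (x ^ (i + j + 2) / real (i + j + 2))"])
    fix x assume x: "x \<in> {\<theta>..pi}"
    show "0 \<le> ?c * x ^ (i + j + 1)" using x assms by auto
    have "((\<lambda>x::real. x ^ (i + j + 2)) has_real_derivative real (i + j + 2) * x ^ (i + j + 1)) (at x)"
      using DERIV_pow[of "i + j + 2" x] by simp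
    then have "((\<lambda>x::real. x ^ (i + j + 2) / real (i + j + 2)) has_real_derivative
       real (i + j + 2) * x ^ (i + j + 1) / real (i + j + 2)) (at x)"
      by (rule DERIV_cdivide)
    then have "((\<lambda>x::real. x ^ (i + j + 2) / real (i + j + 2)) has_real_derivative x ^ (i + j + 1)) (at x)"
      by simp
    then show "((\<lambda>x. ?c * (x ^ (i + j + 2) / real (i + j + 2))) has_real_derivative ?c * x ^ (i + j + 1)) (at x)"
      by (rule DERIV_cmult)
  qed (use assms in auto)
  also have "?c * (pi ^ (i + j + 2) / (i + j + 2)) - ?c * (\<theta> ^ (i + j + 2) / (i + j + 2))
    = fact i * fact j / fact (i + j + 2) * (pi ^ (i + j + 2) - \<theta> ^ (i + j + 2))"
  proof -
    have "(fact (i + j + 2) :: real) = real (i + j + 2) * fact (i + j + 1)" by simp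
    then show ?thesis
      by (simp only: divide_inverse inverse_mult_distrib right_diff_distrib mult_ac)
  qed
  finally show ?thesis .
qed

lemma has_bochner_integral_tri_monomial:
  assumes "0 \<le> \<theta>" "\<theta> \<le> pi"
  shows "has_bochner_integral (lborel :: (real \<times> real) measure)
     (\<lambda>z. indicator (tri \<theta>) z * (fst z ^ i * snd z ^ j))
     (fact i * fact j / fact (i + j + 2) * (pi ^ (i + j + 2) - \<theta> ^ (i + j + 2)))"
proof (rule has_bochner_integral_nn_integral[OF _ _ _ nn_integral_tri_monomial[OF assms]])
  show "AE z in lborel. 0 \<le> indicator (tri \<theta>) z * (fst z ^ i * snd z ^ j)"
    by (auto simp: indicator_def tri_def)
  show "0 \<le> fact i * fact j / fact (i + j + 2) * (pi ^ (i + j + 2) - \<theta> ^ (i + j + 2))"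
    using power_mono[OF assms(2,1), of "i + j + 2"] by (intro mult_nonneg_nonneg) auto
qed measurable

section \<open>Catalan numbers\<close>

definition catalan_number :: "nat \<Rightarrow> real" where
  "catalan_number n = fact (2 * n) / (fact n * fact (Suc n))"

text \<open>These are the coefficients of sqrt (1 - 4 t) after the constant term; both sides obey
  the same first-order recursion in \<open>n\<close>.\<close>

lemma gbinomial_half_catalan:
  "((1/2::real) gchoose Suc n) * (-4) ^ Suc n = -2 * catalan_number n"
proof (induction n)
  case 0
  then show ?case by (simp add: catalan_number_def)
next
  case (Suc n)
  have "real (Suc (Suc n)) * ((1/2::real) gchoose Suc (Suc n))
      = (1/2 - real (Suc n)) * ((1/2) gchoose Suc n)"
    using gbinomial_mult_1[of "1/2::real" "Suc n"] by (simp only: left_diff_distrib)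
  then have e: "((1/2::real) gchoose Suc (Suc n)) = (1/2 - real (Suc n)) * ((1/2) gchoose Suc n) / real (Suc (Suc n))"
    by (simp only: field_simps)
  have "((1/2::real) gchoose Suc (Suc n)) * (-4) ^ Suc (Suc n)
    = (1/2 - real (Suc n)) * (-4) / real (Suc (Suc n)) * (((1/2) gchoose Suc n) * (-4) ^ Suc n)"
    unfolding e power_Suc[of "-4" "Suc n"] by (simp only: divide_inverse mult_ac)
  also have "\<dots> = (1/2 - real (Suc n)) * (-4) / real (Suc (Suc n)) * (-2 * catalan_number n)"
    by (simp only: Suc.IH)
  also have "\<dots> = -2 * catalan_number (Suc n)"
    by (simp add: catalan_number_def divide_simps) (simp add: algebra_simps)
  finally show ?case .
qed

text \<open>The two sides are the coefficients of the square of \<open>1 - sqrt (1 - 4 t)\<close>.\<close>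
lemma catalan_number_convolution:
  "(\<Sum>i\<le>n. catalan_number i * catalan_number (n - i)) = catalan_number (Suc n)"
proof -
  define g where "g k = ((1/2::real) gchoose k) * (-4) ^ k" for k
  have gS: "g (Suc k) = -2 * catalan_number k" for k
    unfolding g_def by (rule gbinomial_half_catalan)
  have g0: "g 0 = 1" by (simp add: g_def)
  have "(\<Sum>k\<le>n + 2. g k * g (n + 2 - k))
     = (-4) ^ (n + 2) * (\<Sum>k\<le>n + 2. ((1/2::real) gchoose k) * ((1/2) gchoose (n + 2 - k)))"
    unfolding sum_distrib_left
  proof (rule sum.cong[OF refl])
    fix k assume "k \<in> {..n + 2}"
    then have *: "(-4::real) ^ (n + 2) = (-4) ^ k * (-4) ^ (n + 2 - k)"
      by (simp flip: power_add)
    show "g k * g (n + 2 - k) = (-4) ^ (n + 2) * (((1/2::real) gchoose k) * ((1/2) gchoose (n + 2 - k)))"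
      unfolding g_def * by (simp only: mult_ac)
  qed
  also have "(\<Sum>k\<le>n + 2. ((1/2::real) gchoose k) * ((1/2) gchoose (n + 2 - k))) = (1 gchoose (n + 2))"
    using gbinomial_Vandermonde[of "1/2::real" "1/2" "n + 2"] by (simp add: atLeast0AtMost)
  \<comment> \<open>The square of sqrt (1 - 4 t) is the polynomial 1 - 4 t, which has no
    coefficients from degree 2 on.\<close>
  also have "(1::real) gchoose (n + 2) = 0"
    using binomial_gbinomial[of 1 "n + 2", where ?'a = real] by simp
  finally have "0 = (\<Sum>k\<le>Suc (Suc n). g k * g (Suc (Suc n) - k))" by simp
  also have "\<dots> = g 0 * g (Suc (Suc n)) + (\<Sum>k\<le>n. g (Suc k) * g (Suc n - k)) + g (Suc (Suc n)) * g 0"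
    by (subst sum.atMost_Suc_shift, subst sum.atMost_Suc) simp
  also have "(\<Sum>k\<le>n. g (Suc k) * g (Suc n - k)) = (\<Sum>k\<le>n. 4 * (catalan_number k * catalan_number (n - k)))"
    by (rule sum.cong[OF refl]) (simp add: gS Suc_diff_le)
  finally show ?thesis by (simp add: gS g0 flip: sum_distrib_left)
qed

section \<open>The integral equation of the Bessel series and the volume recursion\<close>

lemma Phi_nth_0 [simp]: "Phi \<theta> $ 0 = 0"
  and Phi_nth_Suc [simp]: "Phi \<theta> $ Suc n = bessel_coeff n * \<theta> ^ (2 * n)"
  by (simp_all add: Phi_def)

lemma bessel_coeff_0 [simp]: "bessel_coeff 0 = 1"
  by (simp add: bessel_coeff_def)

lemma vol0_nth_0 [simp]: "vol0 $ 0 = 0"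
  by (simp add: vol0_def fps_inv_def)

lemma Phi_compose_vol0: "Phi pi oo vol0 = fps_X"
  unfolding vol0_def by (rule fps_inv_right) simp_all

lemma vol0_compose_Phi: "vol0 oo Phi pi = fps_X"
  unfolding vol0_def by (rule fps_inv) simp_all

text \<open>This is the integral equation \<open>\<Phi> \<theta> = \<Phi> pi + \<integral>\<integral> \<Phi> \<alpha> \<Phi> \<beta>\<close> satisfied by
  \<open>\<Phi> \<theta> = (sqrt p / \<theta>) J_1 (2 \<theta> sqrt p)\<close>, read off coefficientwise in the variable \<open>p\<close>.\<close>
lemma has_bochner_integral_Phi_mult:
  assumes "0 \<le> \<theta>" "\<theta> \<le> pi"
  shows "has_bochner_integral lborel
     (\<lambda>z. indicator (tri \<theta>) z * (Phi (fst z) * Phi (snd z)) $ n) (Phi \<theta> $ n - Phi pi $ n)"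
proof (cases "n < 2")
  case True
  then consider "n = 0" | "n = 1" by linarith
  then show ?thesis
    by cases (auto simp: fps_mult_nth intro: has_bochner_integral_zero)
next
  case False
  then obtain k where n: "n = Suc (Suc k)"
    by (metis add_2_eq_Suc le_Suc_ex not_less)
  have eq: "(Phi (fst z) * Phi (snd z)) $ n
     = (\<Sum>i\<le>k. bessel_coeff i * bessel_coeff (k - i) * (fst z ^ (2 * i) * snd z ^ (2 * (k - i))))" for z
    unfolding n fps_mult_nth atLeast0AtMost
    by (subst sum.atMost_Suc_shift, subst sum.atMost_Suc) (simp add: Suc_diff_le mult_ac)
  have "has_bochner_integral lborel
    (\<lambda>z. \<Sum>i\<le>k. bessel_coeff i * bessel_coeff (k - i) * (indicator (tri \<theta>) z * (fst z ^ (2 * i) * snd z ^ (2 * (k - i)))))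
    (\<Sum>i\<le>k. bessel_coeff i * bessel_coeff (k - i) * (fact (2 * i) * fact (2 * (k - i)) / fact (2 * i + 2 * (k - i) + 2) *
         (pi ^ (2 * i + 2 * (k - i) + 2) - \<theta> ^ (2 * i + 2 * (k - i) + 2))))"
    by (intro has_bochner_integral_sum has_bochner_integral_mult_right has_bochner_integral_tri_monomial assms)
  moreover have "(\<Sum>i\<le>k. bessel_coeff i * bessel_coeff (k - i) * (indicator (tri \<theta>) z * (fst z ^ (2 * i) * snd z ^ (2 * (k - i)))))
     = indicator (tri \<theta>) z * (Phi (fst z) * Phi (snd z)) $ n" for z
    unfolding eq sum_distrib_left by (simp add: mult_ac)
  moreover have "(\<Sum>i\<le>k. bessel_coeff i * bessel_coeff (k - i) * (fact (2 * i) * fact (2 * (k - i)) / fact (2 * i + 2 * (k - i) + 2) *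
         (pi ^ (2 * i + 2 * (k - i) + 2) - \<theta> ^ (2 * i + 2 * (k - i) + 2)))) = Phi \<theta> $ n - Phi pi $ n"
  proof -
    \<comment> \<open>The factor (2 i)! of the moment and the coefficient 1 / (i! (i+1)!) combine to
      a Catalan number, so the dependence on i becomes a pure Catalan convolution.\<close>
    have "(\<Sum>i\<le>k. bessel_coeff i * bessel_coeff (k - i) * (fact (2 * i) * fact (2 * (k - i)) / fact (2 * i + 2 * (k - i) + 2) *
         (pi ^ (2 * i + 2 * (k - i) + 2) - \<theta> ^ (2 * i + 2 * (k - i) + 2))))
      = (\<Sum>i\<le>k. (catalan_number i * catalan_number (k - i)) * ((-1) ^ k * (pi ^ (2 * k + 2) - \<theta> ^ (2 * k + 2)) / fact (2 * k + 2)))"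
    proof (rule sum.cong[OF refl])
      fix i assume "i \<in> {..k}"
      then obtain l where k: "k = i + l" by (auto simp: le_iff_add)
      show "bessel_coeff i * bessel_coeff (k - i) * (fact (2 * i) * fact (2 * (k - i)) / fact (2 * i + 2 * (k - i) + 2) *
         (pi ^ (2 * i + 2 * (k - i) + 2) - \<theta> ^ (2 * i + 2 * (k - i) + 2)))
       = (catalan_number i * catalan_number (k - i)) * ((-1) ^ k * (pi ^ (2 * k + 2) - \<theta> ^ (2 * k + 2)) / fact (2 * k + 2))"
        unfolding k by (simp add: bessel_coeff_def catalan_number_def power_add distrib_left del: fact_Suc)
    qed
    also have "\<dots> = catalan_number (Suc k) * ((-1) ^ k * (pi ^ (2 * k + 2) - \<theta> ^ (2 * k + 2)) / fact (2 * k + 2))"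
      unfolding sum_distrib_right[symmetric] catalan_number_convolution ..
    also have "\<dots> = Phi \<theta> $ n - Phi pi $ n"
      unfolding n by (simp add: bessel_coeff_def catalan_number_def del: fact_Suc)
        (simp add: divide_simps right_diff_distrib del: fact_Suc)
    finally show ?thesis .
  qed
  ultimately show ?thesis by simp
qed

text \<open>Composition with \<open>vol0\<close> is a ring homomorphism. A convolution of volumes is
  thus a finite combination of coefficients of \<open>Phi a * Phi b\<close>, with weights
  independent of the angles, and can be integrated term by term.\<close>

lemma vol_convolution_eq:
  "(\<Sum>k\<le>m. vol k a * vol (m - k) b) = (\<Sum>n\<le>m. (Phi a * Phi b) $ n * (vol0 ^ n) $ m)"
proof -
  have "(\<Sum>k\<le>m. vol k a * vol (m - k) b) = ((Phi a oo vol0) * (Phi b oo vol0)) $ m"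
    by (simp add: vol_def fps_mult_nth atLeast0AtMost)
  also have "\<dots> = ((Phi a * Phi b) oo vol0) $ m"
    by (subst fps_compose_mult_distrib) simp_all
  finally show ?thesis by (simp add: fps_compose_nth atLeast0AtMost)
qed

lemma vol_0 [simp]: "vol 0 \<theta> = 0"
  by (simp add: vol_def)

lemma vol_pi: "vol m pi = (if m = 1 then 1 else 0)"
  by (simp add: vol_def Phi_compose_vol0)

text \<open>The integral equation for \<open>Phi\<close> composed with \<open>vol0\<close>. The
  inhomogeneous term \<open>Phi pi\<close> becomes the variable itself, which accounts for the tree
  with no internal vertex.\<close>

lemma vol_recursion:
  assumes "0 \<le> \<theta>" "\<theta> \<le> pi"
  shows "has_bochner_integral lborel
     (\<lambda>z. indicator (tri \<theta>) z * (\<Sum>k\<le>m. vol k (fst z) * vol (m - k) (snd z)))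
     (vol m \<theta> - (if m = 1 then 1 else 0))"
proof -
  have "has_bochner_integral lborel
     (\<lambda>z. \<Sum>n\<le>m. indicator (tri \<theta>) z * (Phi (fst z) * Phi (snd z)) $ n * (vol0 ^ n) $ m)
     (\<Sum>n\<le>m. (Phi \<theta> $ n - Phi pi $ n) * (vol0 ^ n) $ m)"
    by (intro has_bochner_integral_sum has_bochner_integral_mult_left has_bochner_integral_Phi_mult assms)
  moreover have "(\<Sum>n\<le>m. (Phi \<theta> $ n - Phi pi $ n) * (vol0 ^ n) $ m) = vol m \<theta> - vol m pi"
    by (simp add: vol_def fps_compose_nth atLeast0AtMost left_diff_distrib sum_subtractf)
  ultimately show ?thesis
    by (simp add: vol_convolution_eq sum_distrib_left mult.assoc vol_pi)
qed

lemma vol_1: 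
  assumes "0 \<le> \<theta>" "\<theta> \<le> pi"
  shows "vol 1 \<theta> = 1"
proof -
  have "has_bochner_integral lborel (\<lambda>z::real\<times>real. 0::real) (vol 1 \<theta> - 1)"
    using vol_recursion[OF assms, of 1] by simp
  from has_bochner_integral_eq[OF this has_bochner_integral_zero] show ?thesis by simp
qed

text \<open>The sign cannot be seen on the alternating series; it comes from the recursion. The end
  terms k = 0 and k = m vanish because \<open>vol 0\<close> is 0, so only smaller indices occur
  under the integral.\<close>

lemma vol_nonneg:
  assumes "0 \<le> \<theta>" "\<theta> \<le> pi"
  shows "0 \<le> vol m \<theta>"
  using assms
proof (induction m arbitrary: \<theta> rule: less_induct)
  case (less m)
  show ?case
  proof (cases "m \<le> 1")
    case True
    then show ?thesis using vol_1[OF less.prems] by (cases "m = 0") (auto simp: le_Suc_eq)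
  next
    case False
    have "0 \<le> integral\<^sup>L lborel (\<lambda>z. indicator (tri \<theta>) z * (\<Sum>k\<le>m. vol k (fst z) * vol (m - k) (snd z)))"
    proof (rule Bochner_Integration.integral_nonneg)
      fix z :: "real \<times> real"
      show "0 \<le> indicator (tri \<theta>) z * (\<Sum>k\<le>m. vol k (fst z) * vol (m - k) (snd z))"
      proof (cases "z \<in> tri \<theta>")
        case True
        then have z: "0 < fst z" "0 < snd z" "fst z \<le> pi" "snd z \<le> pi" by (auto simp: tri_def)
        have "0 \<le> vol k (fst z) * vol (m - k) (snd z)" if "k \<le> m" for k
        proof (cases "k = 0 \<or> k = m")
          case True
          then show ?thesis by auto
        next
          case False
          then show ?thesis using z that by (intro mult_nonneg_nonneg less.IH) auto
        qed
        then show ?thesis using True by (auto intro!: sum_nonneg)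
      qed auto
    qed
    then show ?thesis
      using has_bochner_integral_integral_eq[OF vol_recursion[OF less.prems, of m]] False by simp
  qed
qed

lemma nn_integral_vol_recursion:
  assumes "0 \<le> \<theta>" "\<theta> \<le> pi"
  shows "ennreal (vol m \<theta>) = (if m = 1 then 1 else 0) +
    (\<integral>\<^sup>+z. indicator (tri \<theta>) z * (\<Sum>k\<le>m. ennreal (vol k (fst z)) * ennreal (vol (m - k) (snd z))) \<partial>lborel)"
proof -
  let ?f = "\<lambda>z. indicator (tri \<theta>) z * (\<Sum>k\<le>m. vol k (fst z) * vol (m - k) (snd z))"
  have nn: "0 \<le> vol k (fst z)" "0 \<le> vol k (snd z)" if "z \<in> tri \<theta>" for z k
    using that by (auto intro!: vol_nonneg simp: tri_def)
  have f0: "0 \<le> ?f z" for z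
    by (cases "z \<in> tri \<theta>") (auto intro!: sum_nonneg mult_nonneg_nonneg nn)
  have "(\<integral>\<^sup>+z. ennreal (?f z) \<partial>lborel) = ennreal (vol m \<theta> - (if m = 1 then 1 else 0))"
    using vol_recursion[OF assms, of m] f0
    by (simp add: has_bochner_integral_iff nn_integral_eq_integral)
  also have "(\<integral>\<^sup>+z. ennreal (?f z) \<partial>lborel) =
    (\<integral>\<^sup>+z. indicator (tri \<theta>) z * (\<Sum>k\<le>m. ennreal (vol k (fst z)) * ennreal (vol (m - k) (snd z))) \<partial>lborel)"
  proof (rule nn_integral_cong)
    fix z
    show "ennreal (?f z) = indicator (tri \<theta>) z * (\<Sum>k\<le>m. ennreal (vol k (fst z)) * ennreal (vol (m - k) (snd z)))"
      by (cases "z \<in> tri \<theta>") (auto simp: sum_ennreal[symmetric] ennreal_mult nn intro!: mult_nonneg_nonneg)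
  qed
  finally show ?thesis
    using vol_1[OF assms] vol_nonneg[OF assms, of m] by auto
qed

section \<open>Lagrange inversion\<close>

lemma fps_compose_mult_nth:
  fixes A B X :: "'a::idom fps"
  assumes X0: "X $ 0 = 0"
  shows "((A oo X) * B) $ n = (\<Sum>i\<le>n. A $ i * (X ^ i * B) $ n)"
proof -
  have cut: "(A oo X) $ k = (\<Sum>i\<le>n. A $ i * (X ^ i) $ k)" if "k \<le> n" for k
    unfolding fps_compose_nth
  proof (rule sum.mono_neutral_left)
    show "\<forall>i\<in>{..n} - {0..k}. A $ i * (X ^ i) $ k = 0"
      using startsby_zero_power_prefix[OF X0] by auto
  qed (use that in auto)
  have "((A oo X) * B) $ n = (\<Sum>k\<le>n. \<Sum>i\<le>n. A $ i * ((X ^ i) $ k * B $ (n - k)))"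
    unfolding fps_mult_nth atLeast0AtMost
    by (intro sum.cong refl) (simp add: cut sum_distrib_right mult.assoc)
  also have "\<dots> = (\<Sum>i\<le>n. A $ i * (X ^ i * B) $ n)"
    unfolding fps_mult_nth atLeast0AtMost by (subst sum.swap) (simp add: sum_distrib_left)
  finally show ?thesis .
qed

text \<open>The formal residue of X' / X^(n+1) for X = \<open>fps_X * f\<close>, written without
  negative powers. For n > 0 the quotient is a derivative and has residue 0; for n = 0 the residue
  is the order of X, which is 1.\<close>

lemma fps_deriv_X_mult_inverse_power_nth:
  fixes f :: "'a::field_char_0 fps"
  assumes f0: "f $ 0 = 1"
  shows "(fps_deriv (fps_X * f) * inverse f ^ Suc n) $ n = (if n = 0 then 1 else 0)"
proof -
  let ?\<phi> = "inverse f"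
  have f\<phi>: "f * ?\<phi> = 1"
    using f0 by (simp add: inverse_mult_eq_1')
  have "fps_deriv (fps_X * f) * ?\<phi> ^ Suc n = (f * ?\<phi>) * ?\<phi> ^ n + fps_X * (fps_deriv f * ?\<phi> ^ Suc n)"
    by (simp add: algebra_simps)
  then have e: "fps_deriv (fps_X * f) * ?\<phi> ^ Suc n = ?\<phi> ^ n + fps_X * (fps_deriv f * ?\<phi> ^ Suc n)"
    by (simp add: f\<phi>)
  show ?thesis
  proof (cases n)
    case 0
    then show ?thesis unfolding e by simp
  next
    case (Suc k)
    have "fps_deriv (?\<phi> ^ n) = - (of_nat n * (fps_deriv f * ?\<phi> ^ Suc n))"
      unfolding Suc fps_deriv_power' diff_Suc_1 using f0
      by (simp add: fps_inverse_deriv power2_eq_square mult_ac del: of_nat_Suc)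
    then have "fps_deriv (?\<phi> ^ n) $ k = - (of_nat n * (fps_deriv f * ?\<phi> ^ Suc n)) $ k"
      by simp
    then have "of_nat n * (?\<phi> ^ n) $ n = - (of_nat n * (fps_deriv f * ?\<phi> ^ Suc n) $ k)"
      by (simp add: Suc fps_of_nat[symmetric] del: of_nat_Suc power_Suc)
    then have "(?\<phi> ^ n) $ n = - (fps_deriv f * ?\<phi> ^ Suc n) $ k"
      using Suc by (metis mult_cancel_left mult_minus_right nat.simps(3) of_nat_eq_0_iff fps_neg_nth)
    then show ?thesis unfolding e using Suc by simp
  qed
qed

text \<open>The Lagrange-Buermann formula. Expanding H' = K'(X) X' in powers of X and dividing by
  X^(m+1), the residue lemma leaves only the term of index m.\<close>

lemma fps_lagrange_inversion:
  fixes f H K :: "'a::field_char_0 fps"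
  assumes f0: "f $ 0 = 1" and H: "H = K oo (fps_X * f)"
  shows "of_nat (Suc m) * K $ Suc m = (fps_deriv H * inverse f ^ Suc m) $ m"
proof -
  let ?X = "fps_X * f" and ?\<phi> = "inverse f"
  have X0: "?X $ 0 = 0" by simp
  have f\<phi>: "f * ?\<phi> = 1"
    using f0 by (simp add: inverse_mult_eq_1')
  have "fps_deriv H * ?\<phi> ^ Suc m = (fps_deriv K oo ?X) * (fps_deriv ?X * ?\<phi> ^ Suc m)"
    unfolding H by (subst fps_compose_deriv) (simp_all add: mult.assoc)
  then have "(fps_deriv H * ?\<phi> ^ Suc m) $ m
     = (\<Sum>i\<le>m. fps_deriv K $ i * (?X ^ i * (fps_deriv ?X * ?\<phi> ^ Suc m)) $ m)"
    by (simp only: fps_compose_mult_nth[where X = ?X, OF X0])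
  also have "\<dots> = (\<Sum>i\<le>m. if i = m then fps_deriv K $ i else 0)"
  proof (rule sum.cong[OF refl])
    fix i assume i: "i \<in> {..m}"
    have "f ^ i * ?\<phi> ^ i = 1"
      by (simp add: f\<phi> flip: power_mult_distrib)
    then have "?X ^ i * (fps_deriv ?X * ?\<phi> ^ Suc m) = fps_X ^ i * (fps_deriv ?X * ?\<phi> ^ Suc (m - i))"
    proof -
      have "?\<phi> ^ Suc m = ?\<phi> ^ i * ?\<phi> ^ Suc (m - i)"
        using i by (simp flip: power_add power_Suc)
      then have "?X ^ i * (fps_deriv ?X * ?\<phi> ^ Suc m)
         = fps_X ^ i * (f ^ i * ?\<phi> ^ i) * (fps_deriv ?X * ?\<phi> ^ Suc (m - i))"
        by (simp only: power_mult_distrib mult_ac)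
      then show ?thesis
        by (simp only: \<open>f ^ i * ?\<phi> ^ i = 1\<close> mult_1_right)
    qed
    then have "(?X ^ i * (fps_deriv ?X * ?\<phi> ^ Suc m)) $ m = (fps_deriv ?X * ?\<phi> ^ Suc (m - i)) $ (m - i)"
      using i by (simp only: fps_X_power_mult_nth) auto
    also have "\<dots> = (if i = m then 1 else 0)"
      using fps_deriv_X_mult_inverse_power_nth[OF f0, of "m - i"] i by auto
    finally show "fps_deriv K $ i * (?X ^ i * (fps_deriv ?X * ?\<phi> ^ Suc m)) $ m
      = (if i = m then fps_deriv K $ i else 0)" by simp
  qed
  also have "\<dots> = of_nat (Suc m) * K $ Suc m"
    by simp
  finally show ?thesis by simp
qed

text \<open>As a function of p this is J_1(2 pi sqrt p) / (pi sqrt p), that is,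
  \<open>Phi pi\<close> divided by its variable.\<close>

definition sfps :: "real fps" where
  "sfps = Abs_fps (\<lambda>k. bessel_coeff k * pi ^ (2 * k))"

lemma Phi_pi_eq: "Phi pi = fps_X * sfps"
  by (rule fps_ext) (simp add: Phi_def sfps_def)

lemma sfps_nth_0 [simp]: "sfps $ 0 = 1"
  by (simp add: sfps_def)

lemma vol_lagrange:
  "real (Suc m) * vol (Suc m) \<theta> = (fps_deriv (Phi \<theta>) * inverse sfps ^ Suc m) $ m"
  unfolding vol_def
proof (rule fps_lagrange_inversion)
  have "(Phi \<theta> oo vol0) oo Phi pi = Phi \<theta> oo (vol0 oo Phi pi)"
    by (simp add: fps_compose_assoc)
  then show "Phi \<theta> = (Phi \<theta> oo vol0) oo (fps_X * sfps)"
    by (simp add: vol0_compose_Phi flip: Phi_pi_eq)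
qed simp

section \<open>The logarithm of a Bessel series\<close>

definition ufps :: "real fps" where
  "ufps = - fps_deriv sfps * inverse sfps"

lemma ufps_mult_sfps: "ufps * sfps = - fps_deriv sfps"
  unfolding ufps_def by (simp add: mult.assoc inverse_mult_eq_1)

lemma sfps_ode: "fps_X * fps_deriv (fps_deriv sfps) + 2 * fps_deriv sfps + fps_const (pi\<^sup>2) * sfps = 0"
proof (rule fps_ext)
  fix n
  have b1: "bessel_coeff (Suc k) * (real (Suc k) * real (Suc (Suc k))) = - bessel_coeff k" for k
    by (simp add: bessel_coeff_def divide_simps)
  have two: "(2 * fps_deriv sfps) $ n = 2 * (fps_deriv sfps) $ n" for n
    by (simp add: numeral_fps_const)
  show "(fps_X * fps_deriv (fps_deriv sfps) + 2 * fps_deriv sfps + fps_const (pi\<^sup>2) * sfps) $ n = 0 $ n"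
  proof (cases n)
    case 0
    moreover have "bessel_coeff (Suc 0) = - 1 / 2" by (simp add: bessel_coeff_def)
    ultimately show ?thesis by (simp add: two sfps_def power2_eq_square)
  next
    case (Suc m)
    have "(fps_X * fps_deriv (fps_deriv sfps) + 2 * fps_deriv sfps + fps_const (pi\<^sup>2) * sfps) $ n
      = (bessel_coeff (Suc n) * (real (Suc n) * real (Suc (Suc n))) + bessel_coeff n) * pi ^ (2 * Suc n)"
      unfolding Suc by (simp add: two sfps_def power2_eq_square algebra_simps)
    then show ?thesis by (simp only: b1) simp
  qed
qed

text \<open>Bessel's equation \<open>sfps_ode\<close> turns into a Riccati equation for the negative
  logarithmic derivative. Its right side has only positive terms, so the resulting coefficient
  recursion preserves nonnegativity.\<close>

lemma ufps_riccati: "fps_X * fps_deriv ufps + 2 * ufps = fps_const (pi\<^sup>2) + fps_X * (ufps * ufps)"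
proof -
  have "fps_deriv (ufps * sfps) = fps_deriv (- fps_deriv sfps)"
    by (simp only: ufps_mult_sfps)
  then have "fps_X * (fps_deriv ufps * sfps + ufps * fps_deriv sfps) = - (fps_X * fps_deriv (fps_deriv sfps))"
    by (simp add: algebra_simps)
  also have "\<dots> = 2 * fps_deriv sfps + fps_const (pi\<^sup>2) * sfps"
    using sfps_ode by (simp add: add_eq_0_iff algebra_simps)
  finally have "fps_X * (fps_deriv ufps * sfps + ufps * fps_deriv sfps) = 2 * fps_deriv sfps + fps_const (pi\<^sup>2) * sfps" .
  moreover have "fps_deriv sfps = - (ufps * sfps)"
    by (simp add: ufps_mult_sfps)
  ultimately have "(fps_X * fps_deriv ufps + 2 * ufps - (fps_const (pi\<^sup>2) + fps_X * (ufps * ufps))) * sfps = 0"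
    by (simp add: algebra_simps)
  moreover have "sfps \<noteq> 0"
    using sfps_nth_0 by (metis fps_zero_nth zero_neq_one)
  ultimately show ?thesis by simp
qed

lemma ufps_nth_0: "ufps $ 0 = pi\<^sup>2 / 2"
proof -
  have "(fps_X * fps_deriv ufps + 2 * ufps) $ 0 = (fps_const (pi\<^sup>2) + fps_X * (ufps * ufps)) $ 0"
    by (simp only: ufps_riccati)
  then show ?thesis by (simp add: numeral_fps_const)
qed

lemma ufps_nth_Suc: "real (n + 3) * ufps $ Suc n = (\<Sum>i\<le>n. ufps $ i * ufps $ (n - i))"
proof -
  have "(fps_X * fps_deriv ufps + 2 * ufps) $ Suc n = (fps_const (pi\<^sup>2) + fps_X * (ufps * ufps)) $ Suc n"
    by (simp only: ufps_riccati)
  moreover have "(2 * ufps) $ Suc n = 2 * ufps $ Suc n"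
    by (simp add: numeral_fps_const)
  ultimately have "real (n + 3) * ufps $ Suc n = (ufps * ufps) $ n"
    by (simp add: algebra_simps)
  then show ?thesis by (simp add: fps_mult_nth atLeast0AtMost)
qed

text \<open>The recursion for index k + 1 has k + 1 products on one side and the factor k + 3 on the
  other, so a geometric bound started at the constant term pi^2 / 2 reproduces itself. It yields the
  radius of convergence 2 / pi^2 used throughout.\<close>

lemma ufps_nth_bounds: "0 \<le> ufps $ n \<and> ufps $ n \<le> (pi\<^sup>2 / 2) ^ Suc n"
proof (induction n rule: less_induct)
  case (less n)
  show ?case
  proof (cases n)
    case 0
    then show ?thesis by (simp add: ufps_nth_0)
  next
    case (Suc k)
    have IH: "0 \<le> ufps $ i" "ufps $ i \<le> (pi\<^sup>2 / 2) ^ Suc i" if "i \<le> k" for i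
      using less[of i] that Suc by auto
    have "0 \<le> (\<Sum>i\<le>k. ufps $ i * ufps $ (k - i))"
      by (intro sum_nonneg mult_nonneg_nonneg IH) auto
    then have "0 \<le> real (k + 3) * ufps $ n"
      using ufps_nth_Suc[of k] Suc by simp
    then have nn: "0 \<le> ufps $ n"
      by (simp add: zero_le_mult_iff)
    have "(\<Sum>i\<le>k. ufps $ i * ufps $ (k - i)) \<le> (\<Sum>i\<le>k. (pi\<^sup>2 / 2) ^ (k + 2))"
    proof (rule sum_mono)
      fix i assume i: "i \<in> {..k}"
      have "ufps $ i * ufps $ (k - i) \<le> (pi\<^sup>2 / 2) ^ Suc i * (pi\<^sup>2 / 2) ^ Suc (k - i)"
        using i by (intro mult_mono IH) auto
      also have "\<dots> = (pi\<^sup>2 / 2) ^ (k + 2)"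
        using i by (simp flip: power_add power_Suc)
      finally show "ufps $ i * ufps $ (k - i) \<le> (pi\<^sup>2 / 2) ^ (k + 2)" .
    qed
    also have "\<dots> \<le> real (k + 3) * (pi\<^sup>2 / 2) ^ (k + 2)"
      by (simp del: power_Suc add: mult_right_mono)
    finally have "real (k + 3) * ufps $ n \<le> real (k + 3) * (pi\<^sup>2 / 2) ^ (k + 2)"
      using ufps_nth_Suc[of k] Suc by simp
    then have "ufps $ n \<le> (pi\<^sup>2 / 2) ^ (k + 2)"
      by simp
    then show ?thesis using nn Suc by simp
  qed
qed

text \<open>The series \<open>logfps\<close> is \<open>- ln sfps\<close>; its coefficients are nonnegative, so on a circle around 0 its real part
  is largest on the positive axis.\<close>
definition logfps :: "real fps" where
  "logfps = Abs_fps (\<lambda>n. if n = 0 then 0 else ufps $ (n - 1) / n)"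

lemma fps_deriv_logfps: "fps_deriv logfps = ufps"
  by (rule fps_ext) (simp add: logfps_def)

lemma logfps_nth_0 [simp]: "logfps $ 0 = 0"
  by (simp add: logfps_def)

lemma logfps_nth_bounds: "0 \<le> logfps $ n" "logfps $ n \<le> (pi\<^sup>2 / 2) ^ n"
proof -
  have "logfps $ Suc k \<le> (pi\<^sup>2 / 2) ^ Suc k" for k
  proof -
    have "logfps $ Suc k \<le> ufps $ k"
      using ufps_nth_bounds[of k] by (simp add: logfps_def divide_le_eq mult_right_le_one_le) (simp add: algebra_simps)
    then show ?thesis using ufps_nth_bounds[of k] by linarith
  qed
  then show "logfps $ n \<le> (pi\<^sup>2 / 2) ^ n" by (cases n) auto
  show "0 \<le> logfps $ n" using ufps_nth_bounds[of "n - 1"] by (simp add: logfps_def)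
qed

section \<open>Complexification and evaluation\<close>

definition cfps :: "real fps \<Rightarrow> complex fps" where
  "cfps f = Abs_fps (\<lambda>n. complex_of_real (f $ n))"

lemma cfps_nth [simp]: "cfps f $ n = complex_of_real (f $ n)"
  by (simp add: cfps_def)

lemma cfps_mult: "cfps (f * g) = cfps f * cfps g"
  by (rule fps_ext) (simp add: fps_mult_nth)

lemma cfps_1: "cfps 1 = 1"
  by (rule fps_ext) simp

lemma cfps_power: "cfps (f ^ n) = cfps f ^ n"
  by (induction n) (simp_all add: cfps_1 cfps_mult)

lemma cfps_deriv: "cfps (fps_deriv f) = fps_deriv (cfps f)"
  by (rule fps_ext) simp

lemma cfps_inverse: "f $ 0 \<noteq> 0 \<Longrightarrow> cfps (inverse f) = inverse (cfps f)"
  by (rule sym, rule fps_inverse_unique) (simp add: inverse_mult_eq_1' cfps_1 flip: cfps_mult)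

lemma fps_conv_radius_cfps [simp]: "fps_conv_radius (cfps f) = fps_conv_radius f"
proof -
  have "fps_conv_radius (Abs_fps (\<lambda>n. norm (cfps f $ n))) = fps_conv_radius (Abs_fps (\<lambda>n. norm (f $ n)))"
    by simp
  then show ?thesis by (simp only: fps_conv_radius_norm)
qed

lemma eval_cfps_of_real:
  assumes "norm x < fps_conv_radius f"
  shows "eval_fps (cfps f) (of_real x) = of_real (eval_fps f x)"
proof -
  have "(\<lambda>n. complex_of_real (f $ n * x ^ n)) sums of_real (eval_fps f x)"
    using sums_eval_fps[OF assms] by (simp only: sums_of_real_iff)
  then have "(\<lambda>n. cfps f $ n * of_real x ^ n) sums of_real (eval_fps f x)"
    by simp
  then show ?thesis unfolding eval_fps_def by (rule sums_unique[symmetric])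
qed

lemma fps_conv_radius_geI:
  fixes f :: "real fps"
  assumes "\<And>n. \<bar>f $ n\<bar> \<le> C * q ^ n" and q: "0 < q"
  shows "fps_conv_radius f \<ge> ereal (1 / q)"
  unfolding fps_conv_radius_def
proof (rule conv_radius_geI_ex')
  fix r :: real assume r: "0 < r" "ereal r < ereal (1 / q)"
  then have qr: "q * r < 1" using q by (simp add: field_simps)
  show "summable (\<lambda>n. f $ n * of_real r ^ n)"
  proof (rule summable_comparison_test')
    show "summable (\<lambda>n. C * (q * r) ^ n)"
      using qr q r by (intro summable_mult summable_geometric) auto
    fix n
    show "norm (f $ n * of_real r ^ n) \<le> C * (q * r) ^ n"
      using mult_right_mono[OF assms(1)[of n], of "r ^ n"] r
      by (simp add: abs_mult power_mult_distrib mult.assoc)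
  qed
qed

lemma fps_conv_radius_infI:
  fixes f :: "real fps"
  assumes "\<And>n. \<bar>f $ n\<bar> \<le> a ^ n / fact n" "0 \<le> a"
  shows "fps_conv_radius f = \<infinity>"
proof -
  have "summable (\<lambda>n. f $ n * of_real r ^ n)" if "0 < r" for r :: real
  proof (rule summable_comparison_test')
    show "summable (\<lambda>n. inverse (fact n) * (a * r) ^ n)"
      by (rule summable_exp)
    fix n
    show "norm (f $ n * of_real r ^ n) \<le> inverse (fact n) * (a * r) ^ n"
      using mult_right_mono[OF assms(1)[of n], of "r ^ n"] that
      by (simp add: abs_mult power_mult_distrib field_simps)
  qed
  then have "conv_radius (($) f) \<ge> \<infinity>"
    by (intro conv_radius_geI_ex')
  then show ?thesis by (simp add: fps_conv_radius_def)
qed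

lemma fps_conv_radius_logfps: "fps_conv_radius logfps \<ge> ereal (2 / pi\<^sup>2)"
proof -
  have "fps_conv_radius logfps \<ge> ereal (1 / (pi\<^sup>2 / 2))"
    by (rule fps_conv_radius_geI[of _ 1]) (use logfps_nth_bounds in auto)
  then show ?thesis by simp
qed

lemma abs_bessel_coeff_le: "\<bar>bessel_coeff k\<bar> \<le> 1 / fact (Suc k)"
proof -
  have "\<bar>bessel_coeff k\<bar> = 1 / (fact k * fact (Suc k))"
    by (simp add: bessel_coeff_def abs_mult power_abs)
  also have "\<dots> \<le> 1 / fact (Suc k)"
  proof (rule divide_left_mono)
    have "1 * fact (Suc k) \<le> (fact k * fact (Suc k) :: real)"
      by (rule mult_right_mono) auto
    then show "fact (Suc k) \<le> (fact k * fact (Suc k) :: real)" by simp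
  qed auto
  finally show ?thesis .
qed

section \<open>Bessel functions and the critical point\<close>

definition J0fps :: "real fps" where
  "J0fps = Abs_fps (\<lambda>k. (-1) ^ k / (fact k)\<^sup>2)"

text \<open>The critical point of \<open>Phi pi\<close>; its critical value is \<open>xc\<close>.\<close>
definition pc :: real where
  "pc = c0\<^sup>2 / (4 * pi\<^sup>2)"

lemma fps_conv_radius_J0fps [simp]: "fps_conv_radius J0fps = \<infinity>"
proof (rule fps_conv_radius_infI[where a = 1])
  fix n
  have "1 * fact n \<le> ((fact n)\<^sup>2 :: real)"
    unfolding power2_eq_square by (rule mult_right_mono) auto
  then show "\<bar>J0fps $ n\<bar> \<le> 1 ^ n / fact n"
    by (simp add: J0fps_def power_abs frac_le)
qed simp

lemma fps_conv_radius_Phi [simp]: "fps_conv_radius (Phi \<theta>) = \<infinity>"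
proof (rule fps_conv_radius_infI[where a = "1 + \<theta>\<^sup>2"])
  fix n
  show "\<bar>Phi \<theta> $ n\<bar> \<le> (1 + \<theta>\<^sup>2) ^ n / fact n"
  proof (cases n)
    case (Suc k)
    have "(\<theta>\<^sup>2) ^ k \<le> (1 + \<theta>\<^sup>2) ^ k"
      by (rule power_mono) auto
    also have "\<dots> \<le> (1 + \<theta>\<^sup>2) ^ Suc k"
      by (rule power_increasing) auto
    finally have "\<bar>bessel_coeff k\<bar> * (\<theta>\<^sup>2) ^ k \<le> 1 / fact (Suc k) * (1 + \<theta>\<^sup>2) ^ Suc k"
      by (intro mult_mono abs_bessel_coeff_le) auto
    then show ?thesis
      by (simp add: Suc abs_mult power_mult del: fact_Suc power_Suc)
  qed simp
qed (simp add: add_nonneg_nonneg)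

lemma fps_conv_radius_sfps [simp]: "fps_conv_radius sfps = \<infinity>"
proof -
  have "sfps = fps_shift 1 (Phi pi)"
    by (rule fps_ext) (simp add: sfps_def)
  then have "fps_conv_radius sfps = fps_conv_radius (Phi pi)"
    by (metis fps_conv_radius_shift)
  then show ?thesis by simp
qed

lemma fps_conv_radius_ufps: "fps_conv_radius ufps \<ge> ereal (2 / pi\<^sup>2)"
  using fps_conv_radius_logfps fps_conv_radius_deriv[of logfps] fps_deriv_logfps by (metis order_trans)

lemma fps_deriv_Phi_nth: "fps_deriv (Phi \<theta>) $ k = J0fps $ k * (\<theta>\<^sup>2) ^ k"
  by (simp add: J0fps_def bessel_coeff_def power_mult power2_eq_square divide_simps)

lemma eval_fps_deriv_Phi: "eval_fps (fps_deriv (Phi \<theta>)) p = eval_fps J0fps (\<theta>\<^sup>2 * p)"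
  unfolding eval_fps_def fps_deriv_Phi_nth by (simp add: power_mult_distrib mult.assoc)

lemma besselJ0_eq: "besselJ0 x = eval_fps J0fps ((x / 2)\<^sup>2)"
  unfolding besselJ0_def eval_fps_def J0fps_def by (simp add: power_mult)

text \<open>This says J_0(2 sqrt 2) < 0. By Leibniz' criterion four terms after the leading 1 bound
  the alternating tail from below, and they already exceed 1. The argument 2 is chosen because (c_0
  / 2)^2 < 2 is exactly \<open>pc\<close> < 2 / pi^2.\<close>

lemma eval_J0fps_2: "eval_fps J0fps 2 < 0"
proof -
  define a where "a k = (2::real) ^ Suc k / (fact (Suc k))\<^sup>2" for k
  have a_Suc: "a (Suc k) = 2 / (real k + 2)\<^sup>2 * a k" for k
    by (simp add: a_def power2_eq_square divide_simps) (simp add: algebra_simps)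
  have a_pos: "0 \<le> a k" for k by (simp add: a_def)
  have half: "a (Suc k) \<le> (1/2) * a k" for k
  proof -
    have "2\<^sup>2 \<le> (real k + 2)\<^sup>2" by (rule power_mono) auto
    then have "2 / (real k + 2)\<^sup>2 \<le> 1 / 2" by (simp add: divide_simps)
    then show ?thesis unfolding a_Suc by (rule mult_right_mono[OF _ a_pos])
  qed
  have le: "a k \<le> 2 * (1/2) ^ k" for k
  proof (induction k)
    case (Suc k)
    have "a (Suc k) \<le> (1/2) * a k" by (rule half)
    also have "\<dots> \<le> (1/2) * (2 * (1/2) ^ k)" using Suc by simp
    finally show ?case by simp
  qed (simp add: a_def)
  have "a \<longlonglongrightarrow> 0"
  proof (rule tendsto_sandwich[OF _ _ tendsto_const])
    show "(\<lambda>k. 2 * (1/2) ^ k :: real) \<longlonglongrightarrow> 0"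
      by (intro tendsto_mult_right_zero LIMSEQ_realpow_zero) auto
  qed (auto simp: a_pos le)
  moreover have "a (Suc k) \<le> a k" for k
    using half[of k] a_pos[of k] by linarith
  ultimately have "(\<Sum>i<2 * 2. (-1) ^ i * a i) \<le> (\<Sum>i. (-1) ^ i * a i)" "summable (\<lambda>i. (-1) ^ i * a i)"
    using summable_Leibniz'[of a] a_pos by blast+
  moreover have "(\<Sum>i<2 * 2. (-1) ^ i * a i) > 1"
    by (simp add: a_def lessThan_nat_numeral fact_numeral lessThan_Suc power2_eq_square)
  ultimately have "1 < (\<Sum>i. (-1) ^ i * a i)" "summable (\<lambda>i. (-1) ^ i * a i)" by linarith+
  then have s: "(\<lambda>i. - ((-1) ^ i * a i)) sums - (\<Sum>i. (-1) ^ i * a i)"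
    by (intro sums_minus summable_sums)
  have "(\<lambda>i. J0fps $ Suc i * 2 ^ Suc i) sums - (\<Sum>i. (-1) ^ i * a i)"
    using s by (simp add: J0fps_def a_def)
  then have "(\<lambda>i. J0fps $ i * 2 ^ i) sums (- (\<Sum>i. (-1) ^ i * a i) + J0fps $ 0 * 2 ^ 0)"
    by (rule sums_Suc)
  then have "eval_fps J0fps 2 = - (\<Sum>i. (-1) ^ i * a i) + 1"
    unfolding eval_fps_def by (subst sums_unique[symmetric]) (auto simp: J0fps_def)
  with \<open>1 < (\<Sum>i. (-1) ^ i * a i)\<close> show ?thesis by simp
qed

lemma eval_J0fps_0 [simp]: "eval_fps J0fps 0 = 1"
  by (simp add: eval_fps_at_0 J0fps_def)

lemma continuous_on_eval_J0fps: "continuous_on A (eval_fps J0fps)"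
  by (rule continuous_on_eval_fps'[OF continuous_on_id, unfolded id_def]) auto

text \<open>\<open>c0\<close> is a definite description, so its existence has to be shown: the zeros
  in [0, 2] of the series in y = (x / 2)^2 form a compact set, nonempty by the intermediate value
  theorem, and the least one gives the first positive zero of J_0.\<close>

lemma c0_properties:
  "0 < c0" "(c0 / 2)\<^sup>2 < 2" "eval_fps J0fps ((c0 / 2)\<^sup>2) = 0"
  "\<And>y. 0 \<le> y \<Longrightarrow> y < (c0 / 2)\<^sup>2 \<Longrightarrow> 0 < eval_fps J0fps y"
proof -
  let ?J = "eval_fps J0fps"
  define Z where "Z = {y \<in> {0..2}. ?J y = 0}"
  have Z_eq: "Z = {0..2} \<inter> ?J -` {0}" by (auto simp: Z_def)
  have "closed Z"
    unfolding Z_eq by (intro continuous_closed_preimage continuous_on_eval_J0fps) auto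
  moreover have "bounded Z"
    unfolding Z_eq by (rule bounded_subset[OF bounded_closed_interval]) auto
  ultimately have "compact Z" by (simp add: compact_eq_bounded_closed)
  have "\<exists>y. 0 \<le> y \<and> y \<le> 2 \<and> ?J y = 0"
    using eval_J0fps_2 by (intro IVT2' continuous_on_eval_J0fps) auto
  then have "Z \<noteq> {}" by (auto simp: Z_def)
  then obtain y0 where y0: "y0 \<in> Z" "\<And>y. y \<in> Z \<Longrightarrow> y0 \<le> y"
    using compact_attains_inf[OF \<open>compact Z\<close>] by blast
  have J0: "?J y0 = 0" "0 \<le> y0" "y0 \<le> 2" using y0 by (auto simp: Z_def)
  have y02: "y0 < 2" "0 < y0"
    using J0 eval_J0fps_2 eval_J0fps_0 by (auto simp: less_le)
  have nz: "?J y \<noteq> 0" if "0 \<le> y" "y < y0" for y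
    using y0(2)[of y] that J0 by (auto simp: Z_def)
  have pos: "0 < ?J y" if "0 \<le> y" "y < y0" for y
  proof (rule ccontr)
    assume "\<not> 0 < ?J y"
    then have "\<exists>x. 0 \<le> x \<and> x \<le> y \<and> ?J x = 0"
      using that by (intro IVT2' continuous_on_eval_J0fps) auto
    then show False using nz that by force
  qed
  define c where "c = 2 * sqrt y0"
  have c: "0 < c" "(c / 2)\<^sup>2 = y0"
    using y02 by (auto simp: c_def)
  have "c0 = c"
    unfolding c0_def
  proof (rule the_equality)
    show P: "0 < c \<and> besselJ0 c = 0 \<and> (\<forall>y. 0 < y \<and> y < c \<longrightarrow> besselJ0 y \<noteq> 0)"
    proof (intro conjI allI impI)
      show "besselJ0 c = 0" by (simp add: besselJ0_eq c J0)
      fix y assume "0 < y \<and> y < c"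
      then have "(y / 2)\<^sup>2 < (c / 2)\<^sup>2" by (intro power_strict_mono) auto
      then show "besselJ0 y \<noteq> 0" using nz by (simp add: besselJ0_eq c)
    qed (use c in simp)
    fix d assume d: "0 < d \<and> besselJ0 d = 0 \<and> (\<forall>y. 0 < y \<and> y < d \<longrightarrow> besselJ0 y \<noteq> 0)"
    show "d = c"
      using d P by (metis linorder_neqE_linordered_idom)
  qed
  then show "0 < c0" "(c0 / 2)\<^sup>2 < 2" "eval_fps J0fps ((c0 / 2)\<^sup>2) = 0"
    "\<And>y. 0 \<le> y \<Longrightarrow> y < (c0 / 2)\<^sup>2 \<Longrightarrow> 0 < eval_fps J0fps y"
    using c y02 J0 pos by auto
qed

lemma pi2_pc: "pi\<^sup>2 * pc = (c0 / 2)\<^sup>2"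
  by (simp add: pc_def power2_eq_square)

lemma pc_bounds: "0 < pc" "pc < 2 / pi\<^sup>2"
  using c0_properties(1,2) pi2_pc by (auto simp: pc_def field_simps power2_eq_square)

text \<open>The origin of \<open>Finf\<close>: it is the derivative of \<open>Phi \<theta>\<close>
  at the critical point, just as \<open>F\<close> is the value there
  (\<open>eval_Phi_pc\<close>).\<close>

lemma eval_deriv_Phi_pc: "eval_fps (fps_deriv (Phi \<theta>)) pc = Finf \<theta>"
  by (simp add: eval_fps_deriv_Phi Finf_def besselJ0_eq pc_def power_divide power_mult_distrib field_simps)

lemma Finf_pos: "0 \<le> \<theta> \<Longrightarrow> \<theta> < pi \<Longrightarrow> 0 < Finf \<theta>"
  unfolding Finf_def besselJ0_eq
proof (rule c0_properties(4))
  assume "0 \<le> \<theta>" "\<theta> < pi"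
  then have "\<theta> * c0 < pi * c0" using c0_properties(1) by simp
  then have "\<theta> / pi * c0 / 2 < c0 / 2" by (simp add: field_simps)
  then show "(\<theta> / pi * c0 / 2)\<^sup>2 < (c0 / 2)\<^sup>2"
    using \<open>0 \<le> \<theta>\<close> c0_properties(1) by (intro power_strict_mono) auto
qed simp

lemma Finf_nonneg: "0 \<le> \<theta> \<Longrightarrow> \<theta> \<le> pi \<Longrightarrow> 0 \<le> Finf \<theta>"
  using Finf_pos[of \<theta>] c0_properties(3) by (cases "\<theta> = pi") (auto simp: Finf_def besselJ0_eq)

lemma continuous_on_Finf: "continuous_on A Finf"
  unfolding Finf_def besselJ0_eq
  by (rule continuous_on_compose2[OF continuous_on_eval_J0fps[of UNIV]]) (auto intro!: continuous_intros)

lemma Finf_0 [simp]: "Finf 0 = 1"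
  by (simp add: Finf_def besselJ0_eq)

lemma eval_Phi_pc: "eval_fps (Phi \<theta>) pc = F \<theta>"
proof -
  have "eval_fps (Phi \<theta>) pc = (\<Sum>n. bessel_coeff n * \<theta> ^ (2 * n) * pc ^ Suc n)"
  proof -
    have "(\<lambda>n. Phi \<theta> $ n * pc ^ n) sums eval_fps (Phi \<theta>) pc"
      by (rule sums_eval_fps) simp
    then have "(\<lambda>n. Phi \<theta> $ Suc n * pc ^ Suc n) sums eval_fps (Phi \<theta>) pc"
      by (subst sums_Suc_iff) simp
    then show ?thesis by (simp add: sums_iff)
  qed
  also have "\<dots> = F \<theta>"
  proof (cases "\<theta> = 0")
    case True
    have "(\<lambda>n. bessel_coeff n * \<theta> ^ (2 * n) * pc ^ Suc n) = (\<lambda>n. if n = 0 then pc else 0)"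
      using True by (auto simp: fun_eq_iff)
    moreover have "(\<Sum>n::nat. if n = 0 then pc else 0) = pc"
      using sums_single[of 0 "\<lambda>_. pc"] by (simp add: sums_iff)
    ultimately have "(\<Sum>n. bessel_coeff n * \<theta> ^ (2 * n) * pc ^ Suc n) = pc"
      by (simp only:)
    moreover have "F \<theta> = pc" using True by (simp add: F_def pc_def)
    ultimately show ?thesis by (simp only:)
  next
    case False
    define y where "y = \<theta> / pi * c0"
    have "(\<lambda>k. (-1) ^ k / (fact k * fact (Suc k)) * (y / 2) ^ (2 * k + 1)) =
      (\<lambda>k. (2 * pi * \<theta> / c0) * (bessel_coeff k * \<theta> ^ (2 * k) * pc ^ Suc k))"
    proof
      fix k
      have "(y / 2) ^ (2 * k + 1) = (2 * pi * \<theta> / c0) * (\<theta> ^ (2 * k) * pc ^ Suc k)"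
      proof -
        have "pc ^ Suc k = (c0 / (2 * pi)) ^ (2 * k + 2)"
        proof -
          have "pc = (c0 / (2 * pi))\<^sup>2" by (simp add: pc_def power_divide power_mult_distrib)
          then have "pc ^ Suc k = (c0 / (2 * pi)) ^ (2 * Suc k)" by (simp only: power_mult)
          then show ?thesis by simp
        qed
        moreover have "(y / 2) ^ (2 * k + 1) = \<theta> * \<theta> ^ (2 * k) * (c0 / (2 * pi)) ^ (2 * k + 1)"
          by (simp add: y_def power_mult_distrib power_divide mult_ac)
        ultimately show ?thesis using c0_properties(1) by (simp add: mult_ac)
      qed
      then show "(-1) ^ k / (fact k * fact (Suc k)) * (y / 2) ^ (2 * k + 1) =
         (2 * pi * \<theta> / c0) * (bessel_coeff k * \<theta> ^ (2 * k) * pc ^ Suc k)"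
        by (simp add: bessel_coeff_def mult_ac del: fact_Suc)
    qed
    moreover have "summable (\<lambda>n. bessel_coeff n * \<theta> ^ (2 * n) * pc ^ Suc n)"
    proof -
      have "summable (\<lambda>n. Phi \<theta> $ n * pc ^ n)" by (rule summable_fps) simp
      then have "summable (\<lambda>n. Phi \<theta> $ Suc n * pc ^ Suc n)" by (subst summable_Suc_iff)
      then show ?thesis by simp
    qed
    ultimately have "besselJ1 y = (2 * pi * \<theta> / c0) * (\<Sum>n. bessel_coeff n * \<theta> ^ (2 * n) * pc ^ Suc n)"
      unfolding besselJ1_def by (simp only: suminf_mult)
    then show ?thesis
      using False c0_properties(1) by (simp add: F_def y_def)
  qed
  finally show ?thesis .
qed

lemma xc_eq_F_pi: "xc = F pi"
  using c0_properties(1) by (simp add: xc_def F_def power2_eq_square)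

text \<open>Since logfps' = ufps = - sfps' / sfps, the product has derivative zero on the disc, and
  it equals 1 at the origin. In particular \<open>sfps\<close> has no zero in this disc, so the
  Cauchy integrand is holomorphic there.\<close>

lemma eval_sfps_exp_logfps:
  fixes z :: complex
  assumes "norm z < 2 / pi\<^sup>2"
  shows "eval_fps (cfps sfps) z * exp (eval_fps (cfps logfps) z) = 1"
proof -
  have radL: "norm z < fps_conv_radius (cfps logfps)" "norm z < fps_conv_radius (cfps ufps)"
    if "z \<in> ball 0 (2 / pi\<^sup>2)" for z :: complex
    using that fps_conv_radius_logfps fps_conv_radius_ufps
    by (auto intro: less_le_trans[of "ereal (norm z)" "ereal (2 / pi\<^sup>2)"])
  have "\<exists>c. \<forall>z\<in>ball 0 (2 / pi\<^sup>2). eval_fps (cfps sfps) z * exp (eval_fps (cfps logfps) z) = c"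
  proof (rule has_field_derivative_zero_constant)
    fix z :: complex assume z: "z \<in> ball 0 (2 / pi\<^sup>2)"
    have s': "(eval_fps (cfps sfps) has_field_derivative eval_fps (cfps (fps_deriv sfps)) z) (at z within ball 0 (2 / pi\<^sup>2))"
      unfolding cfps_deriv by (rule has_field_derivative_eval_fps) simp
    have l': "(eval_fps (cfps logfps) has_field_derivative eval_fps (cfps ufps) z) (at z within ball 0 (2 / pi\<^sup>2))"
      unfolding fps_deriv_logfps[symmetric] cfps_deriv by (rule has_field_derivative_eval_fps) (use radL[OF z] in simp)
    have "fps_deriv sfps = - (ufps * sfps)" by (simp add: ufps_mult_sfps)
    then have "cfps (fps_deriv sfps) = - (cfps ufps * cfps sfps)"
      by (simp add: fps_eq_iff flip: cfps_mult)
    then have "eval_fps (cfps (fps_deriv sfps)) z = - (eval_fps (cfps ufps) z * eval_fps (cfps sfps) z)"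
    proof -
      have r: "norm z < fps_conv_radius (cfps ufps * cfps sfps)"
        using radL(2)[OF z] fps_conv_radius_mult[of "cfps ufps" "cfps sfps"]
        by (auto intro: less_le_trans)
      show ?thesis
        unfolding \<open>cfps (fps_deriv sfps) = _\<close> eval_fps_minus[OF r]
        by (subst eval_fps_mult) (use radL[OF z] in auto)
    qed
    then show "((\<lambda>z. eval_fps (cfps sfps) z * exp (eval_fps (cfps logfps) z)) has_field_derivative 0)
       (at z within ball 0 (2 / pi\<^sup>2))"
      using DERIV_mult[OF s' DERIV_chain2[OF DERIV_exp l']] by (simp add: mult_ac)
  qed simp
  then obtain c where c: "\<And>z. z \<in> ball 0 (2 / pi\<^sup>2) \<Longrightarrow> eval_fps (cfps sfps) z * exp (eval_fps (cfps logfps) z) = c"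
    by blast
  have "c = 1" using c[of 0] by (simp add: eval_fps_at_0)
  then show ?thesis using c[of z] assms by simp
qed

lemma norm_pc_less: "norm pc < 2 / pi\<^sup>2"
  using pc_bounds by simp

lemma ereal_pc_less [simp]: "ereal \<bar>pc\<bar> < fps_conv_radius logfps" "ereal \<bar>pc\<bar> < fps_conv_radius ufps"
  using norm_pc_less fps_conv_radius_logfps fps_conv_radius_ufps
  by (auto intro: less_le_trans[of "ereal \<bar>pc\<bar>" "ereal (2 / pi\<^sup>2)"])

lemma eval_sfps_pc: "eval_fps sfps pc = exp (- eval_fps logfps pc)"
proof -
  have "eval_fps (cfps sfps) (of_real pc) * exp (eval_fps (cfps logfps) (of_real pc)) = 1"
    by (rule eval_sfps_exp_logfps) (use norm_pc_less in simp)
  then have "complex_of_real (eval_fps sfps pc * exp (eval_fps logfps pc)) = 1"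
    by (simp add: eval_cfps_of_real exp_of_real)
  then have "eval_fps sfps pc * exp (eval_fps logfps pc) = 1"
    by (simp only: of_real_eq_1_iff)
  then show ?thesis by (simp add: exp_minus field_simps)
qed

lemma xc_eq: "xc = pc * exp (- eval_fps logfps pc)"
  unfolding xc_eq_F_pi eval_Phi_pc[symmetric] Phi_pi_eq
  by (subst eval_fps_mult) (auto simp: eval_sfps_pc)

lemma xc_pos: "0 < xc"
  using pc_bounds by (simp add: xc_eq)

text \<open>The saddle point equation. The derivative of \<open>Phi pi\<close> = p sfps is sfps (1 -
  p ufps); it vanishes at \<open>pc\<close> because J_0(c_0) = 0, while \<open>sfps\<close> is
  nonzero there.\<close>

lemma critical_ufps: "pc * eval_fps ufps pc = 1"
proof -
  have s0: "eval_fps sfps pc \<noteq> 0" by (simp add: eval_sfps_pc)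
  have "fps_deriv (Phi pi) = sfps - fps_X * (ufps * sfps)"
    by (simp add: Phi_pi_eq ufps_mult_sfps)
  moreover have r: "ereal (norm pc) < fps_conv_radius (ufps * sfps)"
    using less_le_trans[OF _ fps_conv_radius_mult[of ufps sfps], of "ereal (norm pc)"] by simp
  moreover have "ereal (norm pc) < fps_conv_radius (fps_X * (ufps * sfps))"
    using less_le_trans[OF _ fps_conv_radius_mult[of fps_X "ufps * sfps"], of "ereal (norm pc)"] r by simp
  ultimately have "eval_fps (fps_deriv (Phi pi)) pc = eval_fps sfps pc - pc * (eval_fps ufps pc * eval_fps sfps pc)"
    by (simp add: eval_fps_diff eval_fps_mult)
  moreover have "eval_fps (fps_deriv (Phi pi)) pc = 0"
    using c0_properties(3) by (simp add: eval_fps_deriv_Phi pi2_pc)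
  ultimately show ?thesis using s0 by (simp add: algebra_simps)
qed

section \<open>Laplace's method\<close>

lemma has_bochner_integral_gaussian:
  assumes a: "0 < a"
  shows "has_bochner_integral lborel (\<lambda>x::real. exp (- a * x\<^sup>2)) (sqrt (pi / a))"
proof -
  define \<sigma> where "\<sigma> = sqrt (1 / (2 * a))"
  have \<sigma>: "\<sigma>\<^sup>2 = 1 / (2 * a)" "0 < \<sigma>" using a by (auto simp: \<sigma>_def)
  have e: "sqrt (pi / a) * normal_density 0 \<sigma> x = exp (- a * x\<^sup>2)" for x
    using a unfolding normal_density_def \<sigma> by (simp add: real_sqrt_divide)
  have "has_bochner_integral lborel (\<lambda>x. sqrt (pi / a) * normal_density 0 \<sigma> x) (sqrt (pi / a) * 1)"
    using \<sigma>(2) by (intro has_bochner_integral_mult_right) (auto simp: has_bochner_integral_iff)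
  then show ?thesis unfolding e by simp
qed

text \<open>Under t = x / sqrt m the quadratic bound on Re \<psi> is scale invariant and supplies
  the integrable majorant C exp (- \<epsilon> x^2) for every m at once; pointwise the exponent tends
  to - s x^2, and the Gaussian integral gives the constant.\<close>

lemma laplace_method:
  fixes G \<psi> :: "real \<Rightarrow> complex"
  assumes cG: "continuous_on {-pi..pi} G" and c\<psi>: "continuous_on {-pi..pi} \<psi>"
    and bound: "\<And>t. t \<in> {-pi..pi} \<Longrightarrow> Re (\<psi> t) \<le> - \<epsilon> * t\<^sup>2" and \<epsilon>: "0 < \<epsilon>"
    and lim: "((\<lambda>t. \<psi> t / of_real (t\<^sup>2)) \<longlongrightarrow> of_real (- s)) (at 0)" and s: "0 < s"
  shows "(\<lambda>m. of_real (sqrt m) * integral {-pi..pi} (\<lambda>t. G t * exp (of_nat m * \<psi> t)))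
     \<longlonglongrightarrow> G 0 * of_real (sqrt (pi / s))"
proof -
  define h where "h m t = (indicator {-pi..pi} t *\<^sub>R (G t * exp (of_nat m * \<psi> t)) :: complex)" for m :: nat and t
  have c: "continuous_on {-pi..pi} (\<lambda>t. G t * exp (of_nat m * \<psi> t))" for m
    by (intro continuous_intros cG c\<psi>)
  have hm: "h m \<in> borel_measurable borel" for m
    using borel_integrable_atLeastAtMost'[OF c[of m]]
    unfolding set_integrable_def h_def by (auto simp: integrable_iff_bounded)
  have int_h: "integral {-pi..pi} (\<lambda>t. G t * exp (of_nat m * \<psi> t)) = (\<integral>t. h m t \<partial>lborel)" for m
    using set_borel_integral_eq_integral(2)[OF borel_integrable_atLeastAtMost'[OF c[of m]]]
    unfolding set_lebesgue_integral_def h_def by simp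
  have "bounded (G ` {-pi..pi})"
    by (intro compact_imp_bounded compact_continuous_image cG) auto
  then obtain C where C: "\<And>t. t \<in> {-pi..pi} \<Longrightarrow> norm (G t) \<le> C"
    unfolding bounded_iff by blast
  have C0: "0 \<le> C" using order_trans[OF norm_ge_zero C[of 0]] by simp
  have scale: "of_real (sqrt m) * (\<integral>t. h m t \<partial>lborel) = (\<integral>x. h m (x / sqrt m) \<partial>lborel)" if "0 < m" for m :: nat
  proof -
    have "(\<integral>t. h m t \<partial>lborel) = \<bar>1 / sqrt m\<bar> *\<^sub>R (\<integral>x. h m (0 + 1 / sqrt m * x) \<partial>lborel)"
      using that by (intro lborel_integral_real_affine) auto
    then show ?thesis using that by (simp add: scaleR_conv_of_real field_simps flip: of_real_mult)
  qed
  \<comment> \<open>The sequence is indexed from 1 so that the scaling factor sqrt m is never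
    zero.\<close>
  have "(\<lambda>m. \<integral>x. h (Suc m) (x / sqrt (Suc m)) \<partial>lborel) \<longlonglongrightarrow> (\<integral>x. G 0 * exp (of_real (- s * x\<^sup>2)) \<partial>lborel)"
  proof (rule integral_dominated_convergence[where w = "\<lambda>x. C * exp (- \<epsilon> * x\<^sup>2)"])
    show "(\<lambda>x. h (Suc m) (x / sqrt (Suc m))) \<in> borel_measurable lborel" for m
      using measurable_compose[OF _ hm[of "Suc m"], of "\<lambda>x. x / sqrt (Suc m)" lborel] by simp
    show "integrable lborel (\<lambda>x. C * exp (- \<epsilon> * x\<^sup>2))"
      using has_bochner_integral_gaussian[OF \<epsilon>] by (auto simp: has_bochner_integral_iff)
    show "AE x in lborel. norm (h (Suc m) (x / sqrt (Suc m))) \<le> C * exp (- \<epsilon> * x\<^sup>2)" for m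
    proof (rule AE_I2)
      fix x :: real
      let ?t = "x / sqrt (Suc m)"
      show "norm (h (Suc m) ?t) \<le> C * exp (- \<epsilon> * x\<^sup>2)"
      proof (cases "?t \<in> {-pi..pi}")
        case True
        have "real (Suc m) * Re (\<psi> ?t) \<le> real (Suc m) * (- \<epsilon> * ?t\<^sup>2)"
          by (rule mult_left_mono[OF bound[OF True]]) simp
        also have "\<dots> = - \<epsilon> * x\<^sup>2"
          by (simp add: power_divide del: of_nat_Suc)
        finally have "exp (real (Suc m) * Re (\<psi> ?t)) \<le> exp (- \<epsilon> * x\<^sup>2)"
          by (simp only: exp_le_cancel_iff)
        then have "norm (G ?t) * exp (real (Suc m) * Re (\<psi> ?t)) \<le> C * exp (- \<epsilon> * x\<^sup>2)"
          using C[OF True] C0 by (intro mult_mono) auto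
        then show ?thesis using True by (simp add: h_def norm_mult del: of_nat_Suc)
      qed (use C0 in \<open>auto simp: h_def\<close>)
    qed
    show "AE x in lborel. (\<lambda>m. h (Suc m) (x / sqrt (Suc m))) \<longlonglongrightarrow> G 0 * exp (of_real (- s * x\<^sup>2))"
    proof -
      have "AE x in lborel. x \<noteq> (0::real)" by (rule AE_lborel_singleton)
      then show ?thesis
      proof eventually_elim
        case (elim x)
        have t0: "(\<lambda>m. x / sqrt (Suc m)) \<longlonglongrightarrow> 0" by real_asymp
        then have t: "filterlim (\<lambda>m. x / sqrt (Suc m)) (at 0) sequentially"
          by (rule filterlim_atI) (use elim in \<open>auto intro!: always_eventually simp del: of_nat_Suc\<close>)
        have "isCont G 0"
          using cG by (rule continuous_on_interior) (auto simp: pi_gt_zero)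
        then have l1: "(\<lambda>m. G (x / sqrt (Suc m))) \<longlonglongrightarrow> G 0"
          using t0 by (rule isCont_tendsto_compose)
        have "(\<lambda>m. of_real (x\<^sup>2) * (\<psi> (x / sqrt (Suc m)) / of_real ((x / sqrt (Suc m))\<^sup>2))) \<longlonglongrightarrow> of_real (x\<^sup>2) * of_real (- s)"
          by (intro tendsto_mult tendsto_const filterlim_compose[OF lim t])
        moreover have "of_real (x\<^sup>2) * (\<psi> (x / sqrt (Suc m)) / of_real ((x / sqrt (Suc m))\<^sup>2)) = of_nat (Suc m) * \<psi> (x / sqrt (Suc m))" for m
        proof -
          have "(x / sqrt (Suc m))\<^sup>2 = x\<^sup>2 / real (Suc m)"
            by (simp add: power_divide del: of_nat_Suc)
          then show ?thesis using elim by (simp add: field_simps del: of_nat_Suc)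
        qed
        ultimately have l2: "(\<lambda>m. of_nat (Suc m) * \<psi> (x / sqrt (Suc m))) \<longlonglongrightarrow> of_real (- s * x\<^sup>2)"
          by (simp add: mult.commute del: of_nat_Suc)
        have l3: "(\<lambda>m. G (x / sqrt (Suc m)) * exp (of_nat (Suc m) * \<psi> (x / sqrt (Suc m)))) \<longlonglongrightarrow> G 0 * exp (of_real (- s * x\<^sup>2))"
          by (intro tendsto_mult l1 tendsto_exp l2)
        have "\<forall>\<^sub>F m in sequentially. \<bar>x / sqrt (Suc m)\<bar> < pi"
          using t0 pi_gt_zero by (auto simp: tendsto_iff dist_real_def)
        then have "\<forall>\<^sub>F m in sequentially. G (x / sqrt (Suc m)) * exp (of_nat (Suc m) * \<psi> (x / sqrt (Suc m))) = h (Suc m) (x / sqrt (Suc m))"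
        proof eventually_elim
          case (elim m)
          then have "x / sqrt (Suc m) \<in> {-pi..pi}" by (simp only: abs_less_iff atLeastAtMost_iff) linarith
          then show ?case by (simp add: h_def)
        qed
        then show ?case by (rule Lim_transform_eventually[OF l3])
      qed
    qed
  qed measurable
  also have "(\<integral>x. G 0 * exp (of_real (- s * x\<^sup>2)) \<partial>lborel) = G 0 * of_real (sqrt (pi / s))"
  proof -
    have "(\<integral>x. G 0 * exp (of_real (- s * x\<^sup>2)) \<partial>lborel) = G 0 * (\<integral>x. of_real (exp (- s * x\<^sup>2)) \<partial>lborel)"
      by (simp add: exp_of_real[symmetric])
    also have "(\<integral>x. complex_of_real (exp (- s * x\<^sup>2)) \<partial>lborel) = of_real (\<integral>x. exp (- s * x\<^sup>2) \<partial>lborel)"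
      by (rule integral_complex_of_real)
    also have "(\<integral>x. exp (- s * x\<^sup>2) \<partial>lborel) = sqrt (pi / s)"
      using has_bochner_integral_gaussian[OF s] by (simp add: has_bochner_integral_iff)
    finally show ?thesis .
  qed
  finally have "(\<lambda>m. of_real (sqrt (Suc m)) * integral {-pi..pi} (\<lambda>t. G t * exp (of_nat (Suc m) * \<psi> t)))
     \<longlonglongrightarrow> G 0 * of_real (sqrt (pi / s))"
    by (simp add: int_h scale del: of_nat_Suc)
  then show ?thesis by (rule LIMSEQ_imp_Suc)
qed

section \<open>Coefficient asymptotics\<close>

text \<open>The circle is reparametrised from angle - pi to pi, so that the saddle at angle 0 lies
  in the interior of the interval of integration.\<close>

lemma part_circlepath_eq_shiftpath: "part_circlepath 0 r (-pi) pi = shiftpath (1/2) (circlepath 0 r)"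
proof
  fix x :: real
  have "exp (\<i> * of_real (linepath (-pi) pi x)) = exp (2 * of_real pi * \<i> * of_real (1/2 + x - 1))"
    by (rule arg_cong[of _ _ exp]) (simp add: linepath_def algebra_simps)
  moreover have "exp (2 * of_real pi * \<i> * of_real (1/2 + x)) = exp (2 * of_real pi * \<i> * of_real (1/2 + x - 1))"
  proof -
    have "2 * of_real pi * \<i> * complex_of_real (1/2 + x) = 2 * of_real pi * \<i> * of_real (1/2 + x - 1) + 2 * of_real pi * \<i>"
      by (simp add: algebra_simps)
    then show ?thesis by (simp only: exp_add exp_two_pi_i) simp
  qed
  ultimately show "part_circlepath 0 r (-pi) pi x = shiftpath (1/2) (circlepath 0 r) x"
    by (simp add: part_circlepath_def shiftpath_def circlepath)
qed

lemma has_integral_coefficient: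
  fixes H :: "complex \<Rightarrow> complex" and r R :: real
  assumes hol: "H holomorphic_on ball 0 R" and r: "0 < r" "r < R" and exp: "H has_fps_expansion A"
  shows "((\<lambda>t. H (r * cis t) / (r * cis t) ^ n) has_integral (2 * pi * A $ n)) {-pi..pi}"
proof -
  have sub: "cball 0 r \<subseteq> ball (0::complex) R" "ball 0 r \<subseteq> ball (0::complex) R" using r by auto
  have cont: "continuous_on (cball 0 r) H" "H holomorphic_on ball 0 r"
    using holomorphic_on_subset[OF hol sub(1)] holomorphic_on_subset[OF hol sub(2)]
    by (auto intro!: holomorphic_on_imp_continuous_on)
  have "((\<lambda>u. H u / (u - 0) ^ Suc n) has_contour_integral 2 * pi * \<i> / fact n * (deriv ^^ n) H 0) (circlepath 0 r)"
    using r by (intro Cauchy_has_contour_integral_higher_derivative_circlepath cont) auto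
  then have "((\<lambda>u. H u / u ^ Suc n) has_contour_integral 2 * pi * \<i> * A $ n) (circlepath 0 r)"
    using fps_nth_fps_expansion[OF exp, of n] by simp
  then have "((\<lambda>u. H u / u ^ Suc n) has_contour_integral 2 * pi * \<i> * A $ n) (part_circlepath 0 r (-pi) pi)"
    unfolding part_circlepath_eq_shiftpath by (rule has_contour_integral_shiftpath) auto
  then have "((\<lambda>t. H (0 + r * cis t) / (0 + r * cis t) ^ Suc n * r * \<i> * cis t) has_integral 2 * pi * \<i> * A $ n) {-pi..pi}"
    by (subst (asm) has_contour_integral_part_circlepath_iff) auto
  from has_integral_mult_right[OF this, of "- \<i>"]
  have "((\<lambda>t. - \<i> * (H (0 + r * cis t) / (0 + r * cis t) ^ Suc n * r * \<i> * cis t)) has_integral (2 * pi * A $ n)) {-pi..pi}"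
    by (simp add: mult_ac)
  moreover have "- \<i> * (H (0 + r * cis t) / (0 + r * cis t) ^ Suc n * r * \<i> * cis t) = H (r * cis t) / (r * cis t) ^ n" for t
    using r cis_neq_zero[of t] by (simp add: field_simps)
  ultimately show ?thesis by (simp only:)
qed

text \<open>The phase of the Cauchy integral: \<open>inverse sfps ^ m\<close> divided by \<open>u ^ m\<close> is, up to its value at \<open>t = 0\<close>,
  \<open>exp (m * psi t)\<close> at \<open>u = pc * cis t\<close>.\<close>
definition psi :: "real \<Rightarrow> complex" where
  "psi t = eval_fps (cfps logfps) (pc * cis t) - eval_fps (cfps logfps) pc - \<i> * t"

lemma norm_pc_cis: "norm (pc * cis t) = pc"
  using pc_bounds by (simp add: norm_mult)

lemma ereal_norm_pc_cis [simp]: "ereal (cmod (complex_of_real pc * cis t)) < fps_conv_radius logfps"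
  using ereal_pc_less(1) pc_bounds by (simp add: norm_pc_cis)

text \<open>Cauchy's formula for the coefficient in \<open>vol_lagrange\<close>, with the inverse of
  \<open>sfps\<close> replaced by exp of \<open>logfps\<close>. Multiplying by the power of
  \<open>xc\<close> = pc exp (- logfps pc) normalises the exponential factor to 1 at t = 0.\<close>

lemma has_integral_vol:
  "((\<lambda>t. (pc * cis t * eval_fps (cfps (fps_deriv (Phi \<theta>))) (pc * cis t)) * exp (of_nat (Suc n) * psi t))
     has_integral of_real (2 * pi * (real (Suc n) * vol (Suc n) \<theta> * xc ^ Suc n))) {-pi..pi}"
proof -
  let ?g = "fps_deriv (Phi \<theta>)" and ?R = "2 / pi\<^sup>2"
  define H where "H z = eval_fps (cfps ?g) z * exp (of_nat (Suc n) * eval_fps (cfps logfps) z)" for z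
  have radg: "fps_conv_radius ?g = \<infinity>"
    using fps_conv_radius_deriv[of "Phi \<theta>"] by simp
  have sub: "ball (0::complex) ?R \<subseteq> eball 0 (fps_conv_radius (cfps logfps))"
  proof
    fix z :: complex assume "z \<in> ball 0 ?R"
    then have "ereal (dist 0 z) < ereal ?R" by simp
    also note fps_conv_radius_logfps
    finally show "z \<in> eball 0 (fps_conv_radius (cfps logfps))" by simp
  qed
  have hol: "H holomorphic_on ball 0 ?R"
    unfolding H_def by (intro holomorphic_intros sub) (auto simp: radg)
  have "(\<lambda>z. eval_fps (cfps ?g) z * inverse (eval_fps (cfps sfps) z) ^ Suc n)
      has_fps_expansion cfps ?g * inverse (cfps sfps) ^ Suc n"
    by (intro has_fps_expansion_mult has_fps_expansion_power has_fps_expansion_inverse eval_fps_has_fps_expansion)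
      (auto simp: radg)
  moreover have "\<forall>\<^sub>F z in nhds 0. H z = eval_fps (cfps ?g) z * inverse (eval_fps (cfps sfps) z) ^ Suc n"
  proof -
    have "\<forall>\<^sub>F z in nhds 0. z \<in> ball (0::complex) ?R"
      by (rule eventually_nhds_in_open) auto
    then show ?thesis
    proof eventually_elim
      case (elim z)
      have "eval_fps (cfps sfps) z * exp (eval_fps (cfps logfps) z) = 1"
        by (rule eval_sfps_exp_logfps) (use elim in simp)
      then have "inverse (eval_fps (cfps sfps) z) = exp (eval_fps (cfps logfps) z)"
        by (simp add: inverse_unique)
      then show ?case unfolding H_def by (simp add: exp_of_nat_mult del: of_nat_Suc)
    qed
  qed
  ultimately have "H has_fps_expansion cfps (?g * inverse sfps ^ Suc n)"
    by (subst has_fps_expansion_cong[OF _ refl])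
      (auto simp: cfps_mult cfps_power cfps_inverse simp del: power_Suc)
  from has_integral_coefficient[OF hol pc_bounds this, of n]
  have "((\<lambda>t. H (pc * cis t) / (pc * cis t) ^ n) has_integral
      of_real (2 * pi * (real (Suc n) * vol (Suc n) \<theta>))) {-pi..pi}"
    by (simp only: cfps_nth vol_lagrange[symmetric]) simp
  from has_integral_mult_right[OF this, of "of_real (xc ^ Suc n)"]
  have "((\<lambda>t. of_real (xc ^ Suc n) * (H (pc * cis t) / (pc * cis t) ^ n)) has_integral
      of_real (2 * pi * (real (Suc n) * vol (Suc n) \<theta> * xc ^ Suc n))) {-pi..pi}"
    by (simp add: mult_ac)
  moreover have "of_real (xc ^ Suc n) * (H (pc * cis t) / (pc * cis t) ^ n) =
     (pc * cis t * eval_fps (cfps ?g) (pc * cis t)) * exp (of_nat (Suc n) * psi t)" for t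
  proof -
    have Lpc: "eval_fps (cfps logfps) (of_real pc) = of_real (eval_fps logfps pc)"
      by (rule eval_cfps_of_real) simp
    have e: "exp (of_nat (Suc n) * psi t) = exp (of_nat (Suc n) * eval_fps (cfps logfps) (pc * cis t))
       * of_real (exp (- eval_fps logfps pc) ^ Suc n) * cis (- t) ^ Suc n"
    proof -
      have "of_nat (Suc n) * psi t = of_nat (Suc n) * eval_fps (cfps logfps) (pc * cis t)
        + of_nat (Suc n) * of_real (- eval_fps logfps pc) + of_nat (Suc n) * (\<i> * of_real (- t))"
        by (simp add: psi_def Lpc algebra_simps)
      then show ?thesis
        by (simp only: exp_add exp_of_nat_mult cis_conv_exp exp_of_real of_real_power)
    qed
    have c: "cis (- t) ^ Suc n * cis t ^ Suc n = 1"
      by (simp add: cis_mult flip: power_mult_distrib del: power_Suc)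
    have "cis t \<noteq> 0" "pc \<noteq> 0" using pc_bounds by auto
    then show ?thesis
      unfolding e H_def xc_eq using c
      by (simp add: power_mult_distrib field_simps)
  qed
  ultimately show ?thesis by (simp only:)
qed

section \<open>The phase near the saddle\<close>

definition logcoeff :: "nat \<Rightarrow> real" where
  "logcoeff n = logfps $ n * pc ^ n"

lemma logcoeff_nonneg: "0 \<le> logcoeff n"
  using pc_bounds logfps_nth_bounds[of n] by (simp add: logcoeff_def)

lemma logcoeff_1_pos: "0 < logcoeff 1"
  using pc_bounds by (simp add: logcoeff_def logfps_def ufps_nth_0)

text \<open>The saddle point equation \<open>critical_ufps\<close> in terms of coefficients.\<close>

lemma sums_n_logcoeff: "(\<lambda>n. real n * logcoeff n) sums 1"
proof -
  have "(\<lambda>n. ufps $ n * pc ^ n) sums eval_fps ufps pc"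
    by (rule sums_eval_fps) simp
  from sums_mult[OF this, of pc] have "(\<lambda>n. pc * (ufps $ n * pc ^ n)) sums 1"
    by (simp only: critical_ufps)
  moreover have "pc * (ufps $ n * pc ^ n) = real (Suc n) * logcoeff (Suc n)" for n
    by (simp add: logcoeff_def logfps_def)
  ultimately have "(\<lambda>n. real (Suc n) * logcoeff (Suc n)) sums 1" by simp
  from sums_Suc[OF this] show ?thesis by simp
qed

lemma summable_n2_logcoeff: "summable (\<lambda>n. (real n)\<^sup>2 * logcoeff n)"
proof -
  let ?D = "\<lambda>f :: real fps. fps_X * fps_deriv f"
  have r: "fps_conv_radius f \<le> fps_conv_radius (?D f)" for f :: "real fps"
    using fps_conv_radius_mult[of fps_X "fps_deriv f"] fps_conv_radius_deriv[of f]
    by (simp add: min_def split: if_splits)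
  have n: "?D f $ n = real n * f $ n" for f :: "real fps" and n
    by (cases n) auto
  have "ereal (norm pc) < fps_conv_radius (?D (?D logfps))"
    using less_le_trans[OF _ order_trans[OF r r]] by simp
  then have "summable (\<lambda>n. ?D (?D logfps) $ n * pc ^ n)" by (rule summable_fps)
  then show ?thesis unfolding n by (simp add: logcoeff_def power2_eq_square mult_ac)
qed

text \<open>Half the second moment of \<open>logcoeff\<close>; up to sign it is the coefficient of
  t^2 in the expansion of \<open>psi\<close>.\<close>

definition logvar :: real where
  "logvar = (\<Sum>n. (real n)\<^sup>2 * logcoeff n) / 2"

lemma logvar_pos: "0 < logvar"
proof -
  have "0 < (\<Sum>n. (real n)\<^sup>2 * logcoeff n)"
    by (rule suminf_pos2[OF summable_n2_logcoeff, of 1]) (use logcoeff_1_pos logcoeff_nonneg in auto)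
  then show ?thesis by (simp add: logvar_def)
qed

text \<open>Because n logcoeff n sums to 1, the term - i t of \<open>psi\<close> can be distributed
  over the series, and every summand becomes a Taylor remainder of second order.\<close>

lemma psi_sums: "(\<lambda>n. of_real (logcoeff n) * (cis (real n * t) - 1 - \<i> * of_real (real n * t))) sums psi t"
proof -
  have "(\<lambda>n. cfps logfps $ n * (pc * cis t) ^ n) sums eval_fps (cfps logfps) (pc * cis t)"
    by (rule sums_eval_fps) simp
  moreover have "(\<lambda>n. cfps logfps $ n * of_real pc ^ n) sums eval_fps (cfps logfps) (of_real pc)"
    by (rule sums_eval_fps) simp
  moreover have "(\<lambda>n. \<i> * of_real t * of_real (real n * logcoeff n)) sums (\<i> * of_real t * of_real 1)"
    using sums_n_logcoeff by (intro sums_mult) (simp only: sums_of_real_iff)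
  ultimately have "(\<lambda>n. cfps logfps $ n * (pc * cis t) ^ n - cfps logfps $ n * of_real pc ^ n
      - \<i> * of_real t * of_real (real n * logcoeff n)) sums psi t"
    unfolding psi_def by (auto intro!: sums_diff)
  moreover have "cfps logfps $ n * (pc * cis t) ^ n - cfps logfps $ n * of_real pc ^ n
      - \<i> * of_real t * of_real (real n * logcoeff n) =
      of_real (logcoeff n) * (cis (real n * t) - 1 - \<i> * of_real (real n * t))" for n
  proof -
    have D: "cis (real n * t) = cis t ^ n" by (rule Complex.DeMoivre[symmetric])
    show ?thesis unfolding D logcoeff_def power_mult_distrib by (simp add: algebra_simps)
  qed
  ultimately show ?thesis by simp
qed

lemma cis_approx2: "norm (cis x - 1 - \<i> * x - of_real (- (x\<^sup>2 / 2))) \<le> \<bar>x\<bar> ^ 3 / 6"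
  and cis_approx1: "norm (cis x - 1 - \<i> * x) \<le> x\<^sup>2 / 2"
  and cos_approx3: "cos x - 1 \<le> - (x\<^sup>2 / 2) + x ^ 4 / 24"
proof -
  have "norm (cis x - (\<Sum>k\<le>2. (\<i> * x) ^ k / fact k)) \<le> \<bar>x\<bar> ^ Suc 2 / fact (Suc 2)"
    using iexp_approx1[of x 2] by (simp add: cis_conv_exp)
  moreover have "(\<Sum>k\<le>2. (\<i> * x) ^ k / fact k) = 1 + \<i> * x + of_real (- (x\<^sup>2 / 2))"
    by (simp add: numeral_2_eq_2 power2_eq_square algebra_simps)
  moreover have "\<bar>x\<bar> ^ Suc 2 / fact (Suc 2) = \<bar>x\<bar> ^ 3 / 6"
    by (simp add: eval_nat_numeral)
  ultimately show "norm (cis x - 1 - \<i> * x - of_real (- (x\<^sup>2 / 2))) \<le> \<bar>x\<bar> ^ 3 / 6"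
    by (simp only: diff_diff_eq)
  have "norm (cis x - (\<Sum>k\<le>1. (\<i> * x) ^ k / fact k)) \<le> \<bar>x\<bar> ^ Suc 1 / fact (Suc 1)"
    using iexp_approx1[of x 1] by (simp add: cis_conv_exp)
  then show "norm (cis x - 1 - \<i> * x) \<le> x\<^sup>2 / 2"
    by (simp add: algebra_simps flip: power2_eq_square)
  have "\<bar>Re (cis x - (\<Sum>k\<le>3. (\<i> * x) ^ k / fact k))\<bar> \<le> norm (cis x - (\<Sum>k\<le>3. (\<i> * x) ^ k / fact k))"
    by (rule abs_Re_le_cmod)
  also have "\<dots> \<le> \<bar>x\<bar> ^ Suc 3 / fact (Suc 3)"
    using iexp_approx1[of x 3] by (simp add: cis_conv_exp)
  also have "\<bar>x\<bar> ^ Suc 3 / fact (Suc 3) = x ^ 4 / 24"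
  proof -
    have "Suc 3 = 4" "(fact 4 :: real) = 24" by (simp_all add: fact_numeral)
    moreover have "\<bar>x\<bar> ^ 4 = x ^ 4" by (rule power_even_abs) simp
    ultimately show ?thesis by (simp only:)
  qed
  finally have "\<bar>Re (cis x - (\<Sum>k\<le>3. (\<i> * x) ^ k / fact k))\<bar> \<le> x ^ 4 / 24" .
  moreover have "Re (\<Sum>k\<le>3. (\<i> * x) ^ k / fact k) = 1 - x\<^sup>2 / 2"
    by (simp add: numeral_3_eq_3 power2_eq_square)
  ultimately show "cos x - 1 \<le> - (x\<^sup>2 / 2) + x ^ 4 / 24"
    by (simp only: minus_complex.sel cis.sel)
qed

text \<open>The limit is taken term by term: each remainder divided by t^2 tends to - n^2 / 2 and is
  bounded by n^2 uniformly in t, so the summable weights n^2 logcoeff n allow Tannery's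
  theorem.\<close>

lemma psi_div_square_tendsto: "((\<lambda>t. psi t / of_real (t\<^sup>2)) \<longlongrightarrow> of_real (- logvar)) (at 0)"
proof -
  define a where "a n t = of_real (logcoeff n) * ((cis (real n * t) - 1 - \<i> * of_real (real n * t)) / of_real (t\<^sup>2))" for n :: nat and t :: real
  define b where "b n = complex_of_real (logcoeff n * (- ((real n)\<^sup>2 / 2)))" for n
  have lim: "((a n) \<longlongrightarrow> b n) (at 0)" for n
  proof -
    have "((\<lambda>t. (cis (real n * t) - 1 - \<i> * of_real (real n * t)) / of_real (t\<^sup>2) - of_real (- ((real n)\<^sup>2 / 2))) \<longlongrightarrow> 0) (at 0)"
    proof (rule Lim_null_comparison)
      show "((\<lambda>t. \<bar>real n\<bar> ^ 3 * \<bar>t\<bar> / 6) \<longlongrightarrow> 0) (at 0)"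
        by (auto intro!: tendsto_eq_intros)
      have "\<forall>\<^sub>F t in at 0. t \<noteq> (0::real)" by (rule eventually_neq_at_within)
      then show "\<forall>\<^sub>F t in at 0. norm ((cis (real n * t) - 1 - \<i> * of_real (real n * t)) / of_real (t\<^sup>2) - of_real (- ((real n)\<^sup>2 / 2)))
         \<le> \<bar>real n\<bar> ^ 3 * \<bar>t\<bar> / 6"
      proof eventually_elim
        case (elim t)
        let ?x = "real n * t"
        have "(cis ?x - 1 - \<i> * of_real ?x) / of_real (t\<^sup>2) - of_real (- ((real n)\<^sup>2 / 2))
           = (cis ?x - 1 - \<i> * of_real ?x - of_real (- (?x\<^sup>2 / 2))) / of_real (t\<^sup>2)"
          using elim by (simp add: add_divide_distrib diff_divide_distrib power_mult_distrib)
        also have "norm \<dots> \<le> (\<bar>?x\<bar> ^ 3 / 6) / t\<^sup>2"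
        proof -
          have "norm (complex_of_real (t\<^sup>2)) = t\<^sup>2" by (simp only: norm_of_real abs_power2)
          then show ?thesis
            unfolding norm_divide using cis_approx2[of ?x] by (simp only: divide_right_mono zero_le_power2)
        qed
        also have "\<dots> = \<bar>real n\<bar> ^ 3 * \<bar>t\<bar> / 6"
        proof -
          have "\<bar>t\<bar> ^ 3 = \<bar>t\<bar> * t\<^sup>2" by (simp add: power3_eq_cube power2_eq_square)
          then show ?thesis using elim by (simp add: abs_mult power_mult_distrib)
        qed
        finally show ?case .
      qed
    qed
    then have "((\<lambda>t. (cis (real n * t) - 1 - \<i> * of_real (real n * t)) / of_real (t\<^sup>2)) \<longlongrightarrow> of_real (- ((real n)\<^sup>2 / 2))) (at 0)"
      by (rule LIM_zero_cancel)
    then have "(a n \<longlongrightarrow> of_real (logcoeff n) * of_real (- ((real n)\<^sup>2 / 2))) (at 0)"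
      unfolding a_def by (intro tendsto_mult tendsto_const)
    then show ?thesis by (simp add: b_def)
  qed
  have "((\<lambda>t. \<Sum>n. a n t) \<longlongrightarrow> (\<Sum>n. b n)) (at 0)"
  proof (rule tannerys_theorem[THEN conjunct2, THEN conjunct2])
    have "norm (a n t) \<le> (real n)\<^sup>2 * logcoeff n" for n t
    proof -
      have "norm (cis (real n * t) - 1 - \<i> * of_real (real n * t)) \<le> (real n * t)\<^sup>2"
        by (rule order_trans[OF cis_approx1]) auto
      then have "norm ((cis (real n * t) - 1 - \<i> * of_real (real n * t)) / of_real (t\<^sup>2)) \<le> (real n * t)\<^sup>2 / t\<^sup>2"
      proof -
        have "norm (complex_of_real (t\<^sup>2)) = t\<^sup>2" by (simp only: norm_of_real abs_power2)
        then show ?thesis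
          unfolding norm_divide
          using \<open>norm (cis (real n * t) - 1 - \<i> * of_real (real n * t)) \<le> (real n * t)\<^sup>2\<close>
          by (simp only: divide_right_mono zero_le_power2)
      qed
      also have "\<dots> \<le> (real n)\<^sup>2" by (simp add: power_mult_distrib)
      finally have "logcoeff n * norm ((cis (real n * t) - 1 - \<i> * of_real (real n * t)) / of_real (t\<^sup>2)) \<le> logcoeff n * (real n)\<^sup>2"
        by (rule mult_left_mono[OF _ logcoeff_nonneg])
      then show ?thesis
        unfolding a_def norm_mult norm_of_real abs_of_nonneg[OF logcoeff_nonneg]
        by (simp only: mult.commute)
    qed
    then show "\<forall>\<^sub>F (n, t) in sequentially \<times>\<^sub>F at 0. norm (a n t) \<le> (real n)\<^sup>2 * logcoeff n"
      by (intro always_eventually) auto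
  qed (use lim summable_n2_logcoeff in auto)
  moreover have "(\<Sum>n. a n t) = psi t / of_real (t\<^sup>2)" for t
    using sums_divide[OF psi_sums[of t], of "of_real (t\<^sup>2)"] by (simp add: a_def sums_iff)
  moreover have "(\<Sum>n. b n) = of_real (- logvar)"
  proof -
    have "(\<lambda>n. - ((real n)\<^sup>2 * logcoeff n / 2)) sums - logvar"
      unfolding logvar_def by (intro sums_minus sums_divide summable_sums summable_n2_logcoeff)
    then have "(\<lambda>n. complex_of_real (- ((real n)\<^sup>2 * logcoeff n / 2))) sums of_real (- logvar)"
      by (simp only: sums_of_real_iff)
    then show ?thesis by (simp add: b_def sums_iff mult_ac)
  qed
  ultimately show ?thesis by simp
qed

text \<open>All summands logcoeff n (cos (n t) - 1) are nonpositive, so the term n = 1 alone is an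
  upper bound. With cos t - 1 \<le> - t^2 / 2 + t^4 / 24 and t^2 \<le> pi^2 the constant is positive
  because pi^2 < 12. This rules out any competing saddle on the circle.\<close>

lemma Re_psi_le: "\<exists>\<epsilon>>0. \<forall>t\<in>{-pi..pi}. Re (psi t) \<le> - \<epsilon> * t\<^sup>2"
proof (intro exI conjI ballI)
  let ?\<epsilon> = "logcoeff 1 * (1/2 - pi\<^sup>2 / 24)"
  have "pi\<^sup>2 < (10::real)"
  proof -
    have "pi\<^sup>2 \<le> 3.15\<^sup>2" using pi_approx by (intro power_mono) auto
    then show ?thesis by (simp add: power2_eq_square)
  qed
  then show "0 < ?\<epsilon>" using logcoeff_1_pos by simp
  fix t assume t: "t \<in> {-pi..pi}"
  have "(\<lambda>n. logcoeff n * (cos (real n * t) - 1)) sums Re (psi t)"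
    using sums_Re[OF psi_sums[of t]] by simp
  moreover have "(\<lambda>n. if n = 1 then logcoeff 1 * (cos t - 1) else 0) sums (logcoeff 1 * (cos t - 1))"
    by (rule sums_single)
  ultimately have "Re (psi t) \<le> logcoeff 1 * (cos t - 1)"
    by (rule sums_le[rotated]) (auto simp: logcoeff_nonneg mult_le_0_iff)
  also have "\<dots> \<le> logcoeff 1 * (- (t\<^sup>2 / 2) + t ^ 4 / 24)"
    by (intro mult_left_mono cos_approx3 logcoeff_nonneg)
  also have "\<dots> \<le> logcoeff 1 * (- (t\<^sup>2 / 2) + pi\<^sup>2 * t\<^sup>2 / 24)"
  proof -
    have "t\<^sup>2 \<le> pi\<^sup>2" using t by (intro abs_le_square_iff[THEN iffD1]) auto
    then have "t\<^sup>2 * t\<^sup>2 \<le> pi\<^sup>2 * t\<^sup>2" by (intro mult_right_mono) auto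
    moreover have "t ^ 4 = t\<^sup>2 * t\<^sup>2" using power_add[of t 2 2] by simp
    ultimately have "t ^ 4 / 24 \<le> pi\<^sup>2 * t\<^sup>2 / 24" by linarith
    then show ?thesis by (intro mult_left_mono logcoeff_nonneg) simp
  qed
  also have "\<dots> = - ?\<epsilon> * t\<^sup>2" by (simp add: algebra_simps)
  finally show "Re (psi t) \<le> - ?\<epsilon> * t\<^sup>2" .
qed

section \<open>Asymptotics of the weighted volumes\<close>

definition wt :: "nat \<Rightarrow> real" where
  "wt m = real m * sqrt (real m)"

definition wvol :: "nat \<Rightarrow> real \<Rightarrow> real" where
  "wvol m \<theta> = vol m \<theta> * xc ^ m"

text \<open>The constant \<kappa>. It does not depend on the angle and therefore cancels in all
  conditional densities.\<close>

definition asym_const :: real where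
  "asym_const = pc * sqrt (pi / logvar) / (2 * pi)"

lemma asym_const_pos: "0 < asym_const"
  using logvar_pos pc_bounds by (simp add: asym_const_def)

text \<open>In \<open>wt\<close> the factor m comes from Lagrange inversion and sqrt m from
  Laplace's method; the angle enters only through the amplitude at the saddle,
  \<open>pc * Finf \<theta>\<close>.\<close>

theorem wvol_asymptotics: "(\<lambda>m. wt m * wvol m \<theta>) \<longlonglongrightarrow> asym_const * Finf \<theta>"
proof -
  let ?g = "fps_deriv (Phi \<theta>)"
  define G where "G t = pc * cis t * eval_fps (cfps ?g) (pc * cis t)" for t
  have radg: "fps_conv_radius ?g = \<infinity>"
    using fps_conv_radius_deriv[of "Phi \<theta>"] by simp
  have cG: "continuous_on {-pi..pi} G"
    unfolding G_def by (intro continuous_intros) (auto simp: radg)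
  have c\<psi>: "continuous_on {-pi..pi} psi"
    unfolding psi_def by (intro continuous_intros) auto
  obtain \<epsilon> where \<epsilon>: "0 < \<epsilon>" "\<And>t. t \<in> {-pi..pi} \<Longrightarrow> Re (psi t) \<le> - \<epsilon> * t\<^sup>2"
    using Re_psi_le by blast
  have "(\<lambda>m. of_real (sqrt m) * integral {-pi..pi} (\<lambda>t. G t * exp (of_nat m * psi t)))
      \<longlonglongrightarrow> G 0 * of_real (sqrt (pi / logvar))"
    by (rule laplace_method[OF cG c\<psi> \<epsilon>(2,1) psi_div_square_tendsto logvar_pos])
  then have "(\<lambda>n. of_real (sqrt (Suc n)) * integral {-pi..pi} (\<lambda>t. G t * exp (of_nat (Suc n) * psi t)))
      \<longlonglongrightarrow> G 0 * of_real (sqrt (pi / logvar))"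
    by (rule LIMSEQ_Suc)
  moreover have "integral {-pi..pi} (\<lambda>t. G t * exp (of_nat (Suc n) * psi t))
      = of_real (2 * pi * (real (Suc n) * vol (Suc n) \<theta> * xc ^ Suc n))" for n
    unfolding G_def by (rule integral_unique[OF has_integral_vol])
  ultimately have "(\<lambda>n. of_real (sqrt (Suc n)) * complex_of_real (2 * pi * (real (Suc n) * vol (Suc n) \<theta> * xc ^ Suc n)))
      \<longlonglongrightarrow> G 0 * of_real (sqrt (pi / logvar))" by (simp only:)
  moreover have "G 0 = of_real (pc * Finf \<theta>)"
    using eval_cfps_of_real[of pc ?g] by (simp add: G_def radg eval_deriv_Phi_pc)
  ultimately have "(\<lambda>n. complex_of_real (2 * pi * (wt (Suc n) * wvol (Suc n) \<theta>)))
      \<longlonglongrightarrow> complex_of_real (pc * Finf \<theta> * sqrt (pi / logvar))"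
    by (simp add: wt_def wvol_def mult_ac del: of_nat_Suc power_Suc)
  then have "(\<lambda>n. 2 * pi * (wt (Suc n) * wvol (Suc n) \<theta>)) \<longlonglongrightarrow> pc * Finf \<theta> * sqrt (pi / logvar)"
    by (simp only: tendsto_of_real_iff)
  from tendsto_divide[OF this tendsto_const, of "2 * pi"]
  have "(\<lambda>n. wt (Suc n) * wvol (Suc n) \<theta>) \<longlonglongrightarrow> asym_const * Finf \<theta>"
    by (simp add: asym_const_def mult_ac)
  then show ?thesis by (rule LIMSEQ_imp_Suc)
qed

section \<open>Sums and convolutions of the volumes\<close>

lemma wt_nonneg [simp]: "0 \<le> wt m"
  by (simp add: wt_def)

lemma wt_mono: "m \<le> n \<Longrightarrow> wt m \<le> wt n"
  unfolding wt_def by (intro mult_mono) auto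

text \<open>For 2 k \<le> m this gives wt m \<le> 4 wt (m - k), the comparison behind every
  domination of half a convolution.\<close>

lemma wt_double: "wt (2 * m) \<le> 4 * wt m"
proof -
  have "sqrt (2 * real m) \<le> sqrt (4 * real m)" by simp
  also have "\<dots> = 2 * sqrt (real m)" by (simp add: real_sqrt_mult)
  finally have "2 * real m * sqrt (2 * real m) \<le> 2 * real m * (2 * sqrt (real m))"
    by (rule mult_left_mono) simp
  then show ?thesis by (simp add: wt_def)
qed

lemma wt_shift_ratio: "(\<lambda>m. wt m / wt (m - k)) \<longlonglongrightarrow> 1"
proof -
  have "(\<lambda>n. wt (n + k) / wt n) \<longlonglongrightarrow> 1"
    unfolding wt_def by real_asymp
  then have "(\<lambda>n. wt (n + k) / wt (n + k - k)) \<longlonglongrightarrow> 1" by simp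
  then show ?thesis by (rule LIMSEQ_offset)
qed

text \<open>While k stays below m / 2, the factor wt m * b (m - k) is bounded uniformly, so a k
  times a constant dominates and Tannery's theorem applies. The predicate \<open>P\<close> is
  abstract so that the middle index of an even m can be assigned to just one of the two
  halves.\<close>

lemma half_convolution_tendsto:
  fixes a b :: "nat \<Rightarrow> real" and P :: "nat \<Rightarrow> nat \<Rightarrow> bool"
  assumes a: "\<And>k. 0 \<le> a k" and sa: "a sums SA"
    and b: "\<And>k. 0 \<le> b k" and lb: "(\<lambda>m. wt m * b m) \<longlonglongrightarrow> B"
    and P: "\<And>k m. P k m \<Longrightarrow> 2 * k \<le> m" "\<And>k. \<forall>\<^sub>F m in sequentially. P k m"
  shows "(\<lambda>m. \<Sum>k | k \<le> m \<and> P k m. a k * (wt m * b (m - k))) \<longlonglongrightarrow> SA * B"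
proof -
  obtain C where C: "\<And>m. norm (wt m * b m) \<le> C"
    by (rule BseqE[OF convergent_imp_Bseq[OF convergentI[OF lb]]]) blast
  define f where "f k m = (if P k m then a k * (wt m * b (m - k)) else 0)" for k m
  have lim: "(f k) \<longlonglongrightarrow> a k * B" for k
  proof -
    have "(\<lambda>m. wt (m - k) * b (m - k)) \<longlonglongrightarrow> B"
      using lb by (rule filterlim_compose) (rule filterlim_minus_const_nat_at_top)
    then have "(\<lambda>m. a k * (wt m / wt (m - k) * (wt (m - k) * b (m - k)))) \<longlonglongrightarrow> a k * (1 * B)"
      by (intro tendsto_mult tendsto_const wt_shift_ratio)
    moreover have "\<forall>\<^sub>F m in sequentially. k < m" by (rule eventually_gt_at_top)
    with P(2)[of k] have "\<forall>\<^sub>F m in sequentially. a k * (wt m / wt (m - k) * (wt (m - k) * b (m - k))) = f k m"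
    proof eventually_elim
      case (elim m)
      then have "wt (m - k) \<noteq> 0" by (simp add: wt_def)
      with elim show ?case by (simp add: f_def)
    qed
    ultimately show ?thesis using Lim_transform_eventually by fastforce
  qed
  have "(\<lambda>m. \<Sum>k. f k m) \<longlonglongrightarrow> (\<Sum>k. a k * B)"
  proof (rule tannerys_theorem[THEN conjunct2, THEN conjunct2])
    have "norm (f k m) \<le> a k * (4 * C)" for k m
    proof (cases "P k m")
      case True
      then have k: "2 * k \<le> m" by (rule P)
      have "wt m \<le> wt (2 * (m - k))" using k by (intro wt_mono) auto
      also have "\<dots> \<le> 4 * wt (m - k)" by (rule wt_double)
      finally have "wt m * b (m - k) \<le> 4 * wt (m - k) * b (m - k)"
        by (rule mult_right_mono[OF _ b])
      also have "\<dots> = 4 * (wt (m - k) * b (m - k))" by (rule mult.assoc)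
      also have "\<dots> \<le> 4 * C" using C[of "m - k"] by simp
      finally show ?thesis
        using True a b by (simp add: f_def abs_mult mult_left_mono)
    next
      case False
      have "0 \<le> C" using order_trans[OF norm_ge_zero C[of 0]] .
      then show ?thesis using False a by (simp add: f_def)
    qed
    then show "\<forall>\<^sub>F (k, m) in sequentially \<times>\<^sub>F sequentially. norm (f k m) \<le> a k * (4 * C)"
      by (intro always_eventually) auto
    show "summable (\<lambda>k. a k * (4 * C))"
      using sa by (intro summable_mult2) (auto simp: sums_iff)
  qed (use lim in auto)
  moreover have "(\<Sum>k. f k m) = (\<Sum>k | k \<le> m \<and> P k m. a k * (wt m * b (m - k)))" for m
  proof -
    have "f k m = 0" if "k \<notin> {..m}" for k
      using that P(1)[of k m] by (auto simp: f_def)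
    then have "(\<Sum>k. f k m) = (\<Sum>k\<le>m. f k m)" by (intro suminf_finite) auto
    also have "\<dots> = (\<Sum>k | k \<le> m \<and> P k m. a k * (wt m * b (m - k)))"
      unfolding f_def by (subst sum.inter_filter[symmetric]) (auto intro!: sum.cong)
    finally show ?thesis .
  qed
  moreover have "(\<Sum>k. a k * B) = SA * B"
    using sums_mult2[OF sa, of B] by (simp add: sums_iff)
  ultimately show ?thesis by simp
qed

text \<open>Splitting at the middle, one index stays summable while the other carries the large
  size; reflecting k to m - k brings the second half to the form of the first. The limit records
  which factor is large.\<close>

lemma convolution_tendsto:
  fixes a b :: "nat \<Rightarrow> real"
  assumes a: "\<And>k. 0 \<le> a k" "a sums SA" "(\<lambda>m. wt m * a m) \<longlonglongrightarrow> A"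
    and b: "\<And>k. 0 \<le> b k" "b sums SB" "(\<lambda>m. wt m * b m) \<longlonglongrightarrow> B"
  shows "(\<lambda>m. wt m * (\<Sum>k\<le>m. a k * b (m - k))) \<longlonglongrightarrow> SA * B + A * SB"
proof -
  have "(\<lambda>m. \<Sum>k | k \<le> m \<and> 2 * k \<le> m. a k * (wt m * b (m - k))) \<longlonglongrightarrow> SA * B"
    by (rule half_convolution_tendsto[OF a(1,2) b(1,3)]) (auto intro: eventually_ge_at_top)
  moreover have "(\<lambda>m. \<Sum>k | k \<le> m \<and> 2 * k < m. b k * (wt m * a (m - k))) \<longlonglongrightarrow> SB * A"
    by (rule half_convolution_tendsto[OF b(1,2) a(1,3)]) (auto intro: eventually_gt_at_top)
  moreover have "(\<Sum>k | k \<le> m \<and> 2 * k < m. b k * (wt m * a (m - k)))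
      = (\<Sum>k | k \<le> m \<and> \<not> 2 * k \<le> m. a k * (wt m * b (m - k)))" for m
    by (rule sum.reindex_bij_witness[of _ "\<lambda>k. m - k" "\<lambda>k. m - k"]) auto
  moreover have "(\<Sum>k | k \<le> m \<and> 2 * k \<le> m. a k * (wt m * b (m - k))) + (\<Sum>k | k \<le> m \<and> \<not> 2 * k \<le> m. a k * (wt m * b (m - k)))
     = wt m * (\<Sum>k\<le>m. a k * b (m - k))" for m
  proof -
    have "(\<Sum>k\<le>m. a k * (wt m * b (m - k))) = (\<Sum>k\<in>{..m} \<inter> {k. 2 * k \<le> m}. a k * (wt m * b (m - k)))
      + (\<Sum>k\<in>{..m} - {k. 2 * k \<le> m}. a k * (wt m * b (m - k)))"
      by (rule sum.Int_Diff) simp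
    moreover have "{..m} \<inter> {k. 2 * k \<le> m} = {k. k \<le> m \<and> 2 * k \<le> m}"
      "{..m} - {k. 2 * k \<le> m} = {k. k \<le> m \<and> \<not> 2 * k \<le> m}" by auto
    ultimately show ?thesis by (simp add: sum_distrib_left mult_ac)
  qed
  ultimately show ?thesis
    using tendsto_add[of "\<lambda>m. \<Sum>k | k \<le> m \<and> 2 * k \<le> m. a k * (wt m * b (m - k))" "SA * B" sequentially
      "\<lambda>m. \<Sum>k | k \<le> m \<and> 2 * k < m. b k * (wt m * a (m - k))" "SB * A"]
    by (simp add: mult.commute)
qed

text \<open>The bound depends only on \<open>C\<close>, \<open>SA\<close> and \<open>SB\<close>, so
  it can serve as a majorant that is uniform in m and in the angles.\<close>

lemma convolution_bound:
  fixes a b :: "nat \<Rightarrow> real"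
  assumes a: "\<And>k. 0 \<le> a k" "a sums SA" "\<And>k. wt k * a k \<le> C"
    and b: "\<And>k. 0 \<le> b k" "b sums SB" "\<And>k. wt k * b k \<le> C"
  shows "wt m * (\<Sum>k\<le>m. a k * b (m - k)) \<le> 4 * C * (SA + SB)"
proof -
  have C0: "0 \<le> C" using order_trans[OF _ a(3)[of 0]] a(1)[of 0] by simp
  have le: "wt m * x \<le> 4 * C" if "2 * k \<le> m" "wt (m - k) * x \<le> C" "0 \<le> x" for k x
  proof -
    have "wt m \<le> wt (2 * (m - k))" using that by (intro wt_mono) auto
    also have "\<dots> \<le> 4 * wt (m - k)" by (rule wt_double)
    finally have "wt m * x \<le> 4 * wt (m - k) * x"
      by (rule mult_right_mono) fact
    then show ?thesis using that by simp
  qed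
  have "wt m * (a k * b (m - k)) \<le> 4 * C * a k + 4 * C * b (m - k)" if k: "k \<le> m" for k
  proof (cases "2 * k \<le> m")
    case True
    have "a k * (wt m * b (m - k)) \<le> a k * (4 * C)"
      by (intro mult_left_mono le[OF True] a b)
    moreover have "0 \<le> 4 * C * b (m - k)" using C0 b by auto
    ultimately show ?thesis by (simp add: mult_ac)
  next
    case False
    then have "2 * (m - k) \<le> m" "m - (m - k) = k" using k by auto
    then have "b (m - k) * (wt m * a k) \<le> b (m - k) * (4 * C)"
      by (intro mult_left_mono le[of "m - k"] a b) (auto simp: a)
    moreover have "0 \<le> 4 * C * a k" using C0 a by auto
    ultimately show ?thesis by (simp add: mult_ac)
  qed
  then have "wt m * (\<Sum>k\<le>m. a k * b (m - k)) \<le> (\<Sum>k\<le>m. 4 * C * a k + 4 * C * b (m - k))"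
    unfolding sum_distrib_left by (intro sum_mono) auto
  also have "\<dots> = 4 * C * ((\<Sum>k\<le>m. a k) + (\<Sum>k\<le>m. b (m - k)))"
    by (simp add: sum.distrib sum_distrib_left distrib_left)
  also have "(\<Sum>k\<le>m. b (m - k)) = (\<Sum>k\<le>m. b k)"
    by (rule sum.reindex_bij_witness[of _ "\<lambda>k. m - k" "\<lambda>k. m - k"]) auto
  also have "4 * C * ((\<Sum>k\<le>m. a k) + (\<Sum>k\<le>m. b k)) \<le> 4 * C * (SA + SB)"
  proof (rule mult_left_mono[OF add_mono])
    show "(\<Sum>k\<le>m. a k) \<le> SA"
      using sum_le_suminf[of a "{..m}"] a by (auto simp: sums_iff)
    show "(\<Sum>k\<le>m. b k) \<le> SB"
      using sum_le_suminf[of b "{..m}"] b by (auto simp: sums_iff)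
  qed (use C0 in simp)
  finally show ?thesis .
qed

section \<open>Monotonicity and uniform bounds in the angle\<close>

lemma vol_antimono:
  assumes "0 \<le> a" "a \<le> b" "b \<le> pi"
  shows "vol m b \<le> vol m a"
proof -
  have "ennreal (vol m b) \<le> ennreal (vol m a)"
    unfolding nn_integral_vol_recursion[of a m, OF assms(1) order_trans[OF assms(2,3)]]
      nn_integral_vol_recursion[of b m, OF order_trans[OF assms(1,2)] assms(3)]
  proof (intro add_left_mono nn_integral_mono mult_right_mono)
    fix z show "(indicator (tri b) z :: ennreal) \<le> indicator (tri a) z"
      using assms by (auto simp: indicator_def tri_def)
  qed simp
  then show ?thesis
    using vol_nonneg[of a m] assms by (simp add: ennreal_le_iff)
qed

lemma wvol_nonneg: "0 \<le> \<theta> \<Longrightarrow> \<theta> \<le> pi \<Longrightarrow> 0 \<le> wvol m \<theta>"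
  unfolding wvol_def using xc_pos by (intro mult_nonneg_nonneg vol_nonneg) auto

lemma wvol_antimono: "0 \<le> a \<Longrightarrow> a \<le> b \<Longrightarrow> b \<le> pi \<Longrightarrow> wvol m b \<le> wvol m a"
  unfolding wvol_def using xc_pos by (intro mult_right_mono vol_antimono) auto

text \<open>Monotonicity in the angle reduces uniformity to \<theta> = 0, where a convergent
  sequence is bounded.\<close>

lemma wvol_uniform_bound: "\<exists>C. \<forall>m. \<forall>\<theta>\<in>{0..pi}. wt m * wvol m \<theta> \<le> C"
proof -
  obtain C where C: "\<And>m. norm (wt m * wvol m 0) \<le> C"
    by (rule BseqE[OF convergent_imp_Bseq[OF convergentI[OF wvol_asymptotics[of 0]]]]) blast
  have "wt m * wvol m \<theta> \<le> C" if "\<theta> \<in> {0..pi}" for m \<theta>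
  proof -
    have "wt m * wvol m \<theta> \<le> wt m * wvol m 0"
      using that by (intro mult_left_mono wvol_antimono) auto
    then show ?thesis using C[of m] by simp
  qed
  then show ?thesis by blast
qed

section \<open>The generating function up to its radius of convergence\<close>

lemma vol_at_0: "vol m 0 = vol0 $ m"
proof -
  have "Phi 0 = fps_X"
    by (rule fps_ext) (auto simp: Phi_def fps_X_def)
  then show ?thesis by (simp add: vol_def)
qed

lemma vol0_nonneg: "0 \<le> vol0 $ m"
  using vol_nonneg[of 0 m] by (simp add: vol_at_0)

text \<open>The exponent 3/2 exceeds 1, so the series still converges at the endpoint
  \<open>xc\<close>.\<close>

lemma summable_vol0_xc: "summable (\<lambda>m. vol0 $ m * xc ^ m)"
proof -
  obtain C where C: "\<And>m \<theta>. \<theta> \<in> {0..pi} \<Longrightarrow> wt m * wvol m \<theta> \<le> C"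
    using wvol_uniform_bound by blast
  have "summable (\<lambda>m. C * real m powr (- (3/2)))"
    by (intro summable_mult) (simp add: summable_real_powr_iff)
  then show ?thesis
  proof (rule summable_comparison_test'[where N = 1])
    fix m :: nat assume m: "1 \<le> m"
    have "wt m = real m powr (3/2)"
    proof -
      have "real m powr (3/2) = real m powr (1 + 1/2)" by simp
      also have "\<dots> = wt m" using m by (simp only: powr_add) (simp add: wt_def powr_half_sqrt)
      finally show ?thesis ..
    qed
    moreover have "wt m * (vol0 $ m * xc ^ m) \<le> C"
      using C[of 0 m] by (simp add: wvol_def vol_at_0)
    ultimately show "norm (vol0 $ m * xc ^ m) \<le> C * real m powr (- (3/2))"
      using m xc_pos vol0_nonneg[of m] by (simp add: powr_minus field_simps)
  qed
qed

text \<open>The inverse function of \<open>Phi pi\<close> on [0, \<open>pc\<close>], obtained by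
  summing the inverse series up to the endpoint.\<close>

definition qsum :: "real \<Rightarrow> real" where
  "qsum z = (\<Sum>m. vol0 $ m * z ^ m)"

lemma summable_vol0:
  assumes "0 \<le> z" "z \<le> xc"
  shows "summable (\<lambda>m. vol0 $ m * z ^ m)"
  by (rule summable_comparison_test'[OF summable_vol0_xc])
    (use assms in \<open>auto simp: abs_mult vol0_nonneg intro!: mult_left_mono power_mono\<close>)

lemma vol0_power_nonneg: "0 \<le> (vol0 ^ i) $ m"
  by (induction i arbitrary: m) (auto simp: fps_mult_nth vol0_nonneg intro!: sum_nonneg)

lemma qsum_power:
  assumes z: "0 \<le> z" "z \<le> xc"
  shows "(\<lambda>m. (vol0 ^ i) $ m * z ^ m) sums (qsum z) ^ i"
proof (induction i)
  case 0
  have "(\<lambda>m. (vol0 ^ 0) $ m * z ^ m) = (\<lambda>m. if m = 0 then 1 else 0)" by auto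
  then show ?case using sums_single[of 0 "\<lambda>_. 1::real"] by simp
next
  case (Suc i)
  have s: "summable (\<lambda>m. norm (vol0 $ m * z ^ m))"
    using summable_vol0[OF z] z by (simp add: abs_mult vol0_nonneg)
  have s': "summable (\<lambda>m. norm ((vol0 ^ i) $ m * z ^ m))"
    using Suc z by (simp add: abs_mult vol0_power_nonneg sums_iff)
  have "(\<lambda>m. \<Sum>k\<le>m. (vol0 $ k * z ^ k) * ((vol0 ^ i) $ (m - k) * z ^ (m - k))) sums
     ((\<Sum>m. vol0 $ m * z ^ m) * (\<Sum>m. (vol0 ^ i) $ m * z ^ m))"
    by (rule Cauchy_product_sums[OF s s'])
  moreover have "(\<Sum>k\<le>m. (vol0 $ k * z ^ k) * ((vol0 ^ i) $ (m - k) * z ^ (m - k))) = (vol0 ^ Suc i) $ m * z ^ m" for m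
  proof -
    have "(vol0 $ k * z ^ k) * ((vol0 ^ i) $ (m - k) * z ^ (m - k)) = vol0 $ k * (vol0 ^ i) $ (m - k) * z ^ m" if "k \<le> m" for k
    proof -
      have "z ^ m = z ^ k * z ^ (m - k)" using that by (simp flip: power_add)
      then show ?thesis by simp
    qed
    then show ?thesis
      unfolding power_Suc fps_mult_nth atLeast0AtMost sum_distrib_right
      by (intro sum.cong refl) (simp only: atMost_iff)
  qed
  ultimately show ?case using Suc by (simp add: qsum_def sums_iff)
qed

text \<open>Summation and composition are exchanged by Tannery's theorem: powers of
  \<open>vol0\<close> have nonnegative coefficients, so their partial sums stay below
  \<open>qsum z ^ i\<close>, and \<open>Phi \<theta>\<close> converges absolutely everywhere. This
  works at z = \<open>xc\<close> too.\<close>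

lemma vol_sums_eval_Phi:
  assumes z: "0 \<le> z" "z \<le> xc"
  shows "(\<lambda>m. vol m \<theta> * z ^ m) sums eval_fps (Phi \<theta>) (qsum z)"
proof -
  define f where "f i M = Phi \<theta> $ i * (\<Sum>m\<le>M. (vol0 ^ i) $ m * z ^ m)" for i M
  have "(\<lambda>M. \<Sum>i. f i M) \<longlonglongrightarrow> (\<Sum>i. Phi \<theta> $ i * qsum z ^ i)"
  proof (rule tannerys_theorem[THEN conjunct2, THEN conjunct2])
    show "(f i) \<longlonglongrightarrow> Phi \<theta> $ i * qsum z ^ i" for i
      unfolding f_def using qsum_power[OF z, of i] by (intro tendsto_mult tendsto_const) (simp add: sums_def_le)
    have q0: "0 \<le> qsum z"
      unfolding qsum_def using z by (intro suminf_nonneg summable_vol0) (auto simp: vol0_nonneg)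
    have "norm (f i M) \<le> norm (Phi \<theta> $ i * qsum z ^ i)" for i M
    proof -
      have "(\<Sum>m\<le>M. (vol0 ^ i) $ m * z ^ m) \<le> qsum z ^ i"
        using sum_le_suminf[of "\<lambda>m. (vol0 ^ i) $ m * z ^ m" "{..M}"] qsum_power[OF z, of i] z
        by (auto simp: sums_iff vol0_power_nonneg)
      moreover have "0 \<le> (\<Sum>m\<le>M. (vol0 ^ i) $ m * z ^ m)"
        using z by (intro sum_nonneg) (auto simp: vol0_power_nonneg)
      ultimately show ?thesis using q0 by (auto simp: f_def abs_mult intro!: mult_left_mono)
    qed
    then show "\<forall>\<^sub>F (i, M) in sequentially \<times>\<^sub>F sequentially. norm (f i M) \<le> norm (Phi \<theta> $ i * qsum z ^ i)"
      by (intro always_eventually) auto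
    show "summable (\<lambda>i. norm (Phi \<theta> $ i * qsum z ^ i))"
      by (rule norm_summable_fps) simp
  qed simp
  moreover have "(\<Sum>i. f i M) = (\<Sum>m\<le>M. vol m \<theta> * z ^ m)" for M
  proof -
    have zero: "(vol0 ^ i) $ m = 0" if "m < i" for i m
      using startsby_zero_power_prefix[of vol0 i] that by simp
    have "(\<Sum>i. f i M) = (\<Sum>i\<le>M. f i M)"
      by (rule suminf_finite) (auto simp: f_def zero)
    also have "\<dots> = (\<Sum>m\<le>M. \<Sum>i\<le>M. Phi \<theta> $ i * (vol0 ^ i) $ m * z ^ m)"
      unfolding f_def sum_distrib_left by (subst sum.swap) (simp add: mult_ac)
    also have "\<dots> = (\<Sum>m\<le>M. vol m \<theta> * z ^ m)"
    proof (rule sum.cong[OF refl])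
      fix m assume m: "m \<in> {..M}"
      have "(\<Sum>i\<le>M. Phi \<theta> $ i * (vol0 ^ i) $ m) = (\<Sum>i=0..m. Phi \<theta> $ i * (vol0 ^ i) $ m)"
        by (rule sum.mono_neutral_right) (use m zero in auto)
      then show "(\<Sum>i\<le>M. Phi \<theta> $ i * (vol0 ^ i) $ m * z ^ m) = vol m \<theta> * z ^ m"
        by (simp add: vol_def fps_compose_nth flip: sum_distrib_right)
    qed
    finally show ?thesis .
  qed
  ultimately show ?thesis by (simp add: sums_def_le eval_fps_def)
qed

lemma eval_Phi_pi_qsum:
  assumes "0 \<le> z" "z \<le> xc"
  shows "eval_fps (Phi pi) (qsum z) = z"
proof -
  have "(\<lambda>m. if m = 1 then z else 0) sums z" by (rule sums_single)
  moreover have "(\<lambda>m. vol m pi * z ^ m) = (\<lambda>m. if m = 1 then z else 0)"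
    by (auto simp: vol_pi)
  ultimately show ?thesis using vol_sums_eval_Phi[OF assms, of pi] by (simp add: sums_iff)
qed

lemma continuous_on_qsum: "continuous_on {0..xc} qsum"
proof (rule uniform_limit_theorem)
  show "uniform_limit {0..xc} (\<lambda>n z. \<Sum>m<n. vol0 $ m * z ^ m) qsum sequentially"
    unfolding qsum_def
  proof (rule Weierstrass_m_test[OF _ summable_vol0_xc])
    show "norm (vol0 $ m * z ^ m) \<le> vol0 $ m * xc ^ m" if "z \<in> {0..xc}" for m z
      using that by (auto simp: abs_mult vol0_nonneg intro!: mult_left_mono power_mono)
  qed
qed (auto intro!: always_eventually continuous_intros)

lemma eval_Phi_pi_strict_mono:
  assumes "0 \<le> x" "x < y" "y \<le> pc"
  shows "eval_fps (Phi pi) x < eval_fps (Phi pi) y"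
proof (rule DERIV_pos_imp_increasing_open[OF assms(2)])
  fix p assume p: "x < p" "p < y"
  have "(eval_fps (Phi pi) has_field_derivative eval_fps (fps_deriv (Phi pi)) p) (at p)"
    by (rule has_field_derivative_eval_fps) simp
  moreover have "0 < eval_fps (fps_deriv (Phi pi)) p"
    unfolding eval_fps_deriv_Phi
  proof (rule c0_properties(4))
    show "pi\<^sup>2 * p < (c0 / 2)\<^sup>2"
      unfolding pi2_pc[symmetric] using p assms by (intro mult_strict_left_mono) auto
  qed (use p assms in simp)
  ultimately show "\<exists>d. (eval_fps (Phi pi) has_real_derivative d) (at p) \<and> 0 < d" by blast
qed (auto intro!: continuous_intros)

text \<open>\<open>Phi pi\<close> takes the value \<open>xc\<close> at both points, but it is
  injective only up to \<open>pc\<close>, so the branch must be controlled. If \<open>qsum\<close>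
  exceeded \<open>pc\<close>, continuity would give a z \<le> \<open>xc\<close> with qsum z =
  \<open>pc\<close>; applying \<open>Phi pi\<close> forces z = \<open>xc\<close>, a
  contradiction.\<close>

lemma qsum_xc: "qsum xc = pc"
proof -
  have q0: "qsum 0 = 0"
    unfolding qsum_def by (subst suminf_finite[of "{0}"]) auto
  have Xpc: "eval_fps (Phi pi) pc = xc" by (simp add: eval_Phi_pc xc_eq_F_pi)
  have Xq: "eval_fps (Phi pi) (qsum xc) = xc"
    using xc_pos by (intro eval_Phi_pi_qsum) auto
  have "qsum xc \<le> pc"
  proof (rule ccontr)
    assume "\<not> qsum xc \<le> pc"
    then have "\<exists>z. 0 \<le> z \<and> z \<le> xc \<and> qsum z = pc"
      using q0 pc_bounds xc_pos by (intro IVT' continuous_on_qsum) auto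
    then obtain z where z: "0 \<le> z" "z \<le> xc" "qsum z = pc" by blast
    then have "z = xc" using eval_Phi_pi_qsum[of z] Xpc by simp
    with z \<open>\<not> qsum xc \<le> pc\<close> show False by simp
  qed
  moreover have "0 \<le> qsum xc"
    unfolding qsum_def using xc_pos by (intro suminf_nonneg summable_vol0) (auto simp: vol0_nonneg)
  ultimately show ?thesis
    using eval_Phi_pi_strict_mono[of "qsum xc" pc] Xpc Xq by (cases "qsum xc = pc") auto
qed

text \<open>The total weighted volume is \<open>Phi \<theta>\<close> at the critical point; this is
  why \<open>F \<theta>\<close> normalises \<open>Pfin \<theta>\<close>.\<close>

theorem wvol_sums_F: "(\<lambda>m. wvol m \<theta>) sums F \<theta>"
  using vol_sums_eval_Phi[of xc \<theta>] xc_pos by (simp add: wvol_def qsum_xc eval_Phi_pc)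

lemma F_ge_xc:
  assumes "0 \<le> \<theta>" "\<theta> \<le> pi"
  shows "xc \<le> F \<theta>"
proof -
  have "(\<Sum>m\<in>{1}. wvol m \<theta>) \<le> (\<Sum>m. wvol m \<theta>)"
    using wvol_sums_F[of \<theta>] by (intro sum_le_suminf) (auto simp: sums_iff wvol_nonneg assms)
  then show ?thesis
    using wvol_sums_F[of \<theta>] vol_1[OF assms] by (simp add: sums_iff wvol_def)
qed

lemma F_pos: "0 \<le> \<theta> \<Longrightarrow> \<theta> \<le> pi \<Longrightarrow> 0 < F \<theta>"
  using F_ge_xc xc_pos by (meson less_le_trans)

lemma F_antimono:
  assumes "0 \<le> a" "a \<le> b" "b \<le> pi"
  shows "F b \<le> F a"
  by (rule sums_le[OF _ wvol_sums_F wvol_sums_F]) (use assms in \<open>auto intro: wvol_antimono\<close>)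

section \<open>Measurability in the angle and the integral equation for \<open>Finf\<close>\<close>

lemma measurable_vol [measurable]: "vol m \<in> borel_measurable borel"
proof -
  have [measurable]: "(\<lambda>\<theta>. Phi \<theta> $ i) \<in> borel_measurable borel" for i
    by (cases i) auto
  show ?thesis unfolding vol_def[abs_def] fps_compose_nth by measurable
qed

lemma measurable_wvol [measurable]: "wvol m \<in> borel_measurable borel"
  unfolding wvol_def[abs_def] by measurable

lemma measurable_F [measurable]: "F \<in> borel_measurable borel"
proof (rule borel_measurable_LIMSEQ_real)
  show "(\<lambda>n. \<Sum>m<n. wvol m \<theta>) \<longlonglongrightarrow> F \<theta>" for \<theta>
    using wvol_sums_F[of \<theta>] by (simp add: sums_def)
qed measurable

lemma measurable_Finf [measurable]: "Finf \<in> borel_measurable borel"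
  by (rule borel_measurable_continuous_onI[OF continuous_on_Finf])

lemma tri_bounds:
  assumes "z \<in> tri \<theta>"
  shows "0 \<le> fst z" "fst z \<le> pi" "0 \<le> snd z" "snd z \<le> pi" "fst z < pi" "snd z < pi"
  using assms by (auto simp: tri_def)

lemma integrable_indicator_tri: 
  assumes "0 \<le> \<theta>" "\<theta> \<le> pi"
  shows "integrable lborel (indicator (tri \<theta>) :: real \<times> real \<Rightarrow> real)"
  using has_bochner_integral_tri_monomial[OF assms, of 0 0] by (simp add: has_bochner_integral_iff)

text \<open>The volume recursion is multiplied by wt m and xc^m and m tends to infinity. Under the
  integral \<open>convolution_tendsto\<close> gives the limit, and \<open>convolution_bound\<close>,
  made independent of the angles by monotonicity of \<open>F\<close>, gives a constant majorant on
  the triangle.\<close>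

theorem Finf_integral_equation:
  assumes \<theta>: "0 \<le> \<theta>" "\<theta> \<le> pi"
  shows "has_bochner_integral lborel
    (\<lambda>z. indicator (tri \<theta>) z * (F (fst z) * Finf (snd z) + Finf (fst z) * F (snd z))) (Finf \<theta>)"
proof -
  obtain C where C: "\<And>m \<theta>. \<theta> \<in> {0..pi} \<Longrightarrow> wt m * wvol m \<theta> \<le> C"
    using wvol_uniform_bound by blast
  define s where "s m z = indicator (tri \<theta>) z * (wt m * (\<Sum>k\<le>m. wvol k (fst z) * wvol (m - k) (snd z)))" for m z
  define g where "g z = indicator (tri \<theta>) z * (asym_const * (F (fst z) * Finf (snd z) + Finf (fst z) * F (snd z)))" for z
  define w where "w z = indicator (tri \<theta>) z * (4 * C * (F 0 + F 0))" for z
  have C0: "0 \<le> C"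
    using C[of 0 0] by (simp add: wt_def)
  have meas: "s m \<in> borel_measurable lborel" "g \<in> borel_measurable lborel" for m
    unfolding s_def[abs_def] g_def[abs_def] by measurable
  have intw: "integrable lborel w"
    unfolding w_def using integrable_indicator_tri[OF \<theta>] by (rule integrable_mult_left)
  have lim: "(\<lambda>m. s m z) \<longlonglongrightarrow> g z" for z
  proof (cases "z \<in> tri \<theta>")
    case True
    note b = tri_bounds[OF True]
    have "(\<lambda>m. wt m * (\<Sum>k\<le>m. wvol k (fst z) * wvol (m - k) (snd z)))
        \<longlonglongrightarrow> F (fst z) * (asym_const * Finf (snd z)) + (asym_const * Finf (fst z)) * F (snd z)"
      by (intro convolution_tendsto wvol_sums_F wvol_asymptotics wvol_nonneg b)
    then show ?thesis using True by (simp add: s_def g_def algebra_simps)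
  qed (simp add: s_def g_def)
  have bound: "norm (s m z) \<le> w z" for m z
  proof (cases "z \<in> tri \<theta>")
    case True
    note b = tri_bounds[OF True]
    have "wt m * (\<Sum>k\<le>m. wvol k (fst z) * wvol (m - k) (snd z)) \<le> 4 * C * (F (fst z) + F (snd z))"
      by (intro convolution_bound wvol_sums_F wvol_nonneg b C) (use b in auto)
    also have "\<dots> \<le> 4 * C * (F 0 + F 0)"
      using C0 b by (intro mult_left_mono add_mono F_antimono) auto
    finally have "wt m * (\<Sum>k\<le>m. wvol k (fst z) * wvol (m - k) (snd z)) \<le> 4 * C * (F 0 + F 0)" .
    moreover have "0 \<le> wt m * (\<Sum>k\<le>m. wvol k (fst z) * wvol (m - k) (snd z))"
      using b by (intro mult_nonneg_nonneg sum_nonneg wvol_nonneg wt_nonneg) auto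
    ultimately show ?thesis using True by (simp add: s_def w_def)
  qed (simp add: s_def w_def)
  have lims: "(\<lambda>m. integral\<^sup>L lborel (s m)) \<longlonglongrightarrow> integral\<^sup>L lborel g" and intg: "integrable lborel g"
    using integral_dominated_convergence[OF meas(2) meas(1) intw AE_I2[OF lim] AE_I2[OF bound]]
      integrable_dominated_convergence[OF meas(2) meas(1) intw AE_I2[OF lim] AE_I2[OF bound]] by auto
  \<comment> \<open>Indices of at least 2 avoid the inhomogeneous term of the recursion at m =
    1.\<close>
  have ints: "integral\<^sup>L lborel (s (Suc (Suc n))) = wt (Suc (Suc n)) * wvol (Suc (Suc n)) \<theta>" for n
  proof -
    let ?m = "Suc (Suc n)"
    have "has_bochner_integral lborel (\<lambda>z. (wt ?m * xc ^ ?m) * (indicator (tri \<theta>) z * (\<Sum>k\<le>?m. vol k (fst z) * vol (?m - k) (snd z))))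
      ((wt ?m * xc ^ ?m) * (vol ?m \<theta> - (if ?m = 1 then 1 else 0)))"
      by (intro has_bochner_integral_mult_right vol_recursion \<theta>)
    moreover have "(wt ?m * xc ^ ?m) * (indicator (tri \<theta>) z * (\<Sum>k\<le>?m. vol k (fst z) * vol (?m - k) (snd z))) = s ?m z" for z
    proof -
      have "xc ^ ?m * (vol k (fst z) * vol (?m - k) (snd z)) = wvol k (fst z) * wvol (?m - k) (snd z)" if "k \<le> ?m" for k
      proof -
        have "xc ^ ?m = xc ^ k * xc ^ (?m - k)" using that by (simp flip: power_add)
        then show ?thesis by (simp add: wvol_def)
      qed
      then have "xc ^ ?m * (\<Sum>k\<le>?m. vol k (fst z) * vol (?m - k) (snd z)) = (\<Sum>k\<le>?m. wvol k (fst z) * wvol (?m - k) (snd z))"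
        unfolding sum_distrib_left by (intro sum.cong refl) auto
      then show ?thesis unfolding s_def by (metis (no_types, lifting) mult.assoc mult.left_commute)
    qed
    ultimately show ?thesis by (simp add: has_bochner_integral_iff wvol_def mult_ac del: power_Suc)
  qed
  have "(\<lambda>n. wt (Suc (Suc n)) * wvol (Suc (Suc n)) \<theta>) \<longlonglongrightarrow> asym_const * Finf \<theta>"
    by (intro LIMSEQ_Suc wvol_asymptotics)
  moreover have "(\<lambda>n. wt (Suc (Suc n)) * wvol (Suc (Suc n)) \<theta>) \<longlonglongrightarrow> integral\<^sup>L lborel g"
    using LIMSEQ_Suc[OF LIMSEQ_Suc[OF lims]] by (simp only: ints)
  ultimately have "integral\<^sup>L lborel g = asym_const * Finf \<theta>"
    by (rule LIMSEQ_unique[rotated])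
  with intg have "has_bochner_integral lborel g (asym_const * Finf \<theta>)"
    by (simp add: has_bochner_integral_iff)
  from has_bochner_integral_mult_right[OF this, of "1 / asym_const"]
  show ?thesis using asym_const_pos by (simp add: g_def mult_ac)
qed

lemma nn_integral_Finf_equation:
  assumes \<theta>: "0 \<le> \<theta>" "\<theta> \<le> pi"
  shows "(\<integral>\<^sup>+z. indicator (tri \<theta>) z * (ennreal (F (fst z) * Finf (snd z)) + ennreal (Finf (fst z) * F (snd z))) \<partial>lborel) = ennreal (Finf \<theta>)"
proof -
  let ?g = "\<lambda>z. indicator (tri \<theta>) z * (F (fst z) * Finf (snd z) + Finf (fst z) * F (snd z))"
  have nn: "0 \<le> F (fst z) * Finf (snd z)" "0 \<le> Finf (fst z) * F (snd z)" if "z \<in> tri \<theta>" for z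
    using tri_bounds[OF that] by (auto intro!: mult_nonneg_nonneg Finf_nonneg less_imp_le[OF F_pos])
  have "(\<integral>\<^sup>+z. ennreal (?g z) \<partial>lborel) = ennreal (Finf \<theta>)"
  proof (subst nn_integral_eq_integral)
    show "integrable lborel ?g" "ennreal (integral\<^sup>L lborel ?g) = ennreal (Finf \<theta>)"
      using Finf_integral_equation[OF \<theta>] by (auto simp: has_bochner_integral_iff)
    show "AE z in lborel. 0 \<le> ?g z"
    proof (rule AE_I2)
      fix z show "0 \<le> ?g z" using nn[of z] by (cases "z \<in> tri \<theta>") auto
    qed
  qed
  moreover have "ennreal (?g z) = indicator (tri \<theta>) z * (ennreal (F (fst z) * Finf (snd z)) + ennreal (Finf (fst z) * F (snd z)))" for z
    using nn[of z] by (cases "z \<in> tri \<theta>") auto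
  ultimately show ?thesis by simp
qed

section \<open>The measurable space of trees\<close>

lemma space_node_M [simp]: "space node_M = UNIV"
  by (simp add: node_M_def)

lemma sets_node_M_gen:
  "{None} \<in> sets node_M" "{Some None} \<in> sets node_M"
  "B \<in> sets borel \<Longrightarrow> (\<lambda>ab. Some (Some ab)) ` B \<in> sets node_M"
  unfolding node_M_def by (auto intro!: sigma_sets.Basic)

lemma measurable_Some_Some [measurable]: "(\<lambda>ab. Some (Some ab)) \<in> borel \<rightarrow>\<^sub>M node_M"
  unfolding node_M_def
proof (rule measurable_measure_of)
  fix A assume "A \<in> {{None}, {Some None}} \<union> {(\<lambda>ab. Some (Some ab)) ` B |B. B \<in> sets (borel :: (real \<times> real) measure)}"
  then consider "A = {None}" | "A = {Some None}" | B where "A = (\<lambda>ab. Some (Some ab)) ` B" "B \<in> sets (borel :: (real \<times> real) measure)"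
    by auto
  then show "(\<lambda>ab. Some (Some ab)) -` A \<inter> space borel \<in> sets borel"
  proof cases
    case 3
    then have "(\<lambda>ab. Some (Some ab)) -` A = B" by auto
    then show ?thesis using 3 by simp
  qed (simp_all add: vimage_def)
qed (simp_all add: image_subset_iff)

text \<open>The two angle-free values are measurable atoms, so only the trace on internal vertices
  matters.\<close>

lemma sets_node_M_iff: "A \<in> sets node_M \<longleftrightarrow> {ab. Some (Some ab) \<in> A} \<in> sets borel"
proof
  assume "A \<in> sets node_M"
  from measurable_sets[OF measurable_Some_Some this] show "{ab. Some (Some ab) \<in> A} \<in> sets borel"
    by (simp add: vimage_def)
next
  assume *: "{ab. Some (Some ab) \<in> A} \<in> sets borel"
  have "A = (A \<inter> {None}) \<union> (A \<inter> {Some None}) \<union> (\<lambda>ab. Some (Some ab)) ` {ab. Some (Some ab) \<in> A}"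
  proof (rule set_eqI)
    fix x show "x \<in> A \<longleftrightarrow> x \<in> (A \<inter> {None}) \<union> (A \<inter> {Some None}) \<union> (\<lambda>ab. Some (Some ab)) ` {ab. Some (Some ab) \<in> A}"
      by (cases x rule: option.exhaust; cases "the x") auto
  qed
  moreover have "A \<inter> {y} \<in> sets node_M" if "{y} \<in> sets node_M" for y
    using that by (cases "y \<in> A") auto
  ultimately show "A \<in> sets node_M"
    using sets_node_M_gen * by (metis sets.Un)
qed

lemma measurable_node_M_I:
  assumes "f None \<in> space N" "f (Some None) \<in> space N"
    and "(\<lambda>ab. f (Some (Some ab))) \<in> borel \<rightarrow>\<^sub>M N"
  shows "f \<in> node_M \<rightarrow>\<^sub>M N"
proof (rule measurableI)
  fix x show "f x \<in> space N"
    using assms measurable_space[OF assms(3)] by (cases x; cases "the x") auto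
next
  fix A assume "A \<in> sets N"
  from measurable_sets[OF assms(3) this] show "f -` A \<inter> space node_M \<in> sets node_M"
    by (simp add: sets_node_M_iff vimage_def)
qed

lemma space_tree_M [simp]: "space tree_M = UNIV"
  by (simp add: tree_M_def space_PiM)

lemma measurable_tree_component [measurable]: "(\<lambda>t. t p) \<in> tree_M \<rightarrow>\<^sub>M node_M"
  unfolding tree_M_def by (rule measurable_component_singleton) simp

lemma measurable_tree_M_I:
  assumes "\<And>p. (\<lambda>x. f x p) \<in> N \<rightarrow>\<^sub>M node_M"
  shows "f \<in> N \<rightarrow>\<^sub>M tree_M"
  unfolding tree_M_def
  using measurable_PiM_single'[where I = UNIV and f = "\<lambda>p x. f x p" and N = N and M = "\<lambda>_. node_M"] assms
  by (simp add: PiE_UNIV_domain)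

lemma pred_node_M [measurable]: 
  "Measurable.pred node_M (\<lambda>n. n = None)" "Measurable.pred node_M (\<lambda>n. n = Some None)"
  unfolding pred_def by (simp_all add: sets_node_M_iff)

lemma measurable_subL [measurable]: "subL \<in> tree_M \<rightarrow>\<^sub>M tree_M"
  and measurable_subR [measurable]: "subR \<in> tree_M \<rightarrow>\<^sub>M tree_M"
  by (rule measurable_tree_M_I, simp add: subL_def subR_def)+

text \<open>In a root vertex the pair \<open>(\<alpha>, \<beta>)\<close> stands for the corner angles \<open>(pi - \<alpha>, pi - \<beta>)\<close>.\<close>
definition nd :: "real \<times> real \<Rightarrow> node" where
  "nd z = Some (Some (pi - fst z, pi - snd z))"

definition graft :: "real \<times> real \<Rightarrow> atree \<Rightarrow> atree \<Rightarrow> atree" where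
  "graft z l r = (\<lambda>p. case p of [] \<Rightarrow> nd z | c # q \<Rightarrow> if c then r q else l q)"

definition leaf_tree :: atree where
  "leaf_tree = (\<lambda>p. if p = [] then Some None else None)"

definition rect :: "node set \<Rightarrow> atree set \<Rightarrow> atree set \<Rightarrow> atree set" where
  "rect A0 A B = {t. t [] \<in> A0 \<and> subL t \<in> A \<and> subR t \<in> B}"

lemma measurable_nd [measurable]: "nd \<in> borel \<rightarrow>\<^sub>M node_M"
proof -
  have "(\<lambda>z. (pi - fst z, pi - snd z)) \<in> borel \<rightarrow>\<^sub>M (borel \<Otimes>\<^sub>M borel :: (real \<times> real) measure)"
    by measurable
  then have "(\<lambda>z. (pi - fst z, pi - snd z)) \<in> borel \<rightarrow>\<^sub>M (borel :: (real \<times> real) measure)"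
    by (simp add: borel_prod)
  from measurable_compose[OF this measurable_Some_Some] show ?thesis
    by (simp add: nd_def[abs_def])
qed

lemma graft_simps [simp]: "graft z l r [] = nd z" "subL (graft z l r) = l" "subR (graft z l r) = r"
  "graft z l r (False # q) = l q" "graft z l r (True # q) = r q"
  by (auto simp: graft_def subL_def subR_def)

lemma measurable_graft [measurable (raw)]:
  assumes [measurable]: "f \<in> N \<rightarrow>\<^sub>M borel" "g \<in> N \<rightarrow>\<^sub>M tree_M" "h \<in> N \<rightarrow>\<^sub>M tree_M"
  shows "(\<lambda>x. graft (f x) (g x) (h x)) \<in> N \<rightarrow>\<^sub>M tree_M"
proof (rule measurable_tree_M_I)
  fix p show "(\<lambda>x. graft (f x) (g x) (h x) p) \<in> N \<rightarrow>\<^sub>M node_M"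
    by (cases p) (auto simp: graft_def)
qed

lemma sets_rect [measurable]:
  assumes [measurable]: "A0 \<in> sets node_M" "A \<in> sets tree_M" "B \<in> sets tree_M"
  shows "rect A0 A B \<in> sets tree_M"
proof -
  have "rect A0 A B = {t \<in> space tree_M. t [] \<in> A0 \<and> subL t \<in> A \<and> subR t \<in> B}"
    by (simp add: rect_def)
  also have "\<dots> \<in> sets tree_M" by measurable
  finally show ?thesis .
qed

lemma leaf_tree_simps [simp]: "leaf_tree [] = Some None" "leaf_tree (c # p) = None"
  "subL leaf_tree = (\<lambda>_. None)" "subR leaf_tree = (\<lambda>_. None)"
  by (auto simp: leaf_tree_def subL_def subR_def)

section \<open>Cylinders and uniqueness of measures on trees\<close>

definition cylinder :: "nat \<Rightarrow> (bool list \<Rightarrow> node set) \<Rightarrow> atree set" where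
  "cylinder r E = {t. \<forall>p. length p < r \<longrightarrow> t p \<in> E p}"

lemma cylinder_0 [simp]: "cylinder 0 E = UNIV"
  by (simp add: cylinder_def)

lemma cylinder_Suc: "cylinder (Suc r) E = rect (E []) (cylinder r (\<lambda>p. E (False # p))) (cylinder r (\<lambda>p. E (True # p)))"
proof -
  have "(\<forall>p. length p < Suc r \<longrightarrow> t p \<in> E p) \<longleftrightarrow> t [] \<in> E [] \<and>
     (\<forall>p. length p < r \<longrightarrow> t (False # p) \<in> E (False # p)) \<and> (\<forall>p. length p < r \<longrightarrow> t (True # p) \<in> E (True # p))" for t :: atree
    by (metis (full_types) Suc_less_eq length_Cons length_greater_0_conv list.exhaust zero_less_Suc list.size(3))
  then show ?thesis by (auto simp: cylinder_def rect_def subL_def subR_def)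
qed

lemma sets_cylinder:
  assumes "\<And>p. E p \<in> sets node_M"
  shows "cylinder r E \<in> sets tree_M"
  using assms
proof (induction r arbitrary: E)
  case 0
  then show ?case using sets.top[of tree_M] by simp
next
  case (Suc r)
  then show ?case unfolding cylinder_Suc by (intro sets_rect) auto
qed

text \<open>Every finite set of addresses lies below some depth, so each finite-dimensional box is a
  cylinder with the full space at the other addresses; boxes determine a finite measure on the
  product space.\<close>

lemma tree_measure_eqI:
  assumes M: "finite_measure M" "sets M = sets tree_M" and N: "sets N = sets tree_M"
    and eq: "\<And>r E. (\<And>p. E p \<in> sets node_M) \<Longrightarrow> emeasure M (cylinder r E) = emeasure N (cylinder r E)"
  shows "M = N"
proof (rule measure_eqI_PiM_infinite[where I = UNIV and M = "\<lambda>_. node_M"])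
  fix A :: "bool list \<Rightarrow> node set" and J
  assume J: "finite J" "\<And>i. i \<in> J \<Longrightarrow> A i \<in> sets node_M"
  define r where "r = Suc (Max (length ` J))"
  define E where "E p = (if p \<in> J then A p else UNIV)" for p
  have r: "length p < r" if "p \<in> J" for p
    using that J by (auto simp: r_def less_Suc_eq_le)
  have "prod_emb UNIV (\<lambda>_. node_M) J (Pi\<^sub>E J A) = cylinder r E"
    using r by (auto simp: prod_emb_def cylinder_def E_def space_PiM PiE_iff split: if_splits)
  moreover have "E p \<in> sets node_M" for p
    using J sets.top[of node_M] by (auto simp: E_def)
  ultimately show "emeasure M (prod_emb UNIV (\<lambda>_. node_M) J (Pi\<^sub>E J A)) = emeasure N (prod_emb UNIV (\<lambda>_. node_M) J (Pi\<^sub>E J A))"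
    using eq by simp
qed (use M N in \<open>auto simp: tree_M_def\<close>)

text \<open>Every cylinder of positive depth is a rectangle by \<open>cylinder_Suc\<close>, so
  identities obtained by cutting at the root determine the measure.\<close>

lemma tree_measure_eqI_rect:
  assumes M: "finite_measure M" "sets M = sets tree_M" and N: "sets N = sets tree_M"
    and eq: "\<And>A0 A B. A0 \<in> sets node_M \<Longrightarrow> A \<in> sets tree_M \<Longrightarrow> B \<in> sets tree_M \<Longrightarrow>
       emeasure M (rect A0 A B) = emeasure N (rect A0 A B)"
  shows "M = N"
proof (rule tree_measure_eqI[OF M N])
  fix r and E :: "bool list \<Rightarrow> node set" assume E: "\<And>p. E p \<in> sets node_M"
  show "emeasure M (cylinder r E) = emeasure N (cylinder r E)"
  proof (cases r)
    case 0
    have "cylinder r E = rect UNIV UNIV UNIV" using 0 by (simp add: rect_def)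
    then show ?thesis using eq[of UNIV UNIV UNIV] sets.top[of node_M] sets.top[of tree_M] by simp
  next
    case (Suc k)
    then show ?thesis unfolding Suc cylinder_Suc by (intro eq sets_cylinder E)
  qed
qed

section \<open>Allowed assignments under cutting at the root vertex\<close>

definition good :: "real \<Rightarrow> atree \<Rightarrow> bool" where
  "good \<theta> t \<longleftrightarrow> allowed t \<and> \<theta> < corner_opp_parent t []"

lemma all_bool_list: "(\<forall>p. P p) \<longleftrightarrow> P [] \<and> (\<forall>q. P (False # q)) \<and> (\<forall>q. P (True # q))"
  by (metis (full_types) list.exhaust)

text \<open>The edge condition across the left child edge reads (pi - \<alpha>) + corner > pi, so it
  says that the root corner of the left subtree exceeds \<alpha>; likewise with \<beta> on the
  right. The subtrees thus interact only through the root angles, and each satisfies the same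
  condition with its own parameter.\<close>

lemma good_graft_iff:
  assumes l: "l [] \<noteq> None" and r: "r [] \<noteq> None"
  shows "good \<theta> (graft z l r) \<longleftrightarrow> 0 < fst z \<and> fst z < pi \<and> 0 < snd z \<and> snd z < pi \<and>
    0 < fst z + snd z \<and> fst z + snd z < pi \<and> \<theta> < fst z + snd z \<and> good (fst z) l \<and> good (snd z) r"
proof -
  let ?t = "graft z l r"
  define va where "va n \<longleftrightarrow> (\<forall>a b. n = Some (Some (a, b)) \<longrightarrow>
     0 < a \<and> a < pi \<and> 0 < b \<and> b < pi \<and> 0 < 2 * pi - a - b \<and> 2 * pi - a - b < pi)" for n :: node
  have va: "valid_angles t \<longleftrightarrow> (\<forall>p. va (t p))" for t
    by (simp add: valid_angles_def va_def)
  have "va (nd z) \<longleftrightarrow> 0 < pi - fst z \<and> pi - fst z < pi \<and> 0 < pi - snd z \<and> pi - snd z < pi \<and>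
     0 < 2 * pi - (pi - fst z) - (pi - snd z) \<and> 2 * pi - (pi - fst z) - (pi - snd z) < pi"
    by (simp only: va_def nd_def option.inject prod.inject) blast
  then have v: "valid_angles ?t \<longleftrightarrow> (0 < fst z \<and> fst z < pi \<and> 0 < snd z \<and> snd z < pi \<and>
     0 < fst z + snd z \<and> fst z + snd z < pi) \<and> valid_angles l \<and> valid_angles r"
    unfolding va all_bool_list[of "\<lambda>p. va (?t p)"] by auto
  have c: "(\<forall>p c. ?t (p @ [c]) \<noteq> None \<longrightarrow> corner_opp_child ?t p c + corner_opp_parent ?t (p @ [c]) > pi) \<longleftrightarrow>
     (fst z < corner_opp_parent l [] \<and> snd z < corner_opp_parent r []) \<and>
     (\<forall>p c. l (p @ [c]) \<noteq> None \<longrightarrow> corner_opp_child l p c + corner_opp_parent l (p @ [c]) > pi) \<and>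
     (\<forall>p c. r (p @ [c]) \<noteq> None \<longrightarrow> corner_opp_child r p c + corner_opp_parent r (p @ [c]) > pi)"
    unfolding all_bool_list[of "\<lambda>p. \<forall>c. ?t (p @ [c]) \<noteq> None \<longrightarrow> corner_opp_child ?t p c + corner_opp_parent ?t (p @ [c]) > pi"]
    using l r by (auto simp: corner_opp_child_def corner_opp_parent_def nd_def all_bool_eq)
  have "corner_opp_parent ?t [] = fst z + snd z"
    by (simp add: corner_opp_parent_def nd_def)
  then show ?thesis
    unfolding good_def allowed_def v c by auto
qed

lemma measurable_corner_opp_parent [measurable]: "(\<lambda>t. corner_opp_parent t p) \<in> borel_measurable tree_M"
proof -
  have "(\<lambda>n. case n of Some (Some (a, b)) \<Rightarrow> 2 * pi - a - b | _ \<Rightarrow> pi) \<in> node_M \<rightarrow>\<^sub>M borel"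
    by (rule measurable_node_M_I) (auto simp: case_prod_beta)
  from measurable_compose[OF measurable_tree_component this, of p]
  show ?thesis by (simp add: corner_opp_parent_def[abs_def])
qed

lemma measurable_corner_opp_child [measurable]: "(\<lambda>t. corner_opp_child t p c) \<in> borel_measurable tree_M"
proof -
  have "(\<lambda>n. case n of Some (Some (a, b)) \<Rightarrow> if c then b else a | _ \<Rightarrow> pi) \<in> node_M \<rightarrow>\<^sub>M borel"
    by (rule measurable_node_M_I) (cases c; auto simp: case_prod_beta)+
  from measurable_compose[OF measurable_tree_component this, of p]
  show ?thesis by (simp add: corner_opp_child_def[abs_def])
qed

lemma pred_allowed [measurable]: "Measurable.pred tree_M allowed"
proof -
  let ?v = "\<lambda>n::node. \<forall>a b. n = Some (Some (a, b)) \<longrightarrow>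
     0 < a \<and> a < pi \<and> 0 < b \<and> b < pi \<and> 0 < 2 * pi - a - b \<and> 2 * pi - a - b < pi"
  have "Measurable.pred node_M ?v"
  proof -
    have "{ab. ?v (Some (Some ab))} = {ab \<in> space borel. 0 < fst ab \<and> fst ab < pi \<and> 0 < snd ab \<and> snd ab < pi \<and>
       0 < 2 * pi - fst ab - snd ab \<and> 2 * pi - fst ab - snd ab < pi}" by auto
    also have "\<dots> \<in> sets (borel :: (real \<times> real) measure)" by measurable
    finally show ?thesis unfolding pred_def by (simp add: sets_node_M_iff)
  qed
  from measurable_compose[OF measurable_tree_component this]
  have [measurable]: "Measurable.pred tree_M (\<lambda>t. ?v (t p))" for p .
  have "Measurable.pred tree_M (\<lambda>t. (\<forall>p. ?v (t p)) \<and> pi + corner_opp_parent t [] > pi \<and>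
     (\<forall>p c. t (p @ [c]) \<noteq> None \<longrightarrow> corner_opp_child t p c + corner_opp_parent t (p @ [c]) > pi))"
    by measurable
  then show ?thesis unfolding allowed_def[abs_def] valid_angles_def .
qed

lemma pred_good [measurable]: "Measurable.pred tree_M (good \<theta>)"
  unfolding good_def[abs_def] by measurable

section \<open>Tree shapes\<close>

definition node_shape :: "bool list set \<Rightarrow> bool list set \<Rightarrow> bool list set" where
  "node_shape S T = insert [] ((#) False ` S \<union> (#) True ` T)"

lemma node_shape_mem [simp]: "[] \<in> node_shape S T" "False # p \<in> node_shape S T \<longleftrightarrow> p \<in> S"
  "True # p \<in> node_shape S T \<longleftrightarrow> p \<in> T"
  by (auto simp: node_shape_def)

lemma shape_ok_node_shape:
  assumes S: "shape_ok S" and T: "shape_ok T"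
  shows "shape_ok (node_shape S T)"
  unfolding shape_ok_def
proof (intro conjI allI impI)
  show "finite (node_shape S T)"
    using assms by (simp add: node_shape_def shape_ok_def)
  fix p c
  show "p \<in> node_shape S T" if "p @ [c] \<in> node_shape S T"
  proof (cases p)
    case (Cons d q)
    then show ?thesis using that S T by (cases d) (auto simp: shape_ok_def)
  qed simp
  show "p @ [False] \<in> node_shape S T \<longleftrightarrow> p @ [True] \<in> node_shape S T"
  proof (cases p)
    case Nil
    then show ?thesis using S T by (auto simp: shape_ok_def)
  next
    case (Cons d q)
    then show ?thesis using S T by (cases d) (auto simp: shape_ok_def)
  qed
qed simp

lemma shape_ok_prefix:
  assumes "shape_ok S" "p @ q \<in> S"
  shows "p \<in> S"
  using assms(2)
proof (induction q rule: rev_induct)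
  case (snoc c q)
  then have "(p @ q) @ [c] \<in> S" by simp
  then have "p @ q \<in> S" using assms(1) unfolding shape_ok_def by blast
  then show ?case by (rule snoc.IH)
qed simp

lemma shape_ok_cases:
  assumes S: "shape_ok S"
  obtains "S = {[]}" | A B where "shape_ok A" "shape_ok B" "S = node_shape A B"
proof (cases "S = {[]}")
  case False
  then obtain p where "p \<in> S" "p \<noteq> []"
    using S by (auto simp: shape_ok_def)
  then obtain c q where "c # q \<in> S" by (cases p) auto
  then have "[c] \<in> S" using shape_ok_prefix[OF S, of "[c]" q] by simp
  then have both: "[False] \<in> S" "[True] \<in> S"
    using S unfolding shape_ok_def by (metis (full_types) append_Nil)+
  define A where "A = {p. False # p \<in> S}"
  define B where "B = {p. True # p \<in> S}"
  have fin: "finite A" "finite B"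
    unfolding A_def B_def
    using S finite_vimageI[of S "(#) False"] finite_vimageI[of S "(#) True"]
    by (auto simp: shape_ok_def vimage_def)
  have "shape_ok A"
    unfolding shape_ok_def
  proof (intro conjI allI impI)
    fix p c
    show "p \<in> A" if "p @ [c] \<in> A"
      using that shape_ok_prefix[OF S, of "False # p" "[c]"] by (simp add: A_def)
    show "p @ [False] \<in> A \<longleftrightarrow> p @ [True] \<in> A"
      using S unfolding shape_ok_def A_def by (metis append_Cons mem_Collect_eq)
  qed (use fin both in \<open>auto simp: A_def\<close>)
  moreover have "shape_ok B"
    unfolding shape_ok_def
  proof (intro conjI allI impI)
    fix p c
    show "p \<in> B" if "p @ [c] \<in> B"
      using that shape_ok_prefix[OF S, of "True # p" "[c]"] by (simp add: B_def)
    show "p @ [False] \<in> B \<longleftrightarrow> p @ [True] \<in> B"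
      using S unfolding shape_ok_def B_def by (metis append_Cons mem_Collect_eq)
  qed (use fin both in \<open>auto simp: B_def\<close>)
  moreover have "S = node_shape A B"
  proof (rule set_eqI)
    fix p show "p \<in> S \<longleftrightarrow> p \<in> node_shape A B"
    proof (cases p)
      case Nil
      then show ?thesis using S by (simp add: shape_ok_def)
    next
      case (Cons c q)
      then show ?thesis by (cases c) (auto simp: A_def B_def)
    qed
  qed
  ultimately show ?thesis by (rule that(2))
qed (rule that(1))

lemma shape_ok_leaf: "shape_ok {[]}"
  by (simp add: shape_ok_def)

lemma internal_leaf [simp]: "internal {[]} = {}"
  by (auto simp: internal_def)

lemma internal_node_shape:
  assumes "shape_ok S" "shape_ok T"
  shows "internal (node_shape S T) = node_shape (internal S) (internal T)"
proof (rule set_eqI)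
  fix p show "p \<in> internal (node_shape S T) \<longleftrightarrow> p \<in> node_shape (internal S) (internal T)"
  proof (cases p)
    case Nil
    then show ?thesis using assms by (simp add: internal_def shape_ok_def)
  next
    case (Cons c q)
    then show ?thesis by (cases c) (auto simp: internal_def)
  qed
qed

lemma finite_internal: "shape_ok S \<Longrightarrow> finite (internal S)"
  by (simp add: internal_def shape_ok_def)

lemma card_node_shape:
  assumes "finite S" "finite T"
  shows "card (node_shape S T) = Suc (card S + card T)"
proof -
  have "card ((#) False ` S \<union> (#) True ` T) = card S + card T"
    using assms by (subst card_Un_disjoint) (auto simp: card_image)
  then show ?thesis
    using assms unfolding node_shape_def by (subst card_insert_disjoint) auto
qed

lemma node_shape_inject: "node_shape S T = node_shape S' T' \<longleftrightarrow> S = S' \<and> T = T'"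
proof
  assume *: "node_shape S T = node_shape S' T'"
  have "p \<in> S \<longleftrightarrow> p \<in> S'" "p \<in> T \<longleftrightarrow> p \<in> T'" for p
    using * node_shape_mem by (metis, metis)
  then show "S = S' \<and> T = T'" by auto
qed simp

text \<open>Shapes are graded by internal vertices: those in \<open>shapes n\<close> have n + 1
  leaves besides the root, which explains the index shift towards
  \<open>vol (Suc n)\<close>.\<close>

definition shapes :: "nat \<Rightarrow> bool list set set" where
  "shapes n = {S. shape_ok S \<and> card (internal S) = n}"

lemma shapes_0: "shapes 0 = {{[]}}"
proof -
  have "S = {[]}" if "shape_ok S" "card (internal S) = 0" for S
    using that(1)
  proof (cases rule: shape_ok_cases)
    case (2 A B)
    then have "card (internal S) = Suc (card (internal A) + card (internal B))"
      by (simp add: internal_node_shape card_node_shape finite_internal)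
    then show ?thesis using that by simp
  qed
  then show ?thesis by (auto simp: shapes_def shape_ok_leaf)
qed

lemma shapes_Suc: "shapes (Suc n) = (\<lambda>(i, S, T). node_shape S T) ` (SIGMA i:{..n}. shapes i \<times> shapes (n - i))"
proof (intro set_eqI iffI)
  fix U assume "U \<in> shapes (Suc n)"
  then have U: "shape_ok U" "card (internal U) = Suc n" by (auto simp: shapes_def)
  from U(1) show "U \<in> (\<lambda>(i, S, T). node_shape S T) ` (SIGMA i:{..n}. shapes i \<times> shapes (n - i))"
  proof (cases rule: shape_ok_cases)
    case 1
    then show ?thesis using U by simp
  next
    case (2 A B)
    then have c: "card (internal A) + card (internal B) = n"
      using U by (simp add: internal_node_shape card_node_shape finite_internal)
    have "(card (internal A), A, B) \<in> (SIGMA i:{..n}. shapes i \<times> shapes (n - i))"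
      using 2 c by (auto simp: shapes_def)
    then show ?thesis using 2 by (intro image_eqI[of _ _ "(card (internal A), A, B)"]) auto
  qed
next
  fix U assume "U \<in> (\<lambda>(i, S, T). node_shape S T) ` (SIGMA i:{..n}. shapes i \<times> shapes (n - i))"
  then show "U \<in> shapes (Suc n)"
    by (auto simp: shapes_def shape_ok_node_shape internal_node_shape card_node_shape finite_internal)
qed

lemma finite_shapes: "finite (shapes n)"
proof (induction n rule: less_induct)
  case (less n)
  show ?case
  proof (cases n)
    case 0
    then show ?thesis by (simp add: shapes_0)
  next
    case (Suc k)
    have "finite (SIGMA i:{..k}. shapes i \<times> shapes (k - i))"
      using less.IH Suc by (intro finite_SigmaI finite_cartesian_product) auto
    then show ?thesis unfolding Suc shapes_Suc by (rule finite_imageI)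
  qed
qed

lemma sum_shapes_Suc:
  "sum f (shapes (Suc n)) = (\<Sum>i\<le>n. \<Sum>S\<in>shapes i. \<Sum>T\<in>shapes (n - i). f (node_shape S T))"
proof -
  have "inj_on (\<lambda>(i, S, T). node_shape S T) (SIGMA i:{..n}. shapes i \<times> shapes (n - i))"
    by (auto simp: inj_on_def node_shape_inject shapes_def)
  then have "sum f (shapes (Suc n)) = (\<Sum>(i, S, T)\<in>(SIGMA i:{..n}. shapes i \<times> shapes (n - i)). f (node_shape S T))"
    unfolding shapes_Suc by (subst sum.reindex) (auto simp: case_prod_beta o_def)
  also have "\<dots> = (\<Sum>i\<le>n. \<Sum>(S, T)\<in>shapes i \<times> shapes (n - i). f (node_shape S T))"
    using finite_shapes by (subst sum.Sigma[symmetric]) auto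
  finally show ?thesis by (simp add: sum.cartesian_product)
qed

section \<open>Volumes of sets of trees with a given shape\<close>

lemma space_angle_leb: "space (angle_leb S) = (\<Pi>\<^sub>E p\<in>internal S. UNIV)"
  by (simp add: angle_leb_def space_PiM)

lemma sigma_finite_angle_leb:
  assumes "shape_ok S"
  shows "sigma_finite_measure (angle_leb S)"
proof -
  interpret product_sigma_finite "\<lambda>_. lborel :: (real \<times> real) measure" by standard
  show ?thesis
    unfolding angle_leb_def by (rule sigma_finite[OF finite_internal[OF assms]])
qed

lemma measurable_angle_component:
  "p \<in> internal S \<Longrightarrow> (\<lambda>x. x p) \<in> angle_leb S \<rightarrow>\<^sub>M lborel"
  unfolding angle_leb_def by (rule measurable_component_singleton)

lemma measurable_tree_of [measurable]: "tree_of S \<in> angle_leb S \<rightarrow>\<^sub>M tree_M"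
proof (rule measurable_tree_M_I)
  fix p
  show "(\<lambda>x. tree_of S x p) \<in> angle_leb S \<rightarrow>\<^sub>M node_M"
  proof (cases "p \<in> internal S")
    case True
    have "(\<lambda>x. x p) \<in> angle_leb S \<rightarrow>\<^sub>M borel"
      using measurable_angle_component[OF True] by (simp add: measurable_lborel1)
    from measurable_compose[OF this measurable_Some_Some] show ?thesis
      using True by (simp add: tree_of_def)
  qed (simp add: tree_of_def)
qed

definition shape_vol :: "bool list set \<Rightarrow> real \<Rightarrow> atree set \<Rightarrow> ennreal" where
  "shape_vol S \<theta> A = emeasure (angle_leb S) {x \<in> space (angle_leb S). tree_of S x \<in> A \<and> good \<theta> (tree_of S x)}"

lemma shape_vol_antimono:
  assumes [measurable]: "A \<in> sets tree_M" and "\<theta> \<le> \<eta>"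
  shows "shape_vol S \<eta> A \<le> shape_vol S \<theta> A"
  unfolding shape_vol_def
proof (rule emeasure_mono)
  show "{x \<in> space (angle_leb S). tree_of S x \<in> A \<and> good \<theta> (tree_of S x)} \<in> sets (angle_leb S)"
    by measurable
qed (use assms in \<open>auto simp: good_def\<close>)

lemma measurable_antimono_ennreal:
  fixes f :: "real \<Rightarrow> ennreal"
  assumes "\<And>x y. x \<le> y \<Longrightarrow> f y \<le> f x"
  shows "f \<in> borel_measurable borel"
proof (rule borel_measurableI_greater)
  show "{x \<in> space borel. c < f x} \<in> sets borel" for c
  proof (rule real_interval_borel_measurable)
    show "is_interval {x \<in> space borel. c < f x}"
      unfolding is_interval_1 using assms by (auto intro: less_le_trans)
  qed
qed

text \<open>Raising \<theta> only strengthens the root condition, so the volume is decreasing in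
  \<theta>, and the superlevel sets of a decreasing function are intervals.\<close>

lemma measurable_shape_vol [measurable]:
  "A \<in> sets tree_M \<Longrightarrow> (\<lambda>\<theta>. shape_vol S \<theta> A) \<in> borel_measurable borel"
  by (rule measurable_antimono_ennreal) (rule shape_vol_antimono)

definition merge_angles :: "bool list set \<Rightarrow> (real \<times> real) \<times> (bool list \<Rightarrow> real \<times> real) \<times> (bool list \<Rightarrow> real \<times> real)
    \<Rightarrow> bool list \<Rightarrow> real \<times> real" where
  "merge_angles I w = (\<lambda>p\<in>I. case p of [] \<Rightarrow> fst w | c # q \<Rightarrow> if c then snd (snd w) q else fst (snd w) q)"

text \<open>The internal addresses of the joined shape are the root and the prefixed addresses of
  the two parts, so its Lebesgue measure factors accordingly. It suffices to compare boxes.\<close>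

lemma
  assumes S: "shape_ok S" and T: "shape_ok T"
  shows angle_leb_node_shape: "angle_leb (node_shape S T) =
    distr (lborel \<Otimes>\<^sub>M angle_leb S \<Otimes>\<^sub>M angle_leb T) (angle_leb (node_shape S T)) (merge_angles (internal (node_shape S T)))"
    (is "_ = distr ?P ?A ?m")
    and measurable_merge_angles: "merge_angles (internal (node_shape S T)) \<in>
      lborel \<Otimes>\<^sub>M angle_leb S \<Otimes>\<^sub>M angle_leb T \<rightarrow>\<^sub>M angle_leb (node_shape S T)"
proof -
  let ?I = "internal (node_shape S T)"
  have I: "?I = node_shape (internal S) (internal T)" by (rule internal_node_shape[OF assms])
  interpret product_sigma_finite "\<lambda>_. lborel :: (real \<times> real) measure" by standard
  interpret AS: sigma_finite_measure "angle_leb S" by (rule sigma_finite_angle_leb[OF S])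
  interpret AT: sigma_finite_measure "angle_leb T" by (rule sigma_finite_angle_leb[OF T])
  interpret AST: pair_sigma_finite "angle_leb S" "angle_leb T" ..
  show m: "?m \<in> ?P \<rightarrow>\<^sub>M ?A"
    unfolding merge_angles_def angle_leb_def[of "node_shape S T"]
  proof (rule measurable_restrict)
    fix p assume p: "p \<in> ?I"
    show "(\<lambda>w. case p of [] \<Rightarrow> fst w | c # q \<Rightarrow> if c then snd (snd w) q else fst (snd w) q) \<in> ?P \<rightarrow>\<^sub>M lborel"
    proof (cases p)
      case (Cons c q)
      show ?thesis
      proof (cases c)
        case True
        then have "q \<in> internal T" using p I Cons by simp
        moreover have "(\<lambda>w. snd (snd w)) \<in> ?P \<rightarrow>\<^sub>M angle_leb T" by measurable
        ultimately have "(\<lambda>w. snd (snd w) q) \<in> ?P \<rightarrow>\<^sub>M lborel"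
          using measurable_compose[OF _ measurable_angle_component] by blast
        then show ?thesis using Cons True by simp
      next
        case False
        then have "q \<in> internal S" using p I Cons by simp
        moreover have "(\<lambda>w. fst (snd w)) \<in> ?P \<rightarrow>\<^sub>M angle_leb S" by measurable
        ultimately have "(\<lambda>w. fst (snd w) q) \<in> ?P \<rightarrow>\<^sub>M lborel"
          using measurable_compose[OF _ measurable_angle_component] by blast
        then show ?thesis using Cons False by simp
      qed
    qed simp
  qed
  have "distr ?P ?A ?m = PiM ?I (\<lambda>_. lborel)"
  proof (rule PiM_eqI)
    show "finite ?I" using finite_internal shape_ok_node_shape[OF S T] by blast
    show "sets (distr ?P ?A ?m) = sets (PiM ?I (\<lambda>_. lborel))"
      by (simp add: angle_leb_def)
    fix E :: "bool list \<Rightarrow> (real \<times> real) set" assume E: "\<And>i. i \<in> ?I \<Longrightarrow> E i \<in> sets lborel"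
    let ?ES = "\<Pi>\<^sub>E q\<in>internal S. E (False # q)" and ?ET = "\<Pi>\<^sub>E q\<in>internal T. E (True # q)"
    have sE: "E [] \<in> sets lborel" "\<And>q. q \<in> internal S \<Longrightarrow> E (False # q) \<in> sets lborel"
      "\<And>q. q \<in> internal T \<Longrightarrow> E (True # q) \<in> sets lborel"
      using E I by auto
    have sES: "?ES \<in> sets (angle_leb S)" "?ET \<in> sets (angle_leb T)"
      unfolding angle_leb_def using finite_internal[OF S] finite_internal[OF T] sE by (auto intro!: sets_PiM_I_finite)
    have "Pi\<^sub>E ?I E \<in> sets ?A"
      unfolding angle_leb_def using E finite_internal[OF shape_ok_node_shape[OF S T]]
      by (intro sets_PiM_I_finite) auto
    then have "emeasure (distr ?P ?A ?m) (Pi\<^sub>E ?I E) = emeasure ?P (?m -` Pi\<^sub>E ?I E \<inter> space ?P)"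
      by (rule emeasure_distr[OF m])
    also have "?m -` Pi\<^sub>E ?I E \<inter> space ?P = E [] \<times> ?ES \<times> ?ET"
    proof (rule set_eqI)
      fix w :: "(real \<times> real) \<times> (bool list \<Rightarrow> real \<times> real) \<times> (bool list \<Rightarrow> real \<times> real)"
      obtain z x y where w: "w = (z, x, y)" by (metis prod.exhaust)
      have "?m w \<in> Pi\<^sub>E ?I E \<longleftrightarrow> (\<forall>p\<in>?I. (case p of [] \<Rightarrow> z | c # q \<Rightarrow> if c then y q else x q) \<in> E p)"
        unfolding merge_angles_def w fst_conv snd_conv by (simp add: PiE_iff)
      also have "\<dots> \<longleftrightarrow> z \<in> E [] \<and> (\<forall>q\<in>internal S. x q \<in> E (False # q)) \<and> (\<forall>q\<in>internal T. y q \<in> E (True # q))"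
        unfolding I unfolding node_shape_def by (simp add: ball_Un)
      finally show "w \<in> ?m -` Pi\<^sub>E ?I E \<inter> space ?P \<longleftrightarrow> w \<in> E [] \<times> ?ES \<times> ?ET"
        by (auto simp: w space_pair_measure space_angle_leb PiE_iff)
    qed
    also have "emeasure ?P \<dots> = emeasure lborel (E []) * (emeasure (angle_leb S) ?ES * emeasure (angle_leb T) ?ET)"
      using sE(1) sES by (simp add: AST.emeasure_pair_measure_Times AT.emeasure_pair_measure_Times)
    also have "\<dots> = emeasure lborel (E []) * ((\<Prod>q\<in>internal S. emeasure lborel (E (False # q))) * (\<Prod>q\<in>internal T. emeasure lborel (E (True # q))))"
      unfolding angle_leb_def
      by (subst emeasure_PiM, (use sE finite_internal[OF S] finite_internal[OF T] in auto)[2],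
          subst emeasure_PiM) (use sE finite_internal[OF S] finite_internal[OF T] in auto)
    also have "\<dots> = (\<Prod>p\<in>?I. emeasure lborel (E p))"
    proof -
      have "(\<Prod>p\<in>?I. emeasure lborel (E p)) = emeasure lborel (E []) * (\<Prod>p\<in>(#) False ` internal S \<union> (#) True ` internal T. emeasure lborel (E p))"
        unfolding I unfolding node_shape_def using finite_internal[OF S] finite_internal[OF T]
        by (subst prod.insert) auto
      also have "(\<Prod>p\<in>(#) False ` internal S \<union> (#) True ` internal T. emeasure lborel (E p)) =
        (\<Prod>p\<in>(#) False ` internal S. emeasure lborel (E p)) * (\<Prod>p\<in>(#) True ` internal T. emeasure lborel (E p))"
        using finite_internal[OF S] finite_internal[OF T] by (subst prod.union_disjoint) auto
      finally show ?thesis by (simp add: prod.reindex)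
    qed
    finally show "emeasure (distr ?P ?A ?m) (Pi\<^sub>E ?I E) = (\<Prod>p\<in>?I. emeasure lborel (E p))" .
  qed
  then show "?A = distr ?P ?A ?m" by (simp add: angle_leb_def)
qed

lemma tree_of_merge_angles:
  assumes "shape_ok S" "shape_ok T"
  shows "tree_of (node_shape S T) (merge_angles (internal (node_shape S T)) (z, x, y)) =
    graft (pi - fst z, pi - snd z) (tree_of S x) (tree_of T y)"
proof
  fix p
  show "tree_of (node_shape S T) (merge_angles (internal (node_shape S T)) (z, x, y)) p =
    graft (pi - fst z, pi - snd z) (tree_of S x) (tree_of T y) p"
  proof (cases p)
    case Nil
    then show ?thesis by (simp add: tree_of_def internal_node_shape[OF assms] merge_angles_def nd_def)
  next
    case (Cons c q)
    then show ?thesis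
      by (cases c) (simp_all add: tree_of_def internal_node_shape[OF assms] merge_angles_def)
  qed
qed

lemma tree_of_root: "shape_ok S \<Longrightarrow> tree_of S x [] \<noteq> None"
  by (simp add: tree_of_def shape_ok_def)

text \<open>Used with c = d = pi to pass from the corner angles at the root to the variables
  \<alpha>, \<beta>.\<close>

lemma nn_integral_lborel_reflect:
  fixes f :: "real \<times> real \<Rightarrow> ennreal"
  assumes [measurable]: "f \<in> borel_measurable borel"
  shows "(\<integral>\<^sup>+z. f (c - fst z, d - snd z) \<partial>lborel) = (\<integral>\<^sup>+z. f z \<partial>lborel)"
proof -
  have f': "f \<in> borel_measurable (borel \<Otimes>\<^sub>M borel)" by (simp add: borel_prod)
  note [measurable] = f'
  have fst': "(\<integral>\<^sup>+z. g z \<partial>lborel) = (\<integral>\<^sup>+x. \<integral>\<^sup>+y. g (x, y) \<partial>lborel \<partial>lborel)"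
    if "g \<in> borel_measurable (borel \<Otimes>\<^sub>M borel)" for g :: "real \<times> real \<Rightarrow> ennreal"
    unfolding lborel_prod[symmetric]
    by (rule lborel.nn_integral_fst[symmetric]) (use that in \<open>simp add: lborel_prod borel_prod\<close>)
  have "(\<integral>\<^sup>+z. f (c - fst z, d - snd z) \<partial>lborel) = (\<integral>\<^sup>+x. \<integral>\<^sup>+y. f (c - x, d - y) \<partial>lborel \<partial>lborel)"
    by (subst fst') auto
  also have "\<dots> = (\<integral>\<^sup>+x. \<integral>\<^sup>+y. f (c - x, y) \<partial>lborel \<partial>lborel)"
  proof (rule nn_integral_cong)
    fix x
    have "(\<lambda>y. f (c - x, y)) \<in> borel_measurable borel" by measurable
    from nn_integral_real_affine[OF this, of "-1" d]
    show "(\<integral>\<^sup>+y. f (c - x, d - y) \<partial>lborel) = (\<integral>\<^sup>+y. f (c - x, y) \<partial>lborel)" by simp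
  qed
  also have "\<dots> = (\<integral>\<^sup>+x. \<integral>\<^sup>+y. f (x, y) \<partial>lborel \<partial>lborel)"
  proof -
    have "(\<lambda>x. \<integral>\<^sup>+y. f (x, y) \<partial>lborel) \<in> borel_measurable borel" by measurable
    from nn_integral_real_affine[OF this, of "-1" c] show ?thesis by simp
  qed
  also have "\<dots> = (\<integral>\<^sup>+z. f z \<partial>lborel)"
    by (rule fst'[symmetric]) simp
  finally show ?thesis .
qed

text \<open>Fubini over the root angles and the two sets of remaining angles. For fixed root angles
  \<open>good_graft_iff\<close> makes the admissible set a product, and the reflection brings the
  root angles into the triangle.\<close>

lemma shape_vol_node_shape:
  assumes S: "shape_ok S" and T: "shape_ok T" and \<theta>: "0 \<le> \<theta>"
    and [measurable]: "A0 \<in> sets node_M" "A \<in> sets tree_M" "B \<in> sets tree_M"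
  shows "shape_vol (node_shape S T) \<theta> (rect A0 A B) =
    (\<integral>\<^sup>+z. indicator (tri \<theta>) z * indicator A0 (nd z) * (shape_vol S (fst z) A * shape_vol T (snd z) B) \<partial>lborel)"
proof -
  let ?U = "node_shape S T"
  let ?m = "merge_angles (internal ?U)" and ?P = "lborel \<Otimes>\<^sub>M angle_leb S \<Otimes>\<^sub>M angle_leb T"
  let ?G = "\<lambda>S \<theta> A. {x \<in> space (angle_leb S). tree_of S x \<in> A \<and> good \<theta> (tree_of S x)}"
  let ?f = "\<lambda>z. indicator (tri \<theta>) z * indicator A0 (nd z) * (shape_vol S (fst z) A * shape_vol T (snd z) B)"
  interpret AS: sigma_finite_measure "angle_leb S" by (rule sigma_finite_angle_leb[OF S])
  interpret AT: sigma_finite_measure "angle_leb T" by (rule sigma_finite_angle_leb[OF T])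
  interpret AST: pair_sigma_finite "angle_leb S" "angle_leb T" ..
  have [measurable]: "?m \<in> ?P \<rightarrow>\<^sub>M angle_leb ?U" by (rule measurable_merge_angles[OF S T])
  have [measurable]: "rect A0 A B \<in> sets tree_M" by (rule sets_rect) measurable
  have GU: "?G ?U \<theta> (rect A0 A B) \<in> sets (angle_leb ?U)" by measurable
  have GS: "?G S a A \<in> sets (angle_leb S)" "?G T a B \<in> sets (angle_leb T)" for a by measurable
  have "shape_vol ?U \<theta> (rect A0 A B) = emeasure (distr ?P (angle_leb ?U) ?m) (?G ?U \<theta> (rect A0 A B))"
    unfolding shape_vol_def by (subst angle_leb_node_shape[OF S T, symmetric]) simp
  also have "\<dots> = emeasure ?P (?m -` ?G ?U \<theta> (rect A0 A B) \<inter> space ?P)"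
    by (rule emeasure_distr) (use GU in auto)
  also have "\<dots> = (\<integral>\<^sup>+z. emeasure (angle_leb S \<Otimes>\<^sub>M angle_leb T) (Pair z -` (?m -` ?G ?U \<theta> (rect A0 A B) \<inter> space ?P)) \<partial>lborel)"
    by (rule AST.emeasure_pair_measure_alt, rule measurable_sets[OF _ GU]) measurable
  also have "\<dots> = (\<integral>\<^sup>+z. ?f (pi - fst z, pi - snd z) \<partial>lborel)"
  proof (rule nn_integral_cong)
    fix z :: "real \<times> real"
    let ?z = "(pi - fst z, pi - snd z)"
    have iff: "(x, y) \<in> Pair z -` (?m -` ?G ?U \<theta> (rect A0 A B) \<inter> space ?P) \<longleftrightarrow>
       ?z \<in> tri \<theta> \<and> nd ?z \<in> A0 \<and> (x, y) \<in> ?G S (fst ?z) A \<times> ?G T (snd ?z) B" for x y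
    proof -
      have sp: "?m (z, x, y) \<in> space (angle_leb ?U)" if "x \<in> space (angle_leb S)" "y \<in> space (angle_leb T)"
        using that measurable_space[OF measurable_merge_angles[OF S T]] by (simp add: space_pair_measure)
      show ?thesis
        using sp good_graft_iff[of "tree_of S x" "tree_of T y" \<theta> ?z, OF tree_of_root[OF S] tree_of_root[OF T]] \<theta>
        by (auto simp: tree_of_merge_angles[OF S T] rect_def space_pair_measure tri_def)
    qed
    show "emeasure (angle_leb S \<Otimes>\<^sub>M angle_leb T) (Pair z -` (?m -` ?G ?U \<theta> (rect A0 A B) \<inter> space ?P)) = ?f ?z"
    proof (cases "?z \<in> tri \<theta> \<and> nd ?z \<in> A0")
      case True
      then have "Pair z -` (?m -` ?G ?U \<theta> (rect A0 A B) \<inter> space ?P) = ?G S (fst ?z) A \<times> ?G T (snd ?z) B"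
        using iff by auto
      then show ?thesis
        using True GS by (simp add: AT.emeasure_pair_measure_Times shape_vol_def)
    next
      case False
      then have "Pair z -` (?m -` ?G ?U \<theta> (rect A0 A B) \<inter> space ?P) = {}"
        using iff by auto
      then show ?thesis using False by auto
    qed
  qed
  also have "\<dots> = (\<integral>\<^sup>+z. ?f z \<partial>lborel)"
    by (rule nn_integral_lborel_reflect) measurable
  finally show ?thesis .
qed

text \<open>There are no angles to integrate: the empty product measure is a unit mass at the single
  function \<open>\<lambda>_. undefined\<close>. The corner of the leaf is pi, which exceeds
  \<theta>.\<close>

lemma shape_vol_leaf:
  assumes "\<theta> < pi"
  shows "shape_vol {[]} \<theta> A = indicator A leaf_tree"
proof -
  have t: "tree_of {[]} x = leaf_tree" for x
    by (auto simp: tree_of_def leaf_tree_def fun_eq_iff)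
  have "good \<theta> leaf_tree"
    using assms by (simp add: good_def allowed_def valid_angles_def corner_opp_parent_def leaf_tree_def)
  then have "{x \<in> space (angle_leb {[]}). tree_of {[]} x \<in> A \<and> good \<theta> (tree_of {[]} x)} = (if leaf_tree \<in> A then {\<lambda>_. undefined} else {})"
    by (auto simp: t space_angle_leb)
  moreover have "emeasure (angle_leb {[]}) {\<lambda>_. undefined} = 1"
    by (simp add: angle_leb_def)
  ultimately show ?thesis by (simp add: shape_vol_def)
qed

section \<open>The law of the finite tree\<close>

lemma suminf_ennreal_Suc: "(\<Sum>n. f n) = f 0 + (\<Sum>n. f (Suc n) :: ennreal)"
proof -
  have "(\<lambda>n. f (Suc n)) sums (\<Sum>n. f (Suc n))" by (rule summable_sums) simp
  from sums_Suc[OF this] show ?thesis by (simp add: sums_iff add.commute)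
qed

lemma suminf_ennreal_swap: "(\<Sum>i. \<Sum>j. f i j :: ennreal) = (\<Sum>j. \<Sum>i. f i j)"
proof -
  have "(\<Sum>j. \<Sum>i. f i j) = (\<integral>\<^sup>+j. (\<Sum>i. f i j) \<partial>count_space UNIV)"
    by (rule nn_integral_count_space_nat[symmetric])
  also have "\<dots> = (\<Sum>i. \<integral>\<^sup>+j. f i j \<partial>count_space UNIV)"
    by (rule nn_integral_suminf) simp
  finally show ?thesis by (simp add: nn_integral_count_space_nat)
qed

lemma suminf_ennreal_convolution:
  fixes a b :: "nat \<Rightarrow> ennreal"
  shows "(\<Sum>n. \<Sum>i\<le>n. a i * b (n - i)) = (\<Sum>i. a i) * (\<Sum>j. b j)"
proof -
  have shift: "(\<Sum>n. if i \<le> n then g (n - i) else 0) = (\<Sum>n. g n)" for i and g :: "nat \<Rightarrow> ennreal"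
  proof (induction i)
    case (Suc i)
    have "(\<lambda>n. if Suc i \<le> Suc n then g (Suc n - Suc i) else 0) = (\<lambda>n. if i \<le> n then g (n - i) else 0)"
      by auto
    with Suc show ?case
      by (subst suminf_ennreal_Suc) simp
  qed simp
  have "(\<Sum>n. \<Sum>i\<le>n. a i * b (n - i)) = (\<Sum>n. \<Sum>i. if i \<le> n then a i * b (n - i) else 0)"
  proof (rule suminf_cong)
    fix n
    have "(\<Sum>i. if i \<le> n then a i * b (n - i) else 0) = (\<Sum>i\<le>n. if i \<le> n then a i * b (n - i) else 0)"
      by (rule suminf_finite) auto
    then show "(\<Sum>i\<le>n. a i * b (n - i)) = (\<Sum>i. if i \<le> n then a i * b (n - i) else 0)" by simp
  qed
  also have "\<dots> = (\<Sum>i. \<Sum>n. if i \<le> n then a i * b (n - i) else 0)"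
    by (rule suminf_ennreal_swap)
  also have "\<dots> = (\<Sum>i. a i * (\<Sum>j. b j))"
  proof (rule suminf_cong)
    fix i
    show "(\<Sum>n. if i \<le> n then a i * b (n - i) else 0) = a i * (\<Sum>j. b j)"
      using shift[of i "\<lambda>n. a i * b n"] by simp
  qed
  finally show ?thesis by simp
qed

lemma infsum_ennreal_partition:
  fixes f :: "'a \<Rightarrow> ennreal"
  assumes fin: "\<And>n. finite (B n)" and disj: "disjoint_family B"
  shows "infsum f (\<Union>n. B n) = (\<Sum>n. sum f (B n))"
proof -
  have part: "sum f (\<Union>n<N. B n) = (\<Sum>n<N. sum f (B n))" for N :: nat
    using fin disj by (intro sum.UNION_disjoint) (auto simp: disjoint_family_on_def)
  have inf: "infsum f (\<Union>n. B n) = (SUP F\<in>{F. finite F \<and> F \<subseteq> (\<Union>n. B n)}. sum f F)"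
    by (rule nonneg_infsum_complete) simp
  show ?thesis
  proof (rule antisym)
    show "infsum f (\<Union>n. B n) \<le> (\<Sum>n. sum f (B n))"
      unfolding inf
    proof (rule SUP_least)
      fix F assume "F \<in> {F. finite F \<and> F \<subseteq> (\<Union>n. B n)}"
      then have F: "finite F" "\<forall>x\<in>F. \<exists>n. x \<in> B n" by auto
      then obtain k where k: "\<And>x. x \<in> F \<Longrightarrow> x \<in> B (k x)" by metis
      define N where "N = Suc (Max (k ` F))"
      have "F \<subseteq> (\<Union>n<N. B n)"
      proof
        fix x assume "x \<in> F"
        then have "k x \<le> Max (k ` F)" using F by (intro Max_ge) auto
        then have "k x < N" by (simp add: N_def)
        then show "x \<in> (\<Union>n<N. B n)" using k[OF \<open>x \<in> F\<close>] by auto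
      qed
      then have "sum f F \<le> sum f (\<Union>n<N. B n)"
        using fin by (intro sum_mono2) auto
      also have "\<dots> \<le> (\<Sum>n. sum f (B n))"
        unfolding part by (rule sum_le_suminf) auto
      finally show "sum f F \<le> (\<Sum>n. sum f (B n))" .
    qed
    show "(\<Sum>n. sum f (B n)) \<le> infsum f (\<Union>n. B n)"
      unfolding suminf_eq_SUP part[symmetric] inf
      by (rule SUP_least, rule SUP_upper) (use fin in auto)
  qed
qed

definition size_vol :: "nat \<Rightarrow> real \<Rightarrow> atree set \<Rightarrow> ennreal" where
  "size_vol n \<theta> A = (\<Sum>S\<in>shapes n. shape_vol S \<theta> A)"

lemma measurable_size_vol [measurable]:
  "A \<in> sets tree_M \<Longrightarrow> (\<lambda>\<theta>. size_vol n \<theta> A) \<in> borel_measurable borel"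
  unfolding size_vol_def by measurable

lemma size_vol_0: "\<theta> < pi \<Longrightarrow> size_vol 0 \<theta> A = indicator A leaf_tree"
  by (simp add: size_vol_def shapes_0 shape_vol_leaf)

lemma size_vol_Suc:
  assumes \<theta>: "0 \<le> \<theta>"
    and [measurable]: "A0 \<in> sets node_M" "A \<in> sets tree_M" "B \<in> sets tree_M"
  shows "size_vol (Suc n) \<theta> (rect A0 A B) =
    (\<integral>\<^sup>+z. indicator (tri \<theta>) z * indicator A0 (nd z) * (\<Sum>i\<le>n. size_vol i (fst z) A * size_vol (n - i) (snd z) B) \<partial>lborel)"
proof -
  let ?f = "\<lambda>z. indicator (tri \<theta>) z * indicator A0 (nd z) :: ennreal"
  have "size_vol (Suc n) \<theta> (rect A0 A B) = (\<Sum>i\<le>n. \<Sum>S\<in>shapes i. \<Sum>T\<in>shapes (n - i).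
      \<integral>\<^sup>+z. ?f z * (shape_vol S (fst z) A * shape_vol T (snd z) B) \<partial>lborel)"
    unfolding size_vol_def sum_shapes_Suc
    by (intro sum.cong refl shape_vol_node_shape \<theta>) (auto simp: shapes_def)
  also have "\<dots> = (\<integral>\<^sup>+z. (\<Sum>i\<le>n. \<Sum>S\<in>shapes i. \<Sum>T\<in>shapes (n - i).
      ?f z * (shape_vol S (fst z) A * shape_vol T (snd z) B)) \<partial>lborel)"
  proof -
    have [measurable]: "(\<lambda>z. ?f z * (shape_vol S (fst z) A * shape_vol T (snd z) B)) \<in> borel_measurable lborel" for S T
      by measurable
    show ?thesis by (subst nn_integral_sum, simp)+ simp
  qed
  also have "\<dots> = (\<integral>\<^sup>+z. ?f z * (\<Sum>i\<le>n. size_vol i (fst z) A * size_vol (n - i) (snd z) B) \<partial>lborel)"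
    unfolding size_vol_def unfolding sum_product unfolding sum_distrib_left ..
  finally show ?thesis .
qed

lemma rect_UNIV [simp]: "rect UNIV UNIV UNIV = UNIV"
  by (simp add: rect_def)

text \<open>Here the coefficients \<open>vol\<close> acquire their geometric meaning: cutting at the
  root gives the actual volumes the recursion and the initial value that \<open>vol\<close> has by
  construction.\<close>

lemma size_vol_UNIV:
  assumes "0 \<le> \<theta>" "\<theta> < pi"
  shows "size_vol n \<theta> UNIV = ennreal (vol (Suc n) \<theta>)"
  using assms
proof (induction n arbitrary: \<theta> rule: less_induct)
  case (less n)
  show ?case
  proof (cases n)
    case 0
    then show ?thesis using less.prems vol_1[of \<theta>] by (simp add: size_vol_0)
  next
    case (Suc k)
    have "size_vol n \<theta> UNIV = (\<integral>\<^sup>+z. indicator (tri \<theta>) z * (\<Sum>i\<le>k. size_vol i (fst z) UNIV * size_vol (k - i) (snd z) UNIV) \<partial>lborel)"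
      using size_vol_Suc[of \<theta> UNIV UNIV UNIV k] less.prems Suc sets.top[of node_M] sets.top[of tree_M] by simp
    also have "\<dots> = (\<integral>\<^sup>+z. indicator (tri \<theta>) z * (\<Sum>i\<le>Suc (Suc k). ennreal (vol i (fst z)) * ennreal (vol (Suc (Suc k) - i) (snd z))) \<partial>lborel)"
    proof (rule nn_integral_cong)
      fix z
      show "indicator (tri \<theta>) z * (\<Sum>i\<le>k. size_vol i (fst z) UNIV * size_vol (k - i) (snd z) UNIV)
        = indicator (tri \<theta>) z * (\<Sum>i\<le>Suc (Suc k). ennreal (vol i (fst z)) * ennreal (vol (Suc (Suc k) - i) (snd z)))"
      proof (cases "z \<in> tri \<theta>")
        case True
        note b = tri_bounds[OF True]
        have "(\<Sum>i\<le>k. size_vol i (fst z) UNIV * size_vol (k - i) (snd z) UNIV) =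
          (\<Sum>i\<le>k. ennreal (vol (Suc i) (fst z)) * ennreal (vol (Suc (Suc k) - Suc i) (snd z)))"
          using b Suc by (intro sum.cong refl arg_cong2[of _ _ _ _ "(*)"]) (auto simp: less.IH Suc_diff_le)
        \<comment> \<open>The two added end terms contain \<open>vol 0\<close> and vanish.\<close>
        also have "\<dots> = (\<Sum>i\<le>Suc (Suc k). ennreal (vol i (fst z)) * ennreal (vol (Suc (Suc k) - i) (snd z)))"
          by (subst sum.atMost_Suc_shift, subst sum.atMost_Suc) simp
        finally show ?thesis by simp
      qed simp
    qed
    also have "\<dots> = ennreal (vol (Suc n) \<theta>)"
      using nn_integral_vol_recursion[of \<theta> "Suc (Suc k)"] less.prems Suc by simp
    finally show ?thesis .
  qed
qed

lemma size_vol_countably_additive: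
  assumes A: "range A \<subseteq> sets tree_M" "disjoint_family A"
  shows "(\<Sum>i. size_vol n \<theta> (A i)) = size_vol n \<theta> (\<Union>i. A i)"
proof -
  have "(\<Sum>i. shape_vol S \<theta> (A i)) = shape_vol S \<theta> (\<Union>i. A i)" for S
  proof -
    let ?G = "\<lambda>A. {x \<in> space (angle_leb S). tree_of S x \<in> A \<and> good \<theta> (tree_of S x)}"
    have "?G (A i) \<in> sets (angle_leb S)" for i
    proof -
      have [measurable]: "A i \<in> sets tree_M" using A by auto
      show ?thesis by measurable
    qed
    then have "(\<Sum>i. emeasure (angle_leb S) (?G (A i))) = emeasure (angle_leb S) (\<Union>i. ?G (A i))"
      using A by (intro suminf_emeasure) (auto simp: disjoint_family_on_def)
    moreover have "(\<Union>i. ?G (A i)) = ?G (\<Union>i. A i)" by auto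
    ultimately show ?thesis by (simp add: shape_vol_def)
  qed
  then have "size_vol n \<theta> (\<Union>i. A i) = (\<Sum>S\<in>shapes n. \<Sum>i. shape_vol S \<theta> (A i))"
    by (simp add: size_vol_def)
  also have "\<dots> = (\<Sum>i. size_vol n \<theta> (A i))"
    unfolding size_vol_def by (rule suminf_sum[symmetric]) simp
  finally show ?thesis ..
qed

lemma sets_Pfin [simp, measurable_cong]: "sets (Pfin \<theta>) = sets tree_M"
  using sets.sigma_sets_eq[of tree_M] by (simp add: Pfin_def)

lemma space_Pfin [simp]: "space (Pfin \<theta>) = UNIV"
  using sets_eq_imp_space_eq[OF sets_Pfin] by simp

text \<open>\<open>Pfin\<close> is introduced through \<open>measure_of\<close>, which yields the
  intended set function only once that function is known to be countably additive. Grouping the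
  shapes by size turns the sum over all shapes into a series.\<close>

lemma emeasure_Pfin:
  assumes A: "A \<in> sets tree_M"
  shows "emeasure (Pfin \<theta>) A = (\<Sum>n. ennreal (xc ^ Suc n / F \<theta>) * size_vol n \<theta> A)"
proof -
  define \<mu> where "\<mu> A = (\<Sum>n. ennreal (xc ^ Suc n / F \<theta>) * size_vol n \<theta> A)" for A
  have U: "{S. shape_ok S} = (\<Union>n. shapes n)" by (auto simp: shapes_def)
  have disj: "disjoint_family shapes" by (auto simp: disjoint_family_on_def shapes_def)
  have "(\<Sum>\<^sub>\<infinity>S\<in>{S. shape_ok S}. ennreal (xc ^ (card (internal S) + 1) / F \<theta>) *
        emeasure (angle_leb S) {x \<in> space (angle_leb S).
           tree_of S x \<in> A \<and> allowed (tree_of S x) \<and> \<theta> < corner_opp_parent (tree_of S x) []}) = \<mu> A" for A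
  proof -
    have "(\<Sum>\<^sub>\<infinity>S\<in>{S. shape_ok S}. ennreal (xc ^ (card (internal S) + 1) / F \<theta>) * shape_vol S \<theta> A)
      = (\<Sum>n. \<Sum>S\<in>shapes n. ennreal (xc ^ (card (internal S) + 1) / F \<theta>) * shape_vol S \<theta> A)"
      unfolding U by (rule infsum_ennreal_partition[OF finite_shapes disj])
    also have "\<dots> = \<mu> A"
      unfolding \<mu>_def size_vol_def sum_distrib_left
      by (intro suminf_cong sum.cong) (auto simp: shapes_def)
    finally show ?thesis by (simp add: shape_vol_def good_def)
  qed
  then have "Pfin \<theta> = measure_of (space tree_M) (sets tree_M) \<mu>"
    by (simp add: Pfin_def)
  moreover have "emeasure (measure_of (space tree_M) (sets tree_M) \<mu>) A = \<mu> A"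
  proof (rule emeasure_measure_of_sigma)
    show "positive (sets tree_M) \<mu>"
      by (simp add: positive_def \<mu>_def size_vol_def shape_vol_def)
    show "countably_additive (sets tree_M) \<mu>"
    proof (rule countably_additiveI)
      fix A :: "nat \<Rightarrow> atree set" assume A: "range A \<subseteq> sets tree_M" "disjoint_family A"
      have "(\<Sum>i. \<mu> (A i)) = (\<Sum>n. \<Sum>i. ennreal (xc ^ Suc n / F \<theta>) * size_vol n \<theta> (A i))"
        unfolding \<mu>_def by (rule suminf_ennreal_swap)
      then show "(\<Sum>i. \<mu> (A i)) = \<mu> (\<Union>i. A i)"
        by (simp add: \<mu>_def size_vol_countably_additive[OF A])
    qed
  qed (rule sets.sigma_algebra_axioms, rule A)
  ultimately show ?thesis by (simp add: \<mu>_def)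
qed

lemma prob_space_Pfin:
  assumes "0 \<le> \<theta>" "\<theta> < pi"
  shows "prob_space (Pfin \<theta>)"
proof (rule prob_spaceI)
  have F: "0 < F \<theta>" using assms by (intro F_pos) auto
  have nn: "0 \<le> vol (Suc n) \<theta>" for n using assms by (intro vol_nonneg) auto
  have "emeasure (Pfin \<theta>) (space (Pfin \<theta>)) = (\<Sum>n. ennreal (xc ^ Suc n / F \<theta>) * ennreal (vol (Suc n) \<theta>))"
    using sets.top[of tree_M] by (simp add: emeasure_Pfin size_vol_UNIV[OF assms])
  also have "\<dots> = (\<Sum>n. ennreal (wvol (Suc n) \<theta> / F \<theta>))"
    using F nn xc_pos by (intro suminf_cong) (simp add: wvol_def ennreal_mult[symmetric] mult_ac)
  also have "\<dots> = ennreal 1"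
  proof (rule suminf_ennreal_eq)
    show "0 \<le> wvol (Suc n) \<theta> / F \<theta>" for n
      using F assms by (simp add: wvol_nonneg)
    have "(\<lambda>n. wvol (Suc n) \<theta>) sums F \<theta>"
      using wvol_sums_F[of \<theta>] by (subst sums_Suc_iff) (simp add: wvol_def)
    from sums_divide[OF this, of "F \<theta>"] show "(\<lambda>n. wvol (Suc n) \<theta> / F \<theta>) sums 1"
      using F by simp
  qed
  finally show "emeasure (Pfin \<theta>) (space (Pfin \<theta>)) = 1" by simp
qed

text \<open>Summing the root recursion over sizes: xc^(n+2) splits as xc^(i+1) xc^(n-i+1), so the
  convolution factors into the two unnormalised laws. The normalising constants collect into F F /
  F.\<close>

lemma emeasure_Pfin_rect:
  assumes \<theta>: "0 \<le> \<theta>" "\<theta> < pi"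
    and [measurable]: "A0 \<in> sets node_M" "A \<in> sets tree_M" "B \<in> sets tree_M"
  shows "emeasure (Pfin \<theta>) (rect A0 A B) = ennreal (xc / F \<theta>) * indicator (rect A0 A B) leaf_tree +
    (\<integral>\<^sup>+z. indicator (tri \<theta>) z * ennreal (F (fst z) * F (snd z) / F \<theta>) * (indicator A0 (nd z) *
       (emeasure (Pfin (fst z)) A * emeasure (Pfin (snd z)) B)) \<partial>lborel)"
proof -
  let ?a = "\<lambda>n. ennreal (xc ^ Suc n)"
  have F\<theta>: "0 < F \<theta>" using \<theta> by (intro F_pos) auto
  have rm: "rect A0 A B \<in> sets tree_M" by (rule sets_rect) measurable
  have "emeasure (Pfin \<theta>) (rect A0 A B) = ennreal (xc / F \<theta>) * indicator (rect A0 A B) leaf_tree +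
    (\<Sum>n. ennreal (xc ^ Suc (Suc n) / F \<theta>) * size_vol (Suc n) \<theta> (rect A0 A B))"
    unfolding emeasure_Pfin[OF rm] by (subst suminf_ennreal_Suc) (simp add: size_vol_0 \<theta>)
  also have "(\<Sum>n. ennreal (xc ^ Suc (Suc n) / F \<theta>) * size_vol (Suc n) \<theta> (rect A0 A B)) =
    (\<Sum>n. \<integral>\<^sup>+z. ennreal (xc ^ Suc (Suc n) / F \<theta>) * (indicator (tri \<theta>) z * indicator A0 (nd z) * (\<Sum>i\<le>n. size_vol i (fst z) A * size_vol (n - i) (snd z) B)) \<partial>lborel)"
    by (intro suminf_cong, subst size_vol_Suc[OF \<theta>(1)]) (auto intro!: nn_integral_cmult[symmetric])
  also have "\<dots> = (\<integral>\<^sup>+z. (\<Sum>n. ennreal (xc ^ Suc (Suc n) / F \<theta>) * (indicator (tri \<theta>) z * indicator A0 (nd z) * (\<Sum>i\<le>n. size_vol i (fst z) A * size_vol (n - i) (snd z) B))) \<partial>lborel)"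
    by (rule nn_integral_suminf[symmetric]) measurable
  also have "\<dots> = (\<integral>\<^sup>+z. indicator (tri \<theta>) z * ennreal (F (fst z) * F (snd z) / F \<theta>) * (indicator A0 (nd z) *
       (emeasure (Pfin (fst z)) A * emeasure (Pfin (snd z)) B)) \<partial>lborel)"
  proof (rule nn_integral_cong)
    fix z :: "real \<times> real"
    let ?i = "indicator (tri \<theta>) z * indicator A0 (nd z) :: ennreal"
    show "(\<Sum>n. ennreal (xc ^ Suc (Suc n) / F \<theta>) * (?i * (\<Sum>i\<le>n. size_vol i (fst z) A * size_vol (n - i) (snd z) B))) =
      indicator (tri \<theta>) z * ennreal (F (fst z) * F (snd z) / F \<theta>) * (indicator A0 (nd z) *
       (emeasure (Pfin (fst z)) A * emeasure (Pfin (snd z)) B))"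
    proof (cases "z \<in> tri \<theta>")
      case True
      note b = tri_bounds[OF True]
      have Fz: "0 < F (fst z)" "0 < F (snd z)" using b by (auto intro!: F_pos)
      have eP: "ennreal (F \<eta>) * emeasure (Pfin \<eta>) C = (\<Sum>n. ?a n * size_vol n \<eta> C)"
        if "0 < F \<eta>" "C \<in> sets tree_M" for \<eta> C
      proof -
        have "ennreal (F \<eta>) * (ennreal (xc ^ Suc n / F \<eta>) * size_vol n \<eta> C) = ?a n * size_vol n \<eta> C" for n
          using that xc_pos by (simp add: mult.assoc[symmetric] ennreal_mult[symmetric] del: power_Suc)
        then show ?thesis
          unfolding emeasure_Pfin[OF that(2)] by (simp add: ennreal_suminf_cmult[symmetric] del: ennreal_suminf_cmult power_Suc)
      qed
      have "ennreal (xc ^ Suc (Suc n) / F \<theta>) * (?i * (\<Sum>i\<le>n. size_vol i (fst z) A * size_vol (n - i) (snd z) B))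
         = (ennreal (1 / F \<theta>) * ?i) * (\<Sum>i\<le>n. (?a i * size_vol i (fst z) A) * (?a (n - i) * size_vol (n - i) (snd z) B))" for n
      proof -
        have e1: "ennreal (xc ^ Suc (Suc n) / F \<theta>) = ennreal (1 / F \<theta>) * ennreal (xc ^ Suc (Suc n))"
          using F\<theta> xc_pos by (simp add: ennreal_mult[symmetric] del: power_Suc)
        have e2: "ennreal (xc ^ Suc (Suc n)) * (\<Sum>i\<le>n. size_vol i (fst z) A * size_vol (n - i) (snd z) B) =
          (\<Sum>i\<le>n. (?a i * size_vol i (fst z) A) * (?a (n - i) * size_vol (n - i) (snd z) B))"
          unfolding sum_distrib_left
        proof (rule sum.cong[OF refl])
          fix i assume "i \<in> {..n}"
          then have "xc ^ Suc (Suc n) = xc ^ Suc i * xc ^ Suc (n - i)"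
            by (simp flip: power_add power_Suc)
          then have "ennreal (xc ^ Suc (Suc n)) = ?a i * ?a (n - i)"
            using xc_pos by (simp add: ennreal_mult[symmetric] del: power_Suc)
          then show "ennreal (xc ^ Suc (Suc n)) * (size_vol i (fst z) A * size_vol (n - i) (snd z) B) =
            (?a i * size_vol i (fst z) A) * (?a (n - i) * size_vol (n - i) (snd z) B)"
            by (simp only: mult_ac)
        qed
        show ?thesis unfolding e1 e2[symmetric] by (simp only: mult_ac)
      qed
      then have "(\<Sum>n. ennreal (xc ^ Suc (Suc n) / F \<theta>) * (?i * (\<Sum>i\<le>n. size_vol i (fst z) A * size_vol (n - i) (snd z) B)))
        = (ennreal (1 / F \<theta>) * ?i) * ((\<Sum>n. ?a n * size_vol n (fst z) A) * (\<Sum>n. ?a n * size_vol n (snd z) B))"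
        using suminf_ennreal_convolution[of "\<lambda>n. ?a n * size_vol n (fst z) A" "\<lambda>n. ?a n * size_vol n (snd z) B"]
        by (simp del: power_Suc)
      also have "\<dots> = (ennreal (1 / F \<theta>) * ?i) * ((ennreal (F (fst z)) * emeasure (Pfin (fst z)) A) * (ennreal (F (snd z)) * emeasure (Pfin (snd z)) B))"
        by (simp add: eP Fz)
      also have "\<dots> = (ennreal (1 / F \<theta>) * (ennreal (F (fst z)) * ennreal (F (snd z)))) * (?i * (emeasure (Pfin (fst z)) A * emeasure (Pfin (snd z)) B))"
        by (simp only: mult_ac)
      also have "ennreal (1 / F \<theta>) * (ennreal (F (fst z)) * ennreal (F (snd z))) = ennreal (F (fst z) * F (snd z) / F \<theta>)"
        using Fz F\<theta> by (simp add: ennreal_mult[symmetric])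
      finally show ?thesis by (simp only: mult_ac)
    qed simp
  qed
  finally show ?thesis .
qed

section \<open>Decomposition at the root\<close>

text \<open>\<open>Pfin\<close> is a probability measure only for \<open>\<theta> \<in> [0, pi)\<close>; clamping extends it to a Markov kernel on
  the reals.\<close>
definition clamp_angle :: "real \<Rightarrow> real" where
  "clamp_angle \<theta> = (if 0 \<le> \<theta> \<and> \<theta> < pi then \<theta> else 0)"

definition fin_law :: "real \<Rightarrow> atree measure" where
  "fin_law \<theta> = Pfin (clamp_angle \<theta>)"

lemma measurable_clamp_angle [measurable]: "clamp_angle \<in> borel \<rightarrow>\<^sub>M borel"
  unfolding clamp_angle_def[abs_def] by measurable

lemma clamp_angle_bounds: "0 \<le> clamp_angle \<theta>" "clamp_angle \<theta> < pi"
  by (auto simp: clamp_angle_def)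

lemma clamp_angle_eq [simp]: "0 \<le> \<theta> \<Longrightarrow> \<theta> < pi \<Longrightarrow> clamp_angle \<theta> = \<theta>"
  by (simp add: clamp_angle_def)

lemma fin_law_eq: "0 \<le> \<theta> \<Longrightarrow> \<theta> < pi \<Longrightarrow> fin_law \<theta> = Pfin \<theta>"
  by (simp add: fin_law_def)

lemma prob_space_fin_law: "prob_space (fin_law \<theta>)"
  unfolding fin_law_def by (rule prob_space_Pfin[OF clamp_angle_bounds])

lemma sets_fin_law [simp, measurable_cong]: "sets (fin_law \<theta>) = sets tree_M"
  by (simp add: fin_law_def)

lemma space_fin_law [simp]: "space (fin_law \<theta>) = UNIV"
  by (simp add: fin_law_def)

lemma measurable_fin_law [measurable]: "fin_law \<in> borel \<rightarrow>\<^sub>M subprob_algebra tree_M"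
proof (rule measurable_subprob_algebra)
  fix A assume [measurable]: "A \<in> sets tree_M"
  have [measurable]: "(\<lambda>\<theta>. size_vol n (clamp_angle \<theta>) A) \<in> borel_measurable borel" for n
    by (rule measurable_compose[OF measurable_clamp_angle measurable_size_vol]) simp
  show "(\<lambda>\<theta>. emeasure (fin_law \<theta>) A) \<in> borel_measurable borel"
    unfolding fin_law_def emeasure_Pfin[OF \<open>A \<in> sets tree_M\<close>] by measurable
qed (auto intro: prob_space_imp_subprob_space prob_space_fin_law)

lemma rect_graft: "graft z l r \<in> rect A0 A B \<longleftrightarrow> nd z \<in> A0 \<and> l \<in> A \<and> r \<in> B"
  by (simp add: rect_def)

lemma graft_root_not_leaf [simp]: "nd z \<noteq> Some None" "nd z \<noteq> None"
  by (simp_all add: nd_def)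

text \<open>Extends a root identity from rectangles to all integrands. The right side is realised as
  a measure, a leaf atom plus a mixture over z of images of product measures under
  \<open>graft\<close>; the bound on the integral of \<open>d\<close> makes the mixing measure a
  subprobability, as needed for the bind.\<close>

lemma nn_integral_graft_decomposition:
  assumes M: "finite_measure M" "sets M = sets tree_M"
    and K1 [measurable]: "K1 \<in> borel \<rightarrow>\<^sub>M subprob_algebra tree_M"
    and K2 [measurable]: "K2 \<in> borel \<rightarrow>\<^sub>M subprob_algebra tree_M"
    and d [measurable]: "d \<in> borel_measurable (borel :: (real \<times> real) measure)"
    and d1: "(\<integral>\<^sup>+z. d z \<partial>lborel) \<le> 1"
    and rect: "\<And>A0 A B. A0 \<in> sets node_M \<Longrightarrow> A \<in> sets tree_M \<Longrightarrow> B \<in> sets tree_M \<Longrightarrow>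
      emeasure M (rect A0 A B) = c * indicator (rect A0 A B) leaf_tree +
      (\<integral>\<^sup>+z. d z * (indicator A0 (nd z) * (emeasure (K1 (fst z)) A * emeasure (K2 (snd z)) B)) \<partial>lborel)"
    and h [measurable]: "h \<in> borel_measurable tree_M"
  shows "(\<integral>\<^sup>+t. h t \<partial>M) = c * h leaf_tree +
    (\<integral>\<^sup>+z. d z * (\<integral>\<^sup>+l. \<integral>\<^sup>+r. h (graft z l r) \<partial>K2 (snd z) \<partial>K1 (fst z)) \<partial>lborel)"
proof -
  note [measurable_cong] = M(2)
  have sK: "sets (K1 a) = sets tree_M" "sets (K2 a) = sets tree_M" for a
    using sets_kernel[OF K1] sets_kernel[OF K2] by auto
  note [measurable_cong] = sK
  have spK: "space (K1 a) = UNIV" "space (K2 a) = UNIV" for a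
    using sets_eq_imp_space_eq[OF sK(1)[of a]] sets_eq_imp_space_eq[OF sK(2)[of a]] by auto
  have sfK: "sigma_finite_measure (K2 a)" for a
    using subprob_space_kernel[OF K2, of a] by (simp add: subprob_space_imp_sigma_finite)
  define \<kappa> where "\<kappa> z = distr (K1 (fst z) \<Otimes>\<^sub>M K2 (snd z)) tree_M (\<lambda>w. graft z (fst w) (snd w))" for z
  have k [measurable]: "\<kappa> \<in> borel \<rightarrow>\<^sub>M subprob_algebra tree_M"
    unfolding \<kappa>_def
  proof (rule measurable_distr2[where M = "tree_M \<Otimes>\<^sub>M tree_M"])
    show "(\<lambda>(z, w). graft z (fst w) (snd w)) \<in> borel \<Otimes>\<^sub>M (tree_M \<Otimes>\<^sub>M tree_M) \<rightarrow>\<^sub>M tree_M"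
      by measurable
    show "(\<lambda>z. K1 (fst z) \<Otimes>\<^sub>M K2 (snd z)) \<in> borel \<rightarrow>\<^sub>M subprob_algebra (tree_M \<Otimes>\<^sub>M tree_M)"
      using measurable_compose[OF measurable_fst_borel K1] measurable_compose[OF measurable_snd_borel K2]
      by (rule measurable_pair_measure)
  qed
  have int_k: "(\<integral>\<^sup>+t. g t \<partial>\<kappa> z) = (\<integral>\<^sup>+l. \<integral>\<^sup>+r. g (graft z l r) \<partial>K2 (snd z) \<partial>K1 (fst z))"
    if [measurable]: "g \<in> borel_measurable tree_M" for g z
  proof -
    have "(\<integral>\<^sup>+t. g t \<partial>\<kappa> z) = (\<integral>\<^sup>+w. g (graft z (fst w) (snd w)) \<partial>(K1 (fst z) \<Otimes>\<^sub>M K2 (snd z)))"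
      unfolding \<kappa>_def by (rule nn_integral_distr) measurable
    also have "\<dots> = (\<integral>\<^sup>+l. \<integral>\<^sup>+r. g (graft z (fst (l, r)) (snd (l, r))) \<partial>K2 (snd z) \<partial>K1 (fst z))"
      by (rule sigma_finite_measure.nn_integral_fst[OF sfK, symmetric]) measurable
    finally show ?thesis by simp
  qed
  define D where "D = density lborel d"
  have sD [measurable_cong]: "sets D = sets borel" by (simp add: D_def)
  have spD: "space D = UNIV" by (simp add: D_def)
  have "emeasure D (space D) \<le> 1"
    using d1 by (simp add: D_def emeasure_density)
  then interpret D: subprob_space D
    by (intro subprob_spaceI) (auto simp: spD)
  have kD: "\<kappa> \<in> D \<rightarrow>\<^sub>M subprob_algebra tree_M" by measurable
  define N where "N = D \<bind> \<kappa>"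
  have sN: "sets N = sets tree_M" unfolding N_def by (rule sets_bind[OF sets_kernel[OF kD]]) (auto simp: spD)
  have int_N: "(\<integral>\<^sup>+t. g t \<partial>N) = (\<integral>\<^sup>+z. d z * (\<integral>\<^sup>+l. \<integral>\<^sup>+r. g (graft z l r) \<partial>K2 (snd z) \<partial>K1 (fst z)) \<partial>lborel)"
    if [measurable]: "g \<in> borel_measurable tree_M" for g
  proof -
    have "(\<integral>\<^sup>+t. g t \<partial>N) = (\<integral>\<^sup>+z. \<integral>\<^sup>+t. g t \<partial>\<kappa> z \<partial>D)"
      unfolding N_def by (rule nn_integral_bind[OF that kD])
    also have "\<dots> = (\<integral>\<^sup>+z. d z * (\<integral>\<^sup>+t. g t \<partial>\<kappa> z) \<partial>lborel)"
      unfolding D_def by (rule nn_integral_density) measurable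
    finally show ?thesis by (simp add: int_k that)
  qed
  let ?L = "{t \<in> space tree_M. t [] = Some None}"
  have L [measurable]: "?L \<in> sets tree_M" by measurable
  \<comment> \<open>Splitting by whether the root is a leaf separates the mixture from the atom, so
    each part is compared on rectangles on its own.\<close>
  define M1 where "M1 = density M (indicator (- ?L))"
  define M2 where "M2 = density M (indicator ?L)"
  have sM12: "sets M1 = sets tree_M" "sets M2 = sets tree_M"
    by (simp_all add: M1_def M2_def M)
  have spM: "space M = UNIV" using sets_eq_imp_space_eq[OF M(2)] by simp
  have cL: "- ?L \<in> sets tree_M" using sets.compl_sets[OF L] by (simp add: Compl_eq_Diff_UNIV)
  interpret M: finite_measure M by fact
  have M12: "emeasure M1 A = emeasure M (A \<inter> - ?L)" "emeasure M2 A = emeasure M (A \<inter> ?L)" if "A \<in> sets tree_M" for A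
    unfolding M1_def M2_def using that L cL
    by (auto simp: emeasure_restricted M Int_commute)
  have fin: "finite_measure M1" "finite_measure M2"
    using M12[of UNIV] sets.top[of tree_M] sets_eq_imp_space_eq[OF sM12(1)] sets_eq_imp_space_eq[OF sM12(2)]
    by (auto intro!: finite_measureI)
  have M1_eq: "M1 = N"
  proof (rule tree_measure_eqI_rect[OF fin(1) sM12(1) sN])
    fix A0 A B
    assume [measurable]: "A0 \<in> sets node_M" "A \<in> sets tree_M" "B \<in> sets tree_M"
    have s: "rect A0 A B \<in> sets tree_M" by (rule sets_rect) measurable
    have "A0 - {Some None} \<in> sets node_M" using sets_node_M_gen(2) by measurable
    moreover have "rect A0 A B \<inter> - ?L = rect (A0 - {Some None}) A B"
      by (auto simp: rect_def)
    ultimately have "emeasure M1 (rect A0 A B) =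
      (\<integral>\<^sup>+z. d z * (indicator A0 (nd z) * (emeasure (K1 (fst z)) A * emeasure (K2 (snd z)) B)) \<partial>lborel)"
      by (simp add: M12[OF s] rect) (simp add: rect_def indicator_def)
    also have "\<dots> = (\<integral>\<^sup>+t. indicator (rect A0 A B) t \<partial>N)"
      unfolding int_N[OF borel_measurable_indicator[OF s]]
    proof (rule nn_integral_cong)
      fix z :: "real \<times> real"
      have "(\<integral>\<^sup>+l. \<integral>\<^sup>+r. indicator (rect A0 A B) (graft z l r) \<partial>K2 (snd z) \<partial>K1 (fst z)) =
         (\<integral>\<^sup>+l. \<integral>\<^sup>+r. (indicator A0 (nd z) * indicator A l) * indicator B r \<partial>K2 (snd z) \<partial>K1 (fst z))"
        by (intro nn_integral_cong) (auto simp: rect_graft indicator_def)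
      also have "\<dots> = (\<integral>\<^sup>+l. (indicator A0 (nd z) * emeasure (K2 (snd z)) B) * indicator A l \<partial>K1 (fst z))"
        by (intro nn_integral_cong, subst nn_integral_cmult_indicator) (simp_all add: sK, simp only: mult_ac)
      also have "\<dots> = indicator A0 (nd z) * (emeasure (K1 (fst z)) A * emeasure (K2 (snd z)) B)"
        by (subst nn_integral_cmult_indicator) (simp_all add: sK, simp only: mult_ac)
      finally show "d z * (indicator A0 (nd z) * (emeasure (K1 (fst z)) A * emeasure (K2 (snd z)) B)) =
        d z * (\<integral>\<^sup>+l. \<integral>\<^sup>+r. indicator (rect A0 A B) (graft z l r) \<partial>K2 (snd z) \<partial>K1 (fst z))" by simp
    qed
    finally show "emeasure M1 (rect A0 A B) = emeasure N (rect A0 A B)"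
      using s sN by simp
  qed
  have M2rect: "emeasure M2 (rect A0 A B) = c * indicator (rect A0 A B) leaf_tree"
    if [measurable]: "A0 \<in> sets node_M" "A \<in> sets tree_M" "B \<in> sets tree_M" for A0 A B
  proof -
    have s: "rect A0 A B \<in> sets tree_M" by (rule sets_rect) measurable
    have "A0 \<inter> {Some None} \<in> sets node_M" using sets_node_M_gen(2) by measurable
    moreover have "rect A0 A B \<inter> ?L = rect (A0 \<inter> {Some None}) A B"
      by (auto simp: rect_def)
    ultimately show ?thesis
      by (simp add: M12[OF s] rect) (simp add: rect_def indicator_def)
  qed
  have M2_eq: "M2 = scale_measure c (return tree_M leaf_tree)"
  proof (rule tree_measure_eqI_rect[OF fin(2) sM12(2)])
    fix A0 A B
    assume [measurable]: "A0 \<in> sets node_M" "A \<in> sets tree_M" "B \<in> sets tree_M"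
    have s: "rect A0 A B \<in> sets tree_M" by (rule sets_rect) measurable
    show "emeasure M2 (rect A0 A B) = emeasure (scale_measure c (return tree_M leaf_tree)) (rect A0 A B)"
      using s by (simp add: M2rect)
  qed simp
  have hM [measurable]: "h \<in> borel_measurable M" by measurable
  have LM [measurable]: "?L \<in> sets M" "- ?L \<in> sets M" using L cL M(2) by auto
  have "(\<integral>\<^sup>+t. h t \<partial>M) = (\<integral>\<^sup>+t. indicator ?L t * h t + indicator (- ?L) t * h t \<partial>M)"
    by (intro nn_integral_cong) (auto simp: indicator_def)
  also have "\<dots> = (\<integral>\<^sup>+t. indicator ?L t * h t \<partial>M) + (\<integral>\<^sup>+t. indicator (- ?L) t * h t \<partial>M)"
    by (rule nn_integral_add) measurable
  also have "(\<integral>\<^sup>+t. indicator ?L t * h t \<partial>M) = (\<integral>\<^sup>+t. h t \<partial>M2)"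
    unfolding M2_def by (rule nn_integral_density[symmetric]) measurable
  also have "(\<integral>\<^sup>+t. indicator (- ?L) t * h t \<partial>M) = (\<integral>\<^sup>+t. h t \<partial>M1)"
    unfolding M1_def by (rule nn_integral_density[symmetric]) measurable
  also have "(\<integral>\<^sup>+t. h t \<partial>M2) = c * h leaf_tree"
    unfolding M2_eq by (simp add: nn_integral_scale_measure nn_integral_return)
  finally show ?thesis unfolding M1_eq int_N[OF h] .
qed

definition fin_density :: "real \<Rightarrow> real \<times> real \<Rightarrow> ennreal" where
  "fin_density \<theta> z = indicator (tri \<theta>) z * ennreal (F (fst z) * F (snd z) / F \<theta>)"

lemma measurable_fin_density [measurable]: "fin_density \<theta> \<in> borel_measurable borel"
  unfolding fin_density_def[abs_def] by measurable

text \<open>The working form of the root decomposition. The density vanishes outside the triangle,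
  and inside it the clamped kernel coincides with \<open>Pfin\<close>.\<close>

theorem nn_integral_Pfin:
  assumes \<theta>: "0 \<le> \<theta>" "\<theta> < pi" and h [measurable]: "h \<in> borel_measurable tree_M"
  shows "(\<integral>\<^sup>+t. h t \<partial>Pfin \<theta>) = ennreal (xc / F \<theta>) * h leaf_tree +
    (\<integral>\<^sup>+z. fin_density \<theta> z * (\<integral>\<^sup>+l. \<integral>\<^sup>+r. h (graft z l r) \<partial>Pfin (snd z) \<partial>Pfin (fst z)) \<partial>lborel)"
proof -
  interpret prob_space "Pfin \<theta>" by (rule prob_space_Pfin[OF \<theta>])
  have eq: "fin_law (fst z) = Pfin (fst z)" "fin_law (snd z) = Pfin (snd z)" if "fin_density \<theta> z \<noteq> 0" for z
  proof -
    have "z \<in> tri \<theta>" using that by (auto simp: fin_density_def indicator_def split: if_splits)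
    then show "fin_law (fst z) = Pfin (fst z)" "fin_law (snd z) = Pfin (snd z)"
      using tri_bounds[of z \<theta>] by (auto simp: fin_law_eq)
  qed
  have rect: "emeasure (Pfin \<theta>) (rect A0 A B) = ennreal (xc / F \<theta>) * indicator (rect A0 A B) leaf_tree +
      (\<integral>\<^sup>+z. fin_density \<theta> z * (indicator A0 (nd z) * (emeasure (fin_law (fst z)) A * emeasure (fin_law (snd z)) B)) \<partial>lborel)"
    if "A0 \<in> sets node_M" "A \<in> sets tree_M" "B \<in> sets tree_M" for A0 A B
  proof -
    have "fin_density \<theta> z * (indicator A0 (nd z) * (emeasure (fin_law (fst z)) A * emeasure (fin_law (snd z)) B)) =
      fin_density \<theta> z * (indicator A0 (nd z) * (emeasure (Pfin (fst z)) A * emeasure (Pfin (snd z)) B))" for z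
      by (cases "fin_density \<theta> z = 0") (simp_all add: eq)
    then show ?thesis
      unfolding emeasure_Pfin_rect[OF \<theta> that] by (simp add: fin_density_def)
  qed
  have "(\<integral>\<^sup>+z. fin_density \<theta> z \<partial>lborel) \<le> 1"
  proof -
    have "(\<integral>\<^sup>+z. fin_density \<theta> z \<partial>lborel) =
      (\<integral>\<^sup>+z. fin_density \<theta> z * (indicator UNIV (nd z) * (emeasure (fin_law (fst z)) UNIV * emeasure (fin_law (snd z)) UNIV)) \<partial>lborel)"
      using prob_space.emeasure_space_1[OF prob_space_fin_law] by simp
    also have "\<dots> \<le> emeasure (Pfin \<theta>) (rect UNIV UNIV UNIV)"
      using rect[of UNIV UNIV UNIV] sets.top[of node_M] sets.top[of tree_M] by simp
    also have "\<dots> \<le> 1" using emeasure_space_1 by simp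
    finally show ?thesis .
  qed
  from nn_integral_graft_decomposition[OF finite_measure_axioms sets_Pfin measurable_fin_law measurable_fin_law measurable_fin_density this rect h]
  have "(\<integral>\<^sup>+t. h t \<partial>Pfin \<theta>) = ennreal (xc / F \<theta>) * h leaf_tree +
    (\<integral>\<^sup>+z. fin_density \<theta> z * (\<integral>\<^sup>+l. \<integral>\<^sup>+r. h (graft z l r) \<partial>fin_law (snd z) \<partial>fin_law (fst z)) \<partial>lborel)" .
  moreover have "fin_density \<theta> z * (\<integral>\<^sup>+l. \<integral>\<^sup>+r. h (graft z l r) \<partial>fin_law (snd z) \<partial>fin_law (fst z)) =
    fin_density \<theta> z * (\<integral>\<^sup>+l. \<integral>\<^sup>+r. h (graft z l r) \<partial>Pfin (snd z) \<partial>Pfin (fst z))" for z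
    by (cases "fin_density \<theta> z = 0") (simp_all add: eq)
  ultimately show ?thesis by simp
qed

section \<open>Almost sure properties and the size of the finite tree\<close>

text \<open>There are finitely many addresses of each length, so finiteness means bounded depth. The
  right side is a countable combination of coordinate conditions, hence measurable.\<close>

lemma finite_supp_iff: "finite (supp t) \<longleftrightarrow> (\<exists>n. \<forall>p. n \<le> length p \<longrightarrow> t p = None)"
proof
  assume fin: "finite (supp t)"
  have "t p = None" if "Suc (Max (length ` supp t)) \<le> length p" for p
  proof (rule ccontr)
    assume "t p \<noteq> None"
    then have "length p \<le> Max (length ` supp t)"
      using fin by (intro Max_ge) (auto simp: supp_def)
    with that show False by simp
  qed
  then show "\<exists>n. \<forall>p. n \<le> length p \<longrightarrow> t p = None" by blast
next
  assume "\<exists>n. \<forall>p. n \<le> length p \<longrightarrow> t p = None"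
  then obtain n where "\<And>p. n \<le> length p \<Longrightarrow> t p = None" by blast
  then have "length p \<le> n" if "p \<in> supp t" for p
    using that nat_le_linear[of n "length p"] by (auto simp: supp_def)
  then have "supp t \<subseteq> {p. set p \<subseteq> UNIV \<and> length p \<le> n}" by auto
  then show "finite (supp t)"
    by (rule finite_subset) (rule finite_lists_length_le, simp)
qed

lemma pred_finite_supp [measurable]: "Measurable.pred tree_M (\<lambda>t. finite (supp t))"
  unfolding finite_supp_iff by measurable

text \<open>Replaces the quantifier over real angles by tests on node values, which makes the
  condition visibly measurable.\<close>

lemma is_tree_iff: "is_tree t \<longleftrightarrow> t [] \<noteq> None \<and>
     (\<forall>p c. t (p @ [c]) \<noteq> None \<longleftrightarrow> t p \<noteq> None \<and> t p \<noteq> Some None)"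
proof -
  have "(\<exists>ab. n = Some (Some ab)) \<longleftrightarrow> n \<noteq> None \<and> n \<noteq> Some None" for n :: node
    by (cases n; cases "the n") auto
  then show ?thesis by (simp add: is_tree_def)
qed

lemma pred_is_tree [measurable]: "Measurable.pred tree_M is_tree"
  unfolding is_tree_iff[abs_def] by measurable

lemma is_tree_graft_iff: "is_tree (graft z l r) \<longleftrightarrow> is_tree l \<and> is_tree r"
  unfolding is_tree_iff
    all_bool_list[of "\<lambda>p. \<forall>c. graft z l r (p @ [c]) \<noteq> None \<longleftrightarrow> graft z l r p \<noteq> None \<and> graft z l r p \<noteq> Some None"]
  by (auto simp: all_bool_eq)

lemma tree_cases:
  assumes "is_tree t"
  obtains "t = leaf_tree" | z where "t = graft z (subL t) (subR t)" "is_tree (subL t)" "is_tree (subR t)"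
proof -
  consider "t [] = Some None" | a b where "t [] = Some (Some (a, b))"
    using assms by (cases "t []"; cases "the (t [])") (auto simp: is_tree_def)
  then show ?thesis
  proof cases
    case 1
    have "t p = None" if "p \<noteq> []" for p
      using that
    proof (induction p rule: rev_induct)
      case (snoc c p)
      have "t p = None \<or> t p = Some None"
        using snoc 1 by (cases "p = []") auto
      then show ?case using assms unfolding is_tree_iff by blast
    qed simp
    then have "t = leaf_tree" using 1 by (auto simp: leaf_tree_def)
    then show ?thesis by (rule that(1))
  next
    case 2
    have "t p = graft (pi - a, pi - b) (subL t) (subR t) p" for p
      using 2 by (cases p) (auto simp: graft_def nd_def subL_def subR_def)
    then have eq: "t = graft (pi - a, pi - b) (subL t) (subR t)" by (rule ext)
    then have "is_tree (graft (pi - a, pi - b) (subL t) (subR t))" using assms by simp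
    then show ?thesis using that(2)[OF eq] by (simp add: is_tree_graft_iff)
  qed
qed

lemma is_tree_tree_of:
  assumes "shape_ok S"
  shows "is_tree (tree_of S x)"
proof -
  have cl: "p @ [c] \<in> S \<Longrightarrow> p \<in> S" and sib: "p @ [False] \<in> S \<longleftrightarrow> p @ [True] \<in> S" for p c
    using assms unfolding shape_ok_def by metis+
  have i: "p @ [c] \<in> S \<longleftrightarrow> p \<in> internal S" for p c
    using cl[of p c] sib[of p] by (cases c) (auto simp: internal_def)
  have sub: "p \<in> S" if "p \<in> internal S" for p using that by (auto simp: internal_def)
  have 1: "tree_of S x p \<noteq> None \<longleftrightarrow> p \<in> S" for p
    using sub by (auto simp: tree_of_def)
  have 2: "tree_of S x p \<noteq> None \<and> tree_of S x p \<noteq> Some None \<longleftrightarrow> p \<in> internal S" for p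
    using sub by (auto simp: tree_of_def)
  show ?thesis
    unfolding is_tree_iff 2 unfolding 1 i using assms by (simp add: shape_ok_def)
qed

definition fine_tree :: "real \<Rightarrow> atree \<Rightarrow> bool" where
  "fine_tree \<theta> t \<longleftrightarrow> finite (supp t) \<and> is_tree t \<and> good \<theta> t"

lemma pred_fine_tree [measurable]: "Measurable.pred tree_M (fine_tree \<theta>)"
  unfolding fine_tree_def[abs_def] by measurable

lemma AE_fine_tree: "AE t in Pfin \<theta>. fine_tree \<theta> t"
proof (rule AE_I)
  let ?A = "{t. \<not> fine_tree \<theta> t}"
  have "{t \<in> space tree_M. \<not> fine_tree \<theta> t} \<in> sets tree_M" by measurable
  then have A: "?A \<in> sets tree_M" by simp
  have "shape_vol S \<theta> ?A = 0" if "shape_ok S" for S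
  proof -
    have "supp (tree_of S x) = S" for x
      by (auto simp: supp_def tree_of_def internal_def)
    then have "fine_tree \<theta> (tree_of S x)" if "good \<theta> (tree_of S x)" for x
      using that \<open>shape_ok S\<close> by (simp add: fine_tree_def is_tree_tree_of shape_ok_def)
    then have "{x \<in> space (angle_leb S). tree_of S x \<in> ?A \<and> good \<theta> (tree_of S x)} = {}" by auto
    then show ?thesis by (simp only: shape_vol_def emeasure_empty)
  qed
  then have "size_vol n \<theta> ?A = 0" for n
    by (simp add: size_vol_def shapes_def)
  then show "emeasure (Pfin \<theta>) ?A = 0" by (simp add: emeasure_Pfin[OF A])
  show "?A \<in> sets (Pfin \<theta>)" using A by simp
qed auto

text \<open>The index counts the leaves besides the root, in line with \<open>vol\<close>;
  conditioning on n leaves in \<open>Pn\<close> corresponds to m = n - 1.\<close>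

definition size_is :: "nat \<Rightarrow> atree \<Rightarrow> bool" where
  "size_is m t \<longleftrightarrow> finite (supp t) \<and> num_leaves t = Suc m"

text \<open>Once the depth is bounded by n, the number of leaves is a finite sum of coordinate
  functions; only the countable choice of n remains.\<close>

lemma pred_size_is [measurable]: "Measurable.pred tree_M (size_is m)"
proof -
  have "size_is m t \<longleftrightarrow> (\<exists>n. (\<forall>p. n \<le> length p \<longrightarrow> t p = None) \<and>
      (\<Sum>p\<in>{p. length p < n}. if t p = Some None then 1 else 0) = real m)" for t
  proof -
    have "(\<Sum>p\<in>{p. length p < n}. if t p = Some None then 1 else 0) = real (card {p. t p = Some None})"
      if "\<And>p. n \<le> length p \<Longrightarrow> t p = None" for n
    proof -
      have fin: "finite {p :: bool list. length p < n}"
        by (rule finite_subset[OF _ finite_lists_length_le[of UNIV n]]) auto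
      have "{p. length p < n} \<inter> {p. t p = Some None} = {p. t p = Some None}"
      proof -
        have "length p < n" if "t p = Some None" for p
          using that \<open>\<And>p. n \<le> length p \<Longrightarrow> t p = None\<close>[of p] by (cases "n \<le> length p") auto
        then show ?thesis by auto
      qed
      then show ?thesis using fin by (simp add: sum.If_cases)
    qed
    then show ?thesis unfolding size_is_def finite_supp_iff num_leaves_def by auto
  qed
  then have "size_is m = (\<lambda>t. \<exists>n. (\<forall>p. n \<le> length p \<longrightarrow> t p = None) \<and>
      (\<Sum>p\<in>{p. length p < n}. if t p = Some None then 1 else 0) = real m)" by (rule ext)
  moreover have "Measurable.pred tree_M \<dots>" by measurable
  ultimately show ?thesis by (simp only:)
qed

lemma supp_graft: "supp (graft z l r) = node_shape (supp l) (supp r)"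
proof (rule set_eqI)
  fix p show "p \<in> supp (graft z l r) \<longleftrightarrow> p \<in> node_shape (supp l) (supp r)"
    by (cases p) (auto simp: supp_def graft_def node_shape_def nd_def)
qed

lemma finite_supp_graft_iff: "finite (supp (graft z l r)) \<longleftrightarrow> finite (supp l) \<and> finite (supp r)"
  by (auto simp: supp_graft node_shape_def finite_image_iff)

lemma size_is_graft: "size_is m (graft z l r) \<longleftrightarrow> (\<exists>k\<le>m. size_is k l \<and> size_is (m - k) r)"
proof -
  have "card {p. graft z l r p = Some None} = card {p. l p = Some None} + card {p. r p = Some None}"
    if "finite (supp l)" "finite (supp r)"
  proof -
    have "{p. graft z l r p = Some None} = (#) False ` {p. l p = Some None} \<union> (#) True ` {p. r p = Some None}"
    proof (rule set_eqI)
      fix p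
      show "p \<in> {p. graft z l r p = Some None} \<longleftrightarrow>
        p \<in> (#) False ` {p. l p = Some None} \<union> (#) True ` {p. r p = Some None}"
        by (cases p) (auto simp: graft_def)
    qed
    moreover have "finite {p. l p = Some None}" "finite {p. r p = Some None}"
      using finite_subset[OF _ that(1), of "{p. l p = Some None}"] finite_subset[OF _ that(2), of "{p. r p = Some None}"]
      by (auto simp: supp_def)
    ultimately show ?thesis
      by (simp only:) (subst card_Un_disjoint, auto simp: card_image)
  qed
  then show ?thesis
    unfolding size_is_def finite_supp_graft_iff num_leaves_def by auto
qed

lemma indicator_size_is_graft:
  "indicator {t. size_is m t} (graft z l r) =
    (\<Sum>k\<le>m. indicator {t. size_is k t} l * indicator {t. size_is (m - k) t} r :: ennreal)"
proof (cases "size_is m (graft z l r)")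
  case True
  then obtain k where k: "k \<le> m" "size_is k l" "size_is (m - k) r"
    by (auto simp: size_is_graft)
  have uniq: "i = k" if "size_is i l" for i using k that by (simp add: size_is_def)
  have "(\<Sum>i\<le>m. indicator {t. size_is i t} l * indicator {t. size_is (m - i) t} r :: ennreal)
     = (\<Sum>i\<le>m. if i = k then 1 else 0)"
  proof (rule sum.cong[OF refl])
    fix i
    show "(indicator {t. size_is i t} l * indicator {t. size_is (m - i) t} r :: ennreal) = (if i = k then 1 else 0)"
    proof (cases "i = k")
      case False
      then have "\<not> size_is i l" using uniq by blast
      then show ?thesis using False by simp
    qed (simp add: k)
  qed
  then show ?thesis using True k by simp
next
  case False
  then show ?thesis by (auto simp: size_is_graft indicator_def)
qed

lemma size_is_leaf: "size_is m leaf_tree \<longleftrightarrow> m = 1"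
proof -
  have "{p. leaf_tree p = Some None} = {[]}" "supp leaf_tree = {[]}"
    by (auto simp: leaf_tree_def supp_def split: if_splits)
  then show ?thesis by (auto simp: size_is_def num_leaves_def)
qed

lemma not_size_is_0:
  assumes "is_tree t"
  shows "\<not> size_is 0 t"
proof
  assume s: "size_is 0 t"
  then have fin: "finite (supp t)" and no: "t p \<noteq> Some None" for p
  proof -
    show fin: "finite (supp t)" using s by (simp add: size_is_def)
    have "finite {p. t p = Some None}"
      by (rule finite_subset[OF _ fin]) (auto simp: supp_def)
    then show "t p \<noteq> Some None" using s by (auto simp: size_is_def num_leaves_def)
  qed
  have "\<exists>p\<in>supp t. length p = n" for n
  proof (induction n)
    case 0
    then show ?case using assms by (auto simp: is_tree_iff supp_def)
  next
    case (Suc n)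
    then obtain p where p: "p \<in> supp t" "length p = n" by blast
    then have "t (p @ [True]) \<noteq> None"
      using no[of p] assms by (simp add: is_tree_iff supp_def)
    then show ?case using p by (intro bexI[of _ "p @ [True]"]) (auto simp: supp_def)
  qed
  then have "infinite (length ` supp t)"
    by (metis finite_nat_set_iff_bounded image_eqI less_irrefl)
  then show False using fin by simp
qed

text \<open>By the root decomposition the sizes of the two subtrees are independent and add up to m;
  the resulting convolution is the volume recursion multiplied by xc^m / F.\<close>

lemma emeasure_size_is:
  assumes "0 \<le> \<theta>" "\<theta> < pi"
  shows "emeasure (Pfin \<theta>) {t. size_is m t} = ennreal (wvol m \<theta> / F \<theta>)"
  using assms
proof (induction m arbitrary: \<theta> rule: less_induct)
  case (less m)
  note \<theta> = less.prems
  have F\<theta>: "0 < F \<theta>" using \<theta> by (intro F_pos) auto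
  have S [measurable]: "{t. size_is m t} \<in> sets tree_M" for m
  proof -
    have "{t \<in> space tree_M. size_is m t} \<in> sets tree_M" by measurable
    then show ?thesis by simp
  qed
  have zero: "emeasure (Pfin \<eta>) {t. size_is 0 t} = 0" for \<eta>
  proof -
    have "AE t in Pfin \<eta>. \<not> size_is 0 t"
      using AE_fine_tree[of \<eta>] by eventually_elim (auto simp: fine_tree_def not_size_is_0)
    then show ?thesis using S[of 0] by (subst (asm) AE_iff_measurable[OF _ refl]) auto
  qed
  show ?case
  proof (cases "m = 0")
    case True
    then show ?thesis by (simp add: zero wvol_def)
  next
    case False
    have "emeasure (Pfin \<theta>) {t. size_is m t} = (\<integral>\<^sup>+t. indicator {t. size_is m t} t \<partial>Pfin \<theta>)"
      by simp
    also have "\<dots> = ennreal (xc / F \<theta>) * indicator {t. size_is m t} leaf_tree +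
      (\<integral>\<^sup>+z. fin_density \<theta> z * (\<integral>\<^sup>+l. \<integral>\<^sup>+r. indicator {t. size_is m t} (graft z l r) \<partial>Pfin (snd z) \<partial>Pfin (fst z)) \<partial>lborel)"
      by (rule nn_integral_Pfin[OF \<theta>]) measurable
    also have "(\<integral>\<^sup>+z. fin_density \<theta> z * (\<integral>\<^sup>+l. \<integral>\<^sup>+r. indicator {t. size_is m t} (graft z l r) \<partial>Pfin (snd z) \<partial>Pfin (fst z)) \<partial>lborel)
      = (\<integral>\<^sup>+z. ennreal (xc ^ m / F \<theta>) * (indicator (tri \<theta>) z * (\<Sum>k\<le>m. ennreal (vol k (fst z)) * ennreal (vol (m - k) (snd z)))) \<partial>lborel)"
    proof (rule nn_integral_cong)
      fix z :: "real \<times> real"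
      show "fin_density \<theta> z * (\<integral>\<^sup>+l. \<integral>\<^sup>+r. indicator {t. size_is m t} (graft z l r) \<partial>Pfin (snd z) \<partial>Pfin (fst z)) =
        ennreal (xc ^ m / F \<theta>) * (indicator (tri \<theta>) z * (\<Sum>k\<le>m. ennreal (vol k (fst z)) * ennreal (vol (m - k) (snd z))))"
      proof (cases "z \<in> tri \<theta>")
        case True
        note b = tri_bounds[OF True]
        have Fz: "0 < F (fst z)" "0 < F (snd z)" using b by (auto intro!: F_pos)
        have "(\<integral>\<^sup>+l. \<integral>\<^sup>+r. indicator {t. size_is m t} (graft z l r) \<partial>Pfin (snd z) \<partial>Pfin (fst z)) =
          (\<integral>\<^sup>+l. (\<Sum>k\<le>m. indicator {t. size_is k t} l * emeasure (Pfin (snd z)) {t. size_is (m - k) t}) \<partial>Pfin (fst z))"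
          unfolding indicator_size_is_graft
          by (intro nn_integral_cong, subst nn_integral_sum) (auto simp: nn_integral_cmult)
        also have "\<dots> = (\<Sum>k\<le>m. emeasure (Pfin (fst z)) {t. size_is k t} * emeasure (Pfin (snd z)) {t. size_is (m - k) t})"
          by (subst nn_integral_sum) (auto simp: nn_integral_multc)
        also have "\<dots> = (\<Sum>k\<le>m. ennreal (wvol k (fst z) / F (fst z)) * ennreal (wvol (m - k) (snd z) / F (snd z)))"
        proof (rule sum.cong[OF refl])
          fix k assume k: "k \<in> {..m}"
          \<comment> \<open>The induction hypothesis covers only sizes below m; at the ends one of
            the two factors has size 0 and both sides vanish.\<close>
          consider "k = 0" | "k = m" | "0 < k" "k < m" using k by fastforce
          then show "emeasure (Pfin (fst z)) {t. size_is k t} * emeasure (Pfin (snd z)) {t. size_is (m - k) t} =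
             ennreal (wvol k (fst z) / F (fst z)) * ennreal (wvol (m - k) (snd z) / F (snd z))"
            by cases (use b in \<open>simp_all add: zero wvol_def less.IH\<close>)
        qed
        finally have "ennreal (F (fst z) * F (snd z) / F \<theta>) * (\<integral>\<^sup>+l. \<integral>\<^sup>+r. indicator {t. size_is m t} (graft z l r) \<partial>Pfin (snd z) \<partial>Pfin (fst z))
          = (\<Sum>k\<le>m. ennreal (F (fst z) * F (snd z) / F \<theta>) * (ennreal (wvol k (fst z) / F (fst z)) * ennreal (wvol (m - k) (snd z) / F (snd z))))"
          by (simp add: sum_distrib_left)
        also have "\<dots> = (\<Sum>k\<le>m. ennreal (xc ^ m / F \<theta>) * (ennreal (vol k (fst z)) * ennreal (vol (m - k) (snd z))))"
        proof (rule sum.cong[OF refl])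
          fix k assume "k \<in> {..m}"
          then have x: "xc ^ m = xc ^ k * xc ^ (m - k)" by (simp flip: power_add)
          have v: "0 \<le> vol k (fst z)" "0 \<le> vol (m - k) (snd z)" using b by (auto intro: vol_nonneg)
          show "ennreal (F (fst z) * F (snd z) / F \<theta>) * (ennreal (wvol k (fst z) / F (fst z)) * ennreal (wvol (m - k) (snd z) / F (snd z)))
            = ennreal (xc ^ m / F \<theta>) * (ennreal (vol k (fst z)) * ennreal (vol (m - k) (snd z)))"
            using v Fz F\<theta> xc_pos unfolding x wvol_def by (simp add: ennreal_mult[symmetric] field_simps)
        qed
        finally show ?thesis using True by (simp add: fin_density_def sum_distrib_left)
      qed (simp add: fin_density_def)
    qed
    also have "\<dots> = ennreal (xc ^ m / F \<theta>) * (\<integral>\<^sup>+z. indicator (tri \<theta>) z * (\<Sum>k\<le>m. ennreal (vol k (fst z)) * ennreal (vol (m - k) (snd z))) \<partial>lborel)"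
      by (rule nn_integral_cmult) measurable
    also have "ennreal (xc / F \<theta>) * indicator {t. size_is m t} leaf_tree = ennreal (xc ^ m / F \<theta>) * (if m = 1 then 1 else 0)"
      by (auto simp: size_is_leaf indicator_def)
    also have "ennreal (xc ^ m / F \<theta>) * (if m = 1 then 1 else 0) + ennreal (xc ^ m / F \<theta>) * (\<integral>\<^sup>+z. indicator (tri \<theta>) z * (\<Sum>k\<le>m. ennreal (vol k (fst z)) * ennreal (vol (m - k) (snd z))) \<partial>lborel)
      = ennreal (xc ^ m / F \<theta>) * ennreal (vol m \<theta>)"
      using nn_integral_vol_recursion[of \<theta> m] \<theta> by (simp only: distrib_left)
    also have "\<dots> = ennreal (wvol m \<theta> / F \<theta>)"
      using F\<theta> xc_pos vol_nonneg[of \<theta> m] \<theta> by (simp add: ennreal_mult[symmetric] wvol_def mult_ac)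
    finally show ?thesis .
  qed
qed

section \<open>Conditional densities given a truncation\<close>

text \<open>At radius 1 only the neighbour of the root is kept, as a bare vertex, and bare vertices
  are encoded like leaves.\<close>

lemma trunc_1: "t [] \<noteq> None \<Longrightarrow> trunc (Suc 0) t = leaf_tree"
  by (auto simp: trunc_def leaf_tree_def fun_eq_iff)

lemma trunc_graft: "trunc (Suc (Suc n)) (graft z l r) = graft z (trunc (Suc n) l) (trunc (Suc n) r)"
proof
  fix p show "trunc (Suc (Suc n)) (graft z l r) p = graft z (trunc (Suc n) l) (trunc (Suc n) r) p"
  proof (cases p)
    case (Cons c q)
    then show ?thesis by (cases c) (auto simp: trunc_def)
  qed (simp add: trunc_def)
qed

lemma measurable_trunc [measurable]: "trunc n \<in> tree_M \<rightarrow>\<^sub>M tree_M"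
proof (rule measurable_tree_M_I)
  fix p :: "bool list"
  have [measurable]: "(\<lambda>n::node. case n of None \<Rightarrow> None | Some _ \<Rightarrow> Some None) \<in> node_M \<rightarrow>\<^sub>M node_M"
    by (rule measurable_node_M_I) auto
  consider "Suc (length p) < n" | "Suc (length p) = n" | "\<not> Suc (length p) < n" "Suc (length p) \<noteq> n" by auto
  then show "(\<lambda>t. trunc n t p) \<in> tree_M \<rightarrow>\<^sub>M node_M"
    by cases (simp_all add: trunc_def)
qed

definition root_angles :: "atree \<Rightarrow> real \<times> real" where
  "root_angles t = (case t [] of Some (Some (a, b)) \<Rightarrow> (pi - a, pi - b) | _ \<Rightarrow> (0, 0))"

lemma root_angles_graft [simp]: "root_angles (graft z l r) = z"
  by (simp add: root_angles_def nd_def)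

lemma measurable_root_angles [measurable]: "root_angles \<in> tree_M \<rightarrow>\<^sub>M borel"
proof -
  have "(\<lambda>ab. (pi - fst ab, pi - snd ab)) \<in> borel \<rightarrow>\<^sub>M (borel \<Otimes>\<^sub>M borel :: (real \<times> real) measure)"
    by measurable
  then have "(\<lambda>n. case n of Some (Some (a, b)) \<Rightarrow> (pi - a, pi - b) | _ \<Rightarrow> (0, 0)) \<in> node_M \<rightarrow>\<^sub>M (borel :: (real \<times> real) measure)"
    by (intro measurable_node_M_I) (auto simp: case_prod_beta borel_prod)
  from measurable_compose[OF measurable_tree_component this, of "[]"] show ?thesis
    by (simp add: root_angles_def[abs_def])
qed

text \<open>The absolute values only serve to make the densities nonnegative for every argument.\<close>
fun size_density :: "nat \<Rightarrow> nat \<Rightarrow> real \<Rightarrow> atree \<Rightarrow> real" where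
  "size_density 0 m \<theta> t = \<bar>wvol m \<theta> / F \<theta>\<bar>"
| "size_density (Suc n) m \<theta> t = (if t [] = Some None then (if m = 1 then 1 else 0) else
     (\<Sum>k\<le>m. size_density n k (fst (root_angles t)) (subL t) * size_density n (m - k) (snd (root_angles t)) (subR t)))"

text \<open>On a tree this sums Finf / F over the vertices with address length n. In the limit of
  large size exactly one boundary subtree is large, and the size probabilities of every other one
  sum to 1, so the convolution degenerates to a sum.\<close>

fun inf_density :: "nat \<Rightarrow> real \<Rightarrow> atree \<Rightarrow> real" where
  "inf_density 0 \<theta> t = \<bar>Finf \<theta> / F \<theta>\<bar>"
| "inf_density (Suc n) \<theta> t = (if t [] = Some None then 0 else
     inf_density n (fst (root_angles t)) (subL t) + inf_density n (snd (root_angles t)) (subR t))"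

lemma size_density_nonneg: "0 \<le> size_density n m \<theta> t"
  by (induction n arbitrary: m \<theta> t) (auto intro!: sum_nonneg mult_nonneg_nonneg)

lemma inf_density_nonneg: "0 \<le> inf_density n \<theta> t"
  by (induction n arbitrary: \<theta> t) auto

lemma measurable_size_density: "(\<lambda>x. size_density n m (fst x) (snd x)) \<in> borel_measurable (borel \<Otimes>\<^sub>M tree_M)"
proof (induction n arbitrary: m)
  case (Suc n)
  have 1: "(\<lambda>x. size_density n k (fst (root_angles (snd x))) (subL (snd x))) \<in> borel_measurable (borel \<Otimes>\<^sub>M tree_M)"
    "(\<lambda>x. size_density n k (snd (root_angles (snd x))) (subR (snd x))) \<in> borel_measurable (borel \<Otimes>\<^sub>M tree_M)"
    for k
  proof -
    have "(\<lambda>x. (fst (root_angles (snd x)), subL (snd x))) \<in> borel \<Otimes>\<^sub>M tree_M \<rightarrow>\<^sub>M borel \<Otimes>\<^sub>M tree_M"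
      "(\<lambda>x. (snd (root_angles (snd x)), subR (snd x))) \<in> borel \<Otimes>\<^sub>M tree_M \<rightarrow>\<^sub>M borel \<Otimes>\<^sub>M tree_M"
      by measurable
    from measurable_compose[OF this(1) Suc.IH[of k]] measurable_compose[OF this(2) Suc.IH[of k]]
    show "(\<lambda>x. size_density n k (fst (root_angles (snd x))) (subL (snd x))) \<in> borel_measurable (borel \<Otimes>\<^sub>M tree_M)"
    "(\<lambda>x. size_density n k (snd (root_angles (snd x))) (subR (snd x))) \<in> borel_measurable (borel \<Otimes>\<^sub>M tree_M)"
      by simp_all
  qed
  note [measurable] = 1
  show ?case unfolding size_density.simps by measurable
qed (simp add: measurable_compose[OF measurable_fst measurable_wvol] measurable_compose[OF measurable_fst measurable_F])

lemma measurable_inf_density: "(\<lambda>x. inf_density n (fst x) (snd x)) \<in> borel_measurable (borel \<Otimes>\<^sub>M tree_M)"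
proof (induction n)
  case 0
  then show ?case unfolding inf_density.simps by measurable
next
  case (Suc n)
  have 1: "(\<lambda>x. inf_density n (fst (root_angles (snd x))) (subL (snd x))) \<in> borel_measurable (borel \<Otimes>\<^sub>M tree_M)"
    "(\<lambda>x. inf_density n (snd (root_angles (snd x))) (subR (snd x))) \<in> borel_measurable (borel \<Otimes>\<^sub>M tree_M)"
  proof -
    have "(\<lambda>x. (fst (root_angles (snd x)), subL (snd x))) \<in> borel \<Otimes>\<^sub>M tree_M \<rightarrow>\<^sub>M borel \<Otimes>\<^sub>M tree_M"
      "(\<lambda>x. (snd (root_angles (snd x)), subR (snd x))) \<in> borel \<Otimes>\<^sub>M tree_M \<rightarrow>\<^sub>M borel \<Otimes>\<^sub>M tree_M"
      by measurable
    from measurable_compose[OF this(1) Suc.IH] measurable_compose[OF this(2) Suc.IH]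
    show "(\<lambda>x. inf_density n (fst (root_angles (snd x))) (subL (snd x))) \<in> borel_measurable (borel \<Otimes>\<^sub>M tree_M)"
    "(\<lambda>x. inf_density n (snd (root_angles (snd x))) (subR (snd x))) \<in> borel_measurable (borel \<Otimes>\<^sub>M tree_M)"
      by simp_all
  qed
  note [measurable] = 1
  show ?case unfolding inf_density.simps by measurable
qed

lemma measurable_size_density' [measurable]: "size_density n m \<theta> \<in> borel_measurable tree_M"
proof -
  have "(\<lambda>t. (\<theta>, t)) \<in> tree_M \<rightarrow>\<^sub>M borel \<Otimes>\<^sub>M tree_M" by measurable
  from measurable_compose[OF this measurable_size_density] show ?thesis by simp
qed

lemma measurable_inf_density' [measurable]: "inf_density n \<theta> \<in> borel_measurable tree_M"
proof -
  have "(\<lambda>t. (\<theta>, t)) \<in> tree_M \<rightarrow>\<^sub>M borel \<Otimes>\<^sub>M tree_M" by measurable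
  from measurable_compose[OF this measurable_inf_density] show ?thesis by simp
qed

lemma density_leaf [simp]: "size_density (Suc n) m \<theta> leaf_tree = (if m = 1 then 1 else 0)"
  "inf_density (Suc n) \<theta> leaf_tree = 0"
  by simp_all

lemma density_graft: "size_density (Suc n) m \<theta> (graft z l r) = (\<Sum>k\<le>m. size_density n k (fst z) l * size_density n (m - k) (snd z) r)"
  "inf_density (Suc n) \<theta> (graft z l r) = inf_density n (fst z) l + inf_density n (snd z) r"
  by simp_all

lemma nn_integral_graft_product:
  fixes a b :: "'i \<Rightarrow> atree \<Rightarrow> ennreal"
  assumes sM [measurable_cong]: "sets M = sets tree_M" and sN [measurable_cong]: "sets N = sets tree_M"
    and N: "sigma_finite_measure N"
    and a [measurable]: "\<And>i. a i \<in> borel_measurable tree_M" and b [measurable]: "\<And>i. b i \<in> borel_measurable tree_M"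
    and g [measurable]: "g \<in> borel_measurable tree_M"
  shows "(\<integral>\<^sup>+l. \<integral>\<^sup>+r. (\<Sum>i\<in>I. a i l * b i r) * g (graft z (trunc n l) (trunc n r)) \<partial>N \<partial>M) =
    (\<Sum>i\<in>I. \<integral>\<^sup>+l. a i l * (\<integral>\<^sup>+r. b i r * g (graft z (trunc n l) (trunc n r)) \<partial>N) \<partial>M)"
proof -
  interpret N: sigma_finite_measure N by fact
  have "(\<integral>\<^sup>+r. (\<Sum>i\<in>I. a i l * b i r) * g (graft z (trunc n l) (trunc n r)) \<partial>N) =
    (\<Sum>i\<in>I. a i l * (\<integral>\<^sup>+r. b i r * g (graft z (trunc n l) (trunc n r)) \<partial>N))" for l
  proof -
    have "(\<integral>\<^sup>+r. (\<Sum>i\<in>I. a i l * b i r) * g (graft z (trunc n l) (trunc n r)) \<partial>N) =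
      (\<integral>\<^sup>+r. (\<Sum>i\<in>I. a i l * (b i r * g (graft z (trunc n l) (trunc n r)))) \<partial>N)"
      by (simp add: sum_distrib_right mult.assoc)
    also have "\<dots> = (\<Sum>i\<in>I. \<integral>\<^sup>+r. a i l * (b i r * g (graft z (trunc n l) (trunc n r))) \<partial>N)"
      by (rule nn_integral_sum) measurable
    also have "\<dots> = (\<Sum>i\<in>I. a i l * (\<integral>\<^sup>+r. b i r * g (graft z (trunc n l) (trunc n r)) \<partial>N))"
      by (intro sum.cong refl nn_integral_cmult) measurable
    finally show ?thesis .
  qed
  moreover have "(\<lambda>l. a i l * (\<integral>\<^sup>+r. b i r * g (graft z (trunc n l) (trunc n r)) \<partial>N)) \<in> borel_measurable M" for i
    by measurable
  ultimately show ?thesis by (simp add: nn_integral_sum)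
qed

lemma sigma_finite_Pfin: "0 \<le> \<theta> \<Longrightarrow> \<theta> < pi \<Longrightarrow> sigma_finite_measure (Pfin \<theta>)"
  using prob_space_Pfin by (intro prob_space_imp_sigma_finite)

text \<open>This identifies \<open>size_density n m\<close> as the conditional probability of size m
  given the ball of radius n + 1: given the ball, the boundary subtrees are independent finite trees
  and their sizes convolve. Testing against functions g of the truncation lets the induction go
  through the root decomposition.\<close>

theorem nn_integral_size_trunc:
  assumes "0 \<le> \<theta>" "\<theta> < pi" and "g \<in> borel_measurable tree_M"
  shows "(\<integral>\<^sup>+t. indicator {t. size_is m t} t * g (trunc (Suc n) t) \<partial>Pfin \<theta>) =
    (\<integral>\<^sup>+t. ennreal (size_density n m \<theta> t) * g (trunc (Suc n) t) \<partial>Pfin \<theta>)"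
  using assms
proof (induction n arbitrary: m \<theta> g)
  case 0
  note \<theta> = 0(1,2)
  note [measurable] = 0(3)
  interpret prob_space "Pfin \<theta>" by (rule prob_space_Pfin[OF \<theta>])
  have F\<theta>: "0 < F \<theta>" "0 \<le> wvol m \<theta>" using \<theta> by (auto intro: F_pos wvol_nonneg)
  have root: "AE t in Pfin \<theta>. trunc (Suc 0) t = leaf_tree"
    using AE_fine_tree[of \<theta>] by eventually_elim (simp add: fine_tree_def is_tree_def trunc_1)
  have S: "{t. size_is m t} \<in> sets (Pfin \<theta>)"
    using pred_size_is[of m] by (simp add: pred_def)
  have "(\<integral>\<^sup>+t. indicator {t. size_is m t} t * g (trunc (Suc 0) t) \<partial>Pfin \<theta>) =
    (\<integral>\<^sup>+t. g leaf_tree * indicator {t. size_is m t} t \<partial>Pfin \<theta>)"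
    by (rule nn_integral_cong_AE) (use root in eventually_elim, simp add: mult.commute)
  also have "\<dots> = g leaf_tree * ennreal (wvol m \<theta> / F \<theta>)"
    using S by (simp add: nn_integral_cmult_indicator emeasure_size_is[OF \<theta>])
  also have "\<dots> = (\<integral>\<^sup>+t. ennreal (wvol m \<theta> / F \<theta>) * g leaf_tree \<partial>Pfin \<theta>)"
    using emeasure_space_1 by (simp add: mult.commute)
  also have "\<dots> = (\<integral>\<^sup>+t. ennreal (size_density 0 m \<theta> t) * g (trunc (Suc 0) t) \<partial>Pfin \<theta>)"
    by (rule nn_integral_cong_AE) (use root in eventually_elim, use F\<theta> in simp)
  finally show ?case .
next
  case (Suc n)
  note \<theta> = Suc.prems(1,2)
  note g [measurable] = Suc.prems(3)
  have S [measurable]: "{t. size_is m t} \<in> sets tree_M" for m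
    using pred_size_is[of m] by (simp add: pred_def)
  let ?s = "\<lambda>m t. indicator {t. size_is m t} t :: ennreal"
  let ?d = "\<lambda>m \<theta> t. ennreal (size_density n m \<theta> t)"
  have key: "fin_density \<theta> z * (\<integral>\<^sup>+l. \<integral>\<^sup>+r. ?s m (graft z l r) * g (trunc (Suc (Suc n)) (graft z l r)) \<partial>Pfin (snd z) \<partial>Pfin (fst z)) =
    fin_density \<theta> z * (\<integral>\<^sup>+l. \<integral>\<^sup>+r. ennreal (size_density (Suc n) m \<theta> (graft z l r)) * g (trunc (Suc (Suc n)) (graft z l r)) \<partial>Pfin (snd z) \<partial>Pfin (fst z))" for z
  proof (cases "z \<in> tri \<theta>")
    case True
    note b = tri_bounds[OF True]
    interpret Pz: sigma_finite_measure "Pfin (snd z)" using b by (intro sigma_finite_Pfin)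
    \<comment> \<open>The conditional density is inserted first in the right subtree with the left
      one frozen, then in the left subtree, whose test function is the inner integral.\<close>
    have IH1: "(\<integral>\<^sup>+r. ?s k r * g (graft z l (trunc (Suc n) r)) \<partial>Pfin (snd z)) =
       (\<integral>\<^sup>+r. ?d k (snd z) r * g (graft z l (trunc (Suc n) r)) \<partial>Pfin (snd z))" for k l
      using Suc.IH[of "snd z" "\<lambda>r. g (graft z l r)" k] b by simp
    have IH2: "(\<integral>\<^sup>+l. ?s k l * (\<integral>\<^sup>+r. ?d j (snd z) r * g (graft z (trunc (Suc n) l) (trunc (Suc n) r)) \<partial>Pfin (snd z)) \<partial>Pfin (fst z)) =
       (\<integral>\<^sup>+l. ?d k (fst z) l * (\<integral>\<^sup>+r. ?d j (snd z) r * g (graft z (trunc (Suc n) l) (trunc (Suc n) r)) \<partial>Pfin (snd z)) \<partial>Pfin (fst z))" for k j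
      using Suc.IH[of "fst z" "\<lambda>l. \<integral>\<^sup>+r. ?d j (snd z) r * g (graft z l (trunc (Suc n) r)) \<partial>Pfin (snd z)" k] b by simp
    have "(\<integral>\<^sup>+l. \<integral>\<^sup>+r. ?s m (graft z l r) * g (trunc (Suc (Suc n)) (graft z l r)) \<partial>Pfin (snd z) \<partial>Pfin (fst z)) =
      (\<Sum>k\<le>m. \<integral>\<^sup>+l. ?s k l * (\<integral>\<^sup>+r. ?s (m - k) r * g (graft z (trunc (Suc n) l) (trunc (Suc n) r)) \<partial>Pfin (snd z)) \<partial>Pfin (fst z))"
      unfolding indicator_size_is_graft trunc_graft
      by (rule nn_integral_graft_product[where a = ?s and b = "\<lambda>k. ?s (m - k)"]) (auto intro: Pz.sigma_finite_measure_axioms)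
    also have "\<dots> = (\<Sum>k\<le>m. \<integral>\<^sup>+l. ?d k (fst z) l * (\<integral>\<^sup>+r. ?d (m - k) (snd z) r * g (graft z (trunc (Suc n) l) (trunc (Suc n) r)) \<partial>Pfin (snd z)) \<partial>Pfin (fst z))"
      by (simp only: IH1 IH2)
    also have "\<dots> = (\<integral>\<^sup>+l. \<integral>\<^sup>+r. (\<Sum>k\<le>m. ?d k (fst z) l * ?d (m - k) (snd z) r) * g (graft z (trunc (Suc n) l) (trunc (Suc n) r)) \<partial>Pfin (snd z) \<partial>Pfin (fst z))"
      by (rule nn_integral_graft_product[where a = "\<lambda>k. ?d k (fst z)" and b = "\<lambda>k. ?d (m - k) (snd z)", symmetric])
        (auto intro: Pz.sigma_finite_measure_axioms)
    also have "\<dots> = (\<integral>\<^sup>+l. \<integral>\<^sup>+r. ennreal (size_density (Suc n) m \<theta> (graft z l r)) * g (trunc (Suc (Suc n)) (graft z l r)) \<partial>Pfin (snd z) \<partial>Pfin (fst z))"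
      unfolding density_graft trunc_graft
      by (simp add: sum_ennreal[symmetric] ennreal_mult size_density_nonneg)
    finally show ?thesis by simp
  qed (simp add: fin_density_def)
  have "(\<integral>\<^sup>+t. ?s m t * g (trunc (Suc (Suc n)) t) \<partial>Pfin \<theta>) = ennreal (xc / F \<theta>) * (?s m leaf_tree * g (trunc (Suc (Suc n)) leaf_tree)) +
    (\<integral>\<^sup>+z. fin_density \<theta> z * (\<integral>\<^sup>+l. \<integral>\<^sup>+r. ?s m (graft z l r) * g (trunc (Suc (Suc n)) (graft z l r)) \<partial>Pfin (snd z) \<partial>Pfin (fst z)) \<partial>lborel)"
    by (rule nn_integral_Pfin[OF \<theta>]) measurable
  also have "\<dots> = ennreal (xc / F \<theta>) * (ennreal (size_density (Suc n) m \<theta> leaf_tree) * g (trunc (Suc (Suc n)) leaf_tree)) +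
    (\<integral>\<^sup>+z. fin_density \<theta> z * (\<integral>\<^sup>+l. \<integral>\<^sup>+r. ennreal (size_density (Suc n) m \<theta> (graft z l r)) * g (trunc (Suc (Suc n)) (graft z l r)) \<partial>Pfin (snd z) \<partial>Pfin (fst z)) \<partial>lborel)"
    unfolding key density_leaf by (simp add: size_is_leaf indicator_def)
  also have "\<dots> = (\<integral>\<^sup>+t. ennreal (size_density (Suc n) m \<theta> t) * g (trunc (Suc (Suc n)) t) \<partial>Pfin \<theta>)"
    by (rule nn_integral_Pfin[OF \<theta>, symmetric]) measurable
  finally show ?case .
qed

lemma good_graft_bounds:
  assumes "good \<theta> (graft z l r)" "is_tree l" "is_tree r" "0 \<le> \<theta>"
  shows "z \<in> tri \<theta>" "good (fst z) l" "good (snd z) r"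
  using assms good_graft_iff[of l r \<theta> z] by (auto simp: is_tree_def tri_def)

text \<open>Both assertions are carried through the induction together, because
  \<open>convolution_tendsto\<close> needs the sums as well as the tails of the two factors. The
  parameters of the subtrees are again valid since the tree is good.\<close>

theorem size_density_asymptotics:
  assumes "0 \<le> \<theta>" "\<theta> < pi" "is_tree t" "good \<theta> t"
  shows "(\<lambda>m. size_density n m \<theta> t) sums 1 \<and>
    (\<lambda>m. wt m * size_density n m \<theta> t) \<longlonglongrightarrow> asym_const * inf_density n \<theta> t"
  using assms
proof (induction n arbitrary: \<theta> t)
  case 0
  have F\<theta>: "0 < F \<theta>" "0 < Finf \<theta>" and w: "0 \<le> wvol m \<theta>" for m
    using 0 by (auto intro: F_pos wvol_nonneg Finf_pos)
  have "(\<lambda>m. wvol m \<theta> / F \<theta>) sums (F \<theta> / F \<theta>)"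
    by (intro sums_divide wvol_sums_F)
  moreover have "(\<lambda>m. wt m * wvol m \<theta> / F \<theta>) \<longlonglongrightarrow> asym_const * Finf \<theta> / F \<theta>"
    using F\<theta> by (intro tendsto_divide wvol_asymptotics tendsto_const) auto
  ultimately show ?case using F\<theta> w by simp
next
  case (Suc n)
  from Suc.prems(3) show ?case
  proof (cases rule: tree_cases)
    case 1
    have "(\<lambda>m. if m = 1 then 1 else 0) sums (1::real)" by (rule sums_single)
    moreover have "(\<lambda>m. wt m * (if m = 1 then 1 else 0)) \<longlonglongrightarrow> 0"
    proof (rule tendsto_eventually)
      show "\<forall>\<^sub>F m in sequentially. wt m * (if m = 1 then 1 else 0) = 0"
        using eventually_gt_at_top[of 1] by eventually_elim simp
    qed
    ultimately show ?thesis unfolding 1 density_leaf by simp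
  next
    case (2 z)
    define l r where "l = subL t" and "r = subR t"
    have t: "t = graft z l r" using 2 by (simp add: l_def r_def)
    have lr: "is_tree l" "is_tree r" using 2 by (auto simp: l_def r_def)
    note g = good_graft_bounds[OF Suc.prems(4)[unfolded t] lr Suc.prems(1)]
    note b = tri_bounds[OF g(1)]
    note L = Suc.IH[OF b(1,5) lr(1) g(2)] and R = Suc.IH[OF b(3,6) lr(2) g(3)]
    have "summable (\<lambda>m. norm (size_density n m (fst z) l))" "summable (\<lambda>m. norm (size_density n m (snd z) r))"
      using L R by (auto simp: sums_iff size_density_nonneg)
    from Cauchy_product_sums[OF this]
    have "(\<lambda>m. size_density (Suc n) m \<theta> t) sums 1"
      unfolding t density_graft using L R by (simp add: sums_iff)
    moreover have "(\<lambda>m. wt m * size_density (Suc n) m \<theta> t) \<longlonglongrightarrow>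
        1 * (asym_const * inf_density n (snd z) r) + asym_const * inf_density n (fst z) l * 1"
      unfolding t density_graft using L R by (intro convolution_tendsto size_density_nonneg) auto
    ultimately show ?thesis unfolding t density_graft by (simp add: algebra_simps)
  qed
qed

section \<open>Construction of the infinite tree\<close>

text \<open>A step of the spine is a triple: the side on which the spine continues (\<open>True\<close> is right),
  the root angles \<open>(\<alpha>, \<beta>)\<close> and the finite subtree on the other side.\<close>
type_synonym step = "bool \<times> (real \<times> real) \<times> atree"

definition step_M :: "step measure" where
  "step_M = count_space UNIV \<Otimes>\<^sub>M borel \<Otimes>\<^sub>M tree_M"

section \<open>The law of one step of the spine at angle 0\<close>

definition root_density :: "bool \<Rightarrow> real \<times> real \<Rightarrow> ennreal" where
  "root_density d z = indicator (tri 0) z * ennreal (if d then F (fst z) * Finf (snd z) else Finf (fst z) * F (snd z))"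

definition root_law :: "(bool \<times> real \<times> real) measure" where
  "root_law = density (count_space UNIV \<Otimes>\<^sub>M lborel) (\<lambda>x. root_density (fst x) (snd x))"

definition step_law :: "step measure" where
  "step_law = root_law \<bind> (\<lambda>x. distr (fin_law (if fst x then fst (snd x) else snd (snd x))) step_M (\<lambda>t. (fst x, snd x, t)))"

lemma measurable_root_density [measurable]: "root_density d \<in> borel_measurable borel"
  unfolding root_density_def[abs_def] by (cases d) (simp_all, measurable)

lemma measurable_root_density_pair [measurable]:
  "(\<lambda>x. root_density (fst x) (snd x)) \<in> borel_measurable (count_space UNIV \<Otimes>\<^sub>M borel)"
  by (rule measurable_compose_countable'[where f = "\<lambda>d x. root_density d (snd x)" and g = fst and I = UNIV])
    auto

lemma sets_root_law [measurable_cong]: "sets root_law = sets (count_space UNIV \<Otimes>\<^sub>M borel)"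
  unfolding root_law_def sets_density by (rule sets_pair_measure_cong) simp_all

lemma space_root_law [simp]: "space root_law = UNIV"
  using sets_eq_imp_space_eq[OF sets_root_law] by (simp add: space_pair_measure)

lemma space_step_M [simp]: "space step_M = UNIV"
  by (simp add: step_M_def space_pair_measure)

lemma nn_integral_root_law:
  assumes [measurable]: "f \<in> borel_measurable (count_space UNIV \<Otimes>\<^sub>M borel)"
  shows "(\<integral>\<^sup>+x. f x \<partial>root_law) =
    (\<integral>\<^sup>+z. root_density True z * f (True, z) \<partial>lborel) + (\<integral>\<^sup>+z. root_density False z * f (False, z) \<partial>lborel)"
proof -
  have s: "sets (count_space UNIV \<Otimes>\<^sub>M lborel :: (bool \<times> real \<times> real) measure) = sets (count_space UNIV \<Otimes>\<^sub>M borel)"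
    by (rule sets_pair_measure_cong) simp_all
  note [measurable_cong] = s
  have "(\<integral>\<^sup>+x. f x \<partial>root_law) = (\<integral>\<^sup>+x. root_density (fst x) (snd x) * f x \<partial>(count_space UNIV \<Otimes>\<^sub>M lborel))"
    unfolding root_law_def by (rule nn_integral_density) measurable
  also have "\<dots> = (\<integral>\<^sup>+d. \<integral>\<^sup>+z. root_density (fst (d, z)) (snd (d, z)) * f (d, z) \<partial>lborel \<partial>count_space UNIV)"
    by (rule lborel.nn_integral_fst[symmetric]) measurable
  finally show ?thesis by (simp add: nn_integral_count_space_finite UNIV_bool)
qed

text \<open>The integral equation read probabilistically: at angle 0 the event \<theta> < \<alpha> +
  \<beta> has probability \<open>Finf \<theta>\<close>. The step at angle \<theta> is therefore the
  step at angle 0 conditioned on this event.\<close>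

lemma nn_integral_root_density:
  "(\<integral>\<^sup>+z. indicator {z. \<theta> < fst z + snd z} z * root_density True z \<partial>lborel) +
   (\<integral>\<^sup>+z. indicator {z. \<theta> < fst z + snd z} z * root_density False z \<partial>lborel) = ennreal (Finf \<theta>)"
  if \<theta>: "0 \<le> \<theta>" "\<theta> < pi"
proof -
  have t: "indicator {z. \<theta> < fst z + snd z} z * indicator (tri 0) z = (indicator (tri \<theta>) z :: ennreal)" for z
    using \<theta> by (auto simp: indicator_def tri_def)
  have m: "{z :: real \<times> real. \<theta> < fst z + snd z} \<in> sets borel"
  proof -
    have "{z \<in> space borel. \<theta> < fst z + snd z} \<in> sets (borel :: (real \<times> real) measure)" by measurable
    then show ?thesis by simp
  qed
  have "(\<integral>\<^sup>+z. indicator {z. \<theta> < fst z + snd z} z * root_density True z \<partial>lborel) +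
     (\<integral>\<^sup>+z. indicator {z. \<theta> < fst z + snd z} z * root_density False z \<partial>lborel) =
     (\<integral>\<^sup>+z. indicator {z. \<theta> < fst z + snd z} z * root_density True z + indicator {z. \<theta> < fst z + snd z} z * root_density False z \<partial>lborel)"
    by (rule nn_integral_add[symmetric]) (use m in measurable)
  also have "\<dots> = (\<integral>\<^sup>+z. indicator (tri \<theta>) z * (ennreal (F (fst z) * Finf (snd z)) + ennreal (Finf (fst z) * F (snd z))) \<partial>lborel)"
    by (intro nn_integral_cong) (simp add: root_density_def mult.assoc[symmetric] t distrib_left)
  also have "\<dots> = ennreal (Finf \<theta>)"
    using \<theta> by (intro nn_integral_Finf_equation) auto
  finally show ?thesis .
qed

lemma prob_space_root_law: "prob_space root_law"
proof (rule prob_spaceI)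
  have "emeasure root_law (space root_law) = (\<integral>\<^sup>+x. 1 \<partial>root_law)" by simp
  also have "\<dots> = (\<integral>\<^sup>+z. root_density True z \<partial>lborel) + (\<integral>\<^sup>+z. root_density False z \<partial>lborel)"
    by (subst nn_integral_root_law) simp_all
  also have "\<dots> = (\<integral>\<^sup>+z. indicator {z. 0 < fst z + snd z} z * root_density True z \<partial>lborel) +
     (\<integral>\<^sup>+z. indicator {z. 0 < fst z + snd z} z * root_density False z \<partial>lborel)"
    by (intro arg_cong2[of _ _ _ _ "(+)"] nn_integral_cong) (auto simp: root_density_def indicator_def tri_def)
  also have "\<dots> = 1" using nn_integral_root_density[of 0] pi_gt_zero by simp
  finally show "emeasure root_law (space root_law) = 1" .
qed

lemma measurable_step_kernel [measurable]:
  "(\<lambda>x. distr (fin_law (if fst x then fst (snd x) else snd (snd x))) step_M (\<lambda>t. (fst x, snd x, t)))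
    \<in> count_space UNIV \<Otimes>\<^sub>M borel \<rightarrow>\<^sub>M subprob_algebra step_M"
proof (rule measurable_distr2[where M = tree_M])
  show "(\<lambda>(x, t). (fst x, snd x, t)) \<in> (count_space UNIV \<Otimes>\<^sub>M borel) \<Otimes>\<^sub>M tree_M \<rightarrow>\<^sub>M step_M"
    unfolding step_M_def by measurable
  have "(\<lambda>x :: bool \<times> real \<times> real. if fst x then fst (snd x) else snd (snd x)) \<in> count_space UNIV \<Otimes>\<^sub>M borel \<rightarrow>\<^sub>M borel"
    by measurable
  from measurable_compose[OF this measurable_fin_law]
  show "(\<lambda>x. fin_law (if fst x then fst (snd x) else snd (snd x))) \<in> count_space UNIV \<Otimes>\<^sub>M borel \<rightarrow>\<^sub>M subprob_algebra tree_M" .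
qed

lemma measurable_step_kernel' [measurable]:
  "(\<lambda>x. distr (fin_law (if fst x then fst (snd x) else snd (snd x))) step_M (\<lambda>t. (fst x, snd x, t)))
    \<in> root_law \<rightarrow>\<^sub>M subprob_algebra step_M"
  using measurable_step_kernel by (simp add: measurable_cong_sets[OF sets_root_law refl])

lemma sets_step_law [measurable_cong]: "sets step_law = sets step_M"
  unfolding step_law_def by (rule sets_bind) simp_all

lemma space_step_law [simp]: "space step_law = UNIV"
  using sets_eq_imp_space_eq[OF sets_step_law] by simp

lemma nn_integral_step_law:
  assumes f [measurable]: "f \<in> borel_measurable step_M"
  shows "(\<integral>\<^sup>+x. f x \<partial>step_law) =
    (\<integral>\<^sup>+z. root_density True z * (\<integral>\<^sup>+t. f (True, z, t) \<partial>Pfin (fst z)) \<partial>lborel) +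
    (\<integral>\<^sup>+z. root_density False z * (\<integral>\<^sup>+t. f (False, z, t) \<partial>Pfin (snd z)) \<partial>lborel)"
proof -
  let ?k = "\<lambda>x. fin_law (if fst x then fst (snd x) else snd (snd x))"
  have "(\<integral>\<^sup>+x. f x \<partial>step_law) = (\<integral>\<^sup>+x. \<integral>\<^sup>+y. f y \<partial>distr (?k x) step_M (\<lambda>t. (fst x, snd x, t)) \<partial>root_law)"
    unfolding step_law_def by (rule nn_integral_bind[OF f measurable_step_kernel'])
  also have "\<dots> = (\<integral>\<^sup>+x. \<integral>\<^sup>+t. f (fst x, snd x, t) \<partial>?k x \<partial>root_law)"
  proof (rule nn_integral_cong, rule nn_integral_distr)
    fix x show "(\<lambda>t. (fst x, snd x, t)) \<in> ?k x \<rightarrow>\<^sub>M step_M"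
      unfolding step_M_def by measurable
    show "f \<in> borel_measurable (distr (?k x) step_M (\<lambda>t. (fst x, snd x, t)))"
      using f by simp
  qed
  also have "\<dots> = (\<integral>\<^sup>+z. root_density True z * (\<integral>\<^sup>+t. f (True, z, t) \<partial>fin_law (fst z)) \<partial>lborel) +
    (\<integral>\<^sup>+z. root_density False z * (\<integral>\<^sup>+t. f (False, z, t) \<partial>fin_law (snd z)) \<partial>lborel)"
  proof (subst nn_integral_root_law)
    have "(\<lambda>x. \<integral>\<^sup>+y. f y \<partial>distr (?k x) step_M (\<lambda>t. (fst x, snd x, t))) \<in> borel_measurable (count_space UNIV \<Otimes>\<^sub>M borel)"
      by measurable
    moreover have "(\<integral>\<^sup>+y. f y \<partial>distr (?k x) step_M (\<lambda>t. (fst x, snd x, t))) = (\<integral>\<^sup>+t. f (fst x, snd x, t) \<partial>?k x)" for x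
    proof (rule nn_integral_distr)
      show "(\<lambda>t. (fst x, snd x, t)) \<in> ?k x \<rightarrow>\<^sub>M step_M"
        unfolding step_M_def by measurable
    qed (use f in simp)
    ultimately show "(\<lambda>x. \<integral>\<^sup>+t. f (fst x, snd x, t) \<partial>?k x) \<in> borel_measurable (count_space UNIV \<Otimes>\<^sub>M borel)"
      by simp
  qed simp
  also have "\<dots> = (\<integral>\<^sup>+z. root_density True z * (\<integral>\<^sup>+t. f (True, z, t) \<partial>Pfin (fst z)) \<partial>lborel) +
    (\<integral>\<^sup>+z. root_density False z * (\<integral>\<^sup>+t. f (False, z, t) \<partial>Pfin (snd z)) \<partial>lborel)"
  proof (intro arg_cong2[of _ _ _ _ "(+)"] nn_integral_cong)
    fix z :: "real \<times> real"
    show "root_density True z * (\<integral>\<^sup>+t. f (True, z, t) \<partial>fin_law (fst z)) = root_density True z * (\<integral>\<^sup>+t. f (True, z, t) \<partial>Pfin (fst z))"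
      "root_density False z * (\<integral>\<^sup>+t. f (False, z, t) \<partial>fin_law (snd z)) = root_density False z * (\<integral>\<^sup>+t. f (False, z, t) \<partial>Pfin (snd z))"
      by (cases "z \<in> tri 0"; auto simp: root_density_def fin_law_eq tri_bounds)+
  qed
  finally show ?thesis .
qed

lemma prob_space_step_law: "prob_space step_law"
proof (rule prob_spaceI)
  have "emeasure step_law (space step_law) = (\<integral>\<^sup>+x. 1 \<partial>step_law)" by simp
  also have "\<dots> = (\<integral>\<^sup>+z. root_density True z \<partial>lborel) + (\<integral>\<^sup>+z. root_density False z \<partial>lborel)"
  proof (subst nn_integral_step_law)
    have "root_density d z * (\<integral>\<^sup>+t. 1 \<partial>Pfin (f z)) = root_density d z"
      if "f = fst \<or> f = snd" for d z and f :: "real \<times> real \<Rightarrow> real"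
    proof (cases "z \<in> tri 0")
      case True
      then have "prob_space (Pfin (f z))"
        using that tri_bounds[OF True] by (auto intro: prob_space_Pfin)
      then show ?thesis using prob_space.emeasure_space_1 by fastforce
    qed (simp add: root_density_def)
    then show "(\<integral>\<^sup>+z. root_density True z * (\<integral>\<^sup>+t. 1 \<partial>Pfin (fst z)) \<partial>lborel) +
      (\<integral>\<^sup>+z. root_density False z * (\<integral>\<^sup>+t. 1 \<partial>Pfin (snd z)) \<partial>lborel) =
      (\<integral>\<^sup>+z. root_density True z \<partial>lborel) + (\<integral>\<^sup>+z. root_density False z \<partial>lborel)" by simp
  qed simp
  also have "\<dots> = (\<integral>\<^sup>+x. 1 \<partial>root_law)"
    by (subst nn_integral_root_law) simp_all
  also have "\<dots> = 1"
    using prob_space.emeasure_space_1[OF prob_space_root_law] by simp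
  finally show "emeasure step_law (space step_law) = 1" .
qed

section \<open>Rejection sampling\<close>

definition step_sum :: "step \<Rightarrow> real" where
  "step_sum x = fst (fst (snd x)) + snd (fst (snd x))"

lemma measurable_step_sum [measurable]: "step_sum \<in> borel_measurable step_M"
  unfolding step_sum_def[abs_def] step_M_def by measurable

text \<open>Conditioning the step law at \<open>\<theta> = 0\<close> on \<open>\<theta> < \<alpha> + \<beta>\<close>, realised by rejection sampling.\<close>
definition pick :: "real \<Rightarrow> step stream \<Rightarrow> step" where
  "pick \<theta> s = (if \<exists>n. \<theta> < step_sum (s !! n) then s !! (LEAST n. \<theta> < step_sum (s !! n)) else (True, (0, 0), leaf_tree))"

lemma pick_Stream: "pick \<theta> (x ## s) = (if \<theta> < step_sum x then x else pick \<theta> s)"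
proof (cases "\<theta> < step_sum x")
  case True
  then have "(LEAST n. \<theta> < step_sum ((x ## s) !! n)) = 0" by (intro Least_equality) auto
  moreover have "\<exists>n. \<theta> < step_sum ((x ## s) !! n)" using True by (intro exI[of _ 0]) simp
  ultimately show ?thesis using True by (simp add: pick_def)
next
  case False
  have ex: "(\<exists>n. \<theta> < step_sum ((x ## s) !! n)) \<longleftrightarrow> (\<exists>n. \<theta> < step_sum (s !! n))"
  proof
    assume "\<exists>n. \<theta> < step_sum ((x ## s) !! n)"
    then obtain n where "\<theta> < step_sum ((x ## s) !! n)" by blast
    then show "\<exists>n. \<theta> < step_sum (s !! n)" using False by (cases n) auto
  next
    assume "\<exists>n. \<theta> < step_sum (s !! n)"
    then obtain n where "\<theta> < step_sum (s !! n)" by blast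
    then show "\<exists>n. \<theta> < step_sum ((x ## s) !! n)" by (intro exI[of _ "Suc n"]) simp
  qed
  show ?thesis
  proof (cases "\<exists>n. \<theta> < step_sum (s !! n)")
    case True
    then obtain n where "\<theta> < step_sum (s !! n)" by blast
    then have "(LEAST n. \<theta> < step_sum ((x ## s) !! n)) = Suc (LEAST n. \<theta> < step_sum ((x ## s) !! Suc n))"
      using False by (intro Least_Suc[of _ "Suc n"]) auto
    then show ?thesis using False True ex by (simp add: pick_def)
  next
    case F: False
    then show ?thesis using False ex by (simp add: pick_def)
  qed
qed

lemma measurable_pick: "(\<lambda>x. pick (fst x) (snd x)) \<in> borel \<Otimes>\<^sub>M stream_space step_M \<rightarrow>\<^sub>M step_M"
proof -
  have [measurable]: "(\<lambda>x. (LEAST n. fst x < step_sum (snd x !! n))) \<in> borel \<Otimes>\<^sub>M stream_space step_M \<rightarrow>\<^sub>M count_space UNIV"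
    by (rule measurable_Least) measurable
  have [measurable]: "(\<lambda>x. snd x !! (LEAST n. fst x < step_sum (snd x !! n))) \<in> borel \<Otimes>\<^sub>M stream_space step_M \<rightarrow>\<^sub>M step_M"
    by (rule measurable_compose_countable[where f = "\<lambda>n x. snd x !! n"]) measurable
  show ?thesis unfolding pick_def by measurable
qed

lemma measurable_pick' [measurable (raw)]:
  assumes "f \<in> N \<rightarrow>\<^sub>M borel" "g \<in> N \<rightarrow>\<^sub>M stream_space step_M"
  shows "(\<lambda>x. pick (f x) (g x)) \<in> N \<rightarrow>\<^sub>M step_M"
  using measurable_compose[OF measurable_Pair[OF assms] measurable_pick] by simp

lemma sets_stream_step_law [measurable_cong]:
  "sets (stream_space step_law) = sets (stream_space step_M)"
  by (rule sets_stream_space_cong[OF sets_step_law])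

lemma nn_integral_step_indicator:
  assumes \<theta>: "0 \<le> \<theta>" "\<theta> < pi"
  shows "emeasure step_law {x. \<theta> < step_sum x} = ennreal (Finf \<theta>)"
proof -
  have m: "{x. \<theta> < step_sum x} \<in> sets step_M"
  proof -
    have "{x \<in> space step_M. \<theta> < step_sum x} \<in> sets step_M" by measurable
    then show ?thesis by simp
  qed
  have e: "root_density d z * (\<integral>\<^sup>+t. indicator {x. \<theta> < step_sum x} (d, z, t) \<partial>Pfin (f z)) =
     indicator {z. \<theta> < fst z + snd z} z * root_density d z"
    if "f = fst \<or> f = snd" for d z and f :: "real \<times> real \<Rightarrow> real"
  proof (cases "z \<in> tri 0")
    case True
    then have P: "emeasure (Pfin (f z)) UNIV = 1"
      using that tri_bounds[OF True] prob_space.emeasure_space_1[OF prob_space_Pfin] by fastforce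
    have "(\<integral>\<^sup>+t. indicator {x. \<theta> < step_sum x} (d, z, t) \<partial>Pfin (f z)) =
      (\<integral>\<^sup>+t. indicator {z. \<theta> < fst z + snd z} z \<partial>Pfin (f z))"
      by (intro nn_integral_cong) (simp add: indicator_def step_sum_def)
    also have "\<dots> = indicator {z. \<theta> < fst z + snd z} z" by (simp add: P)
    finally show ?thesis by (simp add: mult.commute)
  qed (simp add: root_density_def)
  have "emeasure step_law {x. \<theta> < step_sum x} = (\<integral>\<^sup>+x. indicator {x. \<theta> < step_sum x} x \<partial>step_law)"
    using m sets_step_law by simp
  also have "\<dots> = ennreal (Finf \<theta>)"
    using m by (subst nn_integral_step_law) (simp_all add: e nn_integral_root_density[OF \<theta>])
  finally show ?thesis .
qed

text \<open>By \<open>pick_Stream\<close> the probability I of a set A satisfies I = P(accepted and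
  in A) + I P(rejected). The acceptance probability \<open>Finf \<theta>\<close> is positive, so the
  equation determines I.\<close>

lemma nn_integral_pick:
  assumes \<theta>: "0 \<le> \<theta>" "\<theta> < pi" and g [measurable]: "g \<in> borel_measurable step_M"
  shows "(\<integral>\<^sup>+s. g (pick \<theta> s) \<partial>stream_space step_law) =
    (\<integral>\<^sup>+x. ennreal (1 / Finf \<theta>) * (indicator {x. \<theta> < step_sum x} x * g x) \<partial>step_law)"
proof -
  interpret N: prob_space step_law by (rule prob_space_step_law)
  interpret S: prob_space "stream_space step_law" by (rule N.prob_space_stream_space)
  have F: "0 < Finf \<theta>" by (rule Finf_pos[OF \<theta>])
  let ?acc = "{x. \<theta> < step_sum x}"
  have acc [measurable]: "?acc \<in> sets step_M"
  proof -
    have "{x \<in> space step_M. \<theta> < step_sum x} \<in> sets step_M" by measurable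
    then show ?thesis by simp
  qed
  have pm [measurable]: "pick \<theta> \<in> stream_space step_law \<rightarrow>\<^sub>M step_M"
    using measurable_pick'[of "\<lambda>_. \<theta>" "stream_space step_law" "\<lambda>s. s"] by simp
  define D where "D = density step_law (\<lambda>x. ennreal (1 / Finf \<theta>) * indicator ?acc x)"
  have "distr (stream_space step_law) step_M (pick \<theta>) = D"
  proof (rule measure_eqI)
    show "sets (distr (stream_space step_law) step_M (pick \<theta>)) = sets D"
      by (simp add: D_def sets_step_law)
    fix A assume "A \<in> sets (distr (stream_space step_law) step_M (pick \<theta>))"
    then have A [measurable]: "A \<in> sets step_M" by simp
    define I where "I = (\<integral>\<^sup>+s. indicator A (pick \<theta> s) \<partial>stream_space step_law)"
    have I: "I = emeasure (distr (stream_space step_law) step_M (pick \<theta>)) A"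
    proof -
      have "emeasure (distr (stream_space step_law) step_M (pick \<theta>)) A = (\<integral>\<^sup>+x. indicator A x \<partial>distr (stream_space step_law) step_M (pick \<theta>))"
        by simp
      also have "\<dots> = I" unfolding I_def by (rule nn_integral_distr) measurable
      finally show ?thesis ..
    qed
    have "I \<le> 1"
      unfolding I using prob_space.emeasure_le_1[OF S.prob_space_distr[OF pm]] .
    \<comment> \<open>Finiteness is what permits solving the equation for I in the reals.\<close>
    then have Ifin: "I \<noteq> \<top>" by (auto simp: top_unique)
    have "I = (\<integral>\<^sup>+x. \<integral>\<^sup>+s. indicator A (pick \<theta> (x ## s)) \<partial>stream_space step_law \<partial>step_law)"
      unfolding I_def by (rule N.nn_integral_stream_space) measurable
    also have "\<dots> = (\<integral>\<^sup>+x. indicator (?acc \<inter> A) x + I * indicator (- ?acc) x \<partial>step_law)"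
    proof (rule nn_integral_cong)
      fix x
      show "(\<integral>\<^sup>+s. indicator A (pick \<theta> (x ## s)) \<partial>stream_space step_law) = indicator (?acc \<inter> A) x + I * indicator (- ?acc) x"
        using S.emeasure_space_1 by (cases "\<theta> < step_sum x") (simp_all add: pick_Stream I_def indicator_inter_arith)
    qed
    also have "\<dots> = emeasure step_law (?acc \<inter> A) + I * emeasure step_law (- ?acc)"
    proof -
      have c: "- ?acc \<in> sets step_law" "?acc \<inter> A \<in> sets step_law"
        using sets.compl_sets[OF acc] acc A by (auto simp: sets_step_law Compl_eq_Diff_UNIV)
      then show ?thesis by (subst nn_integral_add) (auto simp: nn_integral_cmult_indicator)
    qed
    also have "emeasure step_law (- ?acc) = ennreal (1 - Finf \<theta>)"
    proof -
      have "N.prob ?acc = Finf \<theta>"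
        using nn_integral_step_indicator[OF \<theta>] F by (simp add: N.emeasure_eq_measure)
      then have "N.prob (space step_law - ?acc) = 1 - Finf \<theta>"
        using acc sets_step_law by (subst N.prob_compl) auto
      then show ?thesis by (simp add: N.emeasure_eq_measure Compl_eq_Diff_UNIV)
    qed
    finally have eq: "I = emeasure step_law (?acc \<inter> A) + I * ennreal (1 - Finf \<theta>)" .
    have "Finf \<theta> \<le> 1"
      using nn_integral_step_indicator[OF \<theta>] F N.emeasure_le_1[of ?acc] by (simp add: ennreal_le_1)
    obtain i where i: "I = ennreal i" "0 \<le> i" using Ifin by (cases I) auto
    have "ennreal i = ennreal (N.prob (?acc \<inter> A) + i * (1 - Finf \<theta>))"
      using eq \<open>Finf \<theta> \<le> 1\<close> i by (simp add: N.emeasure_eq_measure ennreal_mult)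
    then have "i = N.prob (?acc \<inter> A) + i * (1 - Finf \<theta>)"
      using i \<open>Finf \<theta> \<le> 1\<close> by (subst (asm) ennreal_inj) auto
    then have "i = 1 / Finf \<theta> * N.prob (?acc \<inter> A)"
      using F by (simp add: field_simps)
    then have "I = ennreal (1 / Finf \<theta>) * emeasure step_law (?acc \<inter> A)"
      using i F by (simp add: N.emeasure_eq_measure ennreal_mult[symmetric])
    also have "\<dots> = emeasure D A"
    proof -
      have "emeasure D A = (\<integral>\<^sup>+x. ennreal (1 / Finf \<theta>) * indicator (?acc \<inter> A) x \<partial>step_law)"
        unfolding D_def using A by (subst emeasure_density) (auto simp: sets_step_law indicator_inter_arith mult.assoc)
      also have "\<dots> = ennreal (1 / Finf \<theta>) * emeasure step_law (?acc \<inter> A)"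
        using acc A by (subst nn_integral_cmult_indicator) (auto simp: sets_step_law)
      finally show ?thesis ..
    qed
    finally show "emeasure (distr (stream_space step_law) step_M (pick \<theta>)) A = emeasure D A"
      by (simp add: I)
  qed
  then have "(\<integral>\<^sup>+s. g (pick \<theta> s) \<partial>stream_space step_law) = (\<integral>\<^sup>+x. g x \<partial>D)"
    by (subst nn_integral_distr[symmetric, OF pm]) auto
  also have "\<dots> = (\<integral>\<^sup>+x. ennreal (1 / Finf \<theta>) * indicator ?acc x * g x \<partial>step_law)"
    unfolding D_def by (rule nn_integral_density) measurable
  finally show ?thesis by (simp only: mult.assoc)
qed

text \<open>Each stream of \<omega> holds the proposals for one spine vertex. Recursion runs over
  the address: it follows the spine as long as the address does and otherwise looks up the finite
  side tree, so an infinite tree arises without corecursion, coordinate by coordinate and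
  measurably. Clamping keeps the angle in range on exceptional inputs.\<close>

fun spine_node :: "bool list \<Rightarrow> real \<Rightarrow> step stream stream \<Rightarrow> node" where
  "spine_node [] \<theta> \<omega> = nd (fst (snd (pick \<theta> (shd \<omega>))))"
| "spine_node (c # p) \<theta> \<omega> = (let x = pick \<theta> (shd \<omega>) in
     if c = fst x then spine_node p (clamp_angle (if c then snd (fst (snd x)) else fst (fst (snd x)))) (stl \<omega>)
     else snd (snd x) p)"

definition spine_from :: "real \<Rightarrow> step stream stream \<Rightarrow> atree" where
  "spine_from \<theta> \<omega> = (\<lambda>p. spine_node p \<theta> \<omega>)"

lemma spine_from_Stream:
  "spine_from \<theta> (s ## \<omega>) = (case pick \<theta> s of (d, z, t) \<Rightarrow>
     if d then graft z t (spine_from (clamp_angle (snd z)) \<omega>) else graft z (spine_from (clamp_angle (fst z)) \<omega>) t)"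
proof
  fix p
  obtain d z t where x: "pick \<theta> s = (d, z, t)" by (cases "pick \<theta> s")
  show "spine_from \<theta> (s ## \<omega>) p = (case pick \<theta> s of (d, z, t) \<Rightarrow>
     if d then graft z t (spine_from (clamp_angle (snd z)) \<omega>) else graft z (spine_from (clamp_angle (fst z)) \<omega>) t) p"
  proof (cases p)
    case Nil
    then show ?thesis by (simp add: spine_from_def x)
  next
    case (Cons c q)
    then show ?thesis by (cases c; cases d) (simp_all add: spine_from_def x)
  qed
qed

lemma infinite_supp_spine_from: "infinite (supp (spine_from \<theta> \<omega>))"
proof -
  have "\<exists>p. length p = n \<and> spine_node p \<theta> \<omega> \<noteq> None" for n
  proof (induction n arbitrary: \<theta> \<omega>)
    case 0
    then show ?case by (intro exI[of _ "[]"]) simp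
  next
    case (Suc n)
    define x where "x = pick \<theta> (shd \<omega>)"
    obtain p where "length p = n"
      "spine_node p (clamp_angle (if fst x then snd (fst (snd x)) else fst (fst (snd x)))) (stl \<omega>) \<noteq> None"
      using Suc by blast
    then show ?case
      by (intro exI[of _ "fst x # p"]) (cases "fst x"; simp add: x_def[symmetric] Let_def)
  qed
  then show ?thesis
    unfolding finite_supp_iff spine_from_def by (metis order_refl)
qed

lemma measurable_spine_node:
  "(\<lambda>x. spine_node p (fst x) (snd x)) \<in> borel \<Otimes>\<^sub>M stream_space (stream_space step_M) \<rightarrow>\<^sub>M node_M"
proof (induction p)
  case Nil
  have [measurable]: "(\<lambda>x::step. fst (snd x)) \<in> step_M \<rightarrow>\<^sub>M borel" unfolding step_M_def by measurable
  show ?case unfolding spine_node.simps by measurable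
next
  case (Cons c p)
  have [measurable]: "fst \<in> step_M \<rightarrow>\<^sub>M count_space UNIV" "(\<lambda>x::step. fst (snd x)) \<in> step_M \<rightarrow>\<^sub>M borel"
    "(\<lambda>x::step. snd (snd x)) \<in> step_M \<rightarrow>\<^sub>M tree_M"
    unfolding step_M_def by measurable
  let ?x = "\<lambda>w. pick (fst w) (shd (snd w)) :: step"
  have "(\<lambda>w. (clamp_angle (if c then snd (fst (snd (?x w))) else fst (fst (snd (?x w)))), stl (snd w)))
     \<in> borel \<Otimes>\<^sub>M stream_space (stream_space step_M) \<rightarrow>\<^sub>M borel \<Otimes>\<^sub>M stream_space (stream_space step_M)"
    by (cases c) (simp_all, measurable)
  from measurable_compose[OF this Cons.IH]
  have [measurable]: "(\<lambda>w. spine_node p (clamp_angle (if c then snd (fst (snd (?x w))) else fst (fst (snd (?x w))))) (stl (snd w)))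
     \<in> borel \<Otimes>\<^sub>M stream_space (stream_space step_M) \<rightarrow>\<^sub>M node_M" by simp
  show ?case unfolding spine_node.simps Let_def by measurable
qed

lemma measurable_spine_from [measurable (raw)]:
  assumes "f \<in> N \<rightarrow>\<^sub>M borel" "g \<in> N \<rightarrow>\<^sub>M stream_space (stream_space step_M)"
  shows "(\<lambda>x. spine_from (f x) (g x)) \<in> N \<rightarrow>\<^sub>M tree_M"
proof (rule measurable_tree_M_I)
  fix p
  from measurable_compose[OF measurable_Pair[OF assms] measurable_spine_node, of p]
  show "(\<lambda>x. spine_from (f x) (g x) p) \<in> N \<rightarrow>\<^sub>M node_M" by (simp add: spine_from_def)
qed

definition inf_law :: "real \<Rightarrow> atree measure" where
  "inf_law \<theta> = distr (stream_space (stream_space step_law)) tree_M (spine_from (clamp_angle \<theta>))"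

lemma sets_stream_stream_step_law [measurable_cong]:
  "sets (stream_space (stream_space step_law)) = sets (stream_space (stream_space step_M))"
  by (rule sets_stream_space_cong[OF sets_stream_step_law])

lemma prob_space_stream_stream: "prob_space (stream_space (stream_space step_law))"
  by (intro prob_space.prob_space_stream_space prob_space_step_law)

lemma sets_inf_law [simp, measurable_cong]: "sets (inf_law \<theta>) = sets tree_M"
  by (simp add: inf_law_def)

lemma space_inf_law [simp]: "space (inf_law \<theta>) = UNIV"
  by (simp add: inf_law_def)

lemma prob_space_inf_law: "prob_space (inf_law \<theta>)"
  unfolding inf_law_def by (rule prob_space.prob_space_distr[OF prob_space_stream_stream]) measurable

lemma measurable_inf_law [measurable]: "inf_law \<in> borel \<rightarrow>\<^sub>M subprob_algebra tree_M"
  unfolding inf_law_def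
proof (rule measurable_distr2[where M = "stream_space (stream_space step_law)"])
  show "(\<lambda>(\<theta>, \<omega>). spine_from (clamp_angle \<theta>) \<omega>) \<in> borel \<Otimes>\<^sub>M stream_space (stream_space step_law) \<rightarrow>\<^sub>M tree_M"
    by measurable
  show "(\<lambda>\<theta>. stream_space (stream_space step_law)) \<in> borel \<rightarrow>\<^sub>M subprob_algebra (stream_space (stream_space step_law))"
    by (rule measurable_const)
      (simp add: space_subprob_algebra prob_space_imp_subprob_space[OF prob_space_stream_stream])
qed

lemma AE_inf_law_infinite: "AE t in inf_law \<theta>. infinite (supp t)"
proof -
  have "{t \<in> space tree_M. infinite (supp t)} \<in> sets tree_M" by measurable
  moreover have "spine_from (clamp_angle \<theta>) \<in> stream_space (stream_space step_law) \<rightarrow>\<^sub>M tree_M"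
    by measurable
  ultimately show ?thesis
    unfolding inf_law_def by (subst AE_distr_iff) (simp_all add: infinite_supp_spine_from)
qed

definition spine_density :: "real \<Rightarrow> bool \<Rightarrow> real \<times> real \<Rightarrow> ennreal" where
  "spine_density \<theta> d z = indicator (tri \<theta>) z *
     ennreal ((if d then F (fst z) * Finf (snd z) else Finf (fst z) * F (snd z)) / Finf \<theta>)"

text \<open>The first stream fixes the root and the finite side; the remaining streams are an
  independent copy of the whole input and rebuild the law at the angle of the infinite side.
  Restricting the step at angle 0 and dividing by \<open>Finf \<theta>\<close> produces
  \<open>spine_density\<close>.\<close>

theorem nn_integral_inf_law:
  assumes \<theta>: "0 \<le> \<theta>" "\<theta> < pi" and h [measurable]: "h \<in> borel_measurable tree_M"
  shows "(\<integral>\<^sup>+t. h t \<partial>inf_law \<theta>) =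
    (\<integral>\<^sup>+z. spine_density \<theta> True z * (\<integral>\<^sup>+l. \<integral>\<^sup>+r. h (graft z l r) \<partial>inf_law (snd z) \<partial>Pfin (fst z)) \<partial>lborel) +
    (\<integral>\<^sup>+z. spine_density \<theta> False z * (\<integral>\<^sup>+r. \<integral>\<^sup>+l. h (graft z l r) \<partial>inf_law (fst z) \<partial>Pfin (snd z)) \<partial>lborel)"
proof -
  let ?S = "stream_space step_law" and ?SS = "stream_space (stream_space step_law)"
  interpret S: prob_space ?S by (intro prob_space.prob_space_stream_space prob_space_step_law)
  have Fp: "0 < Finf \<theta>" by (rule Finf_pos[OF \<theta>])
  define G where "G x = (if fst x then \<integral>\<^sup>+r. h (graft (fst (snd x)) (snd (snd x)) r) \<partial>inf_law (snd (fst (snd x)))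
     else \<integral>\<^sup>+l. h (graft (fst (snd x)) l (snd (snd x))) \<partial>inf_law (fst (fst (snd x))))" for x :: step
  have pr [measurable]: "fst \<in> step_M \<rightarrow>\<^sub>M count_space UNIV" "(\<lambda>x::step. fst (snd x)) \<in> step_M \<rightarrow>\<^sub>M borel"
    "(\<lambda>x::step. snd (snd x)) \<in> step_M \<rightarrow>\<^sub>M tree_M"
    unfolding step_M_def by measurable
  have k: "(\<lambda>x::step. inf_law (snd (fst (snd x)))) \<in> step_M \<rightarrow>\<^sub>M subprob_algebra tree_M"
    "(\<lambda>x::step. inf_law (fst (fst (snd x)))) \<in> step_M \<rightarrow>\<^sub>M subprob_algebra tree_M"
    by (rule measurable_compose[OF _ measurable_inf_law], measurable)+
  have G [measurable]: "G \<in> borel_measurable step_M"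
  proof -
    have [measurable]: "(\<lambda>x::step. \<integral>\<^sup>+r. h (graft (fst (snd x)) (snd (snd x)) r) \<partial>inf_law (snd (fst (snd x)))) \<in> borel_measurable step_M"
      by (rule nn_integral_measurable_subprob_algebra2[OF _ k(1)]) measurable
    have [measurable]: "(\<lambda>x::step. \<integral>\<^sup>+l. h (graft (fst (snd x)) l (snd (snd x))) \<partial>inf_law (fst (fst (snd x)))) \<in> borel_measurable step_M"
      by (rule nn_integral_measurable_subprob_algebra2[OF _ k(2)]) measurable
    show ?thesis unfolding G_def[abs_def] by measurable
  qed
  have int_inf: "(\<integral>\<^sup>+\<omega>. f (spine_from (clamp_angle \<eta>) \<omega>) \<partial>?SS) = (\<integral>\<^sup>+t. f t \<partial>inf_law \<eta>)"
    if [measurable]: "f \<in> borel_measurable tree_M" for f \<eta>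
    unfolding inf_law_def by (rule nn_integral_distr[symmetric]) measurable
  have step: "root_density d z * (\<integral>\<^sup>+t. ennreal (1 / Finf \<theta>) * (indicator {x. \<theta> < step_sum x} (d, z, t) * G (d, z, t)) \<partial>Pfin (f z))
     = spine_density \<theta> d z * (\<integral>\<^sup>+t. G (d, z, t) \<partial>Pfin (f z))" for d z and f :: "real \<times> real \<Rightarrow> real"
  proof -
    have Gm: "(\<lambda>t. G (d, z, t)) \<in> borel_measurable (Pfin (f z))"
    proof -
      have "(\<lambda>t. (d, z, t)) \<in> tree_M \<rightarrow>\<^sub>M step_M" unfolding step_M_def by measurable
      from measurable_compose[OF this G] show ?thesis by (simp add: measurable_cong_sets[OF sets_Pfin refl])
    qed
    let ?i = "indicator {z. \<theta> < fst z + snd z} z :: ennreal"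
    have "(\<integral>\<^sup>+t. ennreal (1 / Finf \<theta>) * (indicator {x. \<theta> < step_sum x} (d, z, t) * G (d, z, t)) \<partial>Pfin (f z)) =
      (\<integral>\<^sup>+t. (ennreal (1 / Finf \<theta>) * ?i) * G (d, z, t) \<partial>Pfin (f z))"
      by (intro nn_integral_cong) (simp add: indicator_def step_sum_def)
    also have "\<dots> = (ennreal (1 / Finf \<theta>) * ?i) * (\<integral>\<^sup>+t. G (d, z, t) \<partial>Pfin (f z))"
      by (rule nn_integral_cmult[OF Gm])
    finally have e: "(\<integral>\<^sup>+t. ennreal (1 / Finf \<theta>) * (indicator {x. \<theta> < step_sum x} (d, z, t) * G (d, z, t)) \<partial>Pfin (f z)) =
      (ennreal (1 / Finf \<theta>) * ?i) * (\<integral>\<^sup>+t. G (d, z, t) \<partial>Pfin (f z))" .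
    have "root_density d z * (ennreal (1 / Finf \<theta>) * ?i) = spine_density \<theta> d z"
    proof (cases "z \<in> tri 0")
      case True
      note b = tri_bounds[OF True]
      have "0 \<le> (if d then F (fst z) * Finf (snd z) else Finf (fst z) * F (snd z))"
        using b by (auto intro!: mult_nonneg_nonneg Finf_nonneg less_imp_le[OF F_pos])
      moreover have "?i = indicator (tri \<theta>) z" using True \<theta> by (auto simp: indicator_def tri_def)
      ultimately show ?thesis
        using True Fp by (simp add: root_density_def spine_density_def mult_ac ennreal_mult[symmetric] del: ennreal_mult'')
    next
      case False
      then have "z \<notin> tri \<theta>" using \<theta> by (auto simp: tri_def)
      then show ?thesis using False by (simp add: root_density_def spine_density_def)
    qed
    then show ?thesis unfolding e by (simp only: mult.assoc[symmetric])
  qed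
  have "(\<integral>\<^sup>+t. h t \<partial>inf_law \<theta>) = (\<integral>\<^sup>+\<omega>. h (spine_from (clamp_angle \<theta>) \<omega>) \<partial>?SS)"
    by (rule int_inf[symmetric, OF h])
  also have "\<dots> = (\<integral>\<^sup>+s. \<integral>\<^sup>+\<omega>. h (spine_from (clamp_angle \<theta>) (s ## \<omega>)) \<partial>?SS \<partial>?S)"
    by (rule S.nn_integral_stream_space) measurable
  also have "\<dots> = (\<integral>\<^sup>+s. G (pick \<theta> s) \<partial>?S)"
  proof (rule nn_integral_cong)
    fix s
    obtain d z t where x: "pick \<theta> s = (d, z, t)" by (cases "pick \<theta> s")
    show "(\<integral>\<^sup>+\<omega>. h (spine_from (clamp_angle \<theta>) (s ## \<omega>)) \<partial>?SS) = G (pick \<theta> s)"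
      using int_inf[of "\<lambda>r. h (graft z t r)" "snd z"] int_inf[of "\<lambda>l. h (graft z l t)" "fst z"]
      by (cases d) (simp_all add: \<theta> spine_from_Stream x G_def)
  qed
  also have "\<dots> = (\<integral>\<^sup>+x. ennreal (1 / Finf \<theta>) * (indicator {x. \<theta> < step_sum x} x * G x) \<partial>step_law)"
    by (rule nn_integral_pick[OF \<theta> G])
  also have "\<dots> = (\<integral>\<^sup>+z. root_density True z * (\<integral>\<^sup>+t. ennreal (1 / Finf \<theta>) * (indicator {x. \<theta> < step_sum x} (True, z, t) * G (True, z, t)) \<partial>Pfin (fst z)) \<partial>lborel) +
     (\<integral>\<^sup>+z. root_density False z * (\<integral>\<^sup>+t. ennreal (1 / Finf \<theta>) * (indicator {x. \<theta> < step_sum x} (False, z, t) * G (False, z, t)) \<partial>Pfin (snd z)) \<partial>lborel)"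
  proof (rule nn_integral_step_law)
    have "{x \<in> space step_M. \<theta> < step_sum x} \<in> sets step_M" by measurable
    then have [measurable]: "{x. \<theta> < step_sum x} \<in> sets step_M" by simp
    show "(\<lambda>x. ennreal (1 / Finf \<theta>) * (indicator {x. \<theta> < step_sum x} x * G x)) \<in> borel_measurable step_M"
      by measurable
  qed
  finally show ?thesis by (simp only: step) (simp add: G_def)
qed

section \<open>The Markov property and the spine\<close>

lemma root_event_iff: "t \<in> root_event C \<longleftrightarrow> t [] \<noteq> None \<and> t [] \<noteq> Some None \<and> root_angles t \<in> C"
  by (cases "t []"; cases "the (t [])") (auto simp: root_event_def root_angles_def)

lemma graft_in_root_event [simp]: "graft z l r \<in> root_event C \<longleftrightarrow> z \<in> C"
  by (simp add: root_event_iff)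

lemma sets_root_event [measurable]:
  assumes [measurable]: "C \<in> sets borel"
  shows "root_event C \<in> sets tree_M"
proof -
  have "root_event C = {t \<in> space tree_M. t [] \<noteq> None \<and> t [] \<noteq> Some None \<and> root_angles t \<in> C}"
    by (auto simp: root_event_iff)
  also have "\<dots> \<in> sets tree_M" by measurable
  finally show ?thesis .
qed

definition left_finite :: "(real \<times> real) set \<Rightarrow> atree set \<Rightarrow> atree set \<Rightarrow> atree set" where
  "left_finite C A B = {t \<in> root_event C. finite (supp (subL t)) \<and> infinite (supp (subR t)) \<and> subL t \<in> A \<and> subR t \<in> B}"

definition right_finite :: "(real \<times> real) set \<Rightarrow> atree set \<Rightarrow> atree set \<Rightarrow> atree set" where
  "right_finite C A B = {t \<in> root_event C. infinite (supp (subL t)) \<and> finite (supp (subR t)) \<and> subL t \<in> A \<and> subR t \<in> B}"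

lemma sets_side_finite [measurable]:
  assumes [measurable]: "C \<in> sets borel" "A \<in> sets tree_M" "B \<in> sets tree_M"
  shows "left_finite C A B \<in> sets tree_M" "right_finite C A B \<in> sets tree_M"
proof -
  have "left_finite C A B = {t \<in> space tree_M. t \<in> root_event C \<and> finite (supp (subL t)) \<and> infinite (supp (subR t)) \<and> subL t \<in> A \<and> subR t \<in> B}"
    "right_finite C A B = {t \<in> space tree_M. t \<in> root_event C \<and> infinite (supp (subL t)) \<and> finite (supp (subR t)) \<and> subL t \<in> A \<and> subR t \<in> B}"
    by (simp_all add: left_finite_def right_finite_def)
  moreover have "{t \<in> space tree_M. t \<in> root_event C \<and> finite (supp (subL t)) \<and> infinite (supp (subR t)) \<and> subL t \<in> A \<and> subR t \<in> B} \<in> sets tree_M"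
    "{t \<in> space tree_M. t \<in> root_event C \<and> infinite (supp (subL t)) \<and> finite (supp (subR t)) \<and> subL t \<in> A \<and> subR t \<in> B} \<in> sets tree_M"
    by measurable
  ultimately show "left_finite C A B \<in> sets tree_M" "right_finite C A B \<in> sets tree_M" by simp_all
qed

lemma markov_iff: "markov Q \<theta> \<longleftrightarrow>
    (\<forall>A\<in>sets tree_M. \<forall>B\<in>sets tree_M. \<forall>C\<in>sets borel.
      emeasure (Q \<theta>) (left_finite C A B) =
        (\<integral>\<^sup>+z. spine_density \<theta> True z * (indicator C z * (emeasure (Pfin (fst z)) A * emeasure (Q (snd z)) B)) \<partial>lborel) \<and>
      emeasure (Q \<theta>) (right_finite C A B) =
        (\<integral>\<^sup>+z. spine_density \<theta> False z * (indicator C z * (emeasure (Q (fst z)) A * emeasure (Pfin (snd z)) B)) \<partial>lborel))"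
proof -
  have e: "indicator C z * (if 0 < fst z \<and> 0 < snd z \<and> \<theta> < fst z + snd z \<and> fst z + snd z < pi
      then ennreal (F (fst z) * Finf (snd z) / Finf \<theta>) * a * b else 0) = spine_density \<theta> True z * (indicator C z * (a * b))"
    "indicator C z * (if 0 < fst z \<and> 0 < snd z \<and> \<theta> < fst z + snd z \<and> fst z + snd z < pi
      then ennreal (Finf (fst z) * F (snd z) / Finf \<theta>) * a * b else 0) = spine_density \<theta> False z * (indicator C z * (a * b))"
    for C z and a b :: ennreal
    by (auto simp: spine_density_def tri_def indicator_def mult_ac)
  show ?thesis
    unfolding markov_def e left_finite_def right_finite_def by blast
qed

lemma AE_Pfin_finite: "AE t in Pfin \<theta>. finite (supp t)"
  using AE_fine_tree[of \<theta>] by eventually_elim (simp add: fine_tree_def)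

text \<open>One of the two terms of the root decomposition vanishes, since it would require an
  almost surely infinite subtree to be finite; in the other the conditions on finiteness hold almost
  surely and the integral factors.\<close>

lemma markov_inf_law:
  assumes \<theta>: "0 \<le> \<theta>" "\<theta> < pi"
  shows "markov inf_law \<theta>"
  unfolding markov_iff
proof (intro ballI conjI)
  fix A B and C :: "(real \<times> real) set"
  assume ABC: "A \<in> sets tree_M" "B \<in> sets tree_M" "C \<in> sets borel"
  note [measurable] = ABC
  have zero: "(\<integral>\<^sup>+x. \<integral>\<^sup>+y. f x y \<partial>inf_law a \<partial>M) = 0"
    if "\<And>x y. infinite (supp y) \<Longrightarrow> f x y = 0" for f :: "atree \<Rightarrow> atree \<Rightarrow> ennreal" and a M
  proof -
    have "(\<integral>\<^sup>+y. f x y \<partial>inf_law a) = 0" for x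
    proof -
      have "AE y in inf_law a. f x y = 0"
        using AE_inf_law_infinite[of a] by eventually_elim (rule that)
      then have "(\<integral>\<^sup>+y. f x y \<partial>inf_law a) = (\<integral>\<^sup>+y. 0 \<partial>inf_law a)" by (rule nn_integral_cong_AE)
      then show ?thesis by simp
    qed
    then show ?thesis by simp
  qed
  have prod: "(\<integral>\<^sup>+x. \<integral>\<^sup>+y. f x y \<partial>inf_law b \<partial>Pfin a) = indicator C z * (emeasure (Pfin a) A' * emeasure (inf_law b) B')"
    if f: "\<And>x y. finite (supp x) \<Longrightarrow> infinite (supp y) \<Longrightarrow> f x y = indicator C z * indicator A' x * indicator B' y"
      and A': "A' \<in> sets tree_M" "B' \<in> sets tree_M"
    for f :: "atree \<Rightarrow> atree \<Rightarrow> ennreal" and a b A' B' z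
  proof -
    have "(\<integral>\<^sup>+y. f x y \<partial>inf_law b) = (indicator C z * emeasure (inf_law b) B') * indicator A' x" if x: "finite (supp x)" for x
    proof -
      have "AE y in inf_law b. f x y = (indicator C z * indicator A' x) * indicator B' y"
        using AE_inf_law_infinite[of b] by eventually_elim (rule f[OF x])
      then have "(\<integral>\<^sup>+y. f x y \<partial>inf_law b) = (\<integral>\<^sup>+y. (indicator C z * indicator A' x) * indicator B' y \<partial>inf_law b)"
        by (rule nn_integral_cong_AE)
      also have "\<dots> = (indicator C z * indicator A' x) * emeasure (inf_law b) B'"
        using A' by (intro nn_integral_cmult_indicator) simp
      finally show ?thesis by (simp only: mult_ac)
    qed
    then have "AE x in Pfin a. (\<integral>\<^sup>+y. f x y \<partial>inf_law b) = (indicator C z * emeasure (inf_law b) B') * indicator A' x"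
      using AE_Pfin_finite[of a] by (auto elim: eventually_mono)
    then have "(\<integral>\<^sup>+x. \<integral>\<^sup>+y. f x y \<partial>inf_law b \<partial>Pfin a) = (\<integral>\<^sup>+x. (indicator C z * emeasure (inf_law b) B') * indicator A' x \<partial>Pfin a)"
      by (rule nn_integral_cong_AE)
    also have "\<dots> = (indicator C z * emeasure (inf_law b) B') * emeasure (Pfin a) A'"
      using A' by (intro nn_integral_cmult_indicator) simp
    finally show ?thesis by (simp only: mult_ac)
  qed
  have L: "left_finite C A B \<in> sets tree_M" "right_finite C A B \<in> sets tree_M" by measurable
  have "emeasure (inf_law \<theta>) (left_finite C A B) = (\<integral>\<^sup>+t. indicator (left_finite C A B) t \<partial>inf_law \<theta>)"
    using L by simp
  also have "\<dots> = (\<integral>\<^sup>+z. spine_density \<theta> True z * (\<integral>\<^sup>+l. \<integral>\<^sup>+r. indicator (left_finite C A B) (graft z l r) \<partial>inf_law (snd z) \<partial>Pfin (fst z)) \<partial>lborel) +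
    (\<integral>\<^sup>+z. spine_density \<theta> False z * (\<integral>\<^sup>+r. \<integral>\<^sup>+l. indicator (left_finite C A B) (graft z l r) \<partial>inf_law (fst z) \<partial>Pfin (snd z)) \<partial>lborel)"
    using L by (intro nn_integral_inf_law \<theta>) simp
  also have "\<dots> = (\<integral>\<^sup>+z. spine_density \<theta> True z * (indicator C z * (emeasure (Pfin (fst z)) A * emeasure (inf_law (snd z)) B)) \<partial>lborel) + 0"
    by (intro arg_cong2[of _ _ _ _ "(+)"] nn_integral_cong arg_cong2[of _ _ _ _ "(*)"] refl prod ABC)
      (auto simp: left_finite_def indicator_def zero)
  finally show "emeasure (inf_law \<theta>) (left_finite C A B) =
      (\<integral>\<^sup>+z. spine_density \<theta> True z * (indicator C z * (emeasure (Pfin (fst z)) A * emeasure (inf_law (snd z)) B)) \<partial>lborel)"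
    by simp
  have "emeasure (inf_law \<theta>) (right_finite C A B) = (\<integral>\<^sup>+t. indicator (right_finite C A B) t \<partial>inf_law \<theta>)"
    using L by simp
  also have "\<dots> = (\<integral>\<^sup>+z. spine_density \<theta> True z * (\<integral>\<^sup>+l. \<integral>\<^sup>+r. indicator (right_finite C A B) (graft z l r) \<partial>inf_law (snd z) \<partial>Pfin (fst z)) \<partial>lborel) +
    (\<integral>\<^sup>+z. spine_density \<theta> False z * (\<integral>\<^sup>+r. \<integral>\<^sup>+l. indicator (right_finite C A B) (graft z l r) \<partial>inf_law (fst z) \<partial>Pfin (snd z)) \<partial>lborel)"
    using L by (intro nn_integral_inf_law \<theta>) simp
  also have "\<dots> = 0 + (\<integral>\<^sup>+z. spine_density \<theta> False z * (indicator C z * (emeasure (Pfin (snd z)) B * emeasure (inf_law (fst z)) A)) \<partial>lborel)"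
    by (intro arg_cong2[of _ _ _ _ "(+)"] nn_integral_cong arg_cong2[of _ _ _ _ "(*)"] refl prod ABC)
      (auto simp: right_finite_def indicator_def zero)
  finally show "emeasure (inf_law \<theta>) (right_finite C A B) =
      (\<integral>\<^sup>+z. spine_density \<theta> False z * (indicator C z * (emeasure (inf_law (fst z)) A * emeasure (Pfin (snd z)) B)) \<partial>lborel)"
    by (simp add: mult_ac)
qed

text \<open>A finite-depth approximation of \<open>has_spine\<close>: each level is a measurable
  condition that can be proved almost surely by induction, and countably many levels are intersected
  afterwards.\<close>

fun spine_upto :: "nat \<Rightarrow> real \<Rightarrow> atree \<Rightarrow> bool" where
  "spine_upto 0 \<theta> t \<longleftrightarrow> True"
| "spine_upto (Suc n) \<theta> t \<longleftrightarrow> t [] \<noteq> None \<and> t [] \<noteq> Some None \<and> root_angles t \<in> tri \<theta> \<and>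
     (fine_tree (fst (root_angles t)) (subL t) \<and> infinite (supp (subR t)) \<and> spine_upto n (snd (root_angles t)) (subR t) \<or>
      infinite (supp (subL t)) \<and> spine_upto n (fst (root_angles t)) (subL t) \<and> fine_tree (snd (root_angles t)) (subR t))"

lemma measurable_pair_fine_tree: "Measurable.pred (borel \<Otimes>\<^sub>M tree_M) (\<lambda>x. fine_tree (fst x) (snd x))"
  unfolding fine_tree_def good_def by measurable

lemma measurable_spine_upto: "Measurable.pred (borel \<Otimes>\<^sub>M tree_M) (\<lambda>x. spine_upto n (fst x) (snd x))"
proof (induction n)
  case (Suc n)
  have m: "(\<lambda>x. (fst (root_angles (snd x)), subL (snd x))) \<in> borel \<Otimes>\<^sub>M tree_M \<rightarrow>\<^sub>M borel \<Otimes>\<^sub>M tree_M"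
    "(\<lambda>x. (snd (root_angles (snd x)), subR (snd x))) \<in> borel \<Otimes>\<^sub>M tree_M \<rightarrow>\<^sub>M borel \<Otimes>\<^sub>M tree_M"
    by measurable
  note [measurable] = measurable_compose[OF m(1) Suc.IH, simplified] measurable_compose[OF m(2) Suc.IH, simplified]
    measurable_compose[OF m(1) measurable_pair_fine_tree, simplified]
    measurable_compose[OF m(2) measurable_pair_fine_tree, simplified]
  show ?case unfolding spine_upto.simps tri_def mem_Collect_eq by measurable
qed simp

lemma pred_spine_upto [measurable]: "Measurable.pred tree_M (spine_upto n \<theta>)"
proof -
  have "(\<lambda>t. (\<theta>, t)) \<in> tree_M \<rightarrow>\<^sub>M borel \<Otimes>\<^sub>M tree_M" by measurable
  from measurable_compose[OF this measurable_spine_upto, of n] show ?thesis by simp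
qed

lemma AE_spine_upto:
  assumes "0 \<le> \<theta>" "\<theta> < pi"
  shows "AE t in inf_law \<theta>. spine_upto n \<theta> t"
  using assms
proof (induction n arbitrary: \<theta>)
  case (Suc n)
  let ?h = "\<lambda>t. indicator {t. \<not> spine_upto (Suc n) \<theta> t} t :: ennreal"
  have "{t \<in> space tree_M. \<not> spine_upto (Suc n) \<theta> t} \<in> sets tree_M" by measurable
  then have S: "{t. \<not> spine_upto (Suc n) \<theta> t} \<in> sets tree_M" by simp
  have zero: "(\<integral>\<^sup>+x. \<integral>\<^sup>+y. f x y \<partial>inf_law b \<partial>Pfin a) = 0"
    if f: "\<And>x y. fine_tree a x \<Longrightarrow> infinite (supp y) \<Longrightarrow> spine_upto n b y \<Longrightarrow> f x y = 0"
      and b: "0 \<le> b" "b < pi" for f :: "atree \<Rightarrow> atree \<Rightarrow> ennreal" and a b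
  proof -
    have "(\<integral>\<^sup>+y. f x y \<partial>inf_law b) = 0" if x: "fine_tree a x" for x
    proof -
      have "AE y in inf_law b. f x y = 0"
        using AE_inf_law_infinite[of b] Suc.IH[OF b] by eventually_elim (rule f[OF x])
      then have "(\<integral>\<^sup>+y. f x y \<partial>inf_law b) = (\<integral>\<^sup>+y. 0 \<partial>inf_law b)" by (rule nn_integral_cong_AE)
      then show ?thesis by simp
    qed
    then have "AE x in Pfin a. (\<integral>\<^sup>+y. f x y \<partial>inf_law b) = 0"
      using AE_fine_tree[of a] by (auto elim: eventually_mono)
    then have "(\<integral>\<^sup>+x. \<integral>\<^sup>+y. f x y \<partial>inf_law b \<partial>Pfin a) = (\<integral>\<^sup>+x. 0 \<partial>Pfin a)"
      by (rule nn_integral_cong_AE)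
    then show ?thesis by simp
  qed
  have "(\<integral>\<^sup>+t. ?h t \<partial>inf_law \<theta>) =
    (\<integral>\<^sup>+z. spine_density \<theta> True z * (\<integral>\<^sup>+l. \<integral>\<^sup>+r. ?h (graft z l r) \<partial>inf_law (snd z) \<partial>Pfin (fst z)) \<partial>lborel) +
    (\<integral>\<^sup>+z. spine_density \<theta> False z * (\<integral>\<^sup>+r. \<integral>\<^sup>+l. ?h (graft z l r) \<partial>inf_law (fst z) \<partial>Pfin (snd z)) \<partial>lborel)"
    using S by (intro nn_integral_inf_law Suc.prems) simp
  also have "\<dots> = (\<integral>\<^sup>+z. 0 \<partial>(lborel :: (real \<times> real) measure)) + (\<integral>\<^sup>+z. 0 \<partial>(lborel :: (real \<times> real) measure))"
  proof (intro arg_cong2[of _ _ _ _ "(+)"] nn_integral_cong)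
    fix z :: "real \<times> real"
    show "spine_density \<theta> True z * (\<integral>\<^sup>+l. \<integral>\<^sup>+r. ?h (graft z l r) \<partial>inf_law (snd z) \<partial>Pfin (fst z)) = 0"
    proof (cases "z \<in> tri \<theta>")
      case True
      then show ?thesis using tri_bounds[OF True] by (subst zero) auto
    qed (simp add: spine_density_def)
    show "spine_density \<theta> False z * (\<integral>\<^sup>+r. \<integral>\<^sup>+l. ?h (graft z l r) \<partial>inf_law (fst z) \<partial>Pfin (snd z)) = 0"
    proof (cases "z \<in> tri \<theta>")
      case True
      then show ?thesis using tri_bounds[OF True] by (subst zero) auto
    qed (simp add: spine_density_def)
  qed
  finally have "emeasure (inf_law \<theta>) {t. \<not> spine_upto (Suc n) \<theta> t} = 0"
    using S by simp
  then show ?case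
    using S by (intro AE_I[where N = "{t. \<not> spine_upto (Suc n) \<theta> t}"]) auto
qed simp

definition has_spine :: "real \<Rightarrow> atree \<Rightarrow> bool" where
  "has_spine \<theta> t \<longleftrightarrow> (\<forall>n. spine_upto n \<theta> t)"

lemma graft_root_angles:
  assumes "t [] \<noteq> None" "t [] \<noteq> Some None"
  shows "t = graft (root_angles t) (subL t) (subR t)"
proof
  obtain a b where ab: "t [] = Some (Some (a, b))"
    using assms by (cases "t []"; cases "the (t [])") auto
  fix p show "t p = graft (root_angles t) (subL t) (subR t) p"
    by (cases p) (auto simp: ab root_angles_def nd_def graft_def subL_def subR_def)
qed

text \<open>The side chosen at the root cannot change with the depth: one subtree is finite and the
  other infinite, which excludes the opposite alternative at every level. Hence the infinite side
  inherits the property at all depths.\<close>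

lemma has_spine_cases:
  assumes "has_spine \<theta> t"
  obtains z l r where "t = graft z l r" "z \<in> tri \<theta>" "fine_tree (fst z) l" "infinite (supp r)" "has_spine (snd z) r"
  | z l r where "t = graft z l r" "z \<in> tri \<theta>" "infinite (supp l)" "has_spine (fst z) l" "fine_tree (snd z) r"
proof -
  have S: "spine_upto (Suc n) \<theta> t" for n using assms unfolding has_spine_def by blast
  have t: "t = graft (root_angles t) (subL t) (subR t)"
    using S[of 0] by (intro graft_root_angles) auto
  have z: "root_angles t \<in> tri \<theta>" using S[of 0] by simp
  consider "fine_tree (fst (root_angles t)) (subL t)" "infinite (supp (subR t))"
    | "infinite (supp (subL t))" "fine_tree (snd (root_angles t)) (subR t)"
    using S[of 0] by auto
  then show ?thesis
  proof cases
    case 1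
    then have "has_spine (snd (root_angles t)) (subR t)"
      using S unfolding has_spine_def fine_tree_def spine_upto.simps by metis
    with 1 t z show ?thesis using that(1) by blast
  next
    case 2
    then have "has_spine (fst (root_angles t)) (subL t)"
      using S unfolding has_spine_def fine_tree_def spine_upto.simps by metis
    with 2 t z show ?thesis using that(2) by blast
  qed
qed

text \<open>The tree and angle conditions are localised at a single address, because an infinite
  tree admits induction on the address only.\<close>

definition tree_at :: "atree \<Rightarrow> bool list \<Rightarrow> bool" where
  "tree_at t p \<longleftrightarrow> (\<forall>c. t (p @ [c]) \<noteq> None \<longleftrightarrow> t p \<noteq> None \<and> t p \<noteq> Some None)"

definition allowed_at :: "atree \<Rightarrow> bool list \<Rightarrow> bool" where
  "allowed_at t p \<longleftrightarrow> (\<forall>a b. t p = Some (Some (a, b)) \<longrightarrow>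
     0 < a \<and> a < pi \<and> 0 < b \<and> b < pi \<and> 0 < 2 * pi - a - b \<and> 2 * pi - a - b < pi) \<and>
     (\<forall>c. t (p @ [c]) \<noteq> None \<longrightarrow> corner_opp_child t p c + corner_opp_parent t (p @ [c]) > pi)"

lemma is_tree_iff_at: "is_tree t \<longleftrightarrow> t [] \<noteq> None \<and> (\<forall>p. tree_at t p)"
  by (simp add: is_tree_iff tree_at_def)

lemma allowed_iff_at: "allowed t \<longleftrightarrow> 0 < corner_opp_parent t [] \<and> (\<forall>p. allowed_at t p)"
  unfolding allowed_def valid_angles_def allowed_at_def by auto

lemma at_graft:
  "tree_at (graft z l r) (False # p) = tree_at l p" "tree_at (graft z l r) (True # p) = tree_at r p"
  "allowed_at (graft z l r) (False # p) = allowed_at l p" "allowed_at (graft z l r) (True # p) = allowed_at r p"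
  by (simp_all add: tree_at_def allowed_at_def corner_opp_child_def corner_opp_parent_def)

lemma tree_at_graft_root: "l [] \<noteq> None \<Longrightarrow> r [] \<noteq> None \<Longrightarrow> tree_at (graft z l r) []"
  by (auto simp: tree_at_def all_bool_eq)

lemma allowed_at_graft_root:
  assumes "z \<in> tri \<theta>" "0 \<le> \<theta>" "fst z < corner_opp_parent l []" "snd z < corner_opp_parent r []"
  shows "allowed_at (graft z l r) []"
  using assms by (auto simp: allowed_at_def tri_def nd_def corner_opp_child_def all_bool_eq)
    (auto simp: corner_opp_parent_def)

lemma has_spine_root:
  assumes "has_spine \<theta> t"
  shows "t [] \<noteq> None" "\<theta> < corner_opp_parent t []" "0 < corner_opp_parent t []" "infinite (supp t)"
proof -
  from assms have "\<exists>z l r. t = graft z l r \<and> z \<in> tri \<theta> \<and> (infinite (supp l) \<or> infinite (supp r))"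
    by (cases rule: has_spine_cases) auto
  then obtain z l r where t: "t = graft z l r" "z \<in> tri \<theta>" and i: "infinite (supp l) \<or> infinite (supp r)"
    by blast
  show "t [] \<noteq> None" using t by simp
  show "\<theta> < corner_opp_parent t []" "0 < corner_opp_parent t []"
    using t by (auto simp: corner_opp_parent_def nd_def tri_def)
  show "infinite (supp t)" using i t by (auto simp: finite_supp_graft_iff)
qed

lemma has_spine_at:
  assumes "has_spine \<theta> t" "0 \<le> \<theta>"
  shows "tree_at t p \<and> allowed_at t p"
  using assms
proof (induction p arbitrary: \<theta> t)
  case Nil
  from Nil.prems(1) show ?case
  proof (cases rule: has_spine_cases)
    case (1 z l r)
    then have "l [] \<noteq> None" "fst z < corner_opp_parent l []"
      by (auto simp: fine_tree_def is_tree_def good_def)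
    then show ?thesis
      using 1 has_spine_root[OF 1(5)] Nil.prems(2) by (auto intro: tree_at_graft_root allowed_at_graft_root)
  next
    case (2 z l r)
    then have "r [] \<noteq> None" "snd z < corner_opp_parent r []"
      by (auto simp: fine_tree_def is_tree_def good_def)
    then show ?thesis
      using 2 has_spine_root[OF 2(4)] Nil.prems(2) by (auto intro: tree_at_graft_root allowed_at_graft_root)
  qed
next
  case (Cons c p)
  from Cons.prems(1) show ?case
  proof (cases rule: has_spine_cases)
    case (1 z l r)
    have "tree_at l p" "allowed_at l p"
      using 1(3) by (auto simp: fine_tree_def is_tree_iff_at good_def allowed_iff_at)
    moreover have "tree_at r p \<and> allowed_at r p"
      by (rule Cons.IH[OF 1(5)]) (use tri_bounds[OF 1(2)] in simp)
    ultimately show ?thesis using 1(1) by (cases c) (auto simp: at_graft)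
  next
    case (2 z l r)
    have "tree_at r p" "allowed_at r p"
      using 2(5) by (auto simp: fine_tree_def is_tree_iff_at good_def allowed_iff_at)
    moreover have "tree_at l p \<and> allowed_at l p"
      by (rule Cons.IH[OF 2(4)]) (use tri_bounds[OF 2(2)] in simp)
    ultimately show ?thesis using 2(1) by (cases c) (auto simp: at_graft)
  qed
qed

text \<open>The spine goes right exactly when the right subtree is infinite, and T n is the subtree
  reached after n steps. Every sibling off this path is finite, so no other infinite path can leave
  it.\<close>

lemma one_spine_has_spine:
  assumes "has_spine \<theta> t"
  shows "one_spine t"
proof -
  define dir :: "atree \<Rightarrow> bool" where "dir t = infinite (supp (subR t))" for t
  define nxt where "nxt t = (if dir t then subR t else subL t)" for t
  define T where "T n = (nxt ^^ n) t" for n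
  define s where "s n = dir (T n)" for n
  have T0: "T 0 = t" and TS: "T (Suc n) = nxt (T n)" for n by (simp_all add: T_def)
  have sp: "\<exists>\<eta>. has_spine \<eta> (T n)" for n
  proof (induction n)
    case 0
    then show ?case using assms T0 by auto
  next
    case (Suc n)
    then obtain \<eta> where "has_spine \<eta> (T n)" by blast
    then show ?case
      by (cases rule: has_spine_cases) (auto simp: TS nxt_def dir_def fine_tree_def)
  qed
  have addr: "T n p = t (map s [0..<n] @ p)" for n p
  proof (induction n arbitrary: p)
    case (Suc n)
    have "T (Suc n) p = T n (s n # p)"
      by (simp add: TS nxt_def s_def subL_def subR_def)
    then show ?case by (simp add: Suc)
  qed (simp add: T0)
  have fin: "finite (supp (\<lambda>p. T n ((\<not> s n) # p)))" for n
  proof -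
    obtain \<eta> where "has_spine \<eta> (T n)" using sp by blast
    then show ?thesis
      by (cases rule: has_spine_cases) (auto simp: s_def dir_def fine_tree_def)
  qed
  show ?thesis
    unfolding one_spine_def
  proof (rule ex1I[of _ s], rule allI)
    fix k
    obtain \<eta> where "has_spine \<eta> (T k)" using sp by blast
    then have "T k [] \<noteq> None" by (rule has_spine_root)
    then show "t (map s [0..<k]) \<noteq> None" by (simp add: addr)
  next
    fix s' assume s': "\<forall>k. t (map s' [0..<k]) \<noteq> None"
    have "s' n = s n" for n
    proof (induction n rule: less_induct)
      case (less n)
      show ?case
      proof (rule ccontr)
        assume "s' n \<noteq> s n"
        then have neg: "(\<not> s n) = s' n" by auto
        \<comment> \<open>At the first disagreement the rival path enters the finite sibling of the
          spine and must stop within N further steps.\<close>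
        obtain N where N: "\<And>p. N \<le> length p \<Longrightarrow> T n ((\<not> s n) # p) = None"
          using fin[of n] unfolding finite_supp_iff by blast
        have "map s' [0..<n] = map s [0..<n]" using less by simp
        moreover have "[0..<n + Suc N] = [0..<n] @ n # [Suc n..<n + Suc N]"
          by (metis add_Suc_right le_add1 less_add_Suc1 upt_add_eq_append upt_conv_Cons zero_le plus_nat.add_0)
        ultimately have "t (map s' [0..<n + Suc N]) = T n (s' n # map s' [Suc n..<n + Suc N])"
          by (simp only: map_append list.map addr)
        moreover have "T n (s' n # map s' [Suc n..<n + Suc N]) = None"
          using N[of "map s' [Suc n..<n + Suc N]"] neg by (simp del: upt_Suc)
        ultimately show False using s' by metis
      qed
    qed
    then show "s' = s" by blast
  qed
qed

lemma spine_tree_has_spine: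
  assumes "has_spine \<theta> t" "0 \<le> \<theta>"
  shows "spine_tree t"
  unfolding spine_tree_def is_tree_iff_at allowed_iff_at
  using has_spine_at[OF assms] has_spine_root[OF assms(1)] one_spine_has_spine[OF assms(1)] by blast

lemma AE_has_spine:
  assumes "0 \<le> \<theta>" "\<theta> < pi"
  shows "AE t in inf_law \<theta>. has_spine \<theta> t"
  unfolding has_spine_def AE_all_countable using AE_spine_upto[OF assms] by blast

theorem spine_family_inf_law: "spine_family inf_law"
  unfolding spine_family_def
proof (intro ballI conjI)
  fix \<theta> :: real assume \<theta>: "\<theta> \<in> {0..<pi}"
  show "prob_space (inf_law \<theta>)" by (rule prob_space_inf_law)
  show "sets (inf_law \<theta>) = sets tree_M" by simp
  show "markov inf_law \<theta>" using \<theta> by (intro markov_inf_law) auto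
  have "AE t in inf_law \<theta>. has_spine \<theta> t" using \<theta> by (intro AE_has_spine) auto
  then show "AE t in inf_law \<theta>. spine_tree t"
    by eventually_elim (use \<theta> spine_tree_has_spine in auto)
qed

section \<open>Uniqueness\<close>

text \<open>Obtained by testing the constructed law on the constant function 1.\<close>

lemma spine_density_mass:
  assumes \<theta>: "0 \<le> \<theta>" "\<theta> < pi"
  shows "(\<integral>\<^sup>+z. spine_density \<theta> True z \<partial>lborel) + (\<integral>\<^sup>+z. spine_density \<theta> False z \<partial>lborel) = 1"
proof -
  have P: "spine_density \<theta> d z * emeasure (Pfin (f z)) UNIV = spine_density \<theta> d z" if "f = fst \<or> f = snd" for d z f
  proof (cases "z \<in> tri \<theta>")
    case True
    then show ?thesis
      using that tri_bounds[OF True] prob_space.emeasure_space_1[OF prob_space_Pfin] by fastforce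
  qed (simp add: spine_density_def)
  have I: "emeasure (inf_law a) UNIV = 1" for a
    using prob_space.emeasure_space_1[OF prob_space_inf_law, of a] by simp
  have "(\<integral>\<^sup>+t. 1 \<partial>inf_law \<theta>) =
    (\<integral>\<^sup>+z. spine_density \<theta> True z * (\<integral>\<^sup>+l. \<integral>\<^sup>+r. 1 \<partial>inf_law (snd z) \<partial>Pfin (fst z)) \<partial>lborel) +
    (\<integral>\<^sup>+z. spine_density \<theta> False z * (\<integral>\<^sup>+r. \<integral>\<^sup>+l. 1 \<partial>inf_law (fst z) \<partial>Pfin (snd z)) \<partial>lborel)"
    by (rule nn_integral_inf_law[OF \<theta>]) simp
  then show ?thesis by (simp add: I P)
qed

text \<open>The Markov property prescribes the measure only of trees with one finite and one
  infinite subtree. The prescribed masses of the two types add up to 1 by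
  \<open>spine_density_mass\<close>, so almost every tree is of one of them and a rectangle splits
  into two prescribed pieces.\<close>

lemma spine_family_rect:
  assumes Q: "spine_family Q" and \<theta>: "0 \<le> \<theta>" "\<theta> < pi"
    and A0: "A0 \<in> sets node_M" and A: "A \<in> sets tree_M" and B: "B \<in> sets tree_M"
  shows "emeasure (Q \<theta>) (rect A0 A B) =
    (\<integral>\<^sup>+z. spine_density \<theta> True z * (indicator {z. nd z \<in> A0} z * (emeasure (Pfin (fst z)) A * emeasure (Q (snd z)) B)) \<partial>lborel) +
    (\<integral>\<^sup>+z. spine_density \<theta> False z * (indicator {z. nd z \<in> A0} z * (emeasure (Q (fst z)) A * emeasure (Pfin (snd z)) B)) \<partial>lborel)"
proof -
  let ?C = "{z. nd z \<in> A0}"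
  let ?U1 = "left_finite UNIV UNIV UNIV" and ?U2 = "right_finite UNIV UNIV UNIV"
  have prob: "prob_space (Q \<eta>)" and sQ: "sets (Q \<eta>) = sets tree_M" if "0 \<le> \<eta>" "\<eta> < pi" for \<eta>
    using Q that by (auto simp: spine_family_def)
  interpret prob_space "Q \<theta>" by (rule prob[OF \<theta>])
  have m: "emeasure (Q \<theta>) (left_finite C A B) =
        (\<integral>\<^sup>+z. spine_density \<theta> True z * (indicator C z * (emeasure (Pfin (fst z)) A * emeasure (Q (snd z)) B)) \<partial>lborel)"
      "emeasure (Q \<theta>) (right_finite C A B) =
        (\<integral>\<^sup>+z. spine_density \<theta> False z * (indicator C z * (emeasure (Q (fst z)) A * emeasure (Pfin (snd z)) B)) \<partial>lborel)"
    if "C \<in> sets borel" "A \<in> sets tree_M" "B \<in> sets tree_M" for A B C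
    using Q \<theta> that unfolding spine_family_def markov_iff by auto
  have C: "?C \<in> sets borel"
    using measurable_sets[OF measurable_nd A0] by (simp add: vimage_def)
  have top: "UNIV \<in> sets tree_M" using sets.top[of tree_M] by simp
  have U: "?U1 \<in> sets tree_M" "?U2 \<in> sets tree_M"
    using sets_side_finite[OF _ top top, of UNIV] by auto
  have one: "spine_density \<theta> d z * (emeasure (Pfin a) UNIV * emeasure (Q b) UNIV) = spine_density \<theta> d z"
    "spine_density \<theta> d z * (emeasure (Q b) UNIV * emeasure (Pfin a) UNIV) = spine_density \<theta> d z"
    if "a \<in> {fst z, snd z}" "b \<in> {fst z, snd z}" for d z a b
  proof -
    have "emeasure (Pfin a) UNIV = 1 \<and> emeasure (Q b) UNIV = 1" if "z \<in> tri \<theta>"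
    proof -
      have ab: "0 \<le> a" "a < pi" "0 \<le> b" "b < pi"
        using tri_bounds[OF that] \<open>a \<in> {fst z, snd z}\<close> \<open>b \<in> {fst z, snd z}\<close> by auto
      have "space (Q b) = UNIV" using sets_eq_imp_space_eq[OF sQ[OF ab(3,4)]] by simp
      then show ?thesis
        using prob_space.emeasure_space_1[OF prob_space_Pfin[OF ab(1,2)]] prob_space.emeasure_space_1[OF prob[OF ab(3,4)]] by simp
    qed
    then show "spine_density \<theta> d z * (emeasure (Pfin a) UNIV * emeasure (Q b) UNIV) = spine_density \<theta> d z"
      "spine_density \<theta> d z * (emeasure (Q b) UNIV * emeasure (Pfin a) UNIV) = spine_density \<theta> d z"
      by (cases "z \<in> tri \<theta>"; simp add: spine_density_def)+
  qed
  have disj: "?U1 \<inter> ?U2 = {}" by (auto simp: left_finite_def right_finite_def)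
  have "emeasure (Q \<theta>) ?U1 = (\<integral>\<^sup>+z. spine_density \<theta> True z \<partial>lborel)"
    "emeasure (Q \<theta>) ?U2 = (\<integral>\<^sup>+z. spine_density \<theta> False z \<partial>lborel)"
    using m[OF _ top top, of UNIV] by (simp_all add: one)
  then have "emeasure (Q \<theta>) (?U1 \<union> ?U2) = 1"
    using U disj spine_density_mass[OF \<theta>] by (subst plus_emeasure[symmetric]) (auto simp: sQ[OF \<theta>])
  then have "prob (?U1 \<union> ?U2) = 1" by (simp add: measure_def)
  then have AEU: "AE t in Q \<theta>. t \<in> ?U1 \<union> ?U2"
    using U by (intro AE_in_set_eq_1[THEN iffD2]) (auto simp: sQ[OF \<theta>])
  have R: "rect A0 A B \<in> sets tree_M" by (rule sets_rect[OF A0 A B])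
  have LR: "left_finite ?C A B \<in> sets tree_M" "right_finite ?C A B \<in> sets tree_M"
    by (rule sets_side_finite[OF C A B])+
  have inter: "t \<in> rect A0 A B \<longleftrightarrow> t \<in> left_finite ?C A B \<union> right_finite ?C A B" if "t \<in> ?U1 \<union> ?U2" for t
  proof -
    have "t [] \<noteq> None" "t [] \<noteq> Some None"
      using that by (auto simp: left_finite_def right_finite_def root_event_iff)
    then have "t = graft (root_angles t) (subL t) (subR t)" by (rule graft_root_angles)
    then have "t [] = nd (root_angles t)" by (metis graft_simps(1))
    then show ?thesis
      using that by (auto simp: left_finite_def right_finite_def root_event_iff rect_def)
  qed
  have "emeasure (Q \<theta>) (rect A0 A B) = emeasure (Q \<theta>) (left_finite ?C A B \<union> right_finite ?C A B)"
    using AEU R LR by (intro emeasure_eq_AE) (auto simp: sQ[OF \<theta>] inter elim!: eventually_mono)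
  also have "\<dots> = emeasure (Q \<theta>) (left_finite ?C A B) + emeasure (Q \<theta>) (right_finite ?C A B)"
    using LR by (intro plus_emeasure[symmetric]) (auto simp: sQ[OF \<theta>] left_finite_def right_finite_def)
  finally show ?thesis by (simp only: m[OF C A B])
qed

text \<open>The induction on depth treats all angles simultaneously, since the measure of a cylinder
  at \<eta> involves cylinders of smaller depth at the angles of the triangle.\<close>

theorem spine_family_unique:
  assumes Q: "spine_family Q" and R: "spine_family R" and \<theta>: "0 \<le> \<theta>" "\<theta> < pi"
  shows "Q \<theta> = R \<theta>"
proof -
  have eq: "emeasure (Q \<eta>) (cylinder n E) = emeasure (R \<eta>) (cylinder n E)"
    if "\<And>p. E p \<in> sets node_M" "0 \<le> \<eta>" "\<eta> < pi" for n E \<eta>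
    using that
  proof (induction n arbitrary: E \<eta>)
    case 0
    have "emeasure (S \<eta>) UNIV = 1" if "spine_family S" for S
    proof -
      have "prob_space (S \<eta>)" "sets (S \<eta>) = sets tree_M"
        using that 0 by (auto simp: spine_family_def)
      then show ?thesis
        using prob_space.emeasure_space_1[of "S \<eta>"] sets_eq_imp_space_eq[of "S \<eta>" tree_M] by simp
    qed
    then show ?case using Q R by simp
  next
    case (Suc n)
    let ?L = "cylinder n (\<lambda>p. E (False # p))" and ?R = "cylinder n (\<lambda>p. E (True # p))"
    have sE: "E [] \<in> sets node_M" "?L \<in> sets tree_M" "?R \<in> sets tree_M"
      using Suc.prems by (auto intro: sets_cylinder)
    have e: "emeasure (Q (snd z)) ?R = emeasure (R (snd z)) ?R" "emeasure (Q (fst z)) ?L = emeasure (R (fst z)) ?L"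
      if "z \<in> tri \<eta>" for z
      using Suc.IH[of "\<lambda>p. E (True # p)" "snd z"] Suc.IH[of "\<lambda>p. E (False # p)" "fst z"] Suc.prems tri_bounds[OF that] by auto
    have e': "spine_density \<eta> True z * (x * (y * emeasure (Q (snd z)) ?R)) = spine_density \<eta> True z * (x * (y * emeasure (R (snd z)) ?R))"
      "spine_density \<eta> False z * (x * (emeasure (Q (fst z)) ?L * y)) = spine_density \<eta> False z * (x * (emeasure (R (fst z)) ?L * y))" for z x y
      by (cases "z \<in> tri \<eta>"; simp add: e spine_density_def)+
    show ?case
      unfolding cylinder_Suc spine_family_rect[OF Q Suc.prems(2,3) sE] spine_family_rect[OF R Suc.prems(2,3) sE]
      by (simp only: e')
  qed
  show ?thesis
    using Q R \<theta> eq[OF _ \<theta>]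
    by (intro tree_measure_eqI) (auto simp: spine_family_def prob_space_def)
qed

section \<open>Local convergence\<close>

lemma trunc_trunc_Suc: "trunc r (trunc (Suc r) t) = trunc r t"
  by (auto simp: trunc_def fun_eq_iff)

lemma measurable_inf_density_subtrees [measurable]:
  "(\<lambda>t. inf_density n (fst (root_angles t)) (subL t)) \<in> borel_measurable tree_M"
  "(\<lambda>t. inf_density n (snd (root_angles t)) (subR t)) \<in> borel_measurable tree_M"
proof -
  have 1: "(\<lambda>t. (fst (root_angles t), subL t)) \<in> tree_M \<rightarrow>\<^sub>M borel \<Otimes>\<^sub>M tree_M"
    "(\<lambda>t. (snd (root_angles t), subR t)) \<in> tree_M \<rightarrow>\<^sub>M borel \<Otimes>\<^sub>M tree_M"
    by measurable
  show "(\<lambda>t. inf_density n (fst (root_angles t)) (subL t)) \<in> borel_measurable tree_M"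
    "(\<lambda>t. inf_density n (snd (root_angles t)) (subR t)) \<in> borel_measurable tree_M"
    using measurable_compose[OF 1(1) measurable_inf_density] measurable_compose[OF 1(2) measurable_inf_density]
    by simp_all
qed

text \<open>A ball does not reveal which boundary vertex the spine passes through, so the density
  with respect to the finite law is a sum over the possible exits. Along each spine the factors
  telescope and leave Finf / F at the exit times F / Finf at the root.\<close>

theorem nn_integral_inf_law_trunc:
  assumes "0 \<le> \<theta>" "\<theta> < pi" and "g \<in> borel_measurable tree_M"
  shows "(\<integral>\<^sup>+t. g (trunc (Suc n) t) \<partial>inf_law \<theta>) =
    (\<integral>\<^sup>+t. ennreal (inf_density n \<theta> t * (F \<theta> / Finf \<theta>)) * g (trunc (Suc n) t) \<partial>Pfin \<theta>)"
  using assms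
proof (induction n arbitrary: \<theta> g)
  case 0
  note \<theta> = 0(1,2)
  interpret I: prob_space "inf_law \<theta>" by (rule prob_space_inf_law)
  interpret prob_space "Pfin \<theta>" by (rule prob_space_Pfin[OF \<theta>])
  have pos: "0 < F \<theta>" "0 < Finf \<theta>" using \<theta> by (auto intro: F_pos Finf_pos)
  have "(\<integral>\<^sup>+t. g (trunc (Suc 0) t) \<partial>inf_law \<theta>) = (\<integral>\<^sup>+t. g leaf_tree \<partial>inf_law \<theta>)"
  proof (rule nn_integral_cong_AE)
    show "AE t in inf_law \<theta>. g (trunc (Suc 0) t) = g leaf_tree"
      using AE_has_spine[OF \<theta>] by eventually_elim (simp add: trunc_1 has_spine_root)
  qed
  also have "\<dots> = (\<integral>\<^sup>+t. g leaf_tree \<partial>Pfin \<theta>)"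
    using I.emeasure_space_1 emeasure_space_1 by simp
  also have "\<dots> = (\<integral>\<^sup>+t. ennreal (inf_density 0 \<theta> t * (F \<theta> / Finf \<theta>)) * g (trunc (Suc 0) t) \<partial>Pfin \<theta>)"
  proof (rule nn_integral_cong_AE)
    show "AE t in Pfin \<theta>. g leaf_tree = ennreal (inf_density 0 \<theta> t * (F \<theta> / Finf \<theta>)) * g (trunc (Suc 0) t)"
      using AE_fine_tree[of \<theta>] by eventually_elim (use pos in \<open>simp add: fine_tree_def is_tree_def trunc_1\<close>)
  qed
  finally show ?case .
next
  case (Suc n)
  note \<theta> = Suc.prems(1,2)
  note g [measurable] = Suc.prems(3)
  let ?c = "\<lambda>\<theta>. F \<theta> / Finf \<theta>"
  \<comment> \<open>The factor vanishes when the root vertex is a leaf, so that \<open>hL\<close>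
    and \<open>hR\<close> reproduce both clauses of \<open>inf_density (Suc n)\<close> and the leaf
    atom of \<open>Pfin\<close> contributes nothing.\<close>
  let ?d = "\<lambda>t. if t [] = Some None then 0 else 1 :: real"
  define hL where "hL t = ennreal (?d t * inf_density n (fst (root_angles t)) (subL t) * ?c \<theta>) * g (trunc (Suc (Suc n)) t)" for t
  define hR where "hR t = ennreal (?d t * inf_density n (snd (root_angles t)) (subR t) * ?c \<theta>) * g (trunc (Suc (Suc n)) t)" for t
  have [measurable]: "hL \<in> borel_measurable tree_M" "hR \<in> borel_measurable tree_M"
    unfolding hL_def[abs_def] hR_def[abs_def] by measurable
  have c: "0 < ?c \<eta>" if "0 \<le> \<eta>" "\<eta> < pi" for \<eta>
    using that by (intro divide_pos_pos F_pos Finf_pos) auto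
  let ?G = "\<lambda>z l r. g (graft z (trunc (Suc n) l) (trunc (Suc n) r))"
  have pull: "(\<integral>\<^sup>+l. \<integral>\<^sup>+r. ennreal (f l r * k) * ?G z l r \<partial>Pfin b \<partial>Pfin a) =
      ennreal k * (\<integral>\<^sup>+l. \<integral>\<^sup>+r. ennreal (f l r) * ?G z l r \<partial>Pfin b \<partial>Pfin a)"
    if [measurable]: "(\<lambda>(l, r). f l r) \<in> borel_measurable (tree_M \<Otimes>\<^sub>M tree_M)"
      and "0 \<le> k" "\<And>l r. 0 \<le> f l r" "0 \<le> b" "b < pi" for f k z a b
  proof -
    interpret Pb: sigma_finite_measure "Pfin b" using that by (intro sigma_finite_Pfin)
    show ?thesis
      using that(2,3)
      by (simp add: ennreal_mult mult.commute[of "ennreal (f _ _)" "ennreal k"] mult.assoc nn_integral_cmult)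
  qed
  have R: "spine_density \<theta> True z * (\<integral>\<^sup>+l. \<integral>\<^sup>+r. g (trunc (Suc (Suc n)) (graft z l r)) \<partial>inf_law (snd z) \<partial>Pfin (fst z)) =
    fin_density \<theta> z * (\<integral>\<^sup>+l. \<integral>\<^sup>+r. hR (graft z l r) \<partial>Pfin (snd z) \<partial>Pfin (fst z))" for z
  proof (cases "z \<in> tri \<theta>")
    case True
    note b = tri_bounds[OF True]
    let ?Y = "\<integral>\<^sup>+l. \<integral>\<^sup>+r. ennreal (inf_density n (snd z) r) * ?G z l r \<partial>Pfin (snd z) \<partial>Pfin (fst z)"
    have "(\<integral>\<^sup>+r. ?G z l r \<partial>inf_law (snd z)) = (\<integral>\<^sup>+r. ennreal (inf_density n (snd z) r * ?c (snd z)) * ?G z l r \<partial>Pfin (snd z))" for l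
      using Suc.IH[of "snd z" "\<lambda>r. g (graft z (trunc (Suc n) l) r)"] b by simp
    then have "(\<integral>\<^sup>+l. \<integral>\<^sup>+r. g (trunc (Suc (Suc n)) (graft z l r)) \<partial>inf_law (snd z) \<partial>Pfin (fst z)) = ennreal (?c (snd z)) * ?Y"
      unfolding trunc_graft using c[of "snd z"] b by (simp only:) (intro pull; simp add: inf_density_nonneg)
    moreover have "(\<integral>\<^sup>+l. \<integral>\<^sup>+r. hR (graft z l r) \<partial>Pfin (snd z) \<partial>Pfin (fst z)) = ennreal (?c \<theta>) * ?Y"
    proof -
      have "hR (graft z l r) = ennreal (inf_density n (snd z) r * ?c \<theta>) * ?G z l r" for l r
        unfolding hR_def trunc_graft by simp
      then show ?thesis using c[OF \<theta>] b by (simp only:) (intro pull; simp add: inf_density_nonneg)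
    qed
    \<comment> \<open>The telescoping identity: the ratio F / Finf moves from the child on the spine
      to the root while the spine step becomes a finite step.\<close>
    moreover have "spine_density \<theta> True z * ennreal (?c (snd z)) = fin_density \<theta> z * ennreal (?c \<theta>)"
    proof -
      have "0 < Finf \<theta>" "0 < F \<theta>" "0 < F (fst z)" "0 < F (snd z)" "0 < Finf (snd z)"
        using \<theta> b by (auto intro!: F_pos Finf_pos)
      then show ?thesis
        using True by (simp add: spine_density_def fin_density_def ennreal_mult[symmetric] del: ennreal_mult')
    qed
    ultimately show ?thesis by (simp only: mult.assoc[symmetric])
  qed (simp add: spine_density_def fin_density_def)
  have L: "spine_density \<theta> False z * (\<integral>\<^sup>+r. \<integral>\<^sup>+l. g (trunc (Suc (Suc n)) (graft z l r)) \<partial>inf_law (fst z) \<partial>Pfin (snd z)) =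
    fin_density \<theta> z * (\<integral>\<^sup>+l. \<integral>\<^sup>+r. hL (graft z l r) \<partial>Pfin (snd z) \<partial>Pfin (fst z))" for z
  proof (cases "z \<in> tri \<theta>")
    case True
    note b = tri_bounds[OF True]
    let ?Y = "\<integral>\<^sup>+l. \<integral>\<^sup>+r. ennreal (inf_density n (fst z) l) * ?G z l r \<partial>Pfin (snd z) \<partial>Pfin (fst z)"
    interpret P1: sigma_finite_measure "Pfin (fst z)" using b by (intro sigma_finite_Pfin)
    interpret P2: sigma_finite_measure "Pfin (snd z)" using b by (intro sigma_finite_Pfin)
    interpret pair_sigma_finite "Pfin (fst z)" "Pfin (snd z)" ..
    have "(\<integral>\<^sup>+l. ?G z l r \<partial>inf_law (fst z)) = (\<integral>\<^sup>+l. ennreal (inf_density n (fst z) l * ?c (fst z)) * ?G z l r \<partial>Pfin (fst z))" for r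
      using Suc.IH[of "fst z" "\<lambda>l. g (graft z l (trunc (Suc n) r))"] b by simp
    then have "(\<integral>\<^sup>+r. \<integral>\<^sup>+l. g (trunc (Suc (Suc n)) (graft z l r)) \<partial>inf_law (fst z) \<partial>Pfin (snd z)) =
      (\<integral>\<^sup>+r. \<integral>\<^sup>+l. ennreal (inf_density n (fst z) l * ?c (fst z)) * ?G z l r \<partial>Pfin (fst z) \<partial>Pfin (snd z))"
      unfolding trunc_graft by simp
    also have "\<dots> = (\<integral>\<^sup>+l. \<integral>\<^sup>+r. ennreal (inf_density n (fst z) l * ?c (fst z)) * ?G z l r \<partial>Pfin (snd z) \<partial>Pfin (fst z))"
      by (rule Fubini') measurable
    also have "\<dots> = ennreal (?c (fst z)) * ?Y"
      using c[of "fst z"] b by (intro pull; simp add: inf_density_nonneg)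
    finally have "(\<integral>\<^sup>+r. \<integral>\<^sup>+l. g (trunc (Suc (Suc n)) (graft z l r)) \<partial>inf_law (fst z) \<partial>Pfin (snd z)) = ennreal (?c (fst z)) * ?Y" .
    moreover have "(\<integral>\<^sup>+l. \<integral>\<^sup>+r. hL (graft z l r) \<partial>Pfin (snd z) \<partial>Pfin (fst z)) = ennreal (?c \<theta>) * ?Y"
    proof -
      have "hL (graft z l r) = ennreal (inf_density n (fst z) l * ?c \<theta>) * ?G z l r" for l r
        unfolding hL_def trunc_graft by simp
      then show ?thesis using c[OF \<theta>] b by (simp only:) (intro pull; simp add: inf_density_nonneg)
    qed
    moreover have "spine_density \<theta> False z * ennreal (?c (fst z)) = fin_density \<theta> z * ennreal (?c \<theta>)"
    proof -
      have "0 < Finf \<theta>" "0 < F \<theta>" "0 < F (fst z)" "0 < F (snd z)" "0 < Finf (fst z)"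
        using \<theta> b by (auto intro!: F_pos Finf_pos)
      then show ?thesis
        using True by (simp add: spine_density_def fin_density_def ennreal_mult[symmetric] del: ennreal_mult')
    qed
    ultimately show ?thesis by (simp only: mult.assoc[symmetric])
  qed (simp add: spine_density_def fin_density_def)
  have "(\<integral>\<^sup>+t. g (trunc (Suc (Suc n)) t) \<partial>inf_law \<theta>) =
      (\<integral>\<^sup>+z. fin_density \<theta> z * (\<integral>\<^sup>+l. \<integral>\<^sup>+r. hR (graft z l r) \<partial>Pfin (snd z) \<partial>Pfin (fst z)) \<partial>lborel) +
      (\<integral>\<^sup>+z. fin_density \<theta> z * (\<integral>\<^sup>+l. \<integral>\<^sup>+r. hL (graft z l r) \<partial>Pfin (snd z) \<partial>Pfin (fst z)) \<partial>lborel)"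
    by (subst nn_integral_inf_law[OF \<theta>]) (simp_all only: L R, measurable)
  also have "\<dots> = (\<integral>\<^sup>+t. hR t \<partial>Pfin \<theta>) + (\<integral>\<^sup>+t. hL t \<partial>Pfin \<theta>)"
    by (simp add: nn_integral_Pfin[OF \<theta>]) (simp add: hR_def hL_def)
  also have "\<dots> = (\<integral>\<^sup>+t. hR t + hL t \<partial>Pfin \<theta>)"
    by (rule nn_integral_add[symmetric]) measurable
  also have "\<dots> = (\<integral>\<^sup>+t. ennreal (inf_density (Suc n) \<theta> t * ?c \<theta>) * g (trunc (Suc (Suc n)) t) \<partial>Pfin \<theta>)"
  proof (rule nn_integral_cong)
    fix t
    have "ennreal (x * ?c \<theta>) * y + ennreal (x' * ?c \<theta>) * y = ennreal ((x' + x) * ?c \<theta>) * y"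
      if "0 \<le> x" "0 \<le> x'" for x x' y
    proof -
      have "0 \<le> x * ?c \<theta>" "0 \<le> x' * ?c \<theta>"
        using that c[OF \<theta>] by (auto intro: mult_nonneg_nonneg simp del: times_divide_eq_right)
      then show ?thesis by (simp only: distrib_right ennreal_plus add.commute)
    qed
    then show "hR t + hL t = ennreal (inf_density (Suc n) \<theta> t * ?c \<theta>) * g (trunc (Suc (Suc n)) t)"
      unfolding hR_def hL_def by (simp add: inf_density_nonneg)
  qed
  finally show ?case .
qed

section \<open>Total variation distance of the truncated trees\<close>

lemma tv_dist_distr_density_le:
  assumes T [measurable]: "T \<in> M \<rightarrow>\<^sub>M N"
    and P: "sets P = sets N" "\<And>A. A \<in> sets N \<Longrightarrow> emeasure P A = (\<integral>\<^sup>+x. ennreal (f x) * indicator A (T x) \<partial>M)"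
    and Q: "sets Q = sets N" "\<And>A. A \<in> sets N \<Longrightarrow> emeasure Q A = (\<integral>\<^sup>+x. ennreal (g x) * indicator A (T x) \<partial>M)"
    and f: "integrable M f" "\<And>x. 0 \<le> f x" and g: "integrable M g" "\<And>x. 0 \<le> g x"
  shows "0 \<le> tv_dist P Q" "tv_dist P Q \<le> (\<integral>x. \<bar>f x - g x\<bar> \<partial>M)"
proof -
  have m: "measure P' A = (\<integral>x. h x * indicator A (T x) \<partial>M) \<and> integrable M (\<lambda>x. h x * indicator A (T x))"
    if A [measurable]: "A \<in> sets N" and h: "integrable M h" "\<And>x. 0 \<le> h x"
      and P': "emeasure P' A = (\<integral>\<^sup>+x. ennreal (h x) * indicator A (T x) \<partial>M)" for P' A and h :: "_ \<Rightarrow> real"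
  proof -
    have I: "integrable M (\<lambda>x. h x * indicator A (T x))"
      using h by (intro Bochner_Integration.integrable_bound[OF h(1)]) (auto simp: indicator_def)
    have "emeasure P' A = (\<integral>\<^sup>+x. ennreal (h x * indicator A (T x)) \<partial>M)"
      unfolding P' by (intro nn_integral_cong) (auto simp: indicator_def)
    also have "\<dots> = ennreal (\<integral>x. h x * indicator A (T x) \<partial>M)"
      using h by (intro nn_integral_eq_integral[OF I]) auto
    finally have "emeasure P' A = ennreal (\<integral>x. h x * indicator A (T x) \<partial>M)" .
    moreover have "0 \<le> (\<integral>x. h x * indicator A (T x) \<partial>M)" using h by (intro integral_nonneg_AE) auto
    ultimately show ?thesis using I by (simp add: measure_def)
  qed
  have bound: "\<bar>measure P A - measure Q A\<bar> \<le> (\<integral>x. \<bar>f x - g x\<bar> \<partial>M)" if "A \<in> sets P" for A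
  proof -
    have A [measurable]: "A \<in> sets N" using that P(1) by simp
    note mf = m[OF A f P(2)[OF A]] and mg = m[OF A g Q(2)[OF A]]
    have "measure P A - measure Q A = (\<integral>x. f x * indicator A (T x) - g x * indicator A (T x) \<partial>M)"
      using mf mg by simp
    also have "\<bar>\<dots>\<bar> \<le> (\<integral>x. \<bar>f x * indicator A (T x) - g x * indicator A (T x)\<bar> \<partial>M)"
      by (rule integral_abs_bound)
    also have "\<dots> \<le> (\<integral>x. \<bar>f x - g x\<bar> \<partial>M)"
      using mf mg f g by (intro integral_mono integrable_abs Bochner_Integration.integrable_diff) (auto simp: indicator_def)
    finally show ?thesis .
  qed
  show "tv_dist P Q \<le> (\<integral>x. \<bar>f x - g x\<bar> \<partial>M)"
    unfolding tv_dist_def using sets.empty_sets bound by (intro cSUP_least) auto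
  \<comment> \<open>The empty set is a test set with value 0; the bound above makes the supremum
    well behaved.\<close>
  have "\<bar>measure P {} - measure Q {}\<bar> \<le> tv_dist P Q"
    unfolding tv_dist_def using bound by (intro cSUP_upper bdd_aboveI2[where M = "\<integral>x. \<bar>f x - g x\<bar> \<partial>M"]) auto
  then show "0 \<le> tv_dist P Q" by simp
qed

lemma ennreal_divide_eq_mult: "0 \<le> x \<Longrightarrow> 0 < q \<Longrightarrow> ennreal (x / q) = ennreal (1 / q) * ennreal x"
  by (simp add: ennreal_mult[symmetric])

lemma Pn_Suc: "Pn \<theta> (Suc m) = density (Pfin \<theta>) (\<lambda>t. indicator {t. size_is m t} t / emeasure (Pfin \<theta>) {t. size_is m t})"
  by (simp add: Pn_def size_is_def)

lemma emeasure_Pn_trunc: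
  assumes \<theta>: "0 \<le> \<theta>" "\<theta> < pi" and w: "0 < wvol m \<theta>" and A [measurable]: "A \<in> sets tree_M"
  shows "emeasure (distr (Pn \<theta> (Suc m)) tree_M (trunc r)) A =
    (\<integral>\<^sup>+t. ennreal (size_density r m \<theta> t / (wvol m \<theta> / F \<theta>)) * indicator A (trunc r t) \<partial>Pfin \<theta>)"
proof -
  let ?q = "wvol m \<theta> / F \<theta>" and ?S = "{t. size_is m t}"
  have q: "0 < ?q" using w F_pos[of \<theta>] \<theta> by simp
  have S [measurable]: "?S \<in> sets tree_M" using pred_size_is[of m] by (simp add: pred_def)
  have e: "indicator ?S t / emeasure (Pfin \<theta>) ?S = ennreal (1 / ?q) * indicator ?S t" for t
    using divide_ennreal[of 1 ?q] q by (simp add: emeasure_size_is[OF \<theta>] indicator_def)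
  have sPn [measurable_cong]: "sets (Pn \<theta> (Suc m)) = sets tree_M" by (simp add: Pn_Suc)
  have "emeasure (distr (Pn \<theta> (Suc m)) tree_M (trunc r)) A = (\<integral>\<^sup>+t. indicator A (trunc r t) \<partial>Pn \<theta> (Suc m))"
    by (subst nn_integral_indicator[symmetric], simp) (rule nn_integral_distr, measurable)
  also have "\<dots> = (\<integral>\<^sup>+t. ennreal (1 / ?q) * indicator ?S t * indicator A (trunc r t) \<partial>Pfin \<theta>)"
    unfolding Pn_Suc e by (rule nn_integral_density) measurable
  \<comment> \<open>The density formula is available at radius r + 1; factoring
    \<open>trunc r\<close> through that larger truncation covers r = 0 without a separate
    case.\<close>
  also have "\<dots> = ennreal (1 / ?q) * (\<integral>\<^sup>+t. indicator ?S t * indicator A (trunc r (trunc (Suc r) t)) \<partial>Pfin \<theta>)"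
    unfolding mult.assoc trunc_trunc_Suc by (rule nn_integral_cmult) measurable
  also have "\<dots> = ennreal (1 / ?q) * (\<integral>\<^sup>+t. ennreal (size_density r m \<theta> t) * indicator A (trunc r (trunc (Suc r) t)) \<partial>Pfin \<theta>)"
    by (rule arg_cong[OF nn_integral_size_trunc[OF \<theta>, where g = "\<lambda>t. indicator A (trunc r t)"]]) measurable
  also have "\<dots> = (\<integral>\<^sup>+t. ennreal (1 / ?q) * (ennreal (size_density r m \<theta> t) * indicator A (trunc r t)) \<partial>Pfin \<theta>)"
    unfolding trunc_trunc_Suc by (rule nn_integral_cmult[symmetric]) measurable
  also have "\<dots> = (\<integral>\<^sup>+t. ennreal (size_density r m \<theta> t / ?q) * indicator A (trunc r t) \<partial>Pfin \<theta>)"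
  proof -
    have "ennreal (size_density r m \<theta> t / ?q) = ennreal (1 / ?q) * ennreal (size_density r m \<theta> t)" for t
      by (rule ennreal_divide_eq_mult[OF size_density_nonneg q])
    then show ?thesis by (simp only: mult.assoc)
  qed
  finally show ?thesis .
qed

lemma emeasure_inf_law_trunc:
  assumes \<theta>: "0 \<le> \<theta>" "\<theta> < pi" and A [measurable]: "A \<in> sets tree_M"
  shows "emeasure (distr (inf_law \<theta>) tree_M (trunc r)) A =
    (\<integral>\<^sup>+t. ennreal (inf_density r \<theta> t * (F \<theta> / Finf \<theta>)) * indicator A (trunc r t) \<partial>Pfin \<theta>)"
proof -
  have "emeasure (distr (inf_law \<theta>) tree_M (trunc r)) A = (\<integral>\<^sup>+t. indicator A (trunc r t) \<partial>inf_law \<theta>)"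
    by (subst nn_integral_indicator[symmetric], simp) (rule nn_integral_distr, measurable)
  also have "\<dots> = (\<integral>\<^sup>+t. indicator A (trunc r (trunc (Suc r) t)) \<partial>inf_law \<theta>)"
    by (simp add: trunc_trunc_Suc)
  also have "\<dots> = (\<integral>\<^sup>+t. ennreal (inf_density r \<theta> t * (F \<theta> / Finf \<theta>)) * indicator A (trunc r (trunc (Suc r) t)) \<partial>Pfin \<theta>)"
    by (rule nn_integral_inf_law_trunc[OF \<theta>]) measurable
  finally show ?thesis by (simp add: trunc_trunc_Suc)
qed

theorem local_conv_inf_law:
  assumes \<theta>: "0 \<le> \<theta>" "\<theta> < pi"
  shows "local_conv (Pn \<theta>) (inf_law \<theta>)"
  unfolding local_conv_def
proof
  fix r
  interpret prob_space "Pfin \<theta>" by (rule prob_space_Pfin[OF \<theta>])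
  interpret I: prob_space "inf_law \<theta>" by (rule prob_space_inf_law)
  define f where "f m t = size_density r m \<theta> t / (wvol m \<theta> / F \<theta>)" for m t
  define g where "g t = inf_density r \<theta> t * (F \<theta> / Finf \<theta>)" for t
  have pos: "0 < F \<theta>" "0 < Finf \<theta>" "0 \<le> wvol m \<theta>" for m
    using \<theta> by (auto intro: F_pos Finf_pos wvol_nonneg)
  have nonneg: "0 \<le> f m t" "0 \<le> g t" for m t
    using pos by (simp_all add: f_def g_def size_density_nonneg inf_density_nonneg)
  have [measurable]: "f m \<in> borel_measurable tree_M" "g \<in> borel_measurable tree_M" for m
    unfolding f_def[abs_def] g_def[abs_def] by measurable
  have g1: "(\<integral>\<^sup>+t. ennreal (g t) \<partial>Pfin \<theta>) = 1"
    using nn_integral_inf_law_trunc[OF \<theta>, of "\<lambda>_. 1" r] I.emeasure_space_1 by (simp add: g_def)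
  have f1: "(\<integral>\<^sup>+t. ennreal (f m t) \<partial>Pfin \<theta>) \<le> 1" for m
  \<comment> \<open>If the volume vanishes, as for m = 0, division by zero makes \<open>f m\<close>
    identically 0, so the mass bound holds for every m.\<close>
  proof (cases "wvol m \<theta> = 0")
    case False
    then have q: "0 < wvol m \<theta> / F \<theta>" using pos by (simp add: less_le)
    have S: "{t. size_is m t} \<in> sets (Pfin \<theta>)" using pred_size_is[of m] by (simp add: pred_def)
    have "(\<integral>\<^sup>+t. ennreal (f m t) \<partial>Pfin \<theta>) = (\<integral>\<^sup>+t. ennreal (1 / (wvol m \<theta> / F \<theta>)) * ennreal (size_density r m \<theta> t) \<partial>Pfin \<theta>)"
      unfolding f_def by (intro nn_integral_cong ennreal_divide_eq_mult[OF size_density_nonneg q])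
    also have "\<dots> = ennreal (1 / (wvol m \<theta> / F \<theta>)) * (\<integral>\<^sup>+t. ennreal (size_density r m \<theta> t) \<partial>Pfin \<theta>)"
      by (rule nn_integral_cmult) measurable
    also have "(\<integral>\<^sup>+t. ennreal (size_density r m \<theta> t) \<partial>Pfin \<theta>) = ennreal (wvol m \<theta> / F \<theta>)"
      using nn_integral_size_trunc[OF \<theta>, of "\<lambda>_. 1" m r] S by (simp add: emeasure_size_is[OF \<theta>])
    also have "ennreal (1 / (wvol m \<theta> / F \<theta>)) * ennreal (wvol m \<theta> / F \<theta>) = 1"
      using ennreal_divide_eq_mult[OF less_imp_le[OF q] q] q by (metis divide_self ennreal_1 less_irrefl)
    finally show ?thesis by simp
  qed (simp add: f_def)
  have int: "integrable (Pfin \<theta>) (f m)" "integrable (Pfin \<theta>) g" for m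
    using f1[of m] g1 nonneg by (auto intro!: integrableI_nonneg simp: le_less_trans[OF _ ennreal_one_less_top])
  have conv: "AE t in Pfin \<theta>. (\<lambda>m. f m t) \<longlonglongrightarrow> g t"
    using AE_fine_tree[of \<theta>]
  proof eventually_elim
    case (elim t)
    have "(\<lambda>m. wt m * size_density r m \<theta> t) \<longlonglongrightarrow> asym_const * inf_density r \<theta> t"
      using size_density_asymptotics[OF \<theta>, of t r] elim by (simp add: fine_tree_def)
    moreover have "asym_const * Finf \<theta> \<noteq> 0" using asym_const_pos pos by simp
    \<comment> \<open>Numerator and denominator decay at the same rate m^(-3/2), so the weights and
      \<open>asym_const\<close> cancel and only the angle-dependent ratio survives.\<close>
    ultimately have "(\<lambda>m. wt m * size_density r m \<theta> t / (wt m * wvol m \<theta>) * F \<theta>) \<longlonglongrightarrow>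
        asym_const * inf_density r \<theta> t / (asym_const * Finf \<theta>) * F \<theta>"
      by (intro tendsto_mult[OF tendsto_divide[OF _ wvol_asymptotics] tendsto_const])
    also have "asym_const * inf_density r \<theta> t / (asym_const * Finf \<theta>) * F \<theta> = g t"
      using asym_const_pos by (simp add: g_def)
    finally show ?case
    proof (rule Lim_transform_eventually)
      show "\<forall>\<^sub>F m in sequentially. wt m * size_density r m \<theta> t / (wt m * wvol m \<theta>) * F \<theta> = f m t"
        using eventually_gt_at_top[of 0] by eventually_elim (simp add: f_def wt_def)
    qed
  qed
  \<comment> \<open>Scheffe's lemma: the densities converge almost everywhere, their masses are at
    most 1, and the limit has mass exactly 1, so no mass escapes.\<close>
  have "(\<lambda>m. \<integral>\<^sup>+t. norm (f m t - g t) \<partial>Pfin \<theta>) \<longlonglongrightarrow> 0"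
    using conv int f1 g1 nonneg by (intro Scheffe_lemma2) auto
  moreover have "(\<integral>\<^sup>+t. norm (f m t - g t) \<partial>Pfin \<theta>) = ennreal (\<integral>t. \<bar>f m t - g t\<bar> \<partial>Pfin \<theta>)" for m
    using int by (simp add: nn_integral_eq_integral)
  ultimately have L1: "(\<lambda>m. \<integral>t. \<bar>f m t - g t\<bar> \<partial>Pfin \<theta>) \<longlonglongrightarrow> 0"
    by (simp add: tendsto_ennreal_iff[of _ _ 0, simplified])
  have w: "\<forall>\<^sub>F m in sequentially. 0 < wvol m \<theta>"
  proof -
    have "\<forall>\<^sub>F m in sequentially. 0 < wt m * wvol m \<theta>"
      using asym_const_pos pos by (intro order_tendstoD(1)[OF wvol_asymptotics]) auto
    then show ?thesis by eventually_elim (use zero_less_mult_pos wt_nonneg in \<open>metis less_le mult_eq_0_iff pos(3)\<close>)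
  qed
  let ?tv = "\<lambda>n. tv_dist (distr (Pn \<theta> n) tree_M (trunc r)) (distr (inf_law \<theta>) tree_M (trunc r))"
  have "\<forall>\<^sub>F m in sequentially. 0 \<le> ?tv (Suc m) \<and> ?tv (Suc m) \<le> (\<integral>t. \<bar>f m t - g t\<bar> \<partial>Pfin \<theta>)"
    using w
  proof eventually_elim
    case (elim m)
    show ?case
      using emeasure_Pn_trunc[OF \<theta> elim, of _ r] emeasure_inf_law_trunc[OF \<theta>, of _ r] int nonneg
      by (intro conjI tv_dist_distr_density_le[where N = tree_M and T = "trunc r" and f = "f m" and g = g])
        (auto simp: f_def g_def)
  qed
  then have "(\<lambda>m. ?tv (Suc m)) \<longlonglongrightarrow> 0"
    by (intro tendsto_sandwich[OF _ _ tendsto_const L1]) (auto elim: eventually_mono)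
  then show "?tv \<longlonglongrightarrow> 0" by (rule LIMSEQ_imp_Suc)
qed

theorem theorem9:
  "\<exists>Pinf :: real \<Rightarrow> atree measure.
     spine_family Pinf \<and>
     (\<forall>\<theta>\<in>{0..<pi}. local_conv (Pn \<theta>) (Pinf \<theta>)) \<and>
     (\<forall>Q. spine_family Q \<longrightarrow> (\<forall>\<theta>\<in>{0..<pi}. Q \<theta> = Pinf \<theta>))"
proof (intro exI[of _ inf_law] conjI allI impI ballI)
  show "spine_family inf_law" by (rule spine_family_inf_law)
  fix \<theta> :: real assume \<theta>: "\<theta> \<in> {0..<pi}"
  then show "local_conv (Pn \<theta>) (inf_law \<theta>)" by (intro local_conv_inf_law) auto
  fix Q assume "spine_family Q"
  with \<theta> show "Q \<theta> = inf_law \<theta>" by (intro spine_family_unique spine_family_inf_law) auto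
qed

end
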